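(* Let $K$ be a field, let $A$ be a Noetherian flat $K[t]$-algebra, and let $M$ and $N$ be finitely generated $A$-modules which are flat over $K[t]$. Assume that all of $A$, $M$ and $N$ are graded $K[t]$-modules. Let $h$ be an integer. Then $M$ is $N$-fiber-full up to $h$ as an $A$-module if and only if $\operatorname{Ext}^i_A(M,N)$ is flat over $K[t]$ for all $i\le h-1$.
   Context: $K[t]$ is the polynomial ring in one variable $t$ over $K$, with its standard grading ($\deg t=1$). Definition. For an integer $h$, $M$ is called $N$-fiber-full up to $h$ as an $A$-module if, for every integer $m\ge 1$, the natural projection $M/t^mM\to M/tM$ induces injective maps $\operatorname{Ext}^i_A(M/tM,N)\to\operatorname{Ext}^i_A(M/t^mM,N)$ for all $i\le h$.
   Formalization: "Graded K[t]-modules" is strengthened: A is a Z-graded ring and M, N are graded A-modules with the same graded pieces; with bare K[t]-gradings the claim fails (A=K[t,x], M=K[t]^2 with x acting by [[0,t-1],[0,0]], N=K[t] with x=0, h=2). *)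

theory Defs
  imports "HOL-Algebra.Algebra"
begin

section \<open>Modules: homomorphisms, quotients, free modules\<close>

text \<open>
  Modules are records of type \<open>('a, 'm) module\<close>, which extend ring records; the fields
  \<open>mult\<close> and \<open>one\<close> carry no information for a module and are left undefined below.
\<close>

text \<open>Homomorphisms are extensional, so that distinct elements of this set are distinct
  homomorphisms and the set is the carrier of the Hom module.\<close>

definition mod_hom ::
  "('a, 'x) ring_scheme \<Rightarrow> ('a, 'm, 'y) module_scheme \<Rightarrow> ('a, 'n, 'z) module_scheme \<Rightarrow> ('m \<Rightarrow> 'n) set"
  where "mod_hom R M N = {f \<in> carrier M \<rightarrow>\<^sub>E carrier N.
    (\<forall>x\<in>carrier M. \<forall>y\<in>carrier M. f (x \<oplus>\<^bsub>M\<^esub> y) = f x \<oplus>\<^bsub>N\<^esub> f y) \<and>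
    (\<forall>a\<in>carrier R. \<forall>x\<in>carrier M. f (a \<odot>\<^bsub>M\<^esub> x) = a \<odot>\<^bsub>N\<^esub> f x)}"

definition hom_module ::
  "('a, 'x) ring_scheme \<Rightarrow> ('a, 'm, 'y) module_scheme \<Rightarrow> ('a, 'n, 'z) module_scheme
    \<Rightarrow> ('a, 'm \<Rightarrow> 'n) module"
  where "hom_module R M N =
    \<lparr>carrier = mod_hom R M N, monoid.mult = undefined, one = undefined,
     ring.zero = (\<lambda>x\<in>carrier M. \<zero>\<^bsub>N\<^esub>),
     add = (\<lambda>f g. \<lambda>x\<in>carrier M. f x \<oplus>\<^bsub>N\<^esub> g x),
     smult = (\<lambda>a f. \<lambda>x\<in>carrier M. a \<odot>\<^bsub>N\<^esub> f x)\<rparr>"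

definition quot_module ::
  "('a, 'm, 'y) module_scheme \<Rightarrow> 'm set \<Rightarrow> ('a, 'm set) module"
  where "quot_module M H =
    \<lparr>carrier = a_rcosets\<^bsub>M\<^esub> H, monoid.mult = undefined, one = undefined,
     ring.zero = H,
     add = (\<lambda>C D. C <+>\<^bsub>M\<^esub> D),
     smult = (\<lambda>a C. \<Union>x\<in>C. H +>\<^bsub>M\<^esub> (a \<odot>\<^bsub>M\<^esub> x))\<rparr>"

definition submod_span ::
  "('a, 'x) ring_scheme \<Rightarrow> ('a, 'm) module \<Rightarrow> 'm set \<Rightarrow> 'm set"
  where "submod_span R M S = \<Inter>{H. submodule H R M \<and> S \<subseteq> H}"

definition fin_gen_module ::
  "('a, 'x) ring_scheme \<Rightarrow> ('a, 'm) module \<Rightarrow> bool"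
  where "fin_gen_module R M \<longleftrightarrow>
    module R M \<and> (\<exists>S. finite S \<and> S \<subseteq> carrier M \<and> submod_span R M S = carrier M)"

definition free_module ::
  "('a, 'x) ring_scheme \<Rightarrow> 'b set \<Rightarrow> ('a, 'b \<Rightarrow> 'a) module"
  where "free_module R B =
    \<lparr>carrier = {z. (\<forall>b. z b \<in> carrier R) \<and> (\<forall>b. b \<notin> B \<longrightarrow> z b = \<zero>\<^bsub>R\<^esub>) \<and>
                   finite {b. z b \<noteq> \<zero>\<^bsub>R\<^esub>}},
     monoid.mult = undefined, one = undefined,
     ring.zero = (\<lambda>b. \<zero>\<^bsub>R\<^esub>),
     add = (\<lambda>z w b. z b \<oplus>\<^bsub>R\<^esub> w b),
     smult = (\<lambda>a z b. a \<otimes>\<^bsub>R\<^esub> z b)\<rparr>"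

definition basis_vec :: "('a, 'x) ring_scheme \<Rightarrow> 'b \<Rightarrow> ('b \<Rightarrow> 'a)"
  where "basis_vec R b = (\<lambda>c. if c = b then \<one>\<^bsub>R\<^esub> else \<zero>\<^bsub>R\<^esub>)"

text \<open>An algebra in the sense of the locale \<^locale>\<open>algebra\<close> is a \<open>('p, 'a) module\<close> record, so its
  structure map sends \<open>p\<close> to \<open>p \<odot>\<^bsub>A\<^esub> \<one>\<^bsub>A\<^esub>\<close>.\<close>

definition restrict_scalars ::
  "('p, 'a) module \<Rightarrow> ('a, 'm) module \<Rightarrow> ('p, 'm) module"
  where "restrict_scalars A M =
    \<lparr>carrier = carrier M, monoid.mult = monoid.mult M, one = one M, ring.zero = ring.zero M, add = add M,
     smult = (\<lambda>p x. (p \<odot>\<^bsub>A\<^esub> \<one>\<^bsub>A\<^esub>) \<odot>\<^bsub>M\<^esub> x)\<rparr>"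


section \<open>Tensor products and flatness\<close>

definition tensor_relations ::
  "('a, 'x) ring_scheme \<Rightarrow> ('a, 'm) module \<Rightarrow> ('a, 'n) module \<Rightarrow> ('m \<times> 'n \<Rightarrow> 'a) set"
  where "tensor_relations R M N =
    (let F = free_module R (carrier M \<times> carrier N); \<delta> = (\<lambda>x y. basis_vec R (x, y)) in
      {\<delta> (x \<oplus>\<^bsub>M\<^esub> x') y \<ominus>\<^bsub>F\<^esub> (\<delta> x y \<oplus>\<^bsub>F\<^esub> \<delta> x' y) | x x' y.
          x \<in> carrier M \<and> x' \<in> carrier M \<and> y \<in> carrier N} \<union>
      {\<delta> x (y \<oplus>\<^bsub>N\<^esub> y') \<ominus>\<^bsub>F\<^esub> (\<delta> x y \<oplus>\<^bsub>F\<^esub> \<delta> x y') | x y y'.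
          x \<in> carrier M \<and> y \<in> carrier N \<and> y' \<in> carrier N} \<union>
      {\<delta> (a \<odot>\<^bsub>M\<^esub> x) y \<ominus>\<^bsub>F\<^esub> (a \<odot>\<^bsub>F\<^esub> \<delta> x y) | a x y.
          a \<in> carrier R \<and> x \<in> carrier M \<and> y \<in> carrier N} \<union>
      {\<delta> x (a \<odot>\<^bsub>N\<^esub> y) \<ominus>\<^bsub>F\<^esub> (a \<odot>\<^bsub>F\<^esub> \<delta> x y) | a x y.
          a \<in> carrier R \<and> x \<in> carrier M \<and> y \<in> carrier N})"

definition tensor_kernel ::
  "('a, 'x) ring_scheme \<Rightarrow> ('a, 'm) module \<Rightarrow> ('a, 'n) module \<Rightarrow> ('m \<times> 'n \<Rightarrow> 'a) set"
  where "tensor_kernel R M N =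
    submod_span R (free_module R (carrier M \<times> carrier N)) (tensor_relations R M N)"

definition tensor_product ::
  "('a, 'x) ring_scheme \<Rightarrow> ('a, 'm) module \<Rightarrow> ('a, 'n) module \<Rightarrow> ('a, ('m \<times> 'n \<Rightarrow> 'a) set) module"
  where "tensor_product R M N =
    quot_module (free_module R (carrier M \<times> carrier N)) (tensor_kernel R M N)"

definition pure_tensor ::
  "('a, 'x) ring_scheme \<Rightarrow> ('a, 'm) module \<Rightarrow> ('a, 'n) module \<Rightarrow> 'm \<Rightarrow> 'n \<Rightarrow> ('m \<times> 'n \<Rightarrow> 'a) set"
  where "pure_tensor R M N x y =
    tensor_kernel R M N +>\<^bsub>free_module R (carrier M \<times> carrier N)\<^esub> basis_vec R (x, y)"

text \<open>The map \<open>id\<^sub>M \<otimes> f\<close>.\<close>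

definition tensor_map ::
  "('a, 'x) ring_scheme \<Rightarrow> ('a, 'm) module \<Rightarrow> ('a, 'n) module \<Rightarrow> ('a, 'n') module \<Rightarrow> ('n \<Rightarrow> 'n')
    \<Rightarrow> ('m \<times> 'n \<Rightarrow> 'a) set \<Rightarrow> ('m \<times> 'n' \<Rightarrow> 'a) set"
  where "tensor_map R M N N' f =
    (THE g. g \<in> mod_hom R (tensor_product R M N) (tensor_product R M N') \<and>
      (\<forall>x\<in>carrier M. \<forall>y\<in>carrier N. g (pure_tensor R M N x y) = pure_tensor R M N' x (f y)))"

text \<open>\<open>M\<close> is flat if \<open>M \<otimes> _\<close> preserves injectivity of module homomorphisms. HOL cannot quantify
  over the types of the test modules, so their elements are taken from the type \<open>'a\<close> of scalars.
  This loses nothing: the inclusions of ideals of \<open>R\<close> into \<open>R\<close> are among the test maps, and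
  exactness on these already gives exactness on all modules.\<close>

definition flat_module :: "('a, 'x) ring_scheme \<Rightarrow> ('a, 'm) module \<Rightarrow> bool"
  where "flat_module R M \<longleftrightarrow> module R M \<and>
    (\<forall>(U :: ('a, 'a) module) (V :: ('a, 'a) module) f.
      module R U \<and> module R V \<and> f \<in> mod_hom R U V \<and> inj_on f (carrier U) \<longrightarrow>
      inj_on (tensor_map R M U V f) (carrier (tensor_product R M U)))"


section \<open>Ext\<close>

text \<open>A resolution \<open>\<dots> \<rightarrow> F\<^sub>1 \<rightarrow> F\<^sub>0 \<rightarrow> M \<rightarrow> 0\<close> with \<open>F\<^sub>i\<close> free on the set \<open>res_basis i\<close>;
  \<open>res_diff i\<close> is the differential from \<open>F\<^sub>i\<^sub>+\<^sub>1\<close> to \<open>F\<^sub>i\<close>.\<close>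

record ('a, 'b, 'm) free_res =
  res_basis :: "nat \<Rightarrow> 'b set"
  res_diff :: "nat \<Rightarrow> ('b \<Rightarrow> 'a) \<Rightarrow> ('b \<Rightarrow> 'a)"
  res_aug :: "('b \<Rightarrow> 'a) \<Rightarrow> 'm"

definition res_module ::
  "('a, 'x) ring_scheme \<Rightarrow> ('a, 'b, 'm) free_res \<Rightarrow> nat \<Rightarrow> ('a, 'b \<Rightarrow> 'a) module"
  where "res_module R P i = free_module R (res_basis P i)"

definition is_free_res ::
  "('a, 'x) ring_scheme \<Rightarrow> ('a, 'm) module \<Rightarrow> ('a, 'b, 'm) free_res \<Rightarrow> bool"
  where "is_free_res R M P \<longleftrightarrow>
    res_aug P \<in> mod_hom R (res_module R P 0) M \<and>
    (\<forall>i. res_diff P i \<in> mod_hom R (res_module R P (Suc i)) (res_module R P i)) \<and>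
    res_aug P ` carrier (res_module R P 0) = carrier M \<and>
    res_diff P 0 ` carrier (res_module R P 1) =
      {z \<in> carrier (res_module R P 0). res_aug P z = \<zero>\<^bsub>M\<^esub>} \<and>
    (\<forall>i. res_diff P (Suc i) ` carrier (res_module R P (Suc (Suc i))) =
      {z \<in> carrier (res_module R P (Suc i)). res_diff P i z = \<zero>\<^bsub>res_module R P i\<^esub>})"

text \<open>Basis elements are taken from the infinite type \<open>('a \<times> 'm) list\<close>. Its cardinality is at
  least that of \<open>R\<close> and of \<open>M\<close>, so every kernel in the construction of a resolution again has a
  generating set indexed by a subset of this type, and every module over every commutative ring
  has a resolution of this form.\<close>

definition chosen_res ::
  "('a, 'x) ring_scheme \<Rightarrow> ('a, 'm) module \<Rightarrow> ('a, ('a \<times> 'm) list, 'm) free_res"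
  where "chosen_res R M = (SOME P. is_free_res R M P)"

definition cocycles ::
  "('a, 'x) ring_scheme \<Rightarrow> ('a, 'b, 'm) free_res \<Rightarrow> ('a, 'n) module \<Rightarrow> nat \<Rightarrow> (('b \<Rightarrow> 'a) \<Rightarrow> 'n) set"
  where "cocycles R P N i = {f \<in> mod_hom R (res_module R P i) N.
    \<forall>z\<in>carrier (res_module R P (Suc i)). f (res_diff P i z) = \<zero>\<^bsub>N\<^esub>}"

fun coboundaries ::
  "('a, 'x) ring_scheme \<Rightarrow> ('a, 'b, 'm) free_res \<Rightarrow> ('a, 'n) module \<Rightarrow> nat \<Rightarrow> (('b \<Rightarrow> 'a) \<Rightarrow> 'n) set"
  where
    "coboundaries R P N 0 = {\<zero>\<^bsub>hom_module R (res_module R P 0) N\<^esub>}"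
  | "coboundaries R P N (Suc i) =
      (\<lambda>g. compose (carrier (res_module R P (Suc i))) g (res_diff P i)) `
        mod_hom R (res_module R P i) N"

definition Ext ::
  "('a, 'x) ring_scheme \<Rightarrow> nat \<Rightarrow> ('a, 'm) module \<Rightarrow> ('a, 'n) module
    \<Rightarrow> ('a, ((('a \<times> 'm) list \<Rightarrow> 'a) \<Rightarrow> 'n) set) module"
  where "Ext R i M N = (let P = chosen_res R M in
    quot_module ((hom_module R (res_module R P i) N)\<lparr>carrier := cocycles R P N i\<rparr>)
      (coboundaries R P N i))"

definition is_res_lift ::
  "('a, 'x) ring_scheme \<Rightarrow> ('a, 'b, 'm) free_res \<Rightarrow> ('a, 'c, 'n) free_res \<Rightarrow> ('m \<Rightarrow> 'n)
    \<Rightarrow> (nat \<Rightarrow> ('b \<Rightarrow> 'a) \<Rightarrow> ('c \<Rightarrow> 'a)) \<Rightarrow> bool"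
  where "is_res_lift R P Q f \<phi> \<longleftrightarrow>
    (\<forall>i. \<phi> i \<in> mod_hom R (res_module R P i) (res_module R Q i)) \<and>
    (\<forall>z\<in>carrier (res_module R P 0). res_aug Q (\<phi> 0 z) = f (res_aug P z)) \<and>
    (\<forall>i. \<forall>z\<in>carrier (res_module R P (Suc i)).
      res_diff Q i (\<phi> (Suc i) z) = \<phi> i (res_diff P i z))"

text \<open>The map \<open>Ext\<^sup>i(M', N) \<rightarrow> Ext\<^sup>i(M, N)\<close> induced by \<open>f : M \<rightarrow> M'\<close>.\<close>

definition Ext_map ::
  "('a, 'x) ring_scheme \<Rightarrow> nat \<Rightarrow> ('a, 'm) module \<Rightarrow> ('a, 'm') module \<Rightarrow> ('a, 'n) module
    \<Rightarrow> ('m \<Rightarrow> 'm') \<Rightarrow> ((('a \<times> 'm') list \<Rightarrow> 'a) \<Rightarrow> 'n) set \<Rightarrow> ((('a \<times> 'm) list \<Rightarrow> 'a) \<Rightarrow> 'n) set"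
  where "Ext_map R i M M' N f =
    (let P = chosen_res R M; Q = chosen_res R M';
         \<phi> = (SOME \<phi>. is_res_lift R P Q f \<phi>)
     in (\<lambda>C\<in>carrier (Ext R i M' N). \<Union>g\<in>C. coboundaries R P N i
          +>\<^bsub>hom_module R (res_module R P i) N\<^esub> compose (carrier (res_module R P i)) g (\<phi> i)))"


section \<open>Gradings\<close>

text \<open>A \<open>\<int>\<close>-grading of the underlying abelian group: an internal direct sum decomposition.\<close>

definition is_grading :: "('m, 'x) ring_scheme \<Rightarrow> (int \<Rightarrow> 'm set) \<Rightarrow> bool"
  where "is_grading M \<M> \<longleftrightarrow>
    (\<forall>d. additive_subgroup (\<M> d) M) \<and>
    (\<forall>x\<in>carrier M. \<exists>!c. (\<forall>d. c d \<in> \<M> d) \<and> finite {d. c d \<noteq> \<zero>\<^bsub>M\<^esub>} \<and>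
      x = (\<Oplus>\<^bsub>M\<^esub>d\<in>{d. c d \<noteq> \<zero>\<^bsub>M\<^esub>}. c d))"

definition graded_ring :: "('a, 'x) ring_scheme \<Rightarrow> (int \<Rightarrow> 'a set) \<Rightarrow> bool"
  where "graded_ring R \<R> \<longleftrightarrow> ring R \<and> is_grading R \<R> \<and>
    (\<forall>i j. \<forall>a\<in>\<R> i. \<forall>b\<in>\<R> j. a \<otimes>\<^bsub>R\<^esub> b \<in> \<R> (i + j))"

definition graded_module ::
  "('a, 'x) ring_scheme \<Rightarrow> (int \<Rightarrow> 'a set) \<Rightarrow> ('a, 'm) module \<Rightarrow> (int \<Rightarrow> 'm set) \<Rightarrow> bool"
  where "graded_module R \<R> M \<M> \<longleftrightarrow> module R M \<and> is_grading M \<M> \<and>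
    (\<forall>i j. \<forall>a\<in>\<R> i. \<forall>x\<in>\<M> j. a \<odot>\<^bsub>M\<^esub> x \<in> \<M> (i + j))"

definition poly_grading :: "('k, 'x) ring_scheme \<Rightarrow> int \<Rightarrow> (nat \<Rightarrow> 'k) set"
  where "poly_grading K d =
    (if d < 0 then {\<zero>\<^bsub>UP K\<^esub>} else {monom (UP K) c (nat d) | c. c \<in> carrier K})"


section \<open>Fiber-full modules\<close>

text \<open>The image in \<open>A\<close> of the variable of \<open>K[t]\<close>.\<close>

definition alg_var :: "('k, 'x) ring_scheme \<Rightarrow> (nat \<Rightarrow> 'k, 'a) module \<Rightarrow> 'a"
  where "alg_var K A = monom (UP K) \<one>\<^bsub>K\<^esub> 1 \<odot>\<^bsub>A\<^esub> \<one>\<^bsub>A\<^esub>"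

definition pow_mult_image ::
  "('a, 'x) ring_scheme \<Rightarrow> 'a \<Rightarrow> nat \<Rightarrow> ('a, 'm) module \<Rightarrow> 'm set"
  where "pow_mult_image A t m M = (\<lambda>x. (t [^]\<^bsub>A\<^esub> m) \<odot>\<^bsub>M\<^esub> x) ` carrier M"

definition pow_quot ::
  "('a, 'x) ring_scheme \<Rightarrow> 'a \<Rightarrow> nat \<Rightarrow> ('a, 'm) module \<Rightarrow> ('a, 'm set) module"
  where "pow_quot A t m M = quot_module M (pow_mult_image A t m M)"

text \<open>The natural projection \<open>M/t\<^sup>mM \<rightarrow> M/tM\<close>.\<close>

definition pow_proj ::
  "('a, 'x) ring_scheme \<Rightarrow> 'a \<Rightarrow> nat \<Rightarrow> ('a, 'm) module \<Rightarrow> 'm set \<Rightarrow> 'm set"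
  where "pow_proj A t m M =
    (\<lambda>C\<in>carrier (pow_quot A t m M). \<Union>x\<in>C. pow_mult_image A t 1 M +>\<^bsub>M\<^esub> x)"

text \<open>The index \<open>i\<close> ranges over \<open>\<nat>\<close> since Ext vanishes in negative degrees.\<close>

definition fiber_full_up_to ::
  "('k, 'x) ring_scheme \<Rightarrow> (nat \<Rightarrow> 'k, 'a) module \<Rightarrow> ('a, 'n) module \<Rightarrow> int \<Rightarrow> ('a, 'm) module \<Rightarrow> bool"
  where "fiber_full_up_to K A N h M \<longleftrightarrow> (let t = alg_var K A in
    \<forall>m\<ge>1. \<forall>i. int i \<le> h \<longrightarrow>
      inj_on (Ext_map A i (pow_quot A t m M) (pow_quot A t 1 M) N (pow_proj A t m M))
        (carrier (Ext A i (pow_quot A t 1 M) N)))"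

end

theory Submission
  imports Defs
begin

text \<open>Put \<open>E\<^sup>i = Ext\<^sup>i(M, N)\<close>. As \<open>t\<close> is regular on \<open>M\<close>, the long exact sequence of
  \<open>0 \<rightarrow> M \<rightarrow> M \<rightarrow> M/t\<^sup>mM \<rightarrow> 0\<close>, here replaced by the mapping cone of \<open>t\<^sup>m\<close> on a resolution of \<open>M\<close>,
  shows that \<open>Ext\<^sup>i(M/tM, N) \<rightarrow> Ext\<^sup>i(M/t\<^sup>mM, N)\<close> is injective iff multiplication by \<open>t\<^sup>m\<^sup>-\<^sup>1\<close>
  from \<open>E\<^sup>i\<^sup>-\<^sup>1/t\<close> to \<open>E\<^sup>i\<^sup>-\<^sup>1/t\<^sup>m\<close> is. For all \<open>m\<close> together this says that the \<open>t\<close>-power torsion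
  \<open>H\<close> of \<open>E\<^sup>i\<^sup>-\<^sup>1\<close> lies in \<open>t E\<^sup>i\<^sup>-\<^sup>1\<close>, hence \<open>H = t H\<close>; but \<open>H\<close> is finitely generated and so killed by a
  power of \<open>t\<close>, whence \<open>H = 0\<close>. Thus fiber-fullness up to \<open>h\<close> means that \<open>t\<close> is regular on \<open>E\<^sup>i\<close> for
  \<open>i \<le> h - 1\<close>. Computing \<open>E\<^sup>i\<close> from a resolution by finitely generated graded free modules
  makes it graded, and the component of highest degree then shows that every nonzero
  polynomial is regular as soon as \<open>t\<close> is. Over the Euclidean domain \<open>K[t]\<close>, torsion-free means flat.\<close>

section \<open>Linear maps\<close>

text \<open>\<open>chosen_res\<close> and the lift inside \<open>Ext_map\<close> are arbitrary
  choices, of which only the defining property is known. Hence cocycles and coboundaries are treated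
  as predicates on representatives, and the two properties in question, injectivity of an induced
  map and regularity of a scalar, are shown not to depend on the resolution or the lift. This allows
  one to replace \<open>chosen_res\<close> by a finite graded resolution, and the resolutions of the
  quotients by its cones. A cochain on a cone in degree j + 1 is a pair of cochains of degrees j + 1
  and j; this is the origin of the shift from i to i - 1. The step from H inside t E to H = t H
  rests on the remark that a class whose product with t is t-power torsion is itself t-power
  torsion. The last equivalence, torsion-free and flat, uses that finitely generated submodules of a
  torsion-free module over a Euclidean domain are free: a relation in a tensor product involves only
  finitely many elements of the module, and the coordinate functionals on their span detect
  it.\<close>

definition lin ::
  "('a, 'x) ring_scheme \<Rightarrow> ('a, 'm, 'y) module_scheme \<Rightarrow> ('a, 'n, 'z) module_scheme \<Rightarrow> ('m \<Rightarrow> 'n) \<Rightarrow> bool"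
  where "lin R M N f \<longleftrightarrow> f \<in> carrier M \<rightarrow> carrier N \<and>
    (\<forall>x\<in>carrier M. \<forall>y\<in>carrier M. f (x \<oplus>\<^bsub>M\<^esub> y) = f x \<oplus>\<^bsub>N\<^esub> f y) \<and>
    (\<forall>a\<in>carrier R. \<forall>x\<in>carrier M. f (a \<odot>\<^bsub>M\<^esub> x) = a \<odot>\<^bsub>N\<^esub> f x)"

text \<open>Composites, sums and multiples written as plain lambda terms are linear but not
  extensional. All arguments therefore use \<open>lin\<close>, and extensionality is restored by
  \<open>restrict\<close> only where an element of a Hom carrier is required.\<close>

lemma mod_hom_iff: "f \<in> mod_hom R M N \<longleftrightarrow> lin R M N f \<and> f \<in> extensional (carrier M)"
  by (auto simp: mod_hom_def lin_def PiE_def)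

lemma mod_hom_lin: "f \<in> mod_hom R M N \<Longrightarrow> lin R M N f"
  by (simp add: mod_hom_iff)

lemma linI:
  assumes "\<And>x. x \<in> carrier M \<Longrightarrow> f x \<in> carrier N"
    and "\<And>x y. x \<in> carrier M \<Longrightarrow> y \<in> carrier M \<Longrightarrow> f (x \<oplus>\<^bsub>M\<^esub> y) = f x \<oplus>\<^bsub>N\<^esub> f y"
    and "\<And>a x. a \<in> carrier R \<Longrightarrow> x \<in> carrier M \<Longrightarrow> f (a \<odot>\<^bsub>M\<^esub> x) = a \<odot>\<^bsub>N\<^esub> f x"
  shows "lin R M N f"
  using assms by (auto simp: lin_def)

lemma lin_closed: "lin R M N f \<Longrightarrow> x \<in> carrier M \<Longrightarrow> f x \<in> carrier N"
  by (auto simp: lin_def)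

lemma lin_add:
  "lin R M N f \<Longrightarrow> x \<in> carrier M \<Longrightarrow> y \<in> carrier M \<Longrightarrow> f (x \<oplus>\<^bsub>M\<^esub> y) = f x \<oplus>\<^bsub>N\<^esub> f y"
  by (auto simp: lin_def)

lemma lin_smult: "lin R M N f \<Longrightarrow> a \<in> carrier R \<Longrightarrow> x \<in> carrier M \<Longrightarrow> f (a \<odot>\<^bsub>M\<^esub> x) = a \<odot>\<^bsub>N\<^esub> f x"
  by (auto simp: lin_def)

lemma lin_comp:
  assumes "lin R M N f" and "lin R N L g"
  shows "lin R M L (\<lambda>x. g (f x))"
  using assms by (auto simp: lin_def Pi_iff)

lemma module_cring: "module R M \<Longrightarrow> cring R"
  by (simp add: module_def)

lemma lin_cong:
  assumes "lin R M N f" and "module R M" and "\<And>x. x \<in> carrier M \<Longrightarrow> g x = f x"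
  shows "lin R M N g"
proof -
  interpret module R M by fact
  show ?thesis using assms(1,3) by (auto simp: lin_def Pi_iff)
qed

lemma restrict_mod_hom:
  assumes "lin R M N f" and "module R M"
  shows "restrict f (carrier M) \<in> mod_hom R M N"
  using lin_cong[OF assms, of "restrict f (carrier M)"] by (simp add: mod_hom_iff)

lemma lin_zero:
  assumes "module R M" and "module R N" and f: "lin R M N f"
  shows "f \<zero>\<^bsub>M\<^esub> = \<zero>\<^bsub>N\<^esub>"
proof -
  interpret M: module R M by fact
  interpret N: module R N by fact
  have "f (\<zero>\<^bsub>R\<^esub> \<odot>\<^bsub>M\<^esub> \<zero>\<^bsub>M\<^esub>) = \<zero>\<^bsub>R\<^esub> \<odot>\<^bsub>N\<^esub> f \<zero>\<^bsub>M\<^esub>"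
    by (rule lin_smult[OF f]) auto
  thus ?thesis using lin_closed[OF f, of "\<zero>\<^bsub>M\<^esub>"] by simp
qed

lemma lin_neg:
  assumes "module R M" and "module R N" and f: "lin R M N f" and "x \<in> carrier M"
  shows "f (\<ominus>\<^bsub>M\<^esub> x) = \<ominus>\<^bsub>N\<^esub> f x"
proof -
  interpret M: module R M by fact
  interpret N: module R N by fact
  have "f ((\<ominus>\<^bsub>R\<^esub> \<one>\<^bsub>R\<^esub>) \<odot>\<^bsub>M\<^esub> x) = (\<ominus>\<^bsub>R\<^esub> \<one>\<^bsub>R\<^esub>) \<odot>\<^bsub>N\<^esub> f x"
    using assms(4) by (intro lin_smult[OF f]) auto
  thus ?thesis using lin_closed[OF f assms(4)] assms(4)
    by (simp add: M.smult_l_minus N.smult_l_minus)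
qed

lemma lin_minus:
  assumes "module R M" and "module R N" and f: "lin R M N f" and "x \<in> carrier M" and "y \<in> carrier M"
  shows "f (x \<ominus>\<^bsub>M\<^esub> y) = f x \<ominus>\<^bsub>N\<^esub> f y"
proof -
  interpret M: module R M by fact
  show ?thesis using assms lin_neg[OF assms(1,2) f assms(5)]
    by (simp add: a_minus_def lin_add[OF f])
qed

lemma lin_finsum:
  assumes "module R M" and "module R N" and f: "lin R M N f"
    and "finite I" and "g \<in> I \<rightarrow> carrier M"
  shows "f (\<Oplus>\<^bsub>M\<^esub>i\<in>I. g i) = (\<Oplus>\<^bsub>N\<^esub>i\<in>I. f (g i))"
proof -
  interpret M: module R M by fact
  interpret N: module R N by fact
  from assms(4,5) show ?thesis
  proof (induct I)
    case empty
    thus ?case using lin_zero[OF assms(1-3)] by simp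
  next
    case (insert i I)
    have c: "g i \<in> carrier M" "g \<in> I \<rightarrow> carrier M" using insert.prems by auto
    have "(\<lambda>i. f (g i)) \<in> I \<rightarrow> carrier N" using c lin_closed[OF f] by auto
    thus ?case using insert c lin_closed[OF f c(1)] by (simp add: lin_add[OF f])
  qed
qed

lemma lin_zero_map:
  assumes "module R M" and "module R N"
  shows "lin R M N (\<lambda>x. \<zero>\<^bsub>N\<^esub>)"
proof -
  interpret N: module R N by fact
  show ?thesis by (auto intro: linI)
qed

lemma lin_id: "lin R M M (\<lambda>x. x)"
  by (auto intro: linI)

lemma lin_plus:
  assumes "module R M" and "module R N" and f: "lin R M N f" and g: "lin R M N g"
  shows "lin R M N (\<lambda>x. f x \<oplus>\<^bsub>N\<^esub> g x)"
proof -
  interpret M: module R M by fact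
  interpret N: module R N by fact
  note c = lin_closed[OF f] lin_closed[OF g]
  show ?thesis
    by (rule linI) (simp_all add: lin_add[OF f] lin_add[OF g] lin_smult[OF f] lin_smult[OF g] c
        N.a_ac N.smult_r_distr)
qed

lemma lin_scale:
  assumes "module R M" and "module R N" and f: "lin R M N f" and "a \<in> carrier R"
  shows "lin R M N (\<lambda>x. a \<odot>\<^bsub>N\<^esub> f x)"
proof -
  interpret M: module R M by fact
  interpret N: module R N by fact
  note c = lin_closed[OF f]
  show ?thesis using assms(4)
    by (intro linI) (simp_all add: lin_add[OF f] lin_smult[OF f] c
        N.smult_r_distr N.smult_assoc1[symmetric] M.R.m_comm)
qed

lemma lin_uminus:
  assumes "module R M" and "module R N" and f: "lin R M N f"
  shows "lin R M N (\<lambda>x. \<ominus>\<^bsub>N\<^esub> f x)"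
proof -
  interpret M: module R M by fact
  interpret N: module R N by fact
  note c = lin_closed[OF f]
  show ?thesis
    by (intro linI) (simp_all add: lin_add[OF f] lin_smult[OF f] c N.minus_add N.smult_r_minus N.a_comm)
qed

lemma lin_diff:
  assumes "module R M" and "module R N" and f: "lin R M N f" and g: "lin R M N g"
  shows "lin R M N (\<lambda>x. f x \<ominus>\<^bsub>N\<^esub> g x)"
  using lin_plus[OF assms(1,2) f lin_uminus[OF assms(1,2) g]] by (simp add: a_minus_def)

lemma lin_mult:
  assumes "module R M" and "a \<in> carrier R"
  shows "lin R M M (\<lambda>x. a \<odot>\<^bsub>M\<^esub> x)"
  by (rule lin_scale[OF assms(1,1) lin_id assms(2)])


section \<open>Submodules and quotients\<close>

lemma submodule_sub: "submodule H R M \<Longrightarrow> x \<in> H \<Longrightarrow> x \<in> carrier M"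
  using subgroup.subset[of H "add_monoid M"] by (auto simp: submodule_def)

lemma submodule_subset: "submodule H R M \<Longrightarrow> H \<subseteq> carrier M"
  by (rule subsetI) (rule submodule_sub)

lemma submodule_zero: "submodule H R M \<Longrightarrow> \<zero>\<^bsub>M\<^esub> \<in> H"
  using subgroup.one_closed[of H "add_monoid M"] by (auto simp: submodule_def)

lemma submodule_add: "submodule H R M \<Longrightarrow> x \<in> H \<Longrightarrow> y \<in> H \<Longrightarrow> x \<oplus>\<^bsub>M\<^esub> y \<in> H"
  using subgroup.m_closed[of H "add_monoid M"] by (auto simp: submodule_def)

lemma submodule_neg: "submodule H R M \<Longrightarrow> x \<in> H \<Longrightarrow> \<ominus>\<^bsub>M\<^esub> x \<in> H"
  using subgroup.m_inv_closed[of H "add_monoid M"] by (auto simp: submodule_def a_inv_def)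

lemma submodule_minus: "submodule H R M \<Longrightarrow> x \<in> H \<Longrightarrow> y \<in> H \<Longrightarrow> x \<ominus>\<^bsub>M\<^esub> y \<in> H"
  by (simp add: a_minus_def submodule_add submodule_neg)

lemma submodule_smult: "submodule H R M \<Longrightarrow> a \<in> carrier R \<Longrightarrow> x \<in> H \<Longrightarrow> a \<odot>\<^bsub>M\<^esub> x \<in> H"
  by (auto simp: submodule_def submodule_axioms_def)

lemma submodule_finsum:
  assumes "module R M" and H: "submodule H R M" and "finite I" and "g \<in> I \<rightarrow> H"
  shows "(\<Oplus>\<^bsub>M\<^esub>i\<in>I. g i) \<in> H"
proof -
  interpret M: module R M by fact
  from assms(3,4) show ?thesis
  proof (induct I)
    case empty
    thus ?case using submodule_zero[OF H] by simp
  next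
    case (insert i I)
    have "g \<in> I \<rightarrow> carrier M" "g i \<in> carrier M" using insert.prems submodule_sub[OF H] by auto
    thus ?case using insert submodule_add[OF H] by simp
  qed
qed

lemma submodule_vimage:
  assumes "module R M" and "module R N" and f: "lin R M N f" and H: "submodule H R N"
  shows "submodule {x \<in> carrier M. f x \<in> H} R M"
proof -
  interpret M: module R M by fact
  show ?thesis
    by (rule M.submoduleI) (auto simp: lin_zero[OF assms(1-3)] lin_neg[OF assms(1-3)] lin_add[OF f]
        lin_smult[OF f] intro: submodule_zero[OF H] submodule_neg[OF H] submodule_add[OF H]
        submodule_smult[OF H])
qed

lemma submodule_triv: "module R M \<Longrightarrow> submodule {\<zero>\<^bsub>M\<^esub>} R M"
proof -
  assume "module R M"
  then interpret M: module R M .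
  show ?thesis by (rule M.submoduleI) auto
qed

lemma submodule_ker:
  assumes "module R M" and "module R N" and f: "lin R M N f"
  shows "submodule {x \<in> carrier M. f x = \<zero>\<^bsub>N\<^esub>} R M"
  using submodule_vimage[OF assms submodule_triv[OF assms(2)]] by simp

lemma submodule_carrier: "module R M \<Longrightarrow> submodule (carrier M) R M"
  by (rule module.carrier_is_submodule)

lemma submodule_image:
  assumes "module R M" and "module R N" and f: "lin R M N f" and H: "submodule H R M"
  shows "submodule (f ` H) R N"
proof -
  interpret N: module R N by fact
  note sub = submodule_sub[OF H]
  show ?thesis
  proof (rule N.submoduleI)
    show "f ` H \<subseteq> carrier N" using sub lin_closed[OF f] by auto
    show "\<zero>\<^bsub>N\<^esub> \<in> f ` H" using lin_zero[OF assms(1-3)] submodule_zero[OF H] by force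
    show "\<ominus>\<^bsub>N\<^esub> a \<in> f ` H" if "a \<in> f ` H" for a
      using that lin_neg[OF assms(1-3)] submodule_neg[OF H] sub by force
    show "a \<oplus>\<^bsub>N\<^esub> b \<in> f ` H" if ab: "a \<in> f ` H" "b \<in> f ` H" for a b
    proof -
      from ab obtain x y where "a = f x" "b = f y" "x \<in> H" "y \<in> H" by auto
      thus ?thesis using lin_add[OF f, of x y] submodule_add[OF H, of x y] sub by force
    qed
    show "a \<odot>\<^bsub>N\<^esub> x \<in> f ` H" if "a \<in> carrier R" "x \<in> f ` H" for a x
      using that lin_smult[OF f] submodule_smult[OF H] sub by force
  qed
qed

lemma submodule_module:
  assumes "submodule H R M" and "module R M"
  shows "module R (M\<lparr>carrier := H\<rparr>)"
  using submodule.submodule_is_module[OF assms] .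

lemma submodule_abelian_subgroup:
  assumes "module R M" and "submodule H R M"
  shows "abelian_subgroup H M"
  using assms by (intro abelian_subgroupI3 additive_subgroup.intro)
    (auto simp: submodule_def module_def)

lemma quot_carrier: "C \<in> carrier (quot_module M H) \<longleftrightarrow> (\<exists>x\<in>carrier M. C = H +>\<^bsub>M\<^esub> x)"
  by (auto simp: quot_module_def A_RCOSETS_def')

lemma quot_carrierI [intro]: "x \<in> carrier M \<Longrightarrow> H +>\<^bsub>M\<^esub> x \<in> carrier (quot_module M H)"
  by (auto simp: quot_carrier)

lemma mem_coset: "y \<in> H +>\<^bsub>M\<^esub> x \<longleftrightarrow> (\<exists>h\<in>H. y = h \<oplus>\<^bsub>M\<^esub> x)"
  by (auto simp: a_r_coset_def')

lemma coset_eq_iff: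
  assumes "module R M" and H: "submodule H R M" and xy: "x \<in> carrier M" "y \<in> carrier M"
  shows "H +>\<^bsub>M\<^esub> x = H +>\<^bsub>M\<^esub> y \<longleftrightarrow> x \<ominus>\<^bsub>M\<^esub> y \<in> H"
proof -
  interpret M: module R M by fact
  interpret H: abelian_subgroup H M by (rule submodule_abelian_subgroup[OF assms(1,2)])
  note sub = submodule_sub[OF H]
  show ?thesis
  proof
    assume "H +>\<^bsub>M\<^esub> x = H +>\<^bsub>M\<^esub> y"
    then obtain h where "h \<in> H" "x = h \<oplus>\<^bsub>M\<^esub> y" using H.a_rcos_self[OF xy(1)] by (auto simp: mem_coset)
    thus "x \<ominus>\<^bsub>M\<^esub> y \<in> H" using sub[of h] xy by (simp add: a_minus_def M.a_assoc M.r_neg)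
  next
    assume h: "x \<ominus>\<^bsub>M\<^esub> y \<in> H"
    have "x = (x \<ominus>\<^bsub>M\<^esub> y) \<oplus>\<^bsub>M\<^esub> y" using xy by (simp add: a_minus_def M.a_assoc M.l_neg)
    hence "x \<in> H +>\<^bsub>M\<^esub> y" using h by (auto simp: mem_coset)
    thus "H +>\<^bsub>M\<^esub> x = H +>\<^bsub>M\<^esub> y"
      using M.a_repr_independence[of x H y] H xy by (auto simp: submodule_def)
  qed
qed

lemma quot_zero: "\<zero>\<^bsub>quot_module M H\<^esub> = H"
  by (simp add: quot_module_def)

lemma coset_zero:
  assumes "module R M" and H: "submodule H R M"
  shows "H +>\<^bsub>M\<^esub> \<zero>\<^bsub>M\<^esub> = H"
proof -
  interpret M: module R M by fact
  show ?thesis using submodule_sub[OF H] by (intro M.a_coset_add_zero) auto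
qed

lemma coset_eq_zero_iff:
  assumes "module R M" and H: "submodule H R M" and x: "x \<in> carrier M"
  shows "H +>\<^bsub>M\<^esub> x = H \<longleftrightarrow> x \<in> H"
proof -
  interpret M: module R M by fact
  show ?thesis using coset_eq_iff[OF assms, of "\<zero>\<^bsub>M\<^esub>"] x M.minus_equality[of "\<zero>\<^bsub>M\<^esub>" "\<zero>\<^bsub>M\<^esub>"]
    by (simp add: coset_zero[OF assms(1,2)] a_minus_def)
qed

lemma quot_add:
  assumes "module R M" and H: "submodule H R M" and xy: "x \<in> carrier M" "y \<in> carrier M"
  shows "(H +>\<^bsub>M\<^esub> x) \<oplus>\<^bsub>quot_module M H\<^esub> (H +>\<^bsub>M\<^esub> y) = H +>\<^bsub>M\<^esub> (x \<oplus>\<^bsub>M\<^esub> y)"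
proof -
  interpret H: abelian_subgroup H M by (rule submodule_abelian_subgroup[OF assms(1,2)])
  show ?thesis using H.a_rcos_sum[OF xy] by (simp add: quot_module_def)
qed

text \<open>The union in the definitions of scalar multiplication and induced maps on cosets is a
  disguised choice of a representative.\<close>

lemma coset_UN:
  assumes "module R M" and H: "submodule H R M" and x: "x \<in> carrier M"
    and "\<And>h. h \<in> H \<Longrightarrow> F (h \<oplus>\<^bsub>M\<^esub> x) = F x"
  shows "(\<Union>y\<in>H +>\<^bsub>M\<^esub> x. F y) = F x"
proof -
  interpret M: module R M by fact
  have "x \<in> H +>\<^bsub>M\<^esub> x" using submodule_zero[OF H] x by (force simp: mem_coset)
  moreover have "F y = F x" if "y \<in> H +>\<^bsub>M\<^esub> x" for y using that assms(4) by (auto simp: mem_coset)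
  ultimately show ?thesis by blast
qed

lemma quot_smult:
  assumes "module R M" and H: "submodule H R M" and x: "x \<in> carrier M" and a: "a \<in> carrier R"
  shows "a \<odot>\<^bsub>quot_module M H\<^esub> (H +>\<^bsub>M\<^esub> x) = H +>\<^bsub>M\<^esub> (a \<odot>\<^bsub>M\<^esub> x)"
proof -
  interpret M: module R M by fact
  have "(\<Union>y\<in>H +>\<^bsub>M\<^esub> x. H +>\<^bsub>M\<^esub> (a \<odot>\<^bsub>M\<^esub> y)) = H +>\<^bsub>M\<^esub> (a \<odot>\<^bsub>M\<^esub> x)"
  proof (rule coset_UN[OF assms(1,2) x])
    fix h assume h: "h \<in> H"
    have hc: "h \<in> carrier M" using submodule_sub[OF H h] .
    have "a \<odot>\<^bsub>M\<^esub> (h \<oplus>\<^bsub>M\<^esub> x) \<ominus>\<^bsub>M\<^esub> a \<odot>\<^bsub>M\<^esub> x = a \<odot>\<^bsub>M\<^esub> h"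
      using hc x a by (simp add: M.smult_r_distr a_minus_def M.a_assoc M.r_neg)
    thus "H +>\<^bsub>M\<^esub> (a \<odot>\<^bsub>M\<^esub> (h \<oplus>\<^bsub>M\<^esub> x)) = H +>\<^bsub>M\<^esub> (a \<odot>\<^bsub>M\<^esub> x)"
      using hc x a submodule_smult[OF H a h] by (subst coset_eq_iff[OF assms(1,2)]) auto
  qed
  thus ?thesis by (simp add: quot_module_def)
qed

lemma quot_module_module:
  assumes "module R M" and H: "submodule H R M"
  shows "module R (quot_module M H)"
proof -
  interpret M: module R M by fact
  let ?Q = "quot_module M H"
  note q = quot_add[OF assms] quot_smult[OF assms]
  have z: "\<zero>\<^bsub>?Q\<^esub> = H +>\<^bsub>M\<^esub> \<zero>\<^bsub>M\<^esub>" by (simp add: coset_zero[OF assms] quot_zero)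
  show ?thesis
  proof (rule moduleI)
    show "cring R" by (rule M.R.is_cring)
    show "abelian_group ?Q"
    proof (rule abelian_groupI)
      fix C assume "C \<in> carrier ?Q"
      then obtain x where x: "x \<in> carrier M" "C = H +>\<^bsub>M\<^esub> x" by (auto simp: quot_carrier)
      show "\<exists>D\<in>carrier ?Q. D \<oplus>\<^bsub>?Q\<^esub> C = \<zero>\<^bsub>?Q\<^esub>"
        using x by (intro bexI[of _ "H +>\<^bsub>M\<^esub> (\<ominus>\<^bsub>M\<^esub> x)"]) (auto simp: q z M.l_neg)
    qed (auto simp: quot_carrier q z M.a_ac)
  qed (auto simp: quot_carrier q M.smult_l_distr M.smult_r_distr M.smult_assoc1)
qed

lemma quot_proj_lin:
  assumes "module R M" and H: "submodule H R M"
  shows "lin R M (quot_module M H) (\<lambda>x. H +>\<^bsub>M\<^esub> x)"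
  by (rule linI) (auto simp: quot_add[OF assms] quot_smult[OF assms])


section \<open>Generators\<close>

lemma submod_span_submodule:
  assumes "module R M" and S: "S \<subseteq> carrier M"
  shows "submodule (submod_span R M S) R M"
proof -
  interpret M: module R M by fact
  have c: "carrier M \<in> {H. submodule H R M \<and> S \<subseteq> H}" using S submodule_carrier[OF assms(1)] by simp
  show ?thesis unfolding submod_span_def
    by (rule M.submoduleI) (use c in \<open>auto intro: submodule_zero submodule_neg submodule_add submodule_smult\<close>)
qed

lemma submod_span_incl: "S \<subseteq> submod_span R M S"
  by (auto simp: submod_span_def)

lemma submod_span_least: "submodule H R M \<Longrightarrow> S \<subseteq> H \<Longrightarrow> submod_span R M S \<subseteq> H"
  by (auto simp: submod_span_def)

lemma submod_span_mono: "S \<subseteq> T \<Longrightarrow> submod_span R M S \<subseteq> submod_span R M T"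
  by (auto simp: submod_span_def)

lemma submod_span_image:
  assumes M: "module R M" and N: "module R N" and f: "lin R M N f" and S: "S \<subseteq> carrier M"
  shows "f ` submod_span R M S = submod_span R N (f ` S)"
proof
  have fS: "f ` S \<subseteq> carrier N" using S lin_closed[OF f] by auto
  have "submodule {x \<in> carrier M. f x \<in> submod_span R N (f ` S)} R M"
    by (intro submodule_vimage[OF M N f] submod_span_submodule[OF N fS])
  moreover have "S \<subseteq> {x \<in> carrier M. f x \<in> submod_span R N (f ` S)}"
    using S submod_span_incl[of "f ` S" R N] by auto
  ultimately show "f ` submod_span R M S \<subseteq> submod_span R N (f ` S)"
    using submod_span_least by blast
  show "submod_span R N (f ` S) \<subseteq> f ` submod_span R M S"
    using submod_span_incl[of S R M]
    by (intro submod_span_least submodule_image[OF M N f] submod_span_submodule[OF M S]) auto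
qed


section \<open>Hom modules and restriction of scalars\<close>

lemma mod_hom_eqI:
  assumes "f \<in> mod_hom R M N" and "g \<in> mod_hom R M N" and "\<And>x. x \<in> carrier M \<Longrightarrow> f x = g x"
  shows "f = g"
  using assms by (auto simp: mod_hom_iff intro: extensionalityI)

lemma hom_carrier: "carrier (hom_module R M N) = mod_hom R M N"
  by (simp add: hom_module_def)

lemma hom_add: "x \<in> carrier M \<Longrightarrow> (f \<oplus>\<^bsub>hom_module R M N\<^esub> g) x = f x \<oplus>\<^bsub>N\<^esub> g x"
  by (simp add: hom_module_def)

lemma hom_zero: "x \<in> carrier M \<Longrightarrow> \<zero>\<^bsub>hom_module R M N\<^esub> x = \<zero>\<^bsub>N\<^esub>"
  by (simp add: hom_module_def)

lemma hom_smult: "x \<in> carrier M \<Longrightarrow> (a \<odot>\<^bsub>hom_module R M N\<^esub> f) x = a \<odot>\<^bsub>N\<^esub> f x"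
  by (simp add: hom_module_def)

lemma hom_module_module:
  assumes M: "module R M" and N: "module R N"
  shows "module R (hom_module R M N)"
proof -
  interpret M: module R M by fact
  interpret N: module R N by fact
  let ?H = "hom_module R M N"
  note c = lin_closed[OF mod_hom_lin]
  have add: "f \<oplus>\<^bsub>?H\<^esub> g \<in> mod_hom R M N" if "f \<in> mod_hom R M N" "g \<in> mod_hom R M N" for f g
    using restrict_mod_hom[OF lin_plus[OF M N mod_hom_lin[OF that(1)] mod_hom_lin[OF that(2)]] M]
    by (simp add: hom_module_def)
  have sm: "a \<odot>\<^bsub>?H\<^esub> f \<in> mod_hom R M N" if "a \<in> carrier R" "f \<in> mod_hom R M N" for a f
    using restrict_mod_hom[OF lin_scale[OF M N mod_hom_lin[OF that(2)] that(1)] M]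
    by (simp add: hom_module_def)
  have ze: "\<zero>\<^bsub>?H\<^esub> \<in> mod_hom R M N"
    using restrict_mod_hom[OF lin_zero_map[OF M N] M] by (simp add: hom_module_def)
  show ?thesis
  proof (rule moduleI)
    show "cring R" by (rule M.R.is_cring)
    show "abelian_group ?H"
    proof (rule abelian_groupI, unfold hom_carrier)
      fix f assume f: "f \<in> mod_hom R M N"
      have "restrict (\<lambda>x. \<ominus>\<^bsub>N\<^esub> f x) (carrier M) \<in> mod_hom R M N"
        using restrict_mod_hom[OF lin_uminus[OF M N mod_hom_lin[OF f]] M] .
      thus "\<exists>g\<in>mod_hom R M N. g \<oplus>\<^bsub>?H\<^esub> f = \<zero>\<^bsub>?H\<^esub>"
        by (rule rev_bexI) (rule mod_hom_eqI, auto simp: hom_add hom_zero c[OF f] N.l_neg f ze intro!: add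
            restrict_mod_hom[OF lin_uminus[OF M N mod_hom_lin[OF f]] M])
    qed (auto intro!: add ze mod_hom_eqI simp: hom_add hom_zero c N.a_ac)
  qed (auto intro!: add sm mod_hom_eqI simp: hom_add hom_zero hom_smult c hom_carrier
      N.smult_l_distr N.smult_r_distr N.smult_assoc1)
qed

text \<open>Evaluation at a point carries negatives, differences and finite sums in the Hom module
  over to \<open>N\<close>, where they can be computed.\<close>

lemma hom_eval_lin: "x \<in> carrier M \<Longrightarrow> lin R (hom_module R M N) N (\<lambda>f. f x)"
  by (auto intro!: linI simp: hom_carrier hom_add hom_smult dest: lin_closed[OF mod_hom_lin])

lemma restrict_scalars_simps [simp]:
  "carrier (restrict_scalars A M) = carrier M"
  "add (restrict_scalars A M) = add M"
  "ring.zero (restrict_scalars A M) = ring.zero M"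
  "smult (restrict_scalars A M) p x = (p \<odot>\<^bsub>A\<^esub> \<one>\<^bsub>A\<^esub>) \<odot>\<^bsub>M\<^esub> x"
  by (simp_all add: restrict_scalars_def)

lemma restrict_scalars_module:
  fixes A :: "('p, 'a) module" and M :: "('a, 'm) module"
  assumes "algebra P A" and "module A M"
  shows "module P (restrict_scalars A M)"
proof -
  interpret A: algebra P A by fact
  interpret M: module A M by fact
  show ?thesis
  proof (rule moduleI)
    show "cring P" by (rule A.R_cring)
    show "abelian_group (restrict_scalars A M)"
      by (rule abelian_groupI) (auto simp: M.a_ac intro!: bexI[of _ "\<ominus>\<^bsub>M\<^esub> x" for x] M.l_neg)
    fix a b x assume "a \<in> carrier P" "b \<in> carrier P" "x \<in> carrier (restrict_scalars A M)"
    hence abx: "a \<in> carrier P" "b \<in> carrier P" "x \<in> carrier M" by auto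
    \<comment> \<open>The structure map of the algebra is multiplicative; this is what associativity
      of the restricted action amounts to.\<close>
    have "a \<otimes>\<^bsub>P\<^esub> b \<odot>\<^bsub>A\<^esub> \<one>\<^bsub>A\<^esub> = (a \<odot>\<^bsub>A\<^esub> \<one>\<^bsub>A\<^esub>) \<otimes>\<^bsub>A\<^esub> (b \<odot>\<^bsub>A\<^esub> \<one>\<^bsub>A\<^esub>)"
      using abx by (simp add: A.smult_assoc1 A.smult_assoc2)
    thus "(a \<otimes>\<^bsub>P\<^esub> b) \<odot>\<^bsub>restrict_scalars A M\<^esub> x = a \<odot>\<^bsub>restrict_scalars A M\<^esub> (b \<odot>\<^bsub>restrict_scalars A M\<^esub> x)"
      using abx by (simp add: M.smult_assoc1)
  qed (auto simp: A.smult_l_distr M.smult_l_distr M.smult_r_distr)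
qed


lemma minus_eq_zero_iff:
  assumes "module R M" and "x \<in> carrier M" and "y \<in> carrier M"
  shows "x \<ominus>\<^bsub>M\<^esub> y = \<zero>\<^bsub>M\<^esub> \<longleftrightarrow> x = y"
proof -
  interpret M: module R M by fact
  show ?thesis using assms(2,3) M.minus_equality[of x "\<ominus>\<^bsub>M\<^esub> y"] by (auto simp: a_minus_def M.r_neg)
qed

section \<open>Free modules\<close>

lemma free_carrier: "z \<in> carrier (free_module R B) \<longleftrightarrow>
    (\<forall>b. z b \<in> carrier R) \<and> (\<forall>b. b \<notin> B \<longrightarrow> z b = \<zero>\<^bsub>R\<^esub>) \<and> finite {b. z b \<noteq> \<zero>\<^bsub>R\<^esub>}"
  by (simp add: free_module_def)

lemma free_ops [simp]:
  "\<zero>\<^bsub>free_module R B\<^esub> = (\<lambda>b. \<zero>\<^bsub>R\<^esub>)"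
  "z \<oplus>\<^bsub>free_module R B\<^esub> w = (\<lambda>b. z b \<oplus>\<^bsub>R\<^esub> w b)"
  "a \<odot>\<^bsub>free_module R B\<^esub> z = (\<lambda>b. a \<otimes>\<^bsub>R\<^esub> z b)"
  by (simp_all add: free_module_def)

lemma free_module_module:
  assumes "cring R"
  shows "module R (free_module R B)"
proof -
  interpret R: cring R by fact
  let ?F = "free_module R B"
  have add: "z \<oplus>\<^bsub>?F\<^esub> w \<in> carrier ?F" if "z \<in> carrier ?F" "w \<in> carrier ?F" for z w
  proof -
    have "{b. z b \<oplus>\<^bsub>R\<^esub> w b \<noteq> \<zero>\<^bsub>R\<^esub>} \<subseteq> {b. z b \<noteq> \<zero>\<^bsub>R\<^esub>} \<union> {b. w b \<noteq> \<zero>\<^bsub>R\<^esub>}" by auto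
    moreover have "finite ({b. z b \<noteq> \<zero>\<^bsub>R\<^esub>} \<union> {b. w b \<noteq> \<zero>\<^bsub>R\<^esub>})" using that by (simp add: free_carrier)
    ultimately have "finite {b. z b \<oplus>\<^bsub>R\<^esub> w b \<noteq> \<zero>\<^bsub>R\<^esub>}" by (rule finite_subset)
    thus ?thesis using that by (simp add: free_carrier)
  qed
  have sm: "a \<odot>\<^bsub>?F\<^esub> z \<in> carrier ?F" if "a \<in> carrier R" "z \<in> carrier ?F" for a z
  proof -
    have "{b. a \<otimes>\<^bsub>R\<^esub> z b \<noteq> \<zero>\<^bsub>R\<^esub>} \<subseteq> {b. z b \<noteq> \<zero>\<^bsub>R\<^esub>}" using that by auto
    moreover have "finite {b. z b \<noteq> \<zero>\<^bsub>R\<^esub>}" using that by (simp add: free_carrier)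
    ultimately have "finite {b. a \<otimes>\<^bsub>R\<^esub> z b \<noteq> \<zero>\<^bsub>R\<^esub>}" by (rule finite_subset)
    thus ?thesis using that by (simp add: free_carrier)
  qed
  have ze: "\<zero>\<^bsub>?F\<^esub> \<in> carrier ?F" by (simp add: free_carrier)
  show ?thesis
  proof (rule moduleI)
    show "abelian_group ?F"
    proof (rule abelian_groupI)
      fix z assume z: "z \<in> carrier ?F"
      hence "(\<ominus>\<^bsub>R\<^esub> \<one>\<^bsub>R\<^esub>) \<odot>\<^bsub>?F\<^esub> z \<in> carrier ?F" by (intro sm) auto
      thus "\<exists>w\<in>carrier ?F. w \<oplus>\<^bsub>?F\<^esub> z = \<zero>\<^bsub>?F\<^esub>"
        by (rule rev_bexI) (use z in \<open>auto simp: free_carrier R.l_minus R.l_neg\<close>)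
    qed (auto intro!: add ze simp del: free_ops, auto simp: free_carrier R.a_ac)
  qed (use sm in \<open>auto simp: free_carrier R.l_distr R.r_distr R.m_assoc intro: assms\<close>)
qed

lemma free_minus:
  assumes "cring R" and "z \<in> carrier (free_module R B)" and "w \<in> carrier (free_module R B)"
  shows "(z \<ominus>\<^bsub>free_module R B\<^esub> w) b = z b \<ominus>\<^bsub>R\<^esub> w b"
proof -
  interpret R: cring R by fact
  interpret F: module R "free_module R B" by (rule free_module_module[OF assms(1)])
  have "\<ominus>\<^bsub>free_module R B\<^esub> w = (\<ominus>\<^bsub>R\<^esub> \<one>\<^bsub>R\<^esub>) \<odot>\<^bsub>free_module R B\<^esub> w"
    using assms(3) F.smult_l_minus[of "\<one>\<^bsub>R\<^esub>" w] F.smult_one[OF assms(3)] by simp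
  thus ?thesis using assms(2,3) by (simp add: a_minus_def free_carrier R.l_minus)
qed

lemma basis_vec_closed: "cring R \<Longrightarrow> b \<in> B \<Longrightarrow> basis_vec R b \<in> carrier (free_module R B)"
proof -
  assume "cring R" "b \<in> B"
  interpret R: cring R by fact
  have "{c. (if c = b then \<one>\<^bsub>R\<^esub> else \<zero>\<^bsub>R\<^esub>) \<noteq> \<zero>\<^bsub>R\<^esub>} \<subseteq> {b}" by auto
  thus ?thesis using \<open>b \<in> B\<close> by (auto simp: free_carrier basis_vec_def intro: finite_subset)
qed

lemma free_mono: "B \<subseteq> C \<Longrightarrow> z \<in> carrier (free_module R B) \<Longrightarrow> z \<in> carrier (free_module R C)"
  by (auto simp: free_carrier)

text \<open>Induction on the size of the support: setting one nonzero coordinate to zero makes it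
  smaller, and that coordinate is added back as a multiple of a basis vector.\<close>

lemma free_induct [consumes 2, case_names zero add]:
  assumes "cring R" and "z \<in> carrier (free_module R B)"
    and zero: "P (\<lambda>b. \<zero>\<^bsub>R\<^esub>)"
    and add: "\<And>a b w. a \<in> carrier R \<Longrightarrow> b \<in> B \<Longrightarrow> w \<in> carrier (free_module R B) \<Longrightarrow> P w \<Longrightarrow>
      P (w \<oplus>\<^bsub>free_module R B\<^esub> (a \<odot>\<^bsub>free_module R B\<^esub> basis_vec R b))"
  shows "P z"
  using assms(2)
proof (induction "card {b. z b \<noteq> \<zero>\<^bsub>R\<^esub>}" arbitrary: z)
  case 0
  hence "z = (\<lambda>b. \<zero>\<^bsub>R\<^esub>)" by (auto simp: free_carrier)
  thus ?case using zero by simp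
next
  case (Suc n)
  interpret R: cring R by fact
  from Suc.hyps(2) have "{b. z b \<noteq> \<zero>\<^bsub>R\<^esub>} \<noteq> {}" by (metis card.empty nat.distinct(1))
  then obtain b where b: "z b \<noteq> \<zero>\<^bsub>R\<^esub>" by auto
  have fin: "finite {b. z b \<noteq> \<zero>\<^bsub>R\<^esub>}" using Suc.prems by (simp add: free_carrier)
  define w where "w = z(b := \<zero>\<^bsub>R\<^esub>)"
  have s: "{b. w b \<noteq> \<zero>\<^bsub>R\<^esub>} = {b. z b \<noteq> \<zero>\<^bsub>R\<^esub>} - {b}" by (auto simp: w_def)
  have wc: "w \<in> carrier (free_module R B)"
    using Suc.prems fin s by (auto simp: free_carrier w_def)
  have "P w" using Suc.hyps(2) b fin s wc by (intro Suc.hyps(1)) auto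
  moreover have "b \<in> B" "z b \<in> carrier R" using b Suc.prems by (auto simp: free_carrier)
  ultimately have "P (w \<oplus>\<^bsub>free_module R B\<^esub> (z b \<odot>\<^bsub>free_module R B\<^esub> basis_vec R b))"
    using wc by (intro add)
  moreover have "w \<oplus>\<^bsub>free_module R B\<^esub> (z b \<odot>\<^bsub>free_module R B\<^esub> basis_vec R b) = z"
    using Suc.prems by (auto simp: w_def basis_vec_def free_carrier fun_eq_iff)
  ultimately show ?case by simp
qed

text \<open>Whatever is cut out by a submodule of the target need only be checked on basis vectors.
  The case of the zero submodule, applied to a difference of maps, gives uniqueness of linear
  extensions.\<close>

lemma lin_free_mem:
  assumes R: "cring R" and M: "module R M" and f: "lin R (free_module R B) M f"
    and H: "submodule H R M" and "\<And>b. b \<in> B \<Longrightarrow> f (basis_vec R b) \<in> H"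
    and "z \<in> carrier (free_module R B)"
  shows "f z \<in> H"
  using R assms(6)
proof (induction rule: free_induct)
  case zero
  show ?case using lin_zero[OF free_module_module[OF R] M f] submodule_zero[OF H] by simp
next
  case (add a b w)
  interpret F: module R "free_module R B" by (rule free_module_module[OF R])
  note c = basis_vec_closed[OF R add.hyps(2)]
  show ?case
    using add assms(5)[OF add.hyps(2)]
    by (subst lin_add[OF f]) (auto simp del: free_ops simp: c lin_smult[OF f]
        intro!: submodule_add[OF H] submodule_smult[OF H])
qed

lemma lin_free_eqI:
  assumes R: "cring R" and M: "module R M"
    and f: "lin R (free_module R B) M f" and g: "lin R (free_module R B) M g"
    and eq: "\<And>b. b \<in> B \<Longrightarrow> f (basis_vec R b) = g (basis_vec R b)"
    and z: "z \<in> carrier (free_module R B)"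
  shows "f z = g z"
proof -
  interpret M: module R M by fact
  note F = free_module_module[OF R]
  note c = lin_closed[OF f] lin_closed[OF g]
  have "f z \<ominus>\<^bsub>M\<^esub> g z \<in> {\<zero>\<^bsub>M\<^esub>}"
    by (rule lin_free_mem[OF R M lin_diff[OF F M f g] submodule_triv[OF M] _ z])
      (use eq basis_vec_closed[OF R, of _ B] c in \<open>simp add: a_minus_def M.r_neg\<close>)
  thus ?thesis using c[OF z] by (simp add: minus_eq_zero_iff[OF M])
qed

text \<open>The linear extension of an assignment \<open>v\<close> on a basis. Summing over the
  support of \<open>z\<close> keeps the sum finite over an infinite basis, and the basis does not
  occur in the term.\<close>

definition lin_ext ::
  "('a, 'x) ring_scheme \<Rightarrow> ('a, 'm, 'y) module_scheme \<Rightarrow> ('b \<Rightarrow> 'm) \<Rightarrow> ('b \<Rightarrow> 'a) \<Rightarrow> 'm"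
  where "lin_ext R M v z = (\<Oplus>\<^bsub>M\<^esub>b\<in>{b. z b \<noteq> \<zero>\<^bsub>R\<^esub>}. z b \<odot>\<^bsub>M\<^esub> v b)"

text \<open>Additivity compares sums over three different supports; enlarging each of them to a
  common finite set makes them comparable.\<close>

lemma lin_ext_eq:
  assumes M: "module R M" and v: "\<And>b. b \<in> B \<Longrightarrow> v b \<in> carrier M"
    and z: "z \<in> carrier (free_module R B)" and T: "finite T" "{b. z b \<noteq> \<zero>\<^bsub>R\<^esub>} \<subseteq> T" "T \<subseteq> B"
  shows "lin_ext R M v z = (\<Oplus>\<^bsub>M\<^esub>b\<in>T. z b \<odot>\<^bsub>M\<^esub> v b)"
proof -
  interpret M: module R M by fact
  show ?thesis unfolding lin_ext_def
    by (rule M.add.finprod_mono_neutral_cong_left) (use T v z in \<open>auto simp: free_carrier\<close>)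
qed

lemma lin_ext_lin:
  assumes M: "module R M" and v: "\<And>b. b \<in> B \<Longrightarrow> v b \<in> carrier M"
  shows "lin R (free_module R B) M (lin_ext R M v)"
proof -
  interpret M: module R M by fact
  let ?F = "free_module R B"
  interpret F: module R ?F by (rule free_module_module[OF M.R.is_cring])
  show ?thesis
  proof (rule linI)
    fix z assume z: "z \<in> carrier ?F"
    hence "(\<Oplus>\<^bsub>M\<^esub>b\<in>{b. z b \<noteq> \<zero>\<^bsub>R\<^esub>}. z b \<odot>\<^bsub>M\<^esub> v b) \<in> carrier M"
      using v by (intro M.finsum_closed) (auto simp: free_carrier)
    thus "lin_ext R M v z \<in> carrier M" by (simp add: lin_ext_def)
    fix w assume w: "w \<in> carrier ?F"
    let ?T = "{b. z b \<noteq> \<zero>\<^bsub>R\<^esub>} \<union> {b. w b \<noteq> \<zero>\<^bsub>R\<^esub>}"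
    have T: "finite ?T" "?T \<subseteq> B" using z w by (auto simp: free_carrier)
    have zw: "z \<oplus>\<^bsub>?F\<^esub> w \<in> carrier ?F" using z w by (rule F.a_closed)
    have vT: "b \<in> ?T \<Longrightarrow> v b \<in> carrier M" for b using T(2) v by blast
    have "lin_ext R M v (z \<oplus>\<^bsub>?F\<^esub> w) = (\<Oplus>\<^bsub>M\<^esub>b\<in>?T. (z \<oplus>\<^bsub>?F\<^esub> w) b \<odot>\<^bsub>M\<^esub> v b)"
      using z w by (intro lin_ext_eq[OF M v zw T(1) _ T(2)]) (auto simp: free_carrier)
    also have "\<dots> = (\<Oplus>\<^bsub>M\<^esub>b\<in>?T. z b \<odot>\<^bsub>M\<^esub> v b \<oplus>\<^bsub>M\<^esub> w b \<odot>\<^bsub>M\<^esub> v b)"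
      using z w vT by (intro M.finsum_cong') (auto simp: free_carrier M.smult_l_distr)
    also have "\<dots> = (\<Oplus>\<^bsub>M\<^esub>b\<in>?T. z b \<odot>\<^bsub>M\<^esub> v b) \<oplus>\<^bsub>M\<^esub> (\<Oplus>\<^bsub>M\<^esub>b\<in>?T. w b \<odot>\<^bsub>M\<^esub> v b)"
      using z w vT by (intro M.finsum_addf) (auto simp: free_carrier)
    finally show "lin_ext R M v (z \<oplus>\<^bsub>?F\<^esub> w) = lin_ext R M v z \<oplus>\<^bsub>M\<^esub> lin_ext R M v w"
      using lin_ext_eq[OF M v z T(1) _ T(2)] lin_ext_eq[OF M v w T(1) _ T(2)] by simp
  next
    fix a z assume a: "a \<in> carrier R" and z: "z \<in> carrier ?F"
    let ?T = "{b. z b \<noteq> \<zero>\<^bsub>R\<^esub>}"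
    have T: "finite ?T" "?T \<subseteq> B" using z by (auto simp: free_carrier)
    have vT: "b \<in> ?T \<Longrightarrow> v b \<in> carrier M" for b using T(2) v by blast
    have az: "a \<odot>\<^bsub>?F\<^esub> z \<in> carrier ?F" using a z by (rule F.smult_closed)
    have "lin_ext R M v (a \<odot>\<^bsub>?F\<^esub> z) = (\<Oplus>\<^bsub>M\<^esub>b\<in>?T. (a \<odot>\<^bsub>?F\<^esub> z) b \<odot>\<^bsub>M\<^esub> v b)"
      using a z by (intro lin_ext_eq[OF M v az T(1) _ T(2)]) auto
    also have "\<dots> = (\<Oplus>\<^bsub>M\<^esub>b\<in>?T. a \<odot>\<^bsub>M\<^esub> (z b \<odot>\<^bsub>M\<^esub> v b))"
      using a z vT by (intro M.finsum_cong') (auto simp: free_carrier M.smult_assoc1)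
    also have "\<dots> = a \<odot>\<^bsub>M\<^esub> (\<Oplus>\<^bsub>M\<^esub>b\<in>?T. z b \<odot>\<^bsub>M\<^esub> v b)"
      using a z vT T(1) by (intro M.finsum_smult_ldistr[symmetric]) (auto simp: free_carrier)
    finally show "lin_ext R M v (a \<odot>\<^bsub>?F\<^esub> z) = a \<odot>\<^bsub>M\<^esub> lin_ext R M v z" by (simp add: lin_ext_def)
  qed
qed

lemma lin_ext_basis:
  assumes M: "module R M" and v: "\<And>b. b \<in> B \<Longrightarrow> v b \<in> carrier M" and b: "b \<in> B"
  shows "lin_ext R M v (basis_vec R b) = v b"
proof -
  interpret M: module R M by fact
  have "lin_ext R M v (basis_vec R b) = (\<Oplus>\<^bsub>M\<^esub>c\<in>{b}. basis_vec R b c \<odot>\<^bsub>M\<^esub> v c)"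
    using b by (intro lin_ext_eq[OF M v basis_vec_closed[OF M.R.is_cring b]]) (auto simp: basis_vec_def)
  also have "\<dots> = v b" using v[OF b] by (simp add: basis_vec_def)
  finally show ?thesis .
qed

lemma lin_free_eq_lin_ext:
  assumes M: "module R M" and f: "lin R (free_module R B) M f" and z: "z \<in> carrier (free_module R B)"
  shows "f z = lin_ext R M (\<lambda>b. f (basis_vec R b)) z"
proof -
  note R = module_cring[OF M]
  note c = lin_closed[OF f basis_vec_closed[OF R]]
  show ?thesis
    by (rule lin_free_eqI[OF R M f lin_ext_lin[OF M] _ z]) (use c lin_ext_basis[OF M, of B] in auto)
qed

text \<open>Free modules are projective: choose a preimage under \<open>e\<close> for the image of
  each basis vector and extend linearly.\<close>

lemma free_lift:
  assumes Y: "module R Y" and V: "module R V" and h: "lin R (free_module R B) V h"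
    and e: "lin R Y V e" and im: "\<And>z. z \<in> carrier (free_module R B) \<Longrightarrow> h z \<in> e ` carrier Y"
  shows "\<exists>s\<in>mod_hom R (free_module R B) Y. \<forall>z\<in>carrier (free_module R B). e (s z) = h z"
proof -
  note R = module_cring[OF Y]
  have "\<forall>b\<in>B. \<exists>y\<in>carrier Y. e y = h (basis_vec R b)"
    using im basis_vec_closed[OF R, of _ B] by fastforce
  then obtain v where v: "\<And>b. b \<in> B \<Longrightarrow> v b \<in> carrier Y \<and> e (v b) = h (basis_vec R b)" by metis
  define s where "s = restrict (lin_ext R Y v) (carrier (free_module R B))"
  have sh: "s \<in> mod_hom R (free_module R B) Y"
    unfolding s_def using v by (intro restrict_mod_hom lin_ext_lin Y free_module_module R) auto
  have "e (s z) = h z" if "z \<in> carrier (free_module R B)" for z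
    by (rule lin_free_eqI[OF R V lin_comp[OF mod_hom_lin[OF sh] e] h _ that])
      (use v lin_ext_basis[OF Y, of B v] basis_vec_closed[OF R, of _ B] in \<open>simp add: s_def\<close>)
  with sh show ?thesis by blast
qed

lemma free_image_span:
  assumes M: "module R M" and f: "lin R (free_module R B) M f"
  shows "f ` carrier (free_module R B) = submod_span R M ((\<lambda>b. f (basis_vec R b)) ` B)"
proof
  note R = module_cring[OF M]
  have S: "(\<lambda>b. f (basis_vec R b)) ` B \<subseteq> carrier M"
    using lin_closed[OF f basis_vec_closed[OF R]] by auto
  show "f ` carrier (free_module R B) \<subseteq> submod_span R M ((\<lambda>b. f (basis_vec R b)) ` B)"
  proof (rule image_subsetI)
    fix z assume z: "z \<in> carrier (free_module R B)"
    show "f z \<in> submod_span R M ((\<lambda>b. f (basis_vec R b)) ` B)"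
      by (rule lin_free_mem[OF R M f submod_span_submodule[OF M S] _ z])
        (rule subsetD[OF submod_span_incl], blast)
  qed
  show "submod_span R M ((\<lambda>b. f (basis_vec R b)) ` B) \<subseteq> f ` carrier (free_module R B)"
    using basis_vec_closed[OF R, of _ B]
    by (intro submod_span_least submodule_image[OF _ M f] submodule_carrier free_module_module R) blast
qed


section \<open>Noetherian modules\<close>

definition noeth_module :: "('a, 'x) ring_scheme \<Rightarrow> ('a, 'm) module \<Rightarrow> bool"
  where "noeth_module R M \<longleftrightarrow> module R M \<and>
    (\<forall>H. submodule H R M \<longrightarrow> (\<exists>S. finite S \<and> S \<subseteq> H \<and> submod_span R M S = H))"

text \<open>The ring as a module over itself. It is the target of coordinate functionals, it makes
  ideals appear as submodules, and it lets a graded ring be treated as a graded module.\<close>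

definition regular_module :: "('a, 'x) ring_scheme \<Rightarrow> ('a, 'a) module"
  where "regular_module R = \<lparr>carrier = carrier R, monoid.mult = monoid.mult R, one = one R, ring.zero = ring.zero R,
    add = add R, smult = monoid.mult R\<rparr>"

lemma regular_module_simps [simp]:
  "carrier (regular_module R) = carrier R" "add (regular_module R) = add R"
  "ring.zero (regular_module R) = ring.zero R" "smult (regular_module R) = monoid.mult R"
  by (simp_all add: regular_module_def)

lemma regular_module_module:
  assumes "cring R"
  shows "module R (regular_module R)"
proof -
  interpret R: cring R by fact
  show ?thesis
  proof (rule moduleI)
    show "abelian_group (regular_module R)"
      by (rule abelian_groupI) (auto simp: R.a_ac intro!: bexI[of _ "\<ominus>\<^bsub>R\<^esub> x" for x] R.l_neg)
  qed (auto simp: assms R.l_distr R.r_distr R.m_assoc)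
qed

lemma regular_submodule_ideal:
  assumes "cring R" and I: "submodule I R (regular_module R)"
  shows "ideal I R"
proof -
  interpret R: cring R by fact
  have s: "subgroup I (add_monoid R)"
    using I by (simp add: submodule_def regular_module_def subgroup_def m_inv_def)
  have c: "x \<in> I \<Longrightarrow> x \<in> carrier R" for x using submodule_sub[OF I] by simp
  show ?thesis
  proof (rule idealI[OF R.ring_axioms s])
    fix a x assume a: "a \<in> I" and x: "x \<in> carrier R"
    thus xa: "x \<otimes>\<^bsub>R\<^esub> a \<in> I" using submodule_smult[OF I x a] by simp
    thus "a \<otimes>\<^bsub>R\<^esub> x \<in> I" using x a c by (simp add: R.m_comm)
  qed
qed

lemma coord_lin: "lin R (free_module R B) (regular_module R) (\<lambda>z. z b)"
  by (rule linI) (auto simp: free_carrier)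

lemma noeth_image:
  assumes M: "noeth_module R M" and N: "module R N" and f: "lin R M N f" and sur: "f ` carrier M = carrier N"
  shows "noeth_module R N"
  unfolding noeth_module_def
proof (intro conjI allI impI N)
  fix H assume H: "submodule H R N"
  have Mm: "module R M" using M by (simp add: noeth_module_def)
  let ?G = "{x \<in> carrier M. f x \<in> H}"
  obtain S where S: "finite S" "S \<subseteq> ?G" "submod_span R M S = ?G"
    using M submodule_vimage[OF Mm N f H] unfolding noeth_module_def by meson
  have "f ` ?G = H" using sur submodule_sub[OF H] by force
  hence "submod_span R N (f ` S) = H"
    using submod_span_image[OF Mm N f, of S] S by auto
  thus "\<exists>S. finite S \<and> S \<subseteq> H \<and> submod_span R N S = H" using S by blast
qed

text \<open>Induction on the rank. A submodule \<open>H\<close> is controlled by the ideal of its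
  \<open>b\<close>-coordinates and by its intersection with the free module on \<open>B\<close>.
  Lifts of generators of the former together with generators of the latter generate
  \<open>H\<close>: subtracting an element with the same \<open>b\<close>-coordinate moves any
  element of \<open>H\<close> into the intersection.\<close>

lemma noeth_free:
  assumes R: "cring R" "noetherian_ring R" and "finite B"
  shows "noeth_module R (free_module R B)"
  using assms(3)
proof (induct B)
  case empty
  note F = free_module_module[OF R(1), of "{}"]
  have "H = submod_span R (free_module R ({} :: 'c set)) {}" if H: "submodule H R (free_module R ({} :: 'c set))" for H
  proof -
    have "x = y" if "x \<in> carrier (free_module R ({} :: 'c set))" "y \<in> carrier (free_module R ({} :: 'c set))" for x y
      using that by (auto simp: free_carrier)
    moreover have sp: "submodule (submod_span R (free_module R ({} :: 'c set)) {}) R (free_module R ({} :: 'c set))"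
      by (rule submod_span_submodule[OF F]) simp
    ultimately show ?thesis
      using submodule_sub[OF H] submodule_sub[OF sp] submodule_zero[OF H] submodule_zero[OF sp] by blast
  qed
  thus ?case unfolding noeth_module_def using F by blast
next
  case (insert b B)
  interpret R: cring R by fact
  let ?F = "free_module R (insert b B)"
  note F = free_module_module[OF R(1), of "insert b B"]
  note reg = regular_module_module[OF R(1)]
  show ?case unfolding noeth_module_def
  proof (intro conjI allI impI F)
    fix H assume H: "submodule H R ?F"
    have ideal: "ideal ((\<lambda>z. z b) ` L) R" if "submodule L R ?F" for L
      by (rule regular_submodule_ideal[OF R(1) submodule_image[OF F reg coord_lin that]])
    obtain A where A: "A \<subseteq> carrier R" "finite A" "(\<lambda>z. z b) ` H = Idl\<^bsub>R\<^esub> A"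
      using noetherian_ring.finetely_gen[OF R(2) ideal[OF H]] by blast
    have "A \<subseteq> (\<lambda>z. z b) ` H" using A(1) by (simp add: A(3) R.genideal_self)
    then obtain T where T: "T \<subseteq> H" "finite T" "A = (\<lambda>z. z b) ` T"
      using A(2) by (meson finite_subset_image)
    have B_incl: "lin R (free_module R B) ?F (\<lambda>z. z)"
      by (rule linI) (auto intro: free_mono[of B])
    let ?H' = "{z \<in> carrier (free_module R B). z \<in> H}"
    have "submodule ?H' R (free_module R B)"
      by (rule submodule_vimage[OF free_module_module[OF R(1)] F B_incl H])
    then obtain S where S: "finite S" "S \<subseteq> ?H'" "submod_span R (free_module R B) S = ?H'"
      using insert(3) unfolding noeth_module_def by meson
    let ?L = "submod_span R ?F (S \<union> T)"
    have ST: "S \<union> T \<subseteq> H" using S T by auto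
    have L: "submodule ?L R ?F" using ST submodule_subset[OF H] by (intro submod_span_submodule[OF F]) auto
    have SL: "?H' \<subseteq> ?L"
      using submod_span_image[OF free_module_module[OF R(1)] F B_incl, of S] S
        submod_span_mono[of S "S \<union> T" R ?F] by auto
    have "T \<subseteq> ?L" using submod_span_incl[of "S \<union> T" R ?F] by auto
    hence "A \<subseteq> (\<lambda>z. z b) ` ?L" using T(3) by blast
    hence AL: "(\<lambda>z. z b) ` H \<subseteq> (\<lambda>z. z b) ` ?L"
      unfolding A(3) by (rule R.genideal_minimal[OF ideal[OF L]])
    have LH: "?L \<subseteq> H" by (rule submod_span_least[OF H ST])
    have "H \<subseteq> ?L"
    proof
      fix z assume z: "z \<in> H"
      then obtain w where w: "w \<in> ?L" "z b = w b" using AL by blast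
      have c: "z \<in> carrier ?F" "w \<in> carrier ?F" using z w(1) submodule_sub[OF H] submodule_sub[OF L] by auto
      have d: "z \<ominus>\<^bsub>?F\<^esub> w \<in> H" using submodule_minus[OF H z] w(1) LH by auto
      have "(z \<ominus>\<^bsub>?F\<^esub> w) b = \<zero>\<^bsub>R\<^esub>"
        using c w(2) by (simp add: free_minus[OF R(1)] free_carrier)
      hence "z \<ominus>\<^bsub>?F\<^esub> w \<in> carrier (free_module R B)"
        using submodule_sub[OF H d] by (auto simp: free_carrier)
      hence "z \<ominus>\<^bsub>?F\<^esub> w \<in> ?L" using d SL by auto
      hence "z \<ominus>\<^bsub>?F\<^esub> w \<oplus>\<^bsub>?F\<^esub> w \<in> ?L" using submodule_add[OF L] w(1) by blast
      moreover have "z \<ominus>\<^bsub>?F\<^esub> w \<oplus>\<^bsub>?F\<^esub> w = z"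
      proof -
        interpret F: module R ?F by (rule F)
        show ?thesis using c by (simp add: a_minus_def F.a_assoc F.l_neg del: free_ops)
      qed
      ultimately show "z \<in> ?L" by simp
    qed
    thus "\<exists>S. finite S \<and> S \<subseteq> H \<and> submod_span R ?F S = H"
      using LH ST S(1) T(2) by (intro exI[of _ "S \<union> T"]) auto
  qed
qed

lemma fin_gen_noeth:
  assumes "cring R" "noetherian_ring R" and M: "fin_gen_module R M"
  shows "noeth_module R M"
proof -
  obtain S where S: "finite S" "S \<subseteq> carrier M" "submod_span R M S = carrier M"
    using M by (auto simp: fin_gen_module_def)
  have Mm: "module R M" using M by (simp add: fin_gen_module_def)
  have v: "b \<in> S \<Longrightarrow> b \<in> carrier M" for b using S(2) by auto
  have l: "lin R (free_module R S) M (lin_ext R M (\<lambda>b. b))" using v by (rule lin_ext_lin[OF Mm])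
  have "(\<lambda>b. lin_ext R M (\<lambda>b. b) (basis_vec R b)) ` S = S"
    using lin_ext_basis[where v = "\<lambda>b. b", OF Mm v] by force
  hence "lin_ext R M (\<lambda>b. b) ` carrier (free_module R S) = carrier M"
    by (simp only: free_image_span[OF Mm l] S(3))
  thus ?thesis by (rule noeth_image[OF noeth_free[OF assms(1,2) S(1)] Mm l])
qed

lemma fin_gen_image:
  assumes M: "fin_gen_module R M" and N: "module R N" and f: "lin R M N f" and sur: "f ` carrier M = carrier N"
  shows "fin_gen_module R N"
proof -
  obtain S where S: "finite S" "S \<subseteq> carrier M" "submod_span R M S = carrier M" and Mm: "module R M"
    using M by (auto simp: fin_gen_module_def)
  show ?thesis unfolding fin_gen_module_def
    using submod_span_image[OF Mm N f S(2)] S lin_closed[OF f] sur N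
    by (intro conjI exI[of _ "f ` S"]) auto
qed

text \<open>The union of the chain is a submodule, and its finitely many generators already lie in
  one member.\<close>

lemma noeth_chain_stable:
  assumes M: "noeth_module R M" and H: "\<And>n::nat. submodule (H n) R M" and mono: "\<And>n. H n \<subseteq> H (Suc n)"
  obtains n where "\<And>m. H m \<subseteq> H n"
proof -
  interpret M: module R M using M by (simp add: noeth_module_def)
  have le: "H m \<subseteq> H n" if "m \<le> n" for m n using lift_Suc_mono_le[of H, OF mono that] .
  have "submodule (\<Union>n. H n) R M"
  proof (rule M.submoduleI)
    fix a b assume "a \<in> (\<Union>n. H n)" "b \<in> (\<Union>n. H n)"
    then obtain m n where "a \<in> H m" "b \<in> H n" by auto
    hence "a \<in> H (max m n)" "b \<in> H (max m n)" using le[of m "max m n"] le[of n "max m n"] by auto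
    thus "a \<oplus>\<^bsub>M\<^esub> b \<in> (\<Union>n. H n)" using submodule_add[OF H] by blast
  qed (auto intro: submodule_sub[OF H] submodule_zero[OF H] submodule_neg[OF H] submodule_smult[OF H])
  then obtain S where S: "finite S" "S \<subseteq> (\<Union>n. H n)" "submod_span R M S = (\<Union>n. H n)"
    using M unfolding noeth_module_def by blast
  have "\<exists>n. S \<subseteq> H n" using S(1,2)
  proof (induct S rule: finite_induct)
    case (insert x S)
    then obtain n m where "S \<subseteq> H n" "x \<in> H m" by auto
    hence "insert x S \<subseteq> H (max n m)" using le[of n "max n m"] le[of m "max n m"] by auto
    thus ?case by blast
  qed simp
  then obtain n where "S \<subseteq> H n" ..
  hence "(\<Union>n. H n) \<subseteq> H n" using submod_span_least[OF H, of S n] S(3) by simp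
  thus ?thesis using that by blast
qed

text \<open>For finite \<open>B\<close> this module is a finite power of \<open>N\<close>: the maps
  sending \<open>z\<close> to \<open>z b\<close> times a generator of \<open>N\<close> generate
  it.\<close>

lemma fin_gen_hom_free:
  assumes R: "cring R" and N: "fin_gen_module R N" and B: "finite B"
  shows "fin_gen_module R (hom_module R (free_module R B) N)"
proof -
  obtain S where S: "finite S" "S \<subseteq> carrier N" "submod_span R N S = carrier N" and Nm: "module R N"
    using N by (auto simp: fin_gen_module_def)
  let ?F = "free_module R B" and ?H = "hom_module R (free_module R B) N"
  note F = free_module_module[OF R, of B]
  note H = hom_module_module[OF F Nm]
  interpret N: module R N by fact
  interpret H: module R ?H by fact
  define e where "e b n = restrict (\<lambda>z. z b \<odot>\<^bsub>N\<^esub> n) (carrier ?F)" for b n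
  have fc: "z \<in> carrier ?F \<Longrightarrow> z b \<in> carrier R" for z b by (simp add: free_carrier)
  have eh: "e b n \<in> carrier ?H" if "n \<in> carrier N" for b n
    unfolding e_def hom_carrier using that
    by (intro restrict_mod_hom F linI) (auto simp: fc N.smult_l_distr N.smult_assoc1)
  have el: "lin R N ?H (e b)" for b
  proof (rule linI[OF eh])
    interpret F: module R ?F by (rule F)
    fix x y assume xy: "x \<in> carrier N" "y \<in> carrier N"
    show "e b (x \<oplus>\<^bsub>N\<^esub> y) = e b x \<oplus>\<^bsub>?H\<^esub> e b y"
      using xy by (auto simp: e_def hom_module_def fc N.smult_r_distr)
  next
    fix a x assume ax: "a \<in> carrier R" "x \<in> carrier N"
    show "e b (a \<odot>\<^bsub>N\<^esub> x) = a \<odot>\<^bsub>?H\<^esub> e b x"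
      using ax by (auto simp: e_def hom_module_def fc N.smult_assoc1[symmetric] N.R.m_comm)
  qed auto
  define T where "T = (\<lambda>(b, s). e b s) ` (B \<times> S)"
  have T: "finite T" "T \<subseteq> carrier ?H" using B S eh by (auto simp: T_def)
  note sp = submod_span_submodule[OF H T(2)]
  \<comment> \<open>For fixed \<open>b\<close> the elements \<open>n\<close> whose map
    \<open>e b n\<close> lies in the span form a submodule of \<open>N\<close>, and it contains the
    generators \<open>S\<close>.\<close>
  have in_span: "e b n \<in> submod_span R ?H T" if b: "b \<in> B" and n: "n \<in> carrier N" for b n
  proof -
    have "submodule {n \<in> carrier N. e b n \<in> submod_span R ?H T} R N"
      by (rule submodule_vimage[OF Nm H el sp])
    moreover have "S \<subseteq> {n \<in> carrier N. e b n \<in> submod_span R ?H T}"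
      using S(2) b submod_span_incl[of T R ?H] by (auto simp: T_def)
    ultimately have "carrier N \<subseteq> {n \<in> carrier N. e b n \<in> submod_span R ?H T}"
      using submod_span_least S(3) by blast
    thus ?thesis using n by blast
  qed
  have "carrier ?H \<subseteq> submod_span R ?H T"
  proof
    fix f assume f: "f \<in> carrier ?H"
    hence fl: "lin R ?F N f" and fh: "f \<in> mod_hom R ?F N" by (auto simp: hom_carrier mod_hom_iff)
    have fb: "b \<in> B \<Longrightarrow> f (basis_vec R b) \<in> carrier N" for b
      by (rule lin_closed[OF fl basis_vec_closed[OF R]])
    let ?s = "\<Oplus>\<^bsub>?H\<^esub>b\<in>B. e b (f (basis_vec R b))"
    have s: "?s \<in> submod_span R ?H T"
      using in_span fb by (intro submodule_finsum[OF H sp B]) auto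
    have "f = ?s"
    proof (rule mod_hom_eqI[OF fh])
      show "?s \<in> mod_hom R ?F N" using submodule_sub[OF sp s] by (simp add: hom_carrier)
      fix z assume z: "z \<in> carrier ?F"
      have "f z = lin_ext R N (\<lambda>b. f (basis_vec R b)) z" by (rule lin_free_eq_lin_ext[OF Nm fl z])
      also have "\<dots> = (\<Oplus>\<^bsub>N\<^esub>b\<in>B. z b \<odot>\<^bsub>N\<^esub> f (basis_vec R b))"
        using z fb by (intro lin_ext_eq[OF Nm _ z B]) (auto simp: free_carrier)
      also have "\<dots> = (\<Oplus>\<^bsub>N\<^esub>b\<in>B. e b (f (basis_vec R b)) z)" using z by (simp add: e_def)
      also have "\<dots> = ?s z"
        using fb eh by (intro lin_finsum[OF H Nm hom_eval_lin[OF z] B, symmetric]) auto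
      finally show "f z = ?s z" .
    qed
    thus "f \<in> submod_span R ?H T" using s by simp
  qed
  hence "submod_span R ?H T = carrier ?H" using submodule_subset[OF sp] by auto
  thus ?thesis using T H by (auto simp: fin_gen_module_def)
qed


section \<open>Comparison of free resolutions\<close>

text \<open>The kernel of the map leaving position \<open>i\<close>, where the augmentation is the
  map leaving position 0. The two forms of exactness in \<open>is_free_res\<close> become the single
  statement \<open>res_exact\<close>.\<close>

definition res_ker ::
  "('a, 'x) ring_scheme \<Rightarrow> ('a, 'm) module \<Rightarrow> ('a, 'b, 'm) free_res \<Rightarrow> nat \<Rightarrow> ('b \<Rightarrow> 'a) set"
  where "res_ker R M P i = (case i of
    0 \<Rightarrow> {z \<in> carrier (res_module R P 0). res_aug P z = \<zero>\<^bsub>M\<^esub>}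
  | Suc j \<Rightarrow> {z \<in> carrier (res_module R P (Suc j)). res_diff P j z = \<zero>\<^bsub>res_module R P j\<^esub>})"

text \<open>Counterparts of \<open>cocycles\<close> and \<open>coboundaries\<close> for functions
  that need not be extensional. In \<open>cobd\<close> only the values on the carrier matter, so
  representatives may be replaced by any term that agrees there.\<close>

definition cocyc ::
  "('a, 'x) ring_scheme \<Rightarrow> ('a, 'b, 'm) free_res \<Rightarrow> ('a, 'n) module \<Rightarrow> nat \<Rightarrow> (('b \<Rightarrow> 'a) \<Rightarrow> 'n) \<Rightarrow> bool"
  where "cocyc R P N i g \<longleftrightarrow> lin R (res_module R P i) N g \<and>
    (\<forall>z\<in>carrier (res_module R P (Suc i)). g (res_diff P i z) = \<zero>\<^bsub>N\<^esub>)"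

fun cobd ::
  "('a, 'x) ring_scheme \<Rightarrow> ('a, 'b, 'm) free_res \<Rightarrow> ('a, 'n) module \<Rightarrow> nat \<Rightarrow> (('b \<Rightarrow> 'a) \<Rightarrow> 'n) \<Rightarrow> bool"
  where
    "cobd R P N 0 g \<longleftrightarrow> (\<forall>z\<in>carrier (res_module R P 0). g z = \<zero>\<^bsub>N\<^esub>)"
  | "cobd R P N (Suc i) g \<longleftrightarrow> (\<exists>h. lin R (res_module R P i) N h \<and>
      (\<forall>z\<in>carrier (res_module R P (Suc i)). g z = h (res_diff P i z)))"

text \<open>A chain map over \<open>f\<close>, again without extensionality, so that lifts compose
  as plain functions.\<close>

definition lin_lift ::
  "('a, 'x) ring_scheme \<Rightarrow> ('a, 'b, 'm) free_res \<Rightarrow> ('a, 'c, 'n) free_res \<Rightarrow> ('m \<Rightarrow> 'n)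
    \<Rightarrow> (nat \<Rightarrow> ('b \<Rightarrow> 'a) \<Rightarrow> ('c \<Rightarrow> 'a)) \<Rightarrow> bool"
  where "lin_lift R P Q f \<phi> \<longleftrightarrow>
    (\<forall>i. lin R (res_module R P i) (res_module R Q i) (\<phi> i)) \<and>
    (\<forall>z\<in>carrier (res_module R P 0). res_aug Q (\<phi> 0 z) = f (res_aug P z)) \<and>
    (\<forall>i. \<forall>z\<in>carrier (res_module R P (Suc i)).
      res_diff Q i (\<phi> (Suc i) z) = \<phi> i (res_diff P i z))"

text \<open>The map induced by \<open>\<phi>\<close> on cohomology in degree \<open>i\<close> has
  trivial kernel, stated for representatives.\<close>

definition pullback_inj ::
  "('a, 'x) ring_scheme \<Rightarrow> ('a, 'b, 'm) free_res \<Rightarrow> ('a, 'c, 'm') free_res \<Rightarrow> ('a, 'n) module \<Rightarrow> nat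
    \<Rightarrow> (('b \<Rightarrow> 'a) \<Rightarrow> ('c \<Rightarrow> 'a)) \<Rightarrow> bool"
  where "pullback_inj R P Q N i \<phi> \<longleftrightarrow>
    (\<forall>g. cocyc R Q N i g \<longrightarrow> cobd R P N i (\<lambda>z. g (\<phi> z)) \<longrightarrow> cobd R Q N i g)"

lemma res_module_module: "cring R \<Longrightarrow> module R (res_module R P i)"
  by (simp add: res_module_def free_module_module)

lemma
  assumes "is_free_res R M P"
  shows res_aug_lin: "lin R (res_module R P 0) M (res_aug P)"
    and res_diff_lin: "lin R (res_module R P (Suc i)) (res_module R P i) (res_diff P i)"
    and res_aug_surj: "res_aug P ` carrier (res_module R P 0) = carrier M"
  using assms by (simp_all add: is_free_res_def mod_hom_lin)

lemma res_exact:
  assumes "is_free_res R M P"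
  shows "res_diff P i ` carrier (res_module R P (Suc i)) = res_ker R M P i"
  using assms by (cases i) (simp_all add: is_free_res_def res_ker_def)

lemma res_ker_0: "z \<in> res_ker R M P 0 \<longleftrightarrow> z \<in> carrier (res_module R P 0) \<and> res_aug P z = \<zero>\<^bsub>M\<^esub>"
  by (simp add: res_ker_def)

lemma res_ker_Suc: "z \<in> res_ker R M P (Suc i) \<longleftrightarrow>
    z \<in> carrier (res_module R P (Suc i)) \<and> res_diff P i z = \<zero>\<^bsub>res_module R P i\<^esub>"
  by (simp add: res_ker_def)

lemma res_diff_ker:
  assumes "is_free_res R M P" and "z \<in> carrier (res_module R P (Suc i))"
  shows "res_diff P i z \<in> res_ker R M P i"
  using res_exact[OF assms(1), of i] assms(2) by blast

lemma res_diff_diff: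
  assumes "is_free_res R M P" and "z \<in> carrier (res_module R P (Suc (Suc i)))"
  shows "res_diff P i (res_diff P (Suc i) z) = \<zero>\<^bsub>res_module R P i\<^esub>"
  using res_diff_ker[OF assms] by (simp add: res_ker_Suc)

lemma cocyc_iff:
  assumes P: "is_free_res R M P"
  shows "cocyc R P N i g \<longleftrightarrow> lin R (res_module R P i) N g \<and> (\<forall>z\<in>res_ker R M P i. g z = \<zero>\<^bsub>N\<^esub>)"
  unfolding cocyc_def res_exact[OF P, symmetric] by blast

lemma cocyc_lin: "cocyc R P N i g \<Longrightarrow> lin R (res_module R P i) N g"
  by (simp add: cocyc_def)

lemma cobd_cong:
  assumes "cobd R P N i g" and "\<And>z. z \<in> carrier (res_module R P i) \<Longrightarrow> g' z = g z"
  shows "cobd R P N i g'"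
  using assms by (cases i) auto

lemma cobd_zero:
  assumes "module R N"
  shows "cobd R P N i (\<lambda>z. \<zero>\<^bsub>N\<^esub>)"
  using lin_zero_map[OF res_module_module[OF module_cring[OF assms]] assms] by (cases i) auto

lemma cobd_plus:
  assumes N: "module R N" and g: "cobd R P N i g" and g': "cobd R P N i g'"
  shows "cobd R P N i (\<lambda>z. g z \<oplus>\<^bsub>N\<^esub> g' z)"
proof (cases i)
  case 0
  interpret N: module R N by fact
  show ?thesis using g g' 0 by simp
next
  case (Suc j)
  obtain h h' where "lin R (res_module R P j) N h" "lin R (res_module R P j) N h'"
    "\<forall>z\<in>carrier (res_module R P i). g z = h (res_diff P j z)"
    "\<forall>z\<in>carrier (res_module R P i). g' z = h' (res_diff P j z)"
    using g g' Suc by auto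
  thus ?thesis using lin_plus[OF res_module_module[OF module_cring[OF N]] N] Suc
    by (auto intro!: exI[of _ "\<lambda>z. h z \<oplus>\<^bsub>N\<^esub> h' z"])
qed

lemma cobd_scale:
  assumes N: "module R N" and g: "cobd R P N i g" and a: "a \<in> carrier R"
  shows "cobd R P N i (\<lambda>z. a \<odot>\<^bsub>N\<^esub> g z)"
proof (cases i)
  case 0
  interpret N: module R N by fact
  show ?thesis using g a 0 by simp
next
  case (Suc j)
  obtain h where "lin R (res_module R P j) N h"
    "\<forall>z\<in>carrier (res_module R P i). g z = h (res_diff P j z)"
    using g Suc by auto
  thus ?thesis using lin_scale[OF res_module_module[OF module_cring[OF N]] N _ a] Suc
    by (auto intro!: exI[of _ "\<lambda>z. a \<odot>\<^bsub>N\<^esub> h z"])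
qed

lemma cobd_minus:
  assumes N: "module R N" and g: "cobd R P N i g" and g': "cobd R P N i g'"
    and c: "\<And>z. z \<in> carrier (res_module R P i) \<Longrightarrow> g' z \<in> carrier N"
  shows "cobd R P N i (\<lambda>z. g z \<ominus>\<^bsub>N\<^esub> g' z)"
proof -
  interpret N: module R N by fact
  have "cobd R P N i (\<lambda>z. g z \<oplus>\<^bsub>N\<^esub> (\<ominus>\<^bsub>R\<^esub> \<one>\<^bsub>R\<^esub>) \<odot>\<^bsub>N\<^esub> g' z)"
    by (intro cobd_plus cobd_scale N g g') auto
  thus ?thesis by (rule cobd_cong) (simp add: c N.smult_l_minus a_minus_def)
qed

lemma cobd_lin_imp_cocyc:
  assumes N: "module R N" and P: "is_free_res R M P" and g: "cobd R P N i g"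
    and gl: "lin R (res_module R P i) N g"
  shows "cocyc R P N i g"
proof (cases i)
  case 0
  note F = res_module_module[OF module_cring[OF N], of P]
  show ?thesis using g gl 0 lin_closed[OF res_diff_lin[OF P]] by (auto simp: cocyc_def)
next
  case (Suc j)
  note F = res_module_module[OF module_cring[OF N], of P]
  from g Suc obtain h where h: "lin R (res_module R P j) N h"
    "\<And>z. z \<in> carrier (res_module R P i) \<Longrightarrow> g z = h (res_diff P j z)" by auto
  show ?thesis unfolding cocyc_def
    using Suc gl h lin_closed[OF res_diff_lin[OF P]] res_diff_diff[OF P] lin_zero[OF F N h(1)] by auto
qed

section \<open>Chain maps between free resolutions, and their uniqueness up to homotopy\<close>

lemma is_res_lift_lin_lift: "is_res_lift R P Q f \<phi> \<Longrightarrow> lin_lift R P Q f \<phi>"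
  by (simp add: is_res_lift_def lin_lift_def mod_hom_lin)

lemma lin_lift_D:
  assumes "lin_lift R P Q f \<phi>"
  shows "lin R (res_module R P i) (res_module R Q i) (\<phi> i)"
    and "z \<in> carrier (res_module R P 0) \<Longrightarrow> res_aug Q (\<phi> 0 z) = f (res_aug P z)"
    and "z \<in> carrier (res_module R P (Suc i)) \<Longrightarrow> res_diff Q i (\<phi> (Suc i) z) = \<phi> i (res_diff P i z)"
  using assms by (auto simp: lin_lift_def)

lemma lin_lift_id: "lin_lift R P P (\<lambda>x. x) (\<lambda>i z. z)"
  by (simp add: lin_lift_def lin_id)

lemma lin_lift_comp:
  assumes \<phi>: "lin_lift R P Q f \<phi>" and \<psi>: "lin_lift R Q S g \<psi>"
  shows "lin_lift R P S (\<lambda>x. g (f x)) (\<lambda>i z. \<psi> i (\<phi> i z))"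
  unfolding lin_lift_def
  using lin_comp[OF lin_lift_D(1)[OF \<phi>] lin_lift_D(1)[OF \<psi>]] lin_lift_D(2,3)[OF \<phi>]
    lin_lift_D(2,3)[OF \<psi>] lin_closed[OF lin_lift_D(1)[OF \<phi>]] by auto

text \<open>The comparison theorem. Each component is obtained from projectivity of the free module
  and exactness of \<open>Q\<close>, so the family is built by dependent choice.\<close>

lemma res_lift_exists:
  assumes M: "module R M" and M': "module R M'" and P: "is_free_res R M P" and Q: "is_free_res R M' Q"
    and f: "lin R M M' f"
  shows "\<exists>\<phi>. is_res_lift R P Q f \<phi>"
proof -
  note R = module_cring[OF M]
  note FP = res_module_module[OF R, of P] and FQ = res_module_module[OF R, of Q]
  \<comment> \<open>Mapping kernels into kernels is the part of the invariant that drives the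
    recursion: it puts the composite with the differential of \<open>P\<close> into the image of the
    next differential of \<open>Q\<close>, as \<open>free_lift\<close> requires.\<close>
  define I where "I n \<phi> \<longleftrightarrow> \<phi> \<in> mod_hom R (res_module R P n) (res_module R Q n) \<and>
      (\<forall>z\<in>res_ker R M P n. \<phi> z \<in> res_ker R M' Q n) \<and>
      (n = 0 \<longrightarrow> (\<forall>z\<in>carrier (res_module R P 0). res_aug Q (\<phi> z) = f (res_aug P z)))" for n \<phi>
  define J where "J n \<phi> \<phi>' \<longleftrightarrow>
      (\<forall>z\<in>carrier (res_module R P (Suc n)). res_diff Q n (\<phi>' z) = \<phi> (res_diff P n z))" for n \<phi> \<phi>'
  have "\<exists>\<phi>. \<forall>n. I n (\<phi> n) \<and> J n (\<phi> n) (\<phi> (Suc n))"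
  proof (rule dependent_nat_choice)
    have "\<exists>\<phi>\<in>mod_hom R (res_module R P 0) (res_module R Q 0).
        \<forall>z\<in>carrier (res_module R P 0). res_aug Q (\<phi> z) = f (res_aug P z)"
      unfolding res_module_def[of R P]
      by (rule free_lift[OF FQ M' lin_comp[OF res_aug_lin[OF P, unfolded res_module_def] f] res_aug_lin[OF Q]])
        (use res_aug_surj[OF Q] lin_closed[OF f] lin_closed[OF res_aug_lin[OF P]] in \<open>auto simp: res_module_def\<close>)
    then obtain \<phi> where \<phi>: "\<phi> \<in> mod_hom R (res_module R P 0) (res_module R Q 0)"
      "\<And>z. z \<in> carrier (res_module R P 0) \<Longrightarrow> res_aug Q (\<phi> z) = f (res_aug P z)" by blast
    have "I 0 \<phi>"
      using \<phi> lin_closed[OF mod_hom_lin[OF \<phi>(1)]] lin_zero[OF M M' f] by (auto simp: I_def res_ker_0)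
    thus "\<exists>\<phi>. I 0 \<phi>" by blast
  next
    fix \<phi> n assume I: "I n \<phi>"
    hence \<phi>: "lin R (res_module R P n) (res_module R Q n) \<phi>"
      "\<And>z. z \<in> res_ker R M P n \<Longrightarrow> \<phi> z \<in> res_ker R M' Q n" by (auto simp: I_def mod_hom_lin)
    have "\<exists>s\<in>mod_hom R (res_module R P (Suc n)) (res_module R Q (Suc n)).
        \<forall>z\<in>carrier (res_module R P (Suc n)). res_diff Q n (s z) = \<phi> (res_diff P n z)"
      unfolding res_module_def[of R P]
      by (rule free_lift[OF FQ FQ lin_comp[OF res_diff_lin[OF P, of n, unfolded res_module_def[of R P]]
            \<phi>(1)[unfolded res_module_def[of R P]]] res_diff_lin[OF Q]])
        (use res_exact[OF Q, of n] \<phi>(2) res_diff_ker[OF P, of _ n] in \<open>auto simp: res_module_def[of R P]\<close>)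
    then obtain s where s: "s \<in> mod_hom R (res_module R P (Suc n)) (res_module R Q (Suc n))"
      "\<And>z. z \<in> carrier (res_module R P (Suc n)) \<Longrightarrow> res_diff Q n (s z) = \<phi> (res_diff P n z)" by blast
    have "I (Suc n) s"
      using s lin_closed[OF mod_hom_lin[OF s(1)]] lin_zero[OF FP FQ \<phi>(1)] by (auto simp: I_def res_ker_Suc)
    thus "\<exists>s. I (Suc n) s \<and> J n \<phi> s" using s(2) by (auto simp: J_def)
  qed
  then obtain \<phi> where \<phi>: "\<And>n. I n (\<phi> n)" "\<And>n. J n (\<phi> n) (\<phi> (Suc n))" by blast
  have "is_res_lift R P Q f \<phi>"
    using \<phi>(1)[unfolded I_def] \<phi>(2)[unfolded J_def] unfolding is_res_lift_def by blast
  thus ?thesis by blast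
qed

text \<open>Two lifts of the same map are homotopic, so they pull a cocycle back to cohomologous
  cochains. \<open>D\<close> is the difference of the lifts.\<close>

lemma lin_lift_homotopic:
  assumes M: "module R M" and M': "module R M'" and N: "module R N"
    and P: "is_free_res R M P" and Q: "is_free_res R M' Q" and f: "lin R M M' f"
    and \<phi>: "lin_lift R P Q f \<phi>" and \<psi>: "lin_lift R P Q f \<psi>" and g: "cocyc R Q N i g"
  shows "cobd R P N i (\<lambda>z. g (\<phi> i z) \<ominus>\<^bsub>N\<^esub> g (\<psi> i z))"
proof -
  note R = module_cring[OF M]
  note FP = res_module_module[OF R, of P] and FQ = res_module_module[OF R, of Q]
  note dP = lin_closed[OF res_diff_lin[OF P]] and dQ = lin_closed[OF res_diff_lin[OF Q]]
  interpret N: module R N by fact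
  define D where "D i z = \<phi> i z \<ominus>\<^bsub>res_module R Q i\<^esub> \<psi> i z" for i z
  have D: "lin R (res_module R P i) (res_module R Q i) (D i)" for i
    unfolding D_def by (intro lin_diff FP FQ lin_lift_D[OF \<phi>] lin_lift_D[OF \<psi>])
  note cl = lin_closed[OF lin_lift_D(1)[OF \<phi>]] lin_closed[OF lin_lift_D(1)[OF \<psi>]] lin_closed[OF D]
  have Dd: "res_diff Q i (D (Suc i) z) = D i (res_diff P i z)"
    if "z \<in> carrier (res_module R P (Suc i))" for i z
    using that lin_minus[OF FQ FQ res_diff_lin[OF Q]] lin_lift_D(3)[OF \<phi> that] lin_lift_D(3)[OF \<psi> that] cl
    by (simp add: D_def)
  have D0: "D 0 z \<in> res_ker R M' Q 0" if z: "z \<in> carrier (res_module R P 0)" for z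
  proof -
    interpret M': module R M' by fact
    have "res_aug Q (D 0 z) = f (res_aug P z) \<ominus>\<^bsub>M'\<^esub> f (res_aug P z)"
      using z lin_minus[OF FQ M' res_aug_lin[OF Q]] lin_lift_D(2)[OF \<phi> z] lin_lift_D(2)[OF \<psi> z] cl
      by (simp add: D_def)
    also have "\<dots> = \<zero>\<^bsub>M'\<^esub>" using z lin_closed[OF f] lin_closed[OF res_aug_lin[OF P]]
      by (simp add: minus_eq_zero_iff[OF M'])
    finally show ?thesis using cl z by (simp add: res_ker_0)
  qed
  have lift: "\<exists>s. lin R (res_module R P i) (res_module R Q (Suc i)) s \<and>
      (\<forall>z\<in>carrier (res_module R P i). res_diff Q i (s z) = h z)"
    if "lin R (res_module R P i) (res_module R Q i) h"
      "\<And>z. z \<in> carrier (res_module R P i) \<Longrightarrow> h z \<in> res_ker R M' Q i" for i h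
    using free_lift[OF FQ FQ that(1)[unfolded res_module_def[of R P]] res_diff_lin[OF Q]] that(2)
    by (auto simp: res_exact[OF Q] res_module_def[of R P] mod_hom_iff)
  \<comment> \<open>Half of a homotopy is enough: \<open>D - s d\<close> has to land in the kernel
    of the differential of \<open>Q\<close>. A cocycle \<open>g\<close> vanishes on that kernel,
    hence \<open>g D = g s d\<close>, a coboundary. The next \<open>s\<close> is a lift of this very
    map into the kernel.\<close>
  have htpy: "\<exists>s. lin R (res_module R P i) (res_module R Q (Suc i)) s \<and>
      (\<forall>z\<in>carrier (res_module R P (Suc i)).
        D (Suc i) z \<ominus>\<^bsub>res_module R Q (Suc i)\<^esub> s (res_diff P i z) \<in> res_ker R M' Q (Suc i))" for i
  proof (induction i)
    case 0
    obtain s where s: "lin R (res_module R P 0) (res_module R Q (Suc 0)) s"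
      "\<And>z. z \<in> carrier (res_module R P 0) \<Longrightarrow> res_diff Q 0 (s z) = D 0 z"
      using lift[OF D D0] by blast
    interpret Q1: module R "res_module R Q (Suc 0)" by (rule FQ)
    have "D (Suc 0) z \<ominus>\<^bsub>res_module R Q (Suc 0)\<^esub> s (res_diff P 0 z) \<in> res_ker R M' Q (Suc 0)"
      if z: "z \<in> carrier (res_module R P (Suc 0))" for z
      using z dP[OF z] lin_closed[OF s(1)] cl
      by (simp add: res_ker_Suc lin_minus[OF FQ FQ res_diff_lin[OF Q]] Dd s(2) minus_eq_zero_iff[OF FQ])
    thus ?case using s(1) by blast
  next
    case (Suc i)
    then obtain s where s: "lin R (res_module R P i) (res_module R Q (Suc i)) s"
      and sk: "\<And>z. z \<in> carrier (res_module R P (Suc i)) \<Longrightarrow>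
        D (Suc i) z \<ominus>\<^bsub>res_module R Q (Suc i)\<^esub> s (res_diff P i z) \<in> res_ker R M' Q (Suc i)" by blast
    define h where "h z = D (Suc i) z \<ominus>\<^bsub>res_module R Q (Suc i)\<^esub> s (res_diff P i z)" for z
    have h: "lin R (res_module R P (Suc i)) (res_module R Q (Suc i)) h"
      unfolding h_def by (intro lin_diff FP FQ D lin_comp[OF res_diff_lin[OF P] s])
    obtain s' where s': "lin R (res_module R P (Suc i)) (res_module R Q (Suc (Suc i))) s'"
      "\<And>z. z \<in> carrier (res_module R P (Suc i)) \<Longrightarrow> res_diff Q (Suc i) (s' z) = h z"
      using lift[OF h] sk unfolding h_def by blast
    interpret Q1: module R "res_module R Q (Suc i)" by (rule FQ)
    interpret Q2: module R "res_module R Q (Suc (Suc i))" by (rule FQ)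
    have "D (Suc (Suc i)) z \<ominus>\<^bsub>res_module R Q (Suc (Suc i))\<^esub> s' (res_diff P (Suc i) z)
        \<in> res_ker R M' Q (Suc (Suc i))"
      if z: "z \<in> carrier (res_module R P (Suc (Suc i)))" for z
    proof -
      \<comment> \<open>The correction term of \<open>h\<close> disappears on boundaries because two
        consecutive differentials compose to zero.\<close>
      have hd: "h (res_diff P (Suc i) z) = D (Suc i) (res_diff P (Suc i) z)"
        using z dP[OF z] cl Q1.minus_equality[of "\<zero>\<^bsub>res_module R Q (Suc i)\<^esub>" "\<zero>\<^bsub>res_module R Q (Suc i)\<^esub>"]
        by (simp add: h_def res_diff_diff[OF P] lin_zero[OF FP FQ s] a_minus_def)
      show ?thesis using z dP[OF z] lin_closed[OF s'(1)] cl
        by (simp add: res_ker_Suc lin_minus[OF FQ FQ res_diff_lin[OF Q]] Dd s'(2) hd minus_eq_zero_iff[OF FQ])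
    qed
    thus ?case using s'(1) by blast
  qed
  have gl: "lin R (res_module R Q i) N g" and gk: "\<And>z. z \<in> res_ker R M' Q i \<Longrightarrow> g z = \<zero>\<^bsub>N\<^esub>"
    using g by (auto simp: cocyc_iff[OF Q])
  have gD: "g (\<phi> i z) \<ominus>\<^bsub>N\<^esub> g (\<psi> i z) = g (D i z)" if "z \<in> carrier (res_module R P i)" for z
    using that cl by (simp add: D_def lin_minus[OF FQ N gl])
  show ?thesis
  proof (cases i)
    case 0
    thus ?thesis using gD gk D0 by simp
  next
    case (Suc j)
    obtain s where s: "lin R (res_module R P j) (res_module R Q i) s"
      and sk: "\<And>z. z \<in> carrier (res_module R P i) \<Longrightarrow>
        D i z \<ominus>\<^bsub>res_module R Q i\<^esub> s (res_diff P j z) \<in> res_ker R M' Q i" using htpy[of j] Suc by auto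
    have "g (\<phi> i z) \<ominus>\<^bsub>N\<^esub> g (\<psi> i z) = g (s (res_diff P j z))" if z: "z \<in> carrier (res_module R P i)" for z
    proof -
      have sc: "s (res_diff P j z) \<in> carrier (res_module R Q i)"
        using z dP lin_closed[OF s] Suc by auto
      have "g (D i z) \<ominus>\<^bsub>N\<^esub> g (s (res_diff P j z)) = \<zero>\<^bsub>N\<^esub>"
        using gk[OF sk[OF z]] sc cl z by (simp add: lin_minus[OF FQ N gl])
      thus ?thesis using gD[OF z] sc cl z lin_closed[OF gl] by (simp add: minus_eq_zero_iff[OF N])
    qed
    thus ?thesis using lin_comp[OF s gl] Suc by auto
  qed
qed

lemma cocyc_lift:
  assumes \<phi>: "lin_lift R P Q f \<phi>" and g: "cocyc R Q N i g"
  shows "cocyc R P N i (\<lambda>z. g (\<phi> i z))"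
  using g lin_comp[OF lin_lift_D(1)[OF \<phi>] cocyc_lin[OF g]] lin_lift_D(3)[OF \<phi>, symmetric]
    lin_closed[OF lin_lift_D(1)[OF \<phi>]] by (auto simp: cocyc_def)

lemma cobd_lift:
  assumes N: "module R N" and \<phi>: "lin_lift R P Q f \<phi>" and g: "cobd R Q N i g"
  shows "cobd R P N i (\<lambda>z. g (\<phi> i z))"
proof (cases i)
  case 0
  thus ?thesis using g lin_closed[OF lin_lift_D(1)[OF \<phi>]] by auto
next
  case (Suc j)
  then obtain h where h: "lin R (res_module R Q j) N h"
    "\<And>z. z \<in> carrier (res_module R Q i) \<Longrightarrow> g z = h (res_diff Q j z)" using g by auto
  thus ?thesis using Suc lin_comp[OF lin_lift_D(1)[OF \<phi>] h(1)] lin_lift_D(3)[OF \<phi>]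
    lin_closed[OF lin_lift_D(1)[OF \<phi>]] by (auto intro!: exI[of _ "\<lambda>z. h (\<phi> j z)"])
qed

text \<open>Comparison maps over the identities transport the property from the primed to the
  unprimed resolutions. This neutralises the choices in \<open>Ext_map\<close> and is what brings
  the cones into play.\<close>

lemma pullback_inj_indep:
  assumes M: "module R M" and M': "module R M'" and N: "module R N" and f: "lin R M M' f"
    and P: "is_free_res R M P" and Q: "is_free_res R M' Q"
    and P': "is_free_res R M P'" and Q': "is_free_res R M' Q'"
    and \<phi>: "lin_lift R P Q f \<phi>" and \<phi>': "lin_lift R P' Q' f \<phi>'"
    and inj: "pullback_inj R P' Q' N i (\<phi>' i)"
  shows "pullback_inj R P Q N i (\<phi> i)"
  unfolding pullback_inj_def
proof (intro allI impI)
  fix g assume g: "cocyc R Q N i g" and gB: "cobd R P N i (\<lambda>z. g (\<phi> i z))"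
  interpret N: module R N by fact
  note gl = lin_closed[OF cocyc_lin[OF g]]
  obtain \<sigma> where \<sigma>: "lin_lift R P' P (\<lambda>x. x) \<sigma>"
    using res_lift_exists[OF M M P' P lin_id] is_res_lift_lin_lift by blast
  obtain \<tau> where \<tau>: "lin_lift R Q Q' (\<lambda>x. x) \<tau>"
    using res_lift_exists[OF M' M' Q Q' lin_id] is_res_lift_lin_lift by blast
  obtain \<tau>' where \<tau>': "lin_lift R Q' Q (\<lambda>x. x) \<tau>'"
    using res_lift_exists[OF M' M' Q' Q lin_id] is_res_lift_lin_lift by blast
  \<comment> \<open>There are two lifts of \<open>f\<close> from \<open>P'\<close> to
    \<open>Q\<close>, one through \<open>Q'\<close> and one through \<open>P\<close>. The second
    pulls \<open>g\<close> back to a coboundary by assumption, so by homotopy the first does too,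
    and the known injectivity for \<open>\<phi>'\<close> applies.\<close>
  have a: "lin_lift R P' Q f (\<lambda>i z. \<tau>' i (\<phi>' i z))" using lin_lift_comp[OF \<phi>' \<tau>'] by simp
  have b: "lin_lift R P' Q f (\<lambda>i z. \<phi> i (\<sigma> i z))" using lin_lift_comp[OF \<sigma> \<phi>] by simp
  have c: "lin_lift R Q Q (\<lambda>x. x) (\<lambda>i z. \<tau>' i (\<tau> i z))" using lin_lift_comp[OF \<tau> \<tau>'] by simp
  have "cobd R P' N i (\<lambda>z. (g (\<tau>' i (\<phi>' i z)) \<ominus>\<^bsub>N\<^esub> g (\<phi> i (\<sigma> i z))) \<oplus>\<^bsub>N\<^esub> g (\<phi> i (\<sigma> i z)))"
    by (rule cobd_plus[OF N lin_lift_homotopic[OF M M' N P' Q f a b g] cobd_lift[OF N \<sigma> gB]])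
  hence "cobd R P' N i (\<lambda>z. g (\<tau>' i (\<phi>' i z)))"
    by (rule cobd_cong)
      (use gl lin_closed[OF lin_lift_D(1)[OF a]] lin_closed[OF lin_lift_D(1)[OF b]] in
        \<open>simp add: a_minus_def N.a_assoc N.l_neg\<close>)
  hence "cobd R Q' N i (\<lambda>z. g (\<tau>' i z))"
    using inj cocyc_lift[OF \<tau>' g] by (auto simp: pullback_inj_def)
  hence 1: "cobd R Q N i (\<lambda>z. g (\<tau>' i (\<tau> i z)))" by (rule cobd_lift[OF N \<tau>])
  \<comment> \<open>The round trip through \<open>Q'\<close> lifts the identity, so it changes
    \<open>g\<close> only by a coboundary.\<close>
  have 2: "cobd R Q N i (\<lambda>z. g z \<ominus>\<^bsub>N\<^esub> g (\<tau>' i (\<tau> i z)))"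
    by (rule lin_lift_homotopic[OF M' M' N Q Q lin_id lin_lift_id c g])
  show "cobd R Q N i g"
    by (rule cobd_cong[OF cobd_plus[OF N 2 1]])
      (use gl lin_closed[OF lin_lift_D(1)[OF c]] in \<open>simp add: a_minus_def N.a_assoc N.l_neg\<close>)
qed


section \<open>Ext\<close>

lemma cocycles_iff: "g \<in> cocycles R P N i \<longleftrightarrow> g \<in> mod_hom R (res_module R P i) N \<and> cocyc R P N i g"
  by (auto simp: cocycles_def cocyc_def mod_hom_lin)

lemma coboundaries_iff:
  assumes N: "module R N" and P: "is_free_res R M P"
  shows "g \<in> coboundaries R P N i \<longleftrightarrow> g \<in> mod_hom R (res_module R P i) N \<and> cobd R P N i g"
proof (cases i)
  case 0
  note F = res_module_module[OF module_cring[OF N], of P]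
  interpret H: module R "hom_module R (res_module R P 0) N" by (rule hom_module_module[OF F N])
  have "\<zero>\<^bsub>hom_module R (res_module R P 0) N\<^esub> \<in> mod_hom R (res_module R P 0) N"
    using H.zero_closed by (simp only: hom_carrier)
  thus ?thesis using 0 by (auto simp: hom_zero intro: mod_hom_eqI)
next
  case (Suc j)
  note F = res_module_module[OF module_cring[OF N], of P]
  note d = res_diff_lin[OF P, of j]
  have "g \<in> coboundaries R P N (Suc j)" if g: "g \<in> mod_hom R (res_module R P (Suc j)) N"
    and gB: "cobd R P N (Suc j) g"
  proof -
    from gB obtain h where h: "lin R (res_module R P j) N h"
      "\<And>z. z \<in> carrier (res_module R P (Suc j)) \<Longrightarrow> g z = h (res_diff P j z)" by auto
    have h': "restrict h (carrier (res_module R P j)) \<in> mod_hom R (res_module R P j) N"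
      by (rule restrict_mod_hom[OF h(1) F])
    have "g = compose (carrier (res_module R P (Suc j))) (restrict h (carrier (res_module R P j))) (res_diff P j)"
      using g h(2) lin_closed[OF d] by (auto simp: mod_hom_iff compose_def extensional_def fun_eq_iff)
    thus ?thesis using h' by auto
  qed
  moreover have "g \<in> mod_hom R (res_module R P (Suc j)) N \<and> cobd R P N (Suc j) g"
    if "g \<in> coboundaries R P N (Suc j)"
  proof -
    from that obtain h where h: "h \<in> mod_hom R (res_module R P j) N"
      "g = compose (carrier (res_module R P (Suc j))) h (res_diff P j)" by auto
    thus ?thesis using restrict_mod_hom[OF lin_comp[OF d mod_hom_lin[OF h(1)]] F] mod_hom_lin[OF h(1)]
      by (auto simp: compose_def)
  qed
  ultimately show ?thesis using Suc by blast
qed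

lemma cocycles_submodule:
  assumes N: "module R N"  and P: "is_free_res R M P"
  shows "submodule (cocycles R P N i) R (hom_module R (res_module R P i) N)"
proof -
  note F = res_module_module[OF module_cring[OF N], of P]
  interpret N: module R N by fact
  interpret H: module R "hom_module R (res_module R P i) N" by (rule hom_module_module[OF F N])
  note d = lin_closed[OF res_diff_lin[OF P, of i]]
  have z: "\<zero>\<^bsub>hom_module R (res_module R P i) N\<^esub> \<in> mod_hom R (res_module R P i) N"
    using H.zero_closed by (simp only: hom_carrier)
  have neg: "(\<ominus>\<^bsub>hom_module R (res_module R P i) N\<^esub> g) z = \<ominus>\<^bsub>N\<^esub> g z"
    if "g \<in> mod_hom R (res_module R P i) N" "z \<in> carrier (res_module R P i)" for g z
    using lin_neg[OF H.module_axioms N hom_eval_lin[OF that(2)]] that(1) by (simp add: hom_carrier)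
  show ?thesis
    by (rule H.submoduleI)
      (use d z H.a_closed H.smult_closed H.a_inv_closed in
        \<open>auto simp: cocycles_def hom_carrier hom_zero hom_add hom_smult neg\<close>)
qed

lemma coboundaries_submodule:
  assumes N: "module R N" and P: "is_free_res R M P"
  shows "submodule (coboundaries R P N i) R
    ((hom_module R (res_module R P i) N)\<lparr>carrier := cocycles R P N i\<rparr>)"
proof -
  note F = res_module_module[OF module_cring[OF N], of P]
  interpret N: module R N by fact
  let ?H = "hom_module R (res_module R P i) N"
  let ?Z = "?H\<lparr>carrier := cocycles R P N i\<rparr>"
  interpret H: module R ?H by (rule hom_module_module[OF F N])
  interpret Z: module R ?Z
    by (rule submodule_module[OF cocycles_submodule[OF assms] H.module_axioms])
  have bz: "g \<in> cocycles R P N i" if "g \<in> coboundaries R P N i" for g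
    using that cobd_lin_imp_cocyc[OF N P] by (auto simp: coboundaries_iff[OF assms] cocycles_iff mod_hom_lin)
  have zero: "\<zero>\<^bsub>?H\<^esub> \<in> coboundaries R P N i"
    using H.zero_closed cobd_cong[OF cobd_zero[OF N], of P i "\<zero>\<^bsub>?H\<^esub>"]
    by (auto simp: coboundaries_iff[OF assms] hom_carrier hom_zero)
  have add: "g \<oplus>\<^bsub>?H\<^esub> h \<in> coboundaries R P N i"
    if "g \<in> coboundaries R P N i" "h \<in> coboundaries R P N i" for g h
    using that H.a_closed[of g h] cobd_cong[OF cobd_plus[OF N, of P i g h], of "g \<oplus>\<^bsub>?H\<^esub> h"]
    by (auto simp: coboundaries_iff[OF assms] hom_carrier hom_add)
  have sm: "a \<odot>\<^bsub>?H\<^esub> g \<in> coboundaries R P N i" if "a \<in> carrier R" "g \<in> coboundaries R P N i" for a g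
    using that H.smult_closed[of a g] cobd_cong[OF cobd_scale[OF N, of P i g a], of "a \<odot>\<^bsub>?H\<^esub> g"]
    by (auto simp: coboundaries_iff[OF assms] hom_carrier hom_smult)
  show ?thesis
  proof (rule Z.submoduleI)
    fix g assume g: "g \<in> coboundaries R P N i"
    have "\<ominus>\<^bsub>?Z\<^esub> g = (\<ominus>\<^bsub>R\<^esub> \<one>\<^bsub>R\<^esub>) \<odot>\<^bsub>?Z\<^esub> g"
      using Z.smult_l_minus[of "\<one>\<^bsub>R\<^esub>" g] Z.smult_one[of g] bz[OF g] by simp
    thus "\<ominus>\<^bsub>?Z\<^esub> g \<in> coboundaries R P N i" using sm[OF _ g] by simp
  qed (use bz zero add sm in auto)
qed

text \<open>A coset depends only on the addition. \<open>Ext\<close> forms cosets in the module of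
  cocycles, \<open>Ext_map\<close> in the whole Hom module; this identifies the two.\<close>

lemma a_r_coset_carrier_update [simp]: "a_r_coset (M\<lparr>carrier := C\<rparr>) = a_r_coset (M :: ('a, 'm) module)"
  by (simp add: fun_eq_iff a_r_coset_def')

lemma Ext_module:
  assumes N: "module R N" and P: "is_free_res R M (chosen_res R M)"
  shows "module R (Ext R i M N)"
  using quot_module_module[OF submodule_module[OF cocycles_submodule[OF assms]
    hom_module_module[OF res_module_module[OF module_cring[OF N]] N]] coboundaries_submodule[OF assms]]
  by (simp add: Ext_def Let_def)

text \<open>Equality of cosets involves the abstract difference in the module of cocycles, whereas
  \<open>cobd\<close> speaks of values; evaluation at points relates them.\<close>

lemma mod_hom_minus_cobd:
  assumes N: "module R N" and P: "is_free_res R M P"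
    and g: "g \<in> cocycles R P N i" and h: "h \<in> cocycles R P N i"
  shows "g \<ominus>\<^bsub>(hom_module R (res_module R P i) N)\<lparr>carrier := cocycles R P N i\<rparr>\<^esub> h \<in> coboundaries R P N i
    \<longleftrightarrow> cobd R P N i (\<lambda>z. g z \<ominus>\<^bsub>N\<^esub> h z)"
proof -
  note F = res_module_module[OF module_cring[OF N], of P]
  let ?H = "hom_module R (res_module R P i) N"
  let ?Z = "?H\<lparr>carrier := cocycles R P N i\<rparr>"
  have Z: "module R ?Z"
    by (rule submodule_module[OF cocycles_submodule[OF N P] hom_module_module[OF F N]])
  interpret Z: module R ?Z by (rule Z)
  have gh: "g \<ominus>\<^bsub>?Z\<^esub> h \<in> cocycles R P N i" using Z.minus_closed[of g h] g h by simp
  have "lin R ?Z N (\<lambda>f. f z)" if "z \<in> carrier (res_module R P i)" for z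
    using hom_eval_lin[OF that, of R N] that
    by (auto simp: lin_def cocycles_iff hom_carrier)
  hence "(g \<ominus>\<^bsub>?Z\<^esub> h) z = g z \<ominus>\<^bsub>N\<^esub> h z" if "z \<in> carrier (res_module R P i)" for z
    using lin_minus[OF Z N, of "\<lambda>f. f z" g h] g h that by simp
  hence "cobd R P N i (g \<ominus>\<^bsub>?Z\<^esub> h) \<longleftrightarrow> cobd R P N i (\<lambda>z. g z \<ominus>\<^bsub>N\<^esub> h z)"
    using cobd_cong[of R P N i "g \<ominus>\<^bsub>?Z\<^esub> h" "\<lambda>z. g z \<ominus>\<^bsub>N\<^esub> h z"]
      cobd_cong[of R P N i "\<lambda>z. g z \<ominus>\<^bsub>N\<^esub> h z" "g \<ominus>\<^bsub>?Z\<^esub> h"] by auto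
  thus ?thesis using gh by (simp add: coboundaries_iff[OF N P] cocycles_iff)
qed

text \<open>After checking that the induced map is well defined on classes, injectivity of an
  additive map becomes triviality of its kernel. The hypothesis on \<open>\<phi>\<close> names
  precisely the lift chosen inside \<open>Ext_map\<close>.\<close>

lemma Ext_map_inj_iff:
  assumes M: "module R M" and M': "module R M'" and N: "module R N" and f: "lin R M M' f"
    and P: "is_free_res R M (chosen_res R M)" and Q: "is_free_res R M' (chosen_res R M')"
    and \<phi>: "\<phi> = (SOME \<phi>. is_res_lift R (chosen_res R M) (chosen_res R M') f \<phi>)"
  shows "lin_lift R (chosen_res R M) (chosen_res R M') f \<phi>"
    and "inj_on (Ext_map R i M M' N f) (carrier (Ext R i M' N)) \<longleftrightarrow>
      pullback_inj R (chosen_res R M) (chosen_res R M') N i (\<phi> i)"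
proof -
  let ?P = "chosen_res R M" and ?Q = "chosen_res R M'"
  note FP = res_module_module[OF module_cring[OF N], of ?P]
  note FQ = res_module_module[OF module_cring[OF N], of ?Q]
  let ?HP = "hom_module R (res_module R ?P i) N" and ?HQ = "hom_module R (res_module R ?Q i) N"
  let ?ZP = "?HP\<lparr>carrier := cocycles R ?P N i\<rparr>" and ?ZQ = "?HQ\<lparr>carrier := cocycles R ?Q N i\<rparr>"
  let ?BP = "coboundaries R ?P N i" and ?BQ = "coboundaries R ?Q N i"
  have ZP: "module R ?ZP"
    by (rule submodule_module[OF cocycles_submodule[OF N P] hom_module_module[OF FP N]])
  have ZQ: "module R ?ZQ"
    by (rule submodule_module[OF cocycles_submodule[OF N Q] hom_module_module[OF FQ N]])
  note BP = coboundaries_submodule[OF N P, of i] and BQ = coboundaries_submodule[OF N Q, of i]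
  interpret N: module R N by fact
  interpret ZQ: module R ?ZQ by (rule ZQ)
  show lift: "lin_lift R ?P ?Q f \<phi>"
    unfolding \<phi> by (rule is_res_lift_lin_lift[OF someI_ex[OF res_lift_exists[OF M M' P Q f]]])
  define \<Phi> where "\<Phi> g = compose (carrier (res_module R ?P i)) g (\<phi> i)" for g :: "_ \<Rightarrow> 'e"
  have \<Phi>z: "\<Phi> g z = g (\<phi> i z)" if "z \<in> carrier (res_module R ?P i)" for g z
    using that by (simp add: \<Phi>_def compose_def)
  have \<Phi>: "\<Phi> g \<in> cocycles R ?P N i" if "g \<in> cocycles R ?Q N i" for g
  proof -
    have g: "cocyc R ?Q N i g" using that by (simp add: cocycles_iff)
    note c = cocyc_lift[OF lift g]
    have "\<Phi> g \<in> mod_hom R (res_module R ?P i) N"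
      using restrict_mod_hom[OF cocyc_lin[OF c] FP] by (simp add: \<Phi>_def compose_def)
    thus ?thesis using c lin_closed[OF res_diff_lin[OF P, of i]] \<Phi>z
      by (auto simp: cocycles_def cocyc_def)
  qed
  have \<Phi>_eq: "?BP +>\<^bsub>?HP\<^esub> \<Phi> g = ?BP +>\<^bsub>?HP\<^esub> \<Phi> h \<longleftrightarrow> cobd R ?P N i (\<lambda>z. g (\<phi> i z) \<ominus>\<^bsub>N\<^esub> h (\<phi> i z))"
    if "g \<in> cocycles R ?Q N i" "h \<in> cocycles R ?Q N i" for g h
  proof -
    have "?BP +>\<^bsub>?HP\<^esub> \<Phi> g = ?BP +>\<^bsub>?HP\<^esub> \<Phi> h \<longleftrightarrow> cobd R ?P N i (\<lambda>z. \<Phi> g z \<ominus>\<^bsub>N\<^esub> \<Phi> h z)"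
      using coset_eq_iff[OF ZP BP, of "\<Phi> g" "\<Phi> h"] \<Phi> that
      by (simp add: mod_hom_minus_cobd[OF N P \<Phi> \<Phi>])
    also have "\<dots> \<longleftrightarrow> cobd R ?P N i (\<lambda>z. g (\<phi> i z) \<ominus>\<^bsub>N\<^esub> h (\<phi> i z))"
      by (intro iffI; erule cobd_cong) (simp_all add: \<Phi>z)
    finally show ?thesis .
  qed
  \<comment> \<open>All members of the union in \<open>Ext_map\<close> coincide: changing the
    representative by a coboundary \<open>h\<close> changes its pullback by the pullback of
    \<open>h\<close>, which is a coboundary.\<close>
  have map: "Ext_map R i M M' N f (?BQ +>\<^bsub>?HQ\<^esub> g) = ?BP +>\<^bsub>?HP\<^esub> \<Phi> g" if g: "g \<in> cocycles R ?Q N i" for g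
  proof -
    have "(\<Union>g\<in>?BQ +>\<^bsub>?ZQ\<^esub> g. ?BP +>\<^bsub>?HP\<^esub> \<Phi> g) = ?BP +>\<^bsub>?HP\<^esub> \<Phi> g"
    proof (rule coset_UN[OF ZQ BQ])
      show "g \<in> carrier ?ZQ" using g by simp
      fix h assume h: "h \<in> ?BQ"
      have hz: "h \<in> cocycles R ?Q N i" using submodule_sub[OF BQ h] by simp
      have hg: "h \<oplus>\<^bsub>?ZQ\<^esub> g \<in> cocycles R ?Q N i" using ZQ.a_closed[of h g] hz g by simp
      have "cobd R ?P N i (\<lambda>z. h (\<phi> i z))"
        using h by (intro cobd_lift[OF N lift]) (simp add: coboundaries_iff[OF N Q])
      moreover have "(h \<oplus>\<^bsub>?ZQ\<^esub> g) w \<ominus>\<^bsub>N\<^esub> g w = h w" if w: "w \<in> carrier (res_module R ?Q i)" for w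
      proof -
        have "h w \<in> carrier N" "g w \<in> carrier N"
          using hz g w by (auto simp: cocycles_iff dest!: cocyc_lin lin_closed)
        thus ?thesis using hom_add[OF w, of R N h g] by (simp add: a_minus_def N.a_assoc N.r_neg)
      qed
      ultimately have "cobd R ?P N i (\<lambda>z. (h \<oplus>\<^bsub>?ZQ\<^esub> g) (\<phi> i z) \<ominus>\<^bsub>N\<^esub> g (\<phi> i z))"
        using lin_closed[OF lin_lift_D(1)[OF lift]] by (elim cobd_cong) auto
      thus "?BP +>\<^bsub>?HP\<^esub> \<Phi> (h \<oplus>\<^bsub>?ZQ\<^esub> g) = ?BP +>\<^bsub>?HP\<^esub> \<Phi> g" using \<Phi>_eq[OF hg g] by simp
    qed
    moreover have "?BQ +>\<^bsub>?HQ\<^esub> g \<in> carrier (Ext R i M' N)"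
      using quot_carrierI[of g ?ZQ ?BQ] g by (simp add: Ext_def Let_def)
    ultimately show ?thesis by (simp add: Ext_map_def Let_def \<phi>[symmetric] \<Phi>_def)
  qed
  have carr: "carrier (Ext R i M' N) = (\<lambda>g. ?BQ +>\<^bsub>?HQ\<^esub> g) ` cocycles R ?Q N i"
    by (auto simp: Ext_def Let_def quot_carrier)
  have Q_eq: "?BQ +>\<^bsub>?HQ\<^esub> g = ?BQ +>\<^bsub>?HQ\<^esub> h \<longleftrightarrow> cobd R ?Q N i (\<lambda>z. g z \<ominus>\<^bsub>N\<^esub> h z)"
    if "g \<in> cocycles R ?Q N i" "h \<in> cocycles R ?Q N i" for g h
    using coset_eq_iff[OF ZQ BQ, of g h] that by (simp add: mod_hom_minus_cobd[OF N Q])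
  have "inj_on (Ext_map R i M M' N f) (carrier (Ext R i M' N)) \<longleftrightarrow>
      (\<forall>g\<in>cocycles R ?Q N i. \<forall>h\<in>cocycles R ?Q N i.
        cobd R ?P N i (\<lambda>z. g (\<phi> i z) \<ominus>\<^bsub>N\<^esub> h (\<phi> i z)) \<longrightarrow> cobd R ?Q N i (\<lambda>z. g z \<ominus>\<^bsub>N\<^esub> h z))"
    unfolding inj_on_def carr by (simp add: map \<Phi>_eq Q_eq)
  also have "\<dots> \<longleftrightarrow> pullback_inj R ?P ?Q N i (\<phi> i)"
  proof
    assume L: "\<forall>g\<in>cocycles R ?Q N i. \<forall>h\<in>cocycles R ?Q N i.
        cobd R ?P N i (\<lambda>z. g (\<phi> i z) \<ominus>\<^bsub>N\<^esub> h (\<phi> i z)) \<longrightarrow> cobd R ?Q N i (\<lambda>z. g z \<ominus>\<^bsub>N\<^esub> h z)"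
    show "pullback_inj R ?P ?Q N i (\<phi> i)" unfolding pullback_inj_def
    proof (intro allI impI)
      fix g assume g: "cocyc R ?Q N i g" and B: "cobd R ?P N i (\<lambda>z. g (\<phi> i z))"
      note gc = lin_closed[OF cocyc_lin[OF g]]
      let ?g = "restrict g (carrier (res_module R ?Q i))"
      have g': "?g \<in> cocycles R ?Q N i"
        using restrict_mod_hom[OF cocyc_lin[OF g] FQ] g lin_closed[OF res_diff_lin[OF Q]]
        by (auto simp: cocycles_def cocyc_def)
      \<comment> \<open>Comparing with the zero cocycle turns injectivity into a statement about the
        kernel.\<close>
      let ?z = "\<zero>\<^bsub>?ZQ\<^esub>"
      have z: "?z \<in> cocycles R ?Q N i" using ZQ.zero_closed by simp
      have e: "?g w \<ominus>\<^bsub>N\<^esub> ?z w = g w" if "w \<in> carrier (res_module R ?Q i)" for w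
        using gc that N.minus_equality[of "\<zero>\<^bsub>N\<^esub>" "\<zero>\<^bsub>N\<^esub>"] hom_zero[OF that, of R N] by (simp add: a_minus_def)
      have "cobd R ?P N i (\<lambda>z. ?g (\<phi> i z) \<ominus>\<^bsub>N\<^esub> ?z (\<phi> i z))"
        using B by (rule cobd_cong) (use e lin_closed[OF lin_lift_D(1)[OF lift]] in blast)
      hence "cobd R ?Q N i (\<lambda>z. ?g z \<ominus>\<^bsub>N\<^esub> ?z z)" using L g' z by blast
      thus "cobd R ?Q N i g" by (rule cobd_cong) (simp only: e)
    qed
  next
    assume L: "pullback_inj R ?P ?Q N i (\<phi> i)"
    show "\<forall>g\<in>cocycles R ?Q N i. \<forall>h\<in>cocycles R ?Q N i.
        cobd R ?P N i (\<lambda>z. g (\<phi> i z) \<ominus>\<^bsub>N\<^esub> h (\<phi> i z)) \<longrightarrow> cobd R ?Q N i (\<lambda>z. g z \<ominus>\<^bsub>N\<^esub> h z)"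
    proof (intro ballI impI)
      fix g h assume g: "g \<in> cocycles R ?Q N i" and h: "h \<in> cocycles R ?Q N i"
        and B: "cobd R ?P N i (\<lambda>z. g (\<phi> i z) \<ominus>\<^bsub>N\<^esub> h (\<phi> i z))"
      have "cocyc R ?Q N i (\<lambda>z. g z \<ominus>\<^bsub>N\<^esub> h z)"
        using g h lin_diff[OF FQ N] by (auto simp: cocycles_iff cocyc_def minus_eq_zero_iff[OF N])
      thus "cobd R ?Q N i (\<lambda>z. g z \<ominus>\<^bsub>N\<^esub> h z)" using L B by (auto simp: pullback_inj_def)
    qed
  qed
  finally show "inj_on (Ext_map R i M M' N f) (carrier (Ext R i M' N)) \<longleftrightarrow>
      pullback_inj R ?P ?Q N i (\<phi> i)" .
qed

text \<open>Torsion of Ext expressed on representatives, in the form that is later compared across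
  resolutions. An arbitrary cocycle is first restricted to the carrier in order to represent an
  element of Ext.\<close>

lemma Ext_smult_zero_iff:
  assumes N: "module R N" and P: "is_free_res R M (chosen_res R M)" and a: "a \<in> carrier R"
  shows "(\<forall>C\<in>carrier (Ext R i M N). a \<odot>\<^bsub>Ext R i M N\<^esub> C = \<zero>\<^bsub>Ext R i M N\<^esub> \<longrightarrow> C = \<zero>\<^bsub>Ext R i M N\<^esub>) \<longleftrightarrow>
    (\<forall>g. cocyc R (chosen_res R M) N i g \<longrightarrow> cobd R (chosen_res R M) N i (\<lambda>z. a \<odot>\<^bsub>N\<^esub> g z) \<longrightarrow>
      cobd R (chosen_res R M) N i g)"
proof -
  let ?P = "chosen_res R M"
  note F = res_module_module[OF module_cring[OF N], of ?P]
  let ?H = "hom_module R (res_module R ?P i) N"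
  let ?Z = "?H\<lparr>carrier := cocycles R ?P N i\<rparr>"
  let ?B = "coboundaries R ?P N i"
  have Z: "module R ?Z"
    by (rule submodule_module[OF cocycles_submodule[OF N P] hom_module_module[OF F N]])
  interpret Z: module R ?Z by (rule Z)
  interpret N: module R N by (rule N)
  note B = coboundaries_submodule[OF N P, of i]
  have E: "Ext R i M N = quot_module ?Z ?B" by (simp add: Ext_def Let_def)
  have carr: "carrier (Ext R i M N) = (\<lambda>g. ?B +>\<^bsub>?Z\<^esub> g) ` cocycles R ?P N i"
    unfolding E by (auto simp: quot_carrier)
  have eq0: "?B +>\<^bsub>?Z\<^esub> g = \<zero>\<^bsub>Ext R i M N\<^esub> \<longleftrightarrow> cobd R ?P N i g" if "g \<in> cocycles R ?P N i" for g
    unfolding E quot_zero using coset_eq_zero_iff[OF Z B, of g] that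
    by (simp add: coboundaries_iff[OF N P] cocycles_iff)
  have sm: "a \<odot>\<^bsub>Ext R i M N\<^esub> (?B +>\<^bsub>?Z\<^esub> g) = ?B +>\<^bsub>?Z\<^esub> (a \<odot>\<^bsub>?H\<^esub> g)" if "g \<in> cocycles R ?P N i" for g
    unfolding E using quot_smult[OF Z B, of g a] that a by simp
  have smc: "a \<odot>\<^bsub>?H\<^esub> g \<in> cocycles R ?P N i" if "g \<in> cocycles R ?P N i" for g
    using Z.smult_closed[OF a, of g] that by simp
  have "cobd R ?P N i (a \<odot>\<^bsub>?H\<^esub> g) \<longleftrightarrow> cobd R ?P N i (\<lambda>z. a \<odot>\<^bsub>N\<^esub> g z)" for g
    by (intro iffI; erule cobd_cong) (simp_all add: hom_smult)
  hence "(\<forall>C\<in>carrier (Ext R i M N). a \<odot>\<^bsub>Ext R i M N\<^esub> C = \<zero>\<^bsub>Ext R i M N\<^esub> \<longrightarrow> C = \<zero>\<^bsub>Ext R i M N\<^esub>) \<longleftrightarrow>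
      (\<forall>g\<in>cocycles R ?P N i. cobd R ?P N i (\<lambda>z. a \<odot>\<^bsub>N\<^esub> g z) \<longrightarrow> cobd R ?P N i g)"
    unfolding carr ball_simps by (simp add: sm eq0 smc del: a_r_coset_carrier_update)
  also have "\<dots> \<longleftrightarrow> (\<forall>g. cocyc R ?P N i g \<longrightarrow> cobd R ?P N i (\<lambda>z. a \<odot>\<^bsub>N\<^esub> g z) \<longrightarrow> cobd R ?P N i g)"
  proof (intro iffI allI impI ballI)
    fix g assume L: "\<forall>g\<in>cocycles R ?P N i. cobd R ?P N i (\<lambda>z. a \<odot>\<^bsub>N\<^esub> g z) \<longrightarrow> cobd R ?P N i g"
      and g: "cocyc R ?P N i g" and ag: "cobd R ?P N i (\<lambda>z. a \<odot>\<^bsub>N\<^esub> g z)"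
    let ?g = "restrict g (carrier (res_module R ?P i))"
    have "?g \<in> cocycles R ?P N i"
      using restrict_mod_hom[OF cocyc_lin[OF g] F] g lin_closed[OF res_diff_lin[OF P]]
      by (auto simp: cocycles_def cocyc_def)
    moreover have "cobd R ?P N i (\<lambda>z. a \<odot>\<^bsub>N\<^esub> ?g z)" using ag by (rule cobd_cong) simp
    ultimately have "cobd R ?P N i ?g" using L by blast
    thus "cobd R ?P N i g" by (rule cobd_cong) simp
  qed (simp add: cocycles_iff)
  finally show ?thesis .
qed


section \<open>Graded modules\<close>

text \<open>A grading is encoded by its projections \<open>p d\<close> onto the homogeneous components: the homogeneous
  elements of degree \<open>d\<close> are the fixed points of \<open>p d\<close>. In this form the trivial grading of an arbitrary
  module is available for free.\<close>

locale graded_mod = module R M for R (structure) and M (structure) +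
  fixes r :: "int \<Rightarrow> 'a \<Rightarrow> 'a" and p :: "int \<Rightarrow> 'c \<Rightarrow> 'c"
  assumes p_closed: "x \<in> carrier M \<Longrightarrow> p d x \<in> carrier M"
    and p_add: "x \<in> carrier M \<Longrightarrow> y \<in> carrier M \<Longrightarrow> p d (x \<oplus>\<^bsub>M\<^esub> y) = p d x \<oplus>\<^bsub>M\<^esub> p d y"
    and p_finite: "x \<in> carrier M \<Longrightarrow> finite {d. p d x \<noteq> \<zero>\<^bsub>M\<^esub>}"
    and p_sum: "x \<in> carrier M \<Longrightarrow> (\<Oplus>\<^bsub>M\<^esub>d\<in>{d. p d x \<noteq> \<zero>\<^bsub>M\<^esub>}. p d x) = x"
    and p_p: "x \<in> carrier M \<Longrightarrow> p d (p e x) = (if d = e then p e x else \<zero>\<^bsub>M\<^esub>)"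
    and p_smult_hom: "a \<in> carrier R \<Longrightarrow> r e a = a \<Longrightarrow> x \<in> carrier M \<Longrightarrow> p (e + d) (a \<odot>\<^bsub>M\<^esub> x) = a \<odot>\<^bsub>M\<^esub> p d x"
    and p_hom_smult: "a \<in> carrier R \<Longrightarrow> x \<in> carrier M \<Longrightarrow> p e x = x \<Longrightarrow> p d (a \<odot>\<^bsub>M\<^esub> x) = r (d - e) a \<odot>\<^bsub>M\<^esub> x"
begin

lemma p_zero: "p d \<zero>\<^bsub>M\<^esub> = \<zero>\<^bsub>M\<^esub>"
proof -
  have "p d \<zero>\<^bsub>M\<^esub> = p d \<zero>\<^bsub>M\<^esub> \<oplus>\<^bsub>M\<^esub> p d \<zero>\<^bsub>M\<^esub>" using p_add[of "\<zero>\<^bsub>M\<^esub>" "\<zero>\<^bsub>M\<^esub>" d] by simp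
  thus ?thesis using p_closed[of "\<zero>\<^bsub>M\<^esub>" d] by (metis M.add.r_cancel_one' M.zero_closed)
qed

lemma p_sum_superset:
  assumes "x \<in> carrier M" and "finite T" and "{d. p d x \<noteq> \<zero>\<^bsub>M\<^esub>} \<subseteq> T"
  shows "(\<Oplus>\<^bsub>M\<^esub>d\<in>T. p d x) = x"
proof -
  have "(\<Oplus>\<^bsub>M\<^esub>d\<in>{d. p d x \<noteq> \<zero>\<^bsub>M\<^esub>}. p d x) = (\<Oplus>\<^bsub>M\<^esub>d\<in>T. p d x)"
    by (rule M.add.finprod_mono_neutral_cong_left) (use assms p_closed in auto)
  thus ?thesis using p_sum[OF assms(1)] by simp
qed

end

text \<open>Everything is placed in degree 0. The construction of graded resolutions then also
  supplies the ungraded ones behind \<open>chosen_res\<close>.\<close>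

lemma trivially_graded:
  assumes "module R M"
  shows "graded_mod R M (\<lambda>d a. if d = 0 then a else \<zero>\<^bsub>R\<^esub>) (\<lambda>d x. if d = 0 then x else \<zero>\<^bsub>M\<^esub>)"
proof -
  interpret module R M by fact
  have s: "{d::int. (if d = 0 then x else \<zero>\<^bsub>M\<^esub>) \<noteq> \<zero>\<^bsub>M\<^esub>} = (if x = \<zero>\<^bsub>M\<^esub> then {} else {0})" for x by auto
  show ?thesis by unfold_locales (auto simp: s split: if_splits)
qed

text \<open>The basis vector \<open>b\<close> is given degree \<open>dg b\<close>; in a homogeneous
  element of degree \<open>d\<close> its coefficient must therefore have degree
  \<open>d - dg b\<close>.\<close>

definition free_proj ::
  "('a, 'x) ring_scheme \<Rightarrow> (int \<Rightarrow> 'a \<Rightarrow> 'a) \<Rightarrow> ('b \<Rightarrow> int) \<Rightarrow> int \<Rightarrow> ('b \<Rightarrow> 'a) \<Rightarrow> ('b \<Rightarrow> 'a)"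
  where "free_proj R r dg d z = (\<lambda>b. r (d - dg b) (z b))"

lemma free_graded:
  assumes R: "graded_mod R (regular_module R) r r" and B: "finite B"
  shows "graded_mod R (free_module R B) r (free_proj R r dg)"
proof -
  interpret R: graded_mod R "regular_module R" r r by fact
  note Rc = R.R.is_cring
  let ?F = "free_module R B"
  interpret F: module R ?F by (rule free_module_module[OF Rc])
  have r0: "r d \<zero>\<^bsub>R\<^esub> = \<zero>\<^bsub>R\<^esub>" for d using R.p_zero by simp
  have rc: "a \<in> carrier R \<Longrightarrow> r d a \<in> carrier R" for a d using R.p_closed by simp
  have finB: "finite {b. w b \<noteq> \<zero>\<^bsub>R\<^esub>}" if "\<And>b. b \<notin> B \<Longrightarrow> w b = \<zero>\<^bsub>R\<^esub>" for w
    by (rule finite_subset[OF _ B]) (use that in auto)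
  have cl: "free_proj R r dg d z \<in> carrier ?F" if "z \<in> carrier ?F" for d z
    using that by (auto simp: free_carrier free_proj_def r0 rc intro!: finB)
  have zc: "z \<in> carrier ?F \<Longrightarrow> z b \<in> carrier R" for z b by (simp add: free_carrier)
  have supp: "{d. free_proj R r dg d z \<noteq> \<zero>\<^bsub>?F\<^esub>} \<subseteq> (\<Union>b\<in>B. (\<lambda>d. d + dg b) ` {d. r d (z b) \<noteq> \<zero>\<^bsub>R\<^esub>})"
    if z: "z \<in> carrier ?F" for z
  proof
    fix d assume "d \<in> {d. free_proj R r dg d z \<noteq> \<zero>\<^bsub>?F\<^esub>}"
    then obtain b where b: "r (d - dg b) (z b) \<noteq> \<zero>\<^bsub>R\<^esub>" by (auto simp: free_proj_def fun_eq_iff)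
    have "b \<in> B" using b z r0 by (auto simp: free_carrier)
    moreover have "d = (d - dg b) + dg b" by simp
    ultimately show "d \<in> (\<Union>b\<in>B. (\<lambda>d. d + dg b) ` {d. r d (z b) \<noteq> \<zero>\<^bsub>R\<^esub>})" using b by blast
  qed
  have fin: "finite {d. free_proj R r dg d z \<noteq> \<zero>\<^bsub>?F\<^esub>}" if z: "z \<in> carrier ?F" for z
    by (rule finite_subset[OF supp[OF z]]) (use B R.p_finite zc[OF z] in auto)
  show ?thesis
  proof unfold_locales
    fix z assume z: "z \<in> carrier ?F"
    let ?S = "{d. free_proj R r dg d z \<noteq> \<zero>\<^bsub>?F\<^esub>}"
    show "(\<Oplus>\<^bsub>?F\<^esub>d\<in>?S. free_proj R r dg d z) = z"
    proof
      fix b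
      have "(\<Oplus>\<^bsub>?F\<^esub>d\<in>?S. free_proj R r dg d z) b = (\<Oplus>\<^bsub>regular_module R\<^esub>d\<in>?S. r (d - dg b) (z b))"
        using lin_finsum[OF F.module_axioms R.module_axioms coord_lin[of R B b] fin[OF z]] cl[OF z]
        by (simp add: free_proj_def)
      \<comment> \<open>In the coordinate \<open>b\<close> the degrees are shifted by
        \<open>dg b\<close>; after reindexing, the sum is the decomposition of the ring element
        \<open>z b\<close>.\<close>
      also have "\<dots> = (\<Oplus>\<^bsub>regular_module R\<^esub>d\<in>(\<lambda>d. d - dg b) ` ?S. r d (z b))"
        by (intro R.M.finsum_reindex[symmetric]) (auto simp: inj_on_def rc zc[OF z])
      also have "\<dots> = z b"
      proof (rule R.p_sum_superset)
        show "{d. r d (z b) \<noteq> \<zero>\<^bsub>regular_module R\<^esub>} \<subseteq> (\<lambda>d. d - dg b) ` ?S"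
        proof
          fix d assume "d \<in> {d. r d (z b) \<noteq> \<zero>\<^bsub>regular_module R\<^esub>}"
          hence "free_proj R r dg (d + dg b) z b \<noteq> \<zero>\<^bsub>R\<^esub>" by (simp add: free_proj_def)
          hence "d + dg b \<in> ?S" by auto
          thus "d \<in> (\<lambda>d. d - dg b) ` ?S" by (rule rev_image_eqI) simp
        qed
      qed (use fin[OF z] zc[OF z] in auto)
      finally show "(\<Oplus>\<^bsub>?F\<^esub>d\<in>?S. free_proj R r dg d z) b = z b" .
    qed
  next
    fix z d e assume z: "z \<in> carrier ?F"
    show "free_proj R r dg d (free_proj R r dg e z) = (if d = e then free_proj R r dg e z else \<zero>\<^bsub>?F\<^esub>)"
      using R.p_p zc[OF z] by (auto simp: free_proj_def fun_eq_iff)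
  next
    fix a e z d assume a: "a \<in> carrier R" "r e a = a" and z: "z \<in> carrier ?F"
    have "r (e + d - dg b) (a \<otimes>\<^bsub>R\<^esub> z b) = a \<otimes>\<^bsub>R\<^esub> r (d - dg b) (z b)" for b
      using R.p_smult_hom[OF a, of "z b" "d - dg b"] zc[OF z] by (simp add: algebra_simps)
    thus "free_proj R r dg (e + d) (a \<odot>\<^bsub>?F\<^esub> z) = a \<odot>\<^bsub>?F\<^esub> free_proj R r dg d z"
      by (simp add: free_proj_def)
  next
    fix a z e d assume a: "a \<in> carrier R" and z: "z \<in> carrier ?F" and h: "free_proj R r dg e z = z"
    have "r (d - dg b) (a \<otimes>\<^bsub>R\<^esub> z b) = r (d - e) a \<otimes>\<^bsub>R\<^esub> z b" for b
      using R.p_hom_smult[OF a, of "z b" "e - dg b" "d - dg b"] zc[OF z] fun_cong[OF h, of b]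
      by (simp add: free_proj_def)
    thus "free_proj R r dg d (a \<odot>\<^bsub>?F\<^esub> z) = r (d - e) a \<odot>\<^bsub>?F\<^esub> z"
      by (simp add: free_proj_def)
  qed (use cl fin R.p_add zc in \<open>auto simp: free_proj_def\<close>)
qed

text \<open>A map sending each basis vector \<open>b\<close> to a homogeneous element of degree
  \<open>dg b\<close> preserves degrees. It suffices to compare both sides on multiples of basis
  vectors.\<close>

lemma homogeneous_lin_commutes:
  assumes R: "graded_mod R (regular_module R) r r" and M: "graded_mod R M r p" and B: "finite B"
    and f: "lin R (free_module R B) M f"
    and hom: "\<And>b. b \<in> B \<Longrightarrow> p (dg b) (f (basis_vec R b)) = f (basis_vec R b)"
    and z: "z \<in> carrier (free_module R B)"
  shows "f (free_proj R r dg d z) = p d (f z)"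
proof -
  interpret R: graded_mod R "regular_module R" r r by fact
  interpret M: graded_mod R M r p by fact
  note Rc = R.R.is_cring
  let ?F = "free_module R B"
  interpret F: graded_mod R ?F r "free_proj R r dg" by (rule free_graded[OF R B])
  have r0: "r d \<zero>\<^bsub>R\<^esub> = \<zero>\<^bsub>R\<^esub>" for d using R.p_zero by simp
  have rc: "a \<in> carrier R \<Longrightarrow> r d a \<in> carrier R" for a d using R.p_closed by simp
  from Rc z show ?thesis
  proof (induction rule: free_induct)
    case zero
    have "free_proj R r dg d \<zero>\<^bsub>?F\<^esub> = \<zero>\<^bsub>?F\<^esub>" by (rule F.p_zero)
    thus ?case using lin_zero[OF F.module_axioms M.module_axioms f] M.p_zero by simp
  next
    case (add a b w)
    note e = basis_vec_closed[OF Rc add.hyps(2)]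
    note ae = F.smult_closed[OF add.hyps(1) e]
    have "free_proj R r dg d (a \<odot>\<^bsub>?F\<^esub> basis_vec R b) = r (d - dg b) a \<odot>\<^bsub>?F\<^esub> basis_vec R b"
      using add.hyps(1) rc by (auto simp: free_proj_def basis_vec_def fun_eq_iff r0)
    hence "f (free_proj R r dg d (a \<odot>\<^bsub>?F\<^esub> basis_vec R b)) = p d (f (a \<odot>\<^bsub>?F\<^esub> basis_vec R b))"
      using add.hyps(1) rc e lin_closed[OF f e] hom[OF add.hyps(2)]
      by (simp add: lin_smult[OF f] M.p_hom_smult del: free_ops)
    thus ?case
      using add.hyps(3) add.IH ae F.p_closed lin_closed[OF f]
      by (simp add: F.p_add lin_add[OF f] M.p_add del: free_ops)
  qed
qed


section \<open>Free resolutions by finitely generated graded modules\<close>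

text \<open>The homogeneous components of finitely many generators of \<open>H\<close> remain in
  \<open>H\<close>, since \<open>H\<close> is stable under the projections, and they generate it.
  They are relabelled by a finite subset of the given infinite type so that every stage of a
  resolution can use the same type of basis elements.\<close>

lemma graded_generators:
  assumes Rn: "noetherian_ring R" and M: "graded_mod R M r p" and fg: "noeth_module R M"
    and H: "submodule H R M" and Hp: "\<And>d x. x \<in> H \<Longrightarrow> p d x \<in> H"
    and inf: "infinite (UNIV :: 'c set)"
  shows "\<exists>(B :: 'c set) dg \<phi>. finite B \<and> \<phi> \<in> mod_hom R (free_module R B) M \<and>
    \<phi> ` carrier (free_module R B) = H \<and> (\<forall>b\<in>B. p (dg b) (\<phi> (basis_vec R b)) = \<phi> (basis_vec R b))"
proof -
  interpret M: graded_mod R M r p by fact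
  note Rc = M.R.is_cring
  note Mm = M.module_axioms
  obtain S where S: "finite S" "S \<subseteq> H" "submod_span R M S = H"
    using fg H unfolding noeth_module_def by meson
  define T where "T = (\<Union>s\<in>S. (\<lambda>d. p d s) ` {d. p d s \<noteq> \<zero>\<^bsub>M\<^esub>})"
  have Sc: "s \<in> S \<Longrightarrow> s \<in> carrier M" for s using S(2) submodule_sub[OF H] by blast
  have T: "finite T" "T \<subseteq> H" using S(1,2) Hp M.p_finite Sc by (auto simp: T_def)
  have Tc: "t \<in> T \<Longrightarrow> t \<in> carrier M" for t using T(2) submodule_sub[OF H] by blast
  have Tspan: "submodule (submod_span R M T) R M" using Tc by (intro submod_span_submodule[OF Mm]) auto
  have "S \<subseteq> submod_span R M T"
  proof
    fix s assume s: "s \<in> S"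
    have "(\<Oplus>\<^bsub>M\<^esub>d\<in>{d. p d s \<noteq> \<zero>\<^bsub>M\<^esub>}. p d s) \<in> submod_span R M T"
    proof (rule submodule_finsum[OF Mm Tspan M.p_finite[OF Sc[OF s]]])
      have "(\<lambda>d. p d s) ` {d. p d s \<noteq> \<zero>\<^bsub>M\<^esub>} \<subseteq> T" using s by (auto simp: T_def)
      thus "(\<lambda>d. p d s) \<in> {d. p d s \<noteq> \<zero>\<^bsub>M\<^esub>} \<rightarrow> submod_span R M T" using submod_span_incl[of T R M] by auto
    qed
    thus "s \<in> submod_span R M T" using M.p_sum Sc[OF s] by simp
  qed
  hence "H \<subseteq> submod_span R M T" using submod_span_least[OF Tspan] S(3) by auto
  hence TH: "submod_span R M T = H" using submod_span_least[OF H T(2)] by auto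
  obtain B :: "'c set" where B: "finite B" "card B = card T"
    using infinite_arbitrarily_large[OF inf] by blast
  then obtain v where v: "bij_betw v B T" using finite_same_card_bij[of B T] T(1) by auto
  have vT: "b \<in> B \<Longrightarrow> v b \<in> T" for b using v by (auto simp: bij_betw_def)
  have vc: "b \<in> B \<Longrightarrow> v b \<in> carrier M" for b using vT Tc by auto
  define \<phi> where "\<phi> = restrict (lin_ext R M v) (carrier (free_module R B))"
  have \<phi>: "\<phi> \<in> mod_hom R (free_module R B) M"
    unfolding \<phi>_def using vc by (intro restrict_mod_hom lin_ext_lin free_module_module Rc Mm)
  have \<phi>b: "\<phi> (basis_vec R b) = v b" if "b \<in> B" for b
    using lin_ext_basis[OF Mm, of B v] vc basis_vec_closed[OF Rc that] that by (simp add: \<phi>_def)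
  have "(\<lambda>b. \<phi> (basis_vec R b)) ` B = T" using \<phi>b v by (auto simp: bij_betw_def image_iff)
  hence "\<phi> ` carrier (free_module R B) = H"
    using free_image_span[OF Mm mod_hom_lin[OF \<phi>]] TH by metis
  moreover have "\<forall>b\<in>B. \<exists>d. p d (v b) = v b"
    using vT M.p_p Sc unfolding T_def by fastforce
  then obtain dg where "\<forall>b\<in>B. p (dg b) (v b) = v b" by metis
  hence "\<forall>b\<in>B. p (dg b) (\<phi> (basis_vec R b)) = \<phi> (basis_vec R b)" using \<phi>b by simp
  ultimately show ?thesis using B(1) \<phi> by blast
qed

text \<open>Cover \<open>M\<close>, then repeatedly cover the last kernel by a finite free module
  with homogeneous generators. Noetherianity keeps the kernels finitely generated, homogeneity keeps
  them graded.\<close>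

lemma graded_free_res_exists:
  assumes R: "cring R" "noetherian_ring R" and Rg: "graded_mod R (regular_module R) r r"
    and M: "graded_mod R M r p" and fg: "fin_gen_module R M"
    and inf: "infinite (UNIV :: 'c set)"
  shows "\<exists>(P :: ('a, 'c, 'm) free_res) dg. is_free_res R M P \<and> (\<forall>i. finite (res_basis P i)) \<and>
    (\<forall>i. \<forall>b\<in>res_basis P (Suc i).
      free_proj R r (dg i) (dg (Suc i) b) (res_diff P i (basis_vec R b)) = res_diff P i (basis_vec R b))"
proof -
  interpret M: graded_mod R M r p by fact
  note Mm = M.module_axioms
  note F = free_module_module[OF R(1)]
  \<comment> \<open>A stage records the basis, its degrees, the kernel still to be covered, and the
    map into the previous free module. \<open>I\<close> is the invariant of one stage,
    \<open>J\<close> the relation between consecutive stages.\<close>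
  define I where "I = (\<lambda>(B :: 'c set, dg, K, \<phi> :: ('c \<Rightarrow> 'a) \<Rightarrow> 'c \<Rightarrow> 'a). finite B \<and>
    submodule K R (free_module R B) \<and> (\<forall>d. \<forall>z\<in>K. free_proj R r dg d z \<in> K))"
  define J where "J = (\<lambda>(B :: 'c set, dg, K, \<phi> :: ('c \<Rightarrow> 'a) \<Rightarrow> 'c \<Rightarrow> 'a) (B' :: 'c set, dg', K', \<phi>').
    \<phi>' \<in> mod_hom R (free_module R B') (free_module R B) \<and> \<phi>' ` carrier (free_module R B') = K \<and>
    (\<forall>b\<in>B'. free_proj R r dg (dg' b) (\<phi>' (basis_vec R b)) = \<phi>' (basis_vec R b)) \<and>
    K' = {z \<in> carrier (free_module R B'). \<phi>' z = \<zero>\<^bsub>free_module R B\<^esub>})"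
  obtain B0 :: "'c set" and dg0 aug where aug: "finite B0" "aug \<in> mod_hom R (free_module R B0) M"
    "aug ` carrier (free_module R B0) = carrier M"
    "\<And>b. b \<in> B0 \<Longrightarrow> p (dg0 b) (aug (basis_vec R b)) = aug (basis_vec R b)"
    using graded_generators[OF R(2) M fin_gen_noeth[OF R fg] submodule_carrier[OF Mm] M.p_closed inf]
    by blast
  define K0 where "K0 = {z \<in> carrier (free_module R B0). aug z = \<zero>\<^bsub>M\<^esub>}"
  \<comment> \<open>The kernel of a degree-preserving map is stable under the projections, so
    \<open>graded_generators\<close> can be applied to it again.\<close>
  have ker_hom: "free_proj R r dg d z \<in> {z \<in> carrier (free_module R B). f z = \<zero>\<^bsub>L\<^esub>}"
    if "graded_mod R L r q" "finite B" "lin R (free_module R B) L f"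
      "\<And>b. b \<in> B \<Longrightarrow> q (dg b) (f (basis_vec R b)) = f (basis_vec R b)"
      "z \<in> {z \<in> carrier (free_module R B). f z = \<zero>\<^bsub>L\<^esub>}"
    for B :: "'c set" and L :: "('a, 'l) module" and q f dg d z
  proof -
    interpret L: graded_mod R L r q by fact
    interpret FB: graded_mod R "free_module R B" r "free_proj R r dg" by (rule free_graded[OF Rg that(2)])
    show ?thesis using that(5) homogeneous_lin_commutes[OF Rg that(1-4), of z d] L.p_zero FB.p_closed
      by auto
  qed
  \<comment> \<open>The map slot of the initial stage is a dummy: the augmentation has another
    target type and is kept separately.\<close>
  define st0 where "st0 = (B0, dg0, K0, undefined :: ('c \<Rightarrow> 'a) \<Rightarrow> 'c \<Rightarrow> 'a)"
  have I0: "I st0"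
    using aug(1) submodule_ker[OF F Mm mod_hom_lin[OF aug(2)]]
      ker_hom[OF M aug(1) mod_hom_lin[OF aug(2)] aug(4)]
    unfolding I_def st0_def K0_def by auto
  have "\<exists>s. \<forall>n. (I (s n) \<and> (n = 0 \<longrightarrow> s n = st0)) \<and> J (s n) (s (Suc n))"
  proof (rule dependent_nat_choice)
    show "\<exists>st. I st \<and> (0 = 0 \<longrightarrow> st = st0)" using I0 by blast
  next
    fix st and n :: nat assume st: "I st \<and> (n = 0 \<longrightarrow> st = st0)"
    obtain B dg K \<phi> where s: "st = (B, dg, K, \<phi>)" by (cases st)
    have B: "finite B" "submodule K R (free_module R B)" "\<And>d z. z \<in> K \<Longrightarrow> free_proj R r dg d z \<in> K"
      using st by (auto simp: s I_def)
    note FB = free_graded[OF Rg B(1), of dg]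
    obtain B' :: "'c set" and dg' \<phi>' where \<phi>': "finite B'" "\<phi>' \<in> mod_hom R (free_module R B') (free_module R B)"
      "\<phi>' ` carrier (free_module R B') = K"
      "\<And>b. b \<in> B' \<Longrightarrow> free_proj R r dg (dg' b) (\<phi>' (basis_vec R b)) = \<phi>' (basis_vec R b)"
      using graded_generators[OF R(2) FB noeth_free[OF R B(1)] B(2,3) inf] by blast
    let ?K = "{z \<in> carrier (free_module R B'). \<phi>' z = \<zero>\<^bsub>free_module R B\<^esub>}"
    have "I (B', dg', ?K, \<phi>')"
      using \<phi>'(1) submodule_ker[OF F F mod_hom_lin[OF \<phi>'(2)]]
        ker_hom[OF FB \<phi>'(1) mod_hom_lin[OF \<phi>'(2)] \<phi>'(4)]
      unfolding I_def by blast
    moreover have "J st (B', dg', ?K, \<phi>')" using \<phi>' by (simp add: J_def s)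
    ultimately show "\<exists>st'. (I st' \<and> (Suc n = 0 \<longrightarrow> st' = st0)) \<and> J st st'" by blast
  qed
  then obtain s where s: "\<And>n. I (s n)" "s 0 = st0" "\<And>n. J (s n) (s (Suc n))" by blast
  \<comment> \<open>Each stage stores the map out of its own module, so the differential into
    position \<open>n\<close> sits in stage \<open>Suc n\<close>.\<close>
  define P where "P = \<lparr>res_basis = (\<lambda>n. fst (s n)), res_diff = (\<lambda>n. snd (snd (snd (s (Suc n))))), res_aug = aug\<rparr>"
  define dg where "dg n = fst (snd (s n))" for n
  define K where "K n = fst (snd (snd (s n)))" for n
  have sn: "s n = (res_basis P n, dg n, K n, snd (snd (snd (s n))))" for n
    by (simp add: P_def dg_def K_def)
  have I': "finite (res_basis P n)" for n using s(1)[of n] by (subst (asm) sn) (simp add: I_def)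
  have J': "res_diff P n \<in> mod_hom R (res_module R P (Suc n)) (res_module R P n)"
    "res_diff P n ` carrier (res_module R P (Suc n)) = K n"
    "\<forall>b\<in>res_basis P (Suc n).
      free_proj R r (dg n) (dg (Suc n) b) (res_diff P n (basis_vec R b)) = res_diff P n (basis_vec R b)"
    "K (Suc n) = {z \<in> carrier (res_module R P (Suc n)). res_diff P n z = \<zero>\<^bsub>res_module R P n\<^esub>}" for n
    using s(3)[of n]
    by (subst (asm) sn, subst (asm) sn[of "Suc n"], simp add: J_def res_module_def, simp add: P_def)+
  have 0: "res_basis P 0 = B0" "K 0 = K0" using s(2) by (simp_all add: P_def K_def st0_def)
  have "is_free_res R M P" unfolding is_free_res_def
    using J'(1,2,4) aug(2,3) 0 by (auto simp: res_module_def K0_def P_def)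
  thus ?thesis using I' J'(3) by blast
qed

lemma regular_trivially_graded:
  assumes "cring R"
  shows "graded_mod R (regular_module R) (\<lambda>d a. if d = 0 then a else \<zero>\<^bsub>R\<^esub>) (\<lambda>d a. if d = 0 then a else \<zero>\<^bsub>R\<^esub>)"
  using trivially_graded[OF regular_module_module[OF assms]] unfolding regular_module_simps .

text \<open>The choice in \<open>chosen_res\<close> is justified by a resolution with finite bases,
  built from the trivial gradings inside the infinite type of lists.\<close>

lemma chosen_res_free_res:
  fixes M :: "('a, 'm) module"
  assumes R: "cring R" "noetherian_ring R" and fg: "fin_gen_module R M"
  shows "is_free_res R M (chosen_res R M)"
proof -
  have M: "module R M" using fg by (simp add: fin_gen_module_def)
  have "infinite (UNIV :: ('a \<times> 'm) list set)" by (rule infinite_UNIV_listI)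
  from graded_free_res_exists[OF R regular_trivially_graded[OF R(1)] trivially_graded[OF M] fg this]
  have "\<exists>P :: ('a, ('a \<times> 'm) list, 'm) free_res. is_free_res R M P" by blast
  thus ?thesis unfolding chosen_res_def by (rule someI_ex)
qed


section \<open>The mapping cone of multiplication by a ring element\<close>

text \<open>If \<open>s\<close> is a nonzerodivisor on \<open>M\<close> and \<open>F\<close> resolves \<open>M\<close>, then \<open>F\<^sub>i\<^sub>+\<^sub>1 \<oplus> F\<^sub>i\<close> with the differential
  \<open>(a, b) \<mapsto> (d a + s b, - d b)\<close> resolves \<open>M / s M\<close>. The direct sum is the free module on the sum type.\<close>

fun cone_basis :: "('a, 'b, 'm) free_res \<Rightarrow> nat \<Rightarrow> ('b + 'b) set" where
  "cone_basis F 0 = Inl ` res_basis F 0"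
| "cone_basis F (Suc i) = Inl ` res_basis F (Suc i) \<union> Inr ` res_basis F i"

declare cone_basis.simps [simp del]

abbreviation cone_module ::
  "('a, 'x) ring_scheme \<Rightarrow> ('a, 'b, 'm) free_res \<Rightarrow> nat \<Rightarrow> ('a, 'b + 'b \<Rightarrow> 'a) module"
  where "cone_module R F i \<equiv> free_module R (cone_basis F i)"

text \<open>The second component of the cone differential. At \<open>i = 0\<close> its target would
  be the missing module in position -1, so it is zero.\<close>

definition cone_down ::
  "('a, 'x) ring_scheme \<Rightarrow> ('a, 'b, 'm) free_res \<Rightarrow> nat \<Rightarrow> ('b \<Rightarrow> 'a) \<Rightarrow> ('b \<Rightarrow> 'a)"
  where "cone_down R F i b = (case i of 0 \<Rightarrow> (\<lambda>_. \<zero>\<^bsub>R\<^esub>) | Suc j \<Rightarrow> \<ominus>\<^bsub>res_module R F j\<^esub> res_diff F j b)"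

definition cone_diff ::
  "('a, 'x) ring_scheme \<Rightarrow> 'a \<Rightarrow> ('a, 'b, 'm) free_res \<Rightarrow> nat \<Rightarrow> ('b + 'b \<Rightarrow> 'a) \<Rightarrow> ('b + 'b \<Rightarrow> 'a)"
  where "cone_diff R s F i z =
    case_sum (res_diff F i (z \<circ> Inl) \<oplus>\<^bsub>res_module R F i\<^esub> s \<odot>\<^bsub>res_module R F i\<^esub> (z \<circ> Inr))
      (cone_down R F i (z \<circ> Inr))"

definition smult_image :: "'a \<Rightarrow> ('a, 'm) module \<Rightarrow> 'm set"
  where "smult_image s M = (\<lambda>x. s \<odot>\<^bsub>M\<^esub> x) ` carrier M"

definition cone_res ::
  "('a, 'x) ring_scheme \<Rightarrow> ('a, 'm) module \<Rightarrow> 'a \<Rightarrow> ('a, 'b, 'm) free_res \<Rightarrow> ('a, 'b + 'b, 'm set) free_res"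
  where "cone_res R M s F = \<lparr>res_basis = cone_basis F,
    res_diff = (\<lambda>i. restrict (cone_diff R s F i) (carrier (cone_module R F (Suc i)))),
    res_aug = restrict (\<lambda>z. smult_image s M +>\<^bsub>M\<^esub> res_aug F (z \<circ> Inl)) (carrier (cone_module R F 0))\<rparr>"

lemma res_module_cone [simp]: "res_module R (cone_res R M s F) i = cone_module R F i"
  by (simp add: res_module_def cone_res_def)

lemma res_ker_lift:
  assumes "is_free_res R M F" and "z \<in> res_ker R M F i"
  shows "\<exists>c\<in>carrier (res_module R F (Suc i)). res_diff F i c = z"
  using assms(2) unfolding res_exact[OF assms(1), symmetric] by blast

lemma free_carrier_sum:
  "z \<in> carrier (free_module R (Inl ` B \<union> Inr ` C)) \<longleftrightarrow>
    z \<circ> Inl \<in> carrier (free_module R B) \<and> z \<circ> Inr \<in> carrier (free_module R C)"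
proof -
  have "{b. z b \<noteq> \<zero>\<^bsub>R\<^esub>} = Inl ` {b. (z \<circ> Inl) b \<noteq> \<zero>\<^bsub>R\<^esub>} \<union> Inr ` {b. (z \<circ> Inr) b \<noteq> \<zero>\<^bsub>R\<^esub>}" (is "?A = ?B")
  proof (rule Set.set_eqI)
    show "b \<in> ?A \<longleftrightarrow> b \<in> ?B" for b by (cases b) auto
  qed
  hence "finite {b. z b \<noteq> \<zero>\<^bsub>R\<^esub>} \<longleftrightarrow> finite {b. (z \<circ> Inl) b \<noteq> \<zero>\<^bsub>R\<^esub>} \<and> finite {b. (z \<circ> Inr) b \<noteq> \<zero>\<^bsub>R\<^esub>}"
    by (simp add: finite_image_iff)
  thus ?thesis unfolding free_carrier by (auto simp: split_sum_all)
qed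

lemma cone_carrier_Suc: "z \<in> carrier (cone_module R F (Suc i)) \<longleftrightarrow>
    z \<circ> Inl \<in> carrier (res_module R F (Suc i)) \<and> z \<circ> Inr \<in> carrier (res_module R F i)"
  by (simp add: free_carrier_sum res_module_def cone_basis.simps)

lemma cone_carrier_0:
  assumes "cring R"
  shows "z \<in> carrier (cone_module R F 0) \<longleftrightarrow>
    z \<circ> Inl \<in> carrier (res_module R F 0) \<and> z \<circ> Inr = (\<lambda>_. \<zero>\<^bsub>R\<^esub>)"
proof -
  interpret R: cring R by fact
  have "z \<circ> Inr \<in> carrier (free_module R {}) \<longleftrightarrow> z \<circ> Inr = (\<lambda>_. \<zero>\<^bsub>R\<^esub>)"
    by (auto simp: free_carrier fun_eq_iff)
  thus ?thesis using free_carrier_sum[of z R "res_basis F 0" "{}"] by (simp add: res_module_def cone_basis.simps)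
qed

lemma case_sum_comp [simp]: "case_sum a b \<circ> Inl = a" "case_sum a b \<circ> Inr = b"
  by (auto simp: fun_eq_iff)

lemma case_sum_eta: "case_sum (z \<circ> Inl) (z \<circ> Inr) = z"
  by (auto simp: fun_eq_iff split: sum.split)

lemma case_sum_eqI: "z \<circ> Inl = w \<circ> Inl \<Longrightarrow> z \<circ> Inr = w \<circ> Inr \<Longrightarrow> z = w"
  by (metis case_sum_eta)

lemma res_ops [simp]:
  "\<zero>\<^bsub>res_module R F i\<^esub> = (\<lambda>b. \<zero>\<^bsub>R\<^esub>)"
  "z \<oplus>\<^bsub>res_module R F i\<^esub> w = (\<lambda>b. z b \<oplus>\<^bsub>R\<^esub> w b)"
  "a \<odot>\<^bsub>res_module R F i\<^esub> z = (\<lambda>b. a \<otimes>\<^bsub>R\<^esub> z b)"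
  by (simp_all add: res_module_def)

lemma cone_carrier_Inl:
  assumes "cring R" and "z \<in> carrier (cone_module R F i)"
  shows "z \<circ> Inl \<in> carrier (res_module R F i)"
  using assms by (cases i) (simp_all add: cone_carrier_0 cone_carrier_Suc)

lemma lin_Inl: "cring R \<Longrightarrow> lin R (cone_module R F i) (res_module R F i) (\<lambda>z. z \<circ> Inl)"
  by (rule linI) (erule (1) cone_carrier_Inl, simp_all add: comp_def)

lemma lin_Inr: "cring R \<Longrightarrow> lin R (cone_module R F (Suc i)) (res_module R F i) (\<lambda>z. z \<circ> Inr)"
  by (rule linI) (simp only: cone_carrier_Suc, simp_all add: comp_def)

lemma lin_pair:
  assumes "lin R L (res_module R F (Suc i)) f" and "lin R L (res_module R F i) g"
  shows "lin R L (cone_module R F (Suc i)) (\<lambda>x. case_sum (f x) (g x))"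
  by (rule linI) (use assms in \<open>auto simp: cone_carrier_Suc lin_add lin_smult fun_eq_iff
    intro: lin_closed split: sum.split\<close>)

lemma lin_pair_0:
  assumes "cring R" and "lin R L (res_module R F 0) f"
  shows "lin R L (cone_module R F 0) (\<lambda>x. case_sum (f x) (\<lambda>_. \<zero>\<^bsub>R\<^esub>))"
proof -
  interpret R: cring R by fact
  show ?thesis
    by (rule linI) (use assms in \<open>auto simp: cone_carrier_0 lin_add lin_smult fun_eq_iff
      intro: lin_closed split: sum.split\<close>)
qed

lemma lin_in1:
  assumes "cring R"
  shows "lin R (res_module R F i) (cone_module R F i) (\<lambda>a. case_sum a (\<lambda>_. \<zero>\<^bsub>R\<^esub>))"
proof (cases i)
  case 0
  show ?thesis unfolding 0 by (rule lin_pair_0[OF assms lin_id])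
next
  case (Suc j)
  have "lin R (res_module R F i) (res_module R F j) (\<lambda>a. \<zero>\<^bsub>res_module R F j\<^esub>)"
    by (intro lin_zero_map res_module_module assms)
  thus ?thesis unfolding Suc by (intro lin_pair lin_id) simp
qed

lemma lin_in2:
  assumes "cring R"
  shows "lin R (res_module R F i) (cone_module R F (Suc i)) (\<lambda>b. case_sum (\<lambda>_. \<zero>\<^bsub>R\<^esub>) b)"
proof -
  have "lin R (res_module R F i) (res_module R F (Suc i)) (\<lambda>a. \<zero>\<^bsub>res_module R F (Suc i)\<^esub>)"
    by (intro lin_zero_map res_module_module assms)
  thus ?thesis by (intro lin_pair lin_id) simp
qed

text \<open>The decomposition (a, b) = (a, 0) + (0, b), through which a cochain on the cone is
  treated as a pair of cochains.\<close>

lemma cone_split: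
  assumes N: "module R N" and g: "lin R (cone_module R F (Suc i)) N g"
    and z: "z \<in> carrier (cone_module R F (Suc i))"
  shows "g z = g (case_sum (z \<circ> Inl) (\<lambda>_. \<zero>\<^bsub>R\<^esub>)) \<oplus>\<^bsub>N\<^esub> g (case_sum (\<lambda>_. \<zero>\<^bsub>R\<^esub>) (z \<circ> Inr))"
proof -
  interpret R: cring R by (rule module_cring[OF N])
  note Rc = R.is_cring
  have c: "z \<circ> Inl \<in> carrier (res_module R F (Suc i))" "z \<circ> Inr \<in> carrier (res_module R F i)"
    using z unfolding cone_carrier_Suc by auto
  have "z = case_sum (z \<circ> Inl) (\<lambda>_. \<zero>\<^bsub>R\<^esub>) \<oplus>\<^bsub>cone_module R F (Suc i)\<^esub> case_sum (\<lambda>_. \<zero>\<^bsub>R\<^esub>) (z \<circ> Inr)"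
    using c by (auto simp: fun_eq_iff res_module_def free_carrier split: sum.split)
  thus ?thesis
    using lin_add[OF g lin_closed[OF lin_in1[OF Rc] c(1)] lin_closed[OF lin_in2[OF Rc] c(2)]] by simp
qed

lemma lin_cone_down:
  assumes R: "cring R" and F: "is_free_res R M F"
  shows "lin R (res_module R F (Suc i)) (res_module R F i) (cone_down R F (Suc i))"
  unfolding cone_down_def by (simp, intro lin_uminus res_module_module R res_diff_lin[OF F])

lemma cone_diff_lin:
  assumes R: "cring R" and F: "is_free_res R M F" and s: "s \<in> carrier R"
  shows "lin R (cone_module R F (Suc i)) (cone_module R F i) (cone_diff R s F i)"
proof -
  note Fm = res_module_module[OF R]
  have 1: "lin R (cone_module R F (Suc i)) (res_module R F i)
    (\<lambda>z. res_diff F i (z \<circ> Inl) \<oplus>\<^bsub>res_module R F i\<^esub> s \<odot>\<^bsub>res_module R F i\<^esub> (z \<circ> Inr))" for i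
    by (intro lin_plus lin_scale lin_comp[OF lin_Inl[OF R] res_diff_lin[OF F]] lin_Inr[OF R] Fm
        free_module_module R s)
  show ?thesis
  proof (cases i)
    case 0
    show ?thesis using lin_pair_0[OF R 1[of 0]] unfolding 0 cone_diff_def cone_down_def by simp
  next
    case (Suc j)
    show ?thesis using lin_pair[OF 1[of "Suc j"] lin_comp[OF lin_Inr[OF R] lin_cone_down[OF R F]]]
      unfolding Suc cone_diff_def .
  qed
qed

lemma smult_image_submodule:
  assumes "module R M" and "s \<in> carrier R"
  shows "submodule (smult_image s M) R M"
  unfolding smult_image_def
  by (rule submodule_image[OF assms(1,1) lin_mult[OF assms] submodule_carrier[OF assms(1)]])

lemma res_cone_diff: "z \<in> carrier (cone_module R F (Suc i)) \<Longrightarrow>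
    res_diff (cone_res R M s F) i z = cone_diff R s F i z"
  by (simp add: cone_res_def)

text \<open>At position 0 the kernel of the augmentation consists of boundaries of \<open>F\<close>
  plus multiples by \<open>s\<close>, which is the image of the cone differential. At a higher
  position a cycle (a, b) has \<open>b\<close> a boundary of \<open>F\<close>, and \<open>a\<close>
  can then be corrected to a cycle.\<close>

lemma cone_is_free_res:
  assumes M: "module R M" and F: "is_free_res R M F" and s: "s \<in> carrier R"
    and nzd: "\<And>x. x \<in> carrier M \<Longrightarrow> s \<odot>\<^bsub>M\<^esub> x = \<zero>\<^bsub>M\<^esub> \<Longrightarrow> x = \<zero>\<^bsub>M\<^esub>"
  shows "is_free_res R (quot_module M (smult_image s M)) (cone_res R M s F)"
proof -
  note R = module_cring[OF M]
  note Fm = res_module_module[OF R, of F]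
  interpret M: module R M by (rule M)
  note H = smult_image_submodule[OF M s]
  let ?Q = "quot_module M (smult_image s M)"
  let ?D = "cone_diff R s F"
  let ?a = "\<lambda>z. smult_image s M +>\<^bsub>M\<^esub> res_aug F (z \<circ> Inl)"
  note dc = lin_closed[OF res_diff_lin[OF F]]
  note ac = lin_closed[OF res_aug_lin[OF F]]
  note C = free_module_module[OF R]
  note Dlin = cone_diff_lin[OF R F s]
  have alin: "lin R (cone_module R F 0) ?Q ?a"
    by (intro lin_comp[OF _ quot_proj_lin[OF M H]] lin_comp[OF lin_Inl[OF R] res_aug_lin[OF F]])
  have aH: "?a z = \<zero>\<^bsub>?Q\<^esub> \<longleftrightarrow> res_aug F (z \<circ> Inl) \<in> smult_image s M" if "z \<in> carrier (cone_module R F 0)" for z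
    unfolding quot_zero
    by (intro coset_eq_zero_iff[OF M H] ac cone_carrier_Inl[OF R that])
  \<comment> \<open>Write b = d c. Then a + s c is a cycle of \<open>F\<close>, hence equal to d a',
    and (a', -c) is mapped to (a, b).\<close>
  have key: "\<exists>w\<in>carrier (cone_module R F (Suc (Suc i))). ?D (Suc i) w = z"
    if z: "z \<in> carrier (cone_module R F (Suc i))" and b: "z \<circ> Inr \<in> res_ker R M F i"
      and e: "res_diff F i (z \<circ> Inl) \<oplus>\<^bsub>res_module R F i\<^esub> s \<odot>\<^bsub>res_module R F i\<^esub> (z \<circ> Inr) = \<zero>\<^bsub>res_module R F i\<^esub>"
    for i z
  proof -
    interpret F0: module R "res_module R F i" by (rule Fm)
    interpret F1: module R "res_module R F (Suc i)" by (rule Fm)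
    have zc: "z \<circ> Inl \<in> carrier (res_module R F (Suc i))" using z unfolding cone_carrier_Suc by simp
    from res_ker_lift[OF F b] obtain c where c: "c \<in> carrier (res_module R F (Suc i))" "res_diff F i c = z \<circ> Inr"
      by blast
    let ?u = "(z \<circ> Inl) \<oplus>\<^bsub>res_module R F (Suc i)\<^esub> s \<odot>\<^bsub>res_module R F (Suc i)\<^esub> c"
    have uc: "?u \<in> carrier (res_module R F (Suc i))" using zc c(1) s by (intro F1.a_closed F1.smult_closed)
    have "res_diff F i ?u = \<zero>\<^bsub>res_module R F i\<^esub>"
      using zc c s e by (simp add: lin_add[OF res_diff_lin[OF F]] lin_smult[OF res_diff_lin[OF F]]
          F1.smult_closed del: res_ops)
    hence "?u \<in> res_ker R M F (Suc i)" unfolding res_ker_Suc using uc by blast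
    from res_ker_lift[OF F this]
    obtain a where a: "a \<in> carrier (res_module R F (Suc (Suc i)))" "res_diff F (Suc i) a = ?u" by blast
    let ?c = "\<ominus>\<^bsub>res_module R F (Suc i)\<^esub> c"
    have cc: "?c \<in> carrier (res_module R F (Suc i))" using c(1) by (rule F1.a_inv_closed)
    let ?w = "case_sum a ?c"
    have w: "?w \<in> carrier (cone_module R F (Suc (Suc i)))" using a(1) cc unfolding cone_carrier_Suc by simp
    have "?u \<oplus>\<^bsub>res_module R F (Suc i)\<^esub> s \<odot>\<^bsub>res_module R F (Suc i)\<^esub> ?c = z \<circ> Inl"
      using zc c(1) s by (simp add: F1.smult_r_minus F1.a_assoc F1.r_neg del: res_ops)
    moreover have "\<ominus>\<^bsub>res_module R F i\<^esub> res_diff F i ?c = z \<circ> Inr"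
      using c dc[OF c(1)] by (simp add: lin_neg[OF Fm Fm res_diff_lin[OF F]])
    ultimately have "?D (Suc i) ?w = z"
      unfolding cone_diff_def cone_down_def using a(2) by (intro case_sum_eqI) (simp_all del: res_ops)
    thus ?thesis using w by blast
  qed
  \<comment> \<open>The sign in the second component makes the mixed terms s d b and -s d b
    cancel.\<close>
  have DD: "?D i (?D (Suc i) z) = \<zero>\<^bsub>cone_module R F i\<^esub>"
    if z: "z \<in> carrier (cone_module R F (Suc (Suc i)))" for i z
  proof -
    interpret F0: module R "res_module R F i" by (rule Fm)
    interpret F1: module R "res_module R F (Suc i)" by (rule Fm)
    have zc: "z \<circ> Inl \<in> carrier (res_module R F (Suc (Suc i)))" "z \<circ> Inr \<in> carrier (res_module R F (Suc i))"
      using z unfolding cone_carrier_Suc by auto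
    note dz = dc[OF zc(1)] dc[OF zc(2)]
    have l: "(?D (Suc i) z) \<circ> Inl = res_diff F (Suc i) (z \<circ> Inl) \<oplus>\<^bsub>res_module R F (Suc i)\<^esub>
        s \<odot>\<^bsub>res_module R F (Suc i)\<^esub> (z \<circ> Inr)"
      and r: "(?D (Suc i) z) \<circ> Inr = \<ominus>\<^bsub>res_module R F i\<^esub> res_diff F i (z \<circ> Inr)"
      unfolding cone_diff_def cone_down_def by simp_all
    have "(?D i (?D (Suc i) z)) \<circ> Inl = \<zero>\<^bsub>res_module R F i\<^esub>"
      unfolding cone_diff_def[of R s F i] case_sum_comp l r using dz zc s
      by (simp add: lin_add[OF res_diff_lin[OF F]] lin_smult[OF res_diff_lin[OF F]] F1.smult_closed
          res_diff_diff[OF F zc(1)] F0.smult_r_minus F0.r_neg del: res_ops)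
    moreover have "(?D i (?D (Suc i) z)) \<circ> Inr = (\<lambda>_. \<zero>\<^bsub>R\<^esub>)"
    proof (cases i)
      case 0
      thus ?thesis by (simp add: cone_diff_def cone_down_def)
    next
      case (Suc j)
      interpret Fj: module R "res_module R F j" by (rule Fm)
      have n0: "\<ominus>\<^bsub>res_module R F j\<^esub> \<zero>\<^bsub>res_module R F j\<^esub> = \<zero>\<^bsub>res_module R F j\<^esub>"
        using Fj.minus_equality[of "\<zero>\<^bsub>res_module R F j\<^esub>" "\<zero>\<^bsub>res_module R F j\<^esub>"] by (simp del: res_ops)
      have "res_diff F j (\<ominus>\<^bsub>res_module R F i\<^esub> res_diff F i (z \<circ> Inr)) = \<zero>\<^bsub>res_module R F j\<^esub>"
        using dz(2) zc(2) Suc res_diff_diff[OF F, of "z \<circ> Inr" j] n0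
        by (simp add: lin_neg[OF Fm Fm res_diff_lin[OF F]] del: res_ops)
      thus ?thesis unfolding cone_diff_def[of R s F i] case_sum_comp r
        using Suc n0 by (simp add: cone_down_def)
    qed
    ultimately show ?thesis by (intro case_sum_eqI) (simp_all add: comp_def)
  qed
  have aD: "?a (?D 0 z) = \<zero>\<^bsub>?Q\<^esub>" if z: "z \<in> carrier (cone_module R F (Suc 0))" for z
  proof -
    interpret F0: module R "res_module R F 0" by (rule Fm)
    have zc: "z \<circ> Inl \<in> carrier (res_module R F (Suc 0))" "z \<circ> Inr \<in> carrier (res_module R F 0)"
      using z unfolding cone_carrier_Suc by auto
    have "res_aug F (res_diff F 0 (z \<circ> Inl)) = \<zero>\<^bsub>M\<^esub>"
      using res_diff_ker[OF F zc(1)] by (simp add: res_ker_0)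
    hence "res_aug F (?D 0 z \<circ> Inl) = s \<odot>\<^bsub>M\<^esub> res_aug F (z \<circ> Inr)"
      unfolding cone_diff_def case_sum_comp using zc dc[OF zc(1)] s ac
      by (simp add: lin_add[OF res_aug_lin[OF F]] lin_smult[OF res_aug_lin[OF F]] F0.smult_closed del: res_ops)
    thus ?thesis using aH[OF lin_closed[OF Dlin z]] zc(2) ac by (auto simp: smult_image_def)
  qed
  have exact0: "?D 0 ` carrier (cone_module R F (Suc 0)) = {z \<in> carrier (cone_module R F 0). ?a z = \<zero>\<^bsub>?Q\<^esub>}"
  proof (rule Set.set_eqI, rule iffI)
    fix z assume "z \<in> ?D 0 ` carrier (cone_module R F (Suc 0))"
    thus "z \<in> {z \<in> carrier (cone_module R F 0). ?a z = \<zero>\<^bsub>?Q\<^esub>}" using aD lin_closed[OF Dlin] by auto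
  next
    fix z assume "z \<in> {z \<in> carrier (cone_module R F 0). ?a z = \<zero>\<^bsub>?Q\<^esub>}"
    hence z: "z \<in> carrier (cone_module R F 0)" and "res_aug F (z \<circ> Inl) \<in> smult_image s M" using aH by auto
    then obtain x where x: "x \<in> carrier M" "res_aug F (z \<circ> Inl) = s \<odot>\<^bsub>M\<^esub> x" by (auto simp: smult_image_def)
    then obtain b where b: "b \<in> carrier (res_module R F 0)" "res_aug F b = x"
      using res_aug_surj[OF F] by (metis imageE)
    interpret F0: module R "res_module R F 0" by (rule Fm)
    have zc: "z \<circ> Inl \<in> carrier (res_module R F 0)" "z \<circ> Inr = (\<lambda>_. \<zero>\<^bsub>R\<^esub>)" using z unfolding cone_carrier_0[OF R] by auto
    let ?sb = "s \<odot>\<^bsub>res_module R F 0\<^esub> b"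
    have sb: "?sb \<in> carrier (res_module R F 0)" using s b(1) by (rule F0.smult_closed)
    \<comment> \<open>\<open>b\<close> lifts the factor \<open>x\<close> in \<open>s x\<close>;
      subtracting \<open>s b\<close> moves the element into the kernel of the augmentation of
      \<open>F\<close>, where it is a boundary.\<close>
    let ?u = "(z \<circ> Inl) \<ominus>\<^bsub>res_module R F 0\<^esub> ?sb"
    have "res_aug F ?u = res_aug F (z \<circ> Inl) \<ominus>\<^bsub>M\<^esub> s \<odot>\<^bsub>M\<^esub> x"
      using lin_minus[OF Fm M res_aug_lin[OF F] zc(1) sb] lin_smult[OF res_aug_lin[OF F] s b(1)] b(2) by simp
    hence "res_aug F ?u = \<zero>\<^bsub>M\<^esub>" using x s by (simp add: minus_eq_zero_iff[OF M])
    hence "?u \<in> res_ker R M F 0" unfolding res_ker_0 using zc(1) sb F0.minus_closed by blast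
    from res_ker_lift[OF F this]
    obtain a where a: "a \<in> carrier (res_module R F (Suc 0))" "res_diff F 0 a = ?u" by blast
    have "?u \<oplus>\<^bsub>res_module R F 0\<^esub> ?sb = z \<circ> Inl"
      using zc(1) sb by (simp add: a_minus_def F0.a_assoc F0.l_neg del: res_ops)
    hence "?D 0 (case_sum a b) = z" using a(2) zc(2)
      unfolding cone_diff_def cone_down_def by (intro case_sum_eqI) (simp_all del: res_ops)
    moreover have "case_sum a b \<in> carrier (cone_module R F (Suc 0))"
      using a(1) b(1) unfolding cone_carrier_Suc by simp
    ultimately show "z \<in> ?D 0 ` carrier (cone_module R F (Suc 0))" by blast
  qed
  have exact: "?D (Suc i) ` carrier (cone_module R F (Suc (Suc i))) =
      {z \<in> carrier (cone_module R F (Suc i)). ?D i z = \<zero>\<^bsub>cone_module R F i\<^esub>}" for i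
  proof (rule Set.set_eqI, rule iffI)
    fix z assume "z \<in> ?D (Suc i) ` carrier (cone_module R F (Suc (Suc i)))"
    thus "z \<in> {z \<in> carrier (cone_module R F (Suc i)). ?D i z = \<zero>\<^bsub>cone_module R F i\<^esub>}"
      using DD lin_closed[OF Dlin] by blast
  next
    fix z assume "z \<in> {z \<in> carrier (cone_module R F (Suc i)). ?D i z = \<zero>\<^bsub>cone_module R F i\<^esub>}"
    hence z: "z \<in> carrier (cone_module R F (Suc i))" and Dz: "?D i z = \<zero>\<^bsub>cone_module R F i\<^esub>" by auto
    have zc: "z \<circ> Inl \<in> carrier (res_module R F (Suc i))" "z \<circ> Inr \<in> carrier (res_module R F i)"
      using z unfolding cone_carrier_Suc by auto
    interpret F0: module R "res_module R F i" by (rule Fm)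
    have "(?D i z) \<circ> Inl = \<zero>\<^bsub>cone_module R F i\<^esub> \<circ> Inl" by (simp only: Dz)
    hence e: "res_diff F i (z \<circ> Inl) \<oplus>\<^bsub>res_module R F i\<^esub> s \<odot>\<^bsub>res_module R F i\<^esub> (z \<circ> Inr) = \<zero>\<^bsub>res_module R F i\<^esub>"
      unfolding cone_diff_def case_sum_comp by (simp add: comp_def)
    have "(?D i z) \<circ> Inr = \<zero>\<^bsub>cone_module R F i\<^esub> \<circ> Inr" by (simp only: Dz)
    hence d: "cone_down R F i (z \<circ> Inr) = (\<lambda>_. \<zero>\<^bsub>R\<^esub>)"
      unfolding cone_diff_def case_sum_comp by (simp add: comp_def)
    \<comment> \<open>For positive \<open>i\<close> this is the second component of the cycle
      condition. For \<open>i = 0\<close> that component is absent; augmenting the first one gives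
      \<open>s\<close> times the augmentation of \<open>b\<close> equal to zero, and regularity of
      \<open>s\<close> on \<open>M\<close> finishes the argument.\<close>
    have "z \<circ> Inr \<in> res_ker R M F i"
    proof (cases i)
      case 0
      have e0: "res_aug F (res_diff F 0 (z \<circ> Inl)) = \<zero>\<^bsub>M\<^esub>"
        using res_diff_ker[OF F, of "z \<circ> Inl" 0] zc(1) 0 by (simp add: res_ker_0)
      have "res_aug F (res_diff F i (z \<circ> Inl) \<oplus>\<^bsub>res_module R F i\<^esub> s \<odot>\<^bsub>res_module R F i\<^esub> (z \<circ> Inr)) = \<zero>\<^bsub>M\<^esub>"
        unfolding e using 0 lin_zero[OF Fm M res_aug_lin[OF F]] by simp
      moreover have "res_aug F (res_diff F i (z \<circ> Inl) \<oplus>\<^bsub>res_module R F i\<^esub> s \<odot>\<^bsub>res_module R F i\<^esub> (z \<circ> Inr)) =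
          s \<odot>\<^bsub>M\<^esub> res_aug F (z \<circ> Inr)"
        using 0 e0 zc dc[OF zc(1)] s ac F0.smult_closed[OF s zc(2)]
        by (simp add: lin_add[OF res_aug_lin[OF F]] lin_smult[OF res_aug_lin[OF F]] del: res_ops)
      ultimately have "res_aug F (z \<circ> Inr) = \<zero>\<^bsub>M\<^esub>" using nzd[of "res_aug F (z \<circ> Inr)"] ac zc(2) 0 by simp
      thus ?thesis using zc(2) 0 by (simp add: res_ker_0)
    next
      case (Suc j)
      interpret Fj: module R "res_module R F j" by (rule Fm)
      have dz: "res_diff F j (z \<circ> Inr) \<in> carrier (res_module R F j)" using dc zc(2) Suc by simp
      have "\<ominus>\<^bsub>res_module R F j\<^esub> res_diff F j (z \<circ> Inr) = \<zero>\<^bsub>res_module R F j\<^esub>"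
        using d Suc by (simp add: cone_down_def)
      hence "res_diff F j (z \<circ> Inr) = \<zero>\<^bsub>res_module R F j\<^esub>"
        using dz Fj.minus_minus[OF dz] Fj.minus_equality[of "\<zero>\<^bsub>res_module R F j\<^esub>" "\<zero>\<^bsub>res_module R F j\<^esub>"]
        by (simp del: res_ops)
      thus ?thesis using zc(2) Suc by (simp add: res_ker_Suc)
    qed
    from key[OF z this e] show "z \<in> ?D (Suc i) ` carrier (cone_module R F (Suc (Suc i)))" by blast
  qed
  have aug_surj: "?a ` carrier (cone_module R F 0) = carrier ?Q"
  proof
    show "?a ` carrier (cone_module R F 0) \<subseteq> carrier ?Q" using lin_closed[OF alin] by blast
    show "carrier ?Q \<subseteq> ?a ` carrier (cone_module R F 0)"
    proof
      fix E assume "E \<in> carrier ?Q"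
      then obtain x where x: "x \<in> carrier M" "E = smult_image s M +>\<^bsub>M\<^esub> x" by (auto simp: quot_carrier)
      then obtain b where b: "b \<in> carrier (res_module R F 0)" "res_aug F b = x"
        using res_aug_surj[OF F] by (metis imageE)
      have "case_sum b (\<lambda>_. \<zero>\<^bsub>R\<^esub>) \<in> carrier (cone_module R F 0)" by (rule lin_closed[OF lin_in1[OF R] b(1)])
      thus "E \<in> ?a ` carrier (cone_module R F 0)" using x b by (intro rev_image_eqI) auto
    qed
  qed
  have rd: "res_diff (cone_res R M s F) i = restrict (?D i) (carrier (cone_module R F (Suc i)))" for i
    by (simp add: cone_res_def)
  have ra: "res_aug (cone_res R M s F) = restrict ?a (carrier (cone_module R F 0))"
    by (simp add: cone_res_def)
  show ?thesis unfolding is_free_res_def res_module_cone rd ra One_nat_def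
    using restrict_mod_hom[OF alin C] restrict_mod_hom[OF Dlin C] aug_surj exact0 exact
    by (simp del: free_ops) blast
qed

section \<open>Maps between cones, and cochains on a cone as pairs of cochains\<close>

definition cone_map ::
  "('a, 'x) ring_scheme \<Rightarrow> 'a \<Rightarrow> nat \<Rightarrow> ('b + 'b \<Rightarrow> 'a) \<Rightarrow> ('b + 'b \<Rightarrow> 'a)"
  where "cone_map R u i z = (case i of 0 \<Rightarrow> z | Suc _ \<Rightarrow> case_sum (z \<circ> Inl) (\<lambda>b. u \<otimes>\<^bsub>R\<^esub> z (Inr b)))"

lemma cone_map_lin:
  assumes R: "cring R" and u: "u \<in> carrier R"
  shows "lin R (cone_module R F i) (cone_module R F i) (cone_map R u i)"
proof (cases i)
  case 0
  thus ?thesis by (simp add: cone_map_def[abs_def] lin_id)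
next
  case (Suc j)
  have "lin R (cone_module R F (Suc j)) (cone_module R F (Suc j))
    (\<lambda>z. case_sum (z \<circ> Inl) (u \<odot>\<^bsub>res_module R F j\<^esub> (z \<circ> Inr)))"
    by (intro lin_pair lin_Inl lin_scale lin_Inr R u free_module_module res_module_module)
  thus ?thesis using Suc by (simp add: cone_map_def[abs_def])
qed

text \<open>The map (a, b) to (a, u b) goes from the cone of \<open>u s\<close> to the cone of
  \<open>s\<close>: both ways round the square add the term u s b to the first component. It is the
  identity on the \<open>F\<close> summand that carries the augmentation, hence it lifts the
  projection from M/usM to M/sM.\<close>

lemma cone_map_lift:
  assumes M: "module R M" and F: "is_free_res R M F" and s: "s \<in> carrier R" and u: "u \<in> carrier R"
    and f: "\<And>x. x \<in> carrier M \<Longrightarrow> f (smult_image (u \<otimes>\<^bsub>R\<^esub> s) M +>\<^bsub>M\<^esub> x) = smult_image s M +>\<^bsub>M\<^esub> x"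
  shows "lin_lift R (cone_res R M (u \<otimes>\<^bsub>R\<^esub> s) F) (cone_res R M s F) f (cone_map R u)"
proof -
  note R = module_cring[OF M]
  interpret R: cring R by (rule R)
  note Fm = res_module_module[OF R, of F]
  note ac = lin_closed[OF res_aug_lin[OF F]] and dc = lin_closed[OF res_diff_lin[OF F]]
  have "cone_diff R s F i (cone_map R u (Suc i) z) = cone_map R u i (cone_diff R (u \<otimes>\<^bsub>R\<^esub> s) F i z)"
    if z: "z \<in> carrier (cone_module R F (Suc i))" for i z
  proof -
    have zc: "z \<circ> Inl \<in> carrier (res_module R F (Suc i))" "z \<circ> Inr \<in> carrier (res_module R F i)"
      using z unfolding cone_carrier_Suc by auto
    have zr: "z (Inr b) \<in> carrier R" for b using zc(2) by (simp add: res_module_def free_carrier)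
    have ur: "(\<lambda>b. u \<otimes>\<^bsub>R\<^esub> z (Inr b)) = u \<odot>\<^bsub>res_module R F i\<^esub> (z \<circ> Inr)" by auto
    have l: "cone_map R u i w \<circ> Inl = w \<circ> Inl" for w by (cases i) (simp_all add: cone_map_def)
    have "s \<otimes>\<^bsub>R\<^esub> (u \<otimes>\<^bsub>R\<^esub> z (Inr b)) = u \<otimes>\<^bsub>R\<^esub> s \<otimes>\<^bsub>R\<^esub> z (Inr b)" for b
      using s u zr[of b] by (simp add: R.m_ac)
    hence "cone_diff R s F i (cone_map R u (Suc i) z) \<circ> Inl =
        cone_map R u i (cone_diff R (u \<otimes>\<^bsub>R\<^esub> s) F i z) \<circ> Inl"
      unfolding l by (simp add: cone_diff_def cone_map_def)
    moreover have "cone_down R F i (u \<odot>\<^bsub>res_module R F i\<^esub> (z \<circ> Inr)) =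
        cone_map R u i (cone_diff R (u \<otimes>\<^bsub>R\<^esub> s) F i z) \<circ> Inr"
    proof (cases i)
      case 0
      thus ?thesis by (simp add: cone_map_def cone_diff_def cone_down_def)
    next
      case (Suc j)
      have "cone_down R F (Suc j) (u \<odot>\<^bsub>res_module R F (Suc j)\<^esub> (z \<circ> Inr)) =
          u \<odot>\<^bsub>res_module R F j\<^esub> cone_down R F (Suc j) (z \<circ> Inr)"
        using lin_smult[OF lin_cone_down[OF R F] u, of "z \<circ> Inr"] zc(2) Suc by simp
      thus ?thesis using Suc by (simp add: cone_map_def cone_diff_def)
    qed
    hence "cone_diff R s F i (cone_map R u (Suc i) z) \<circ> Inr =
        cone_map R u i (cone_diff R (u \<otimes>\<^bsub>R\<^esub> s) F i z) \<circ> Inr"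
      unfolding ur[symmetric] by (simp add: cone_diff_def cone_map_def)
    ultimately show ?thesis by (rule case_sum_eqI)
  qed
  moreover have "res_aug (cone_res R M s F) z = f (res_aug (cone_res R M (u \<otimes>\<^bsub>R\<^esub> s) F) z)"
    if z: "z \<in> carrier (cone_module R F 0)" for z
    using z f ac cone_carrier_Inl[OF R z] by (simp add: cone_res_def)
  moreover have "cone_map R u 0 z = z" if "z \<in> carrier (cone_module R F 0)" for z
    by (simp add: cone_map_def)
  ultimately show ?thesis unfolding lin_lift_def res_module_cone
    using cone_map_lin[OF R u, of F] lin_closed[OF cone_map_lin[OF R u, of F]]
    by (simp add: res_cone_diff)
qed

text \<open>With g = (\<alpha>, \<beta>), evaluating g on the differentials of (a, 0) and (0, b)
  gives the two conditions \<alpha> d = 0 and s \<alpha> = \<beta> d.\<close>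

lemma cone_cocyc_iff:
  assumes M: "module R M" and N: "module R N" and F: "is_free_res R M F" and s: "s \<in> carrier R"
  shows "cocyc R (cone_res R M s F) N (Suc j) g \<longleftrightarrow> lin R (cone_module R F (Suc j)) N g \<and>
    (\<forall>a\<in>carrier (res_module R F (Suc (Suc j))). g (case_sum (res_diff F (Suc j) a) (\<lambda>_. \<zero>\<^bsub>R\<^esub>)) = \<zero>\<^bsub>N\<^esub>) \<and>
    (\<forall>b\<in>carrier (res_module R F (Suc j)).
      s \<odot>\<^bsub>N\<^esub> g (case_sum b (\<lambda>_. \<zero>\<^bsub>R\<^esub>)) = g (case_sum (\<lambda>_. \<zero>\<^bsub>R\<^esub>) (res_diff F j b)))"
proof (cases "lin R (cone_module R F (Suc j)) N g")
  case True
  note R = module_cring[OF M]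
  interpret R: cring R by (rule R)
  interpret N: module R N by (rule N)
  note Fm = res_module_module[OF R, of F]
  note dc = lin_closed[OF res_diff_lin[OF F]]
  note i1 = lin_in1[OF R, of F "Suc j"] and i2 = lin_in2[OF R, of F j]
  note g1 = lin_comp[OF i1 True] and g2 = lin_comp[OF i2 True]
  let ?D = "cone_diff R s F (Suc j)"
  have D1: "g (?D (case_sum a (\<lambda>_. \<zero>\<^bsub>R\<^esub>))) = g (case_sum (res_diff F (Suc j) a) (\<lambda>_. \<zero>\<^bsub>R\<^esub>))"
    if a: "a \<in> carrier (res_module R F (Suc (Suc j)))" for a
  proof -
    have "cone_down R F (Suc j) (\<lambda>_. \<zero>\<^bsub>R\<^esub>) = (\<lambda>_. \<zero>\<^bsub>R\<^esub>)"
      using lin_zero[OF Fm Fm lin_cone_down[OF R F], of j] by simp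
    moreover have "res_diff F (Suc j) a \<oplus>\<^bsub>res_module R F (Suc j)\<^esub> s \<odot>\<^bsub>res_module R F (Suc j)\<^esub> (\<lambda>_. \<zero>\<^bsub>R\<^esub>)
        = res_diff F (Suc j) a"
      using dc[OF a] s by (simp add: res_module_def free_carrier)
    ultimately show ?thesis by (simp add: cone_diff_def del: res_ops)
  qed
  have D2: "g (?D (case_sum (\<lambda>_. \<zero>\<^bsub>R\<^esub>) b)) =
      s \<odot>\<^bsub>N\<^esub> g (case_sum b (\<lambda>_. \<zero>\<^bsub>R\<^esub>)) \<ominus>\<^bsub>N\<^esub> g (case_sum (\<lambda>_. \<zero>\<^bsub>R\<^esub>) (res_diff F j b))"
    if b: "b \<in> carrier (res_module R F (Suc j))" for b
  proof -
    interpret F1: module R "res_module R F (Suc j)" by (rule Fm)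
    have "res_diff F (Suc j) (\<lambda>_. \<zero>\<^bsub>R\<^esub>) = \<zero>\<^bsub>res_module R F (Suc j)\<^esub>"
      using lin_zero[OF Fm Fm res_diff_lin[OF F], of "Suc j"] by simp
    hence e: "res_diff F (Suc j) (\<lambda>_. \<zero>\<^bsub>R\<^esub>) \<oplus>\<^bsub>res_module R F (Suc j)\<^esub> s \<odot>\<^bsub>res_module R F (Suc j)\<^esub> b =
        s \<odot>\<^bsub>res_module R F (Suc j)\<^esub> b"
      using F1.smult_closed[OF s b] by (simp only: F1.l_zero)
    have c: "?D (case_sum (\<lambda>_. \<zero>\<^bsub>R\<^esub>) b) \<in> carrier (cone_module R F (Suc j))"
      by (rule lin_closed[OF cone_diff_lin[OF R F s] lin_closed[OF lin_in2[OF R] b]])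
    have l: "(?D (case_sum (\<lambda>_. \<zero>\<^bsub>R\<^esub>) b)) \<circ> Inl = s \<odot>\<^bsub>res_module R F (Suc j)\<^esub> b"
      unfolding cone_diff_def case_sum_comp by (rule e)
    have r: "(?D (case_sum (\<lambda>_. \<zero>\<^bsub>R\<^esub>) b)) \<circ> Inr = \<ominus>\<^bsub>res_module R F j\<^esub> res_diff F j b"
      unfolding cone_diff_def case_sum_comp by (simp add: cone_down_def)
    show ?thesis
      using cone_split[OF N True c] lin_smult[OF g1 s b] lin_neg[OF Fm N g2 dc[OF b]]
      unfolding l r a_minus_def by simp
  qed
  have cl: "g (case_sum b (\<lambda>_. \<zero>\<^bsub>R\<^esub>)) \<in> carrier N" "g (case_sum (\<lambda>_. \<zero>\<^bsub>R\<^esub>) (res_diff F j b)) \<in> carrier N"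
    if "b \<in> carrier (res_module R F (Suc j))" for b
    using lin_closed[OF g1 that] lin_closed[OF g2 dc[OF that]] by auto
  have "(\<forall>z\<in>carrier (cone_module R F (Suc (Suc j))). g (?D z) = \<zero>\<^bsub>N\<^esub>) \<longleftrightarrow>
    (\<forall>a\<in>carrier (res_module R F (Suc (Suc j))). g (?D (case_sum a (\<lambda>_. \<zero>\<^bsub>R\<^esub>))) = \<zero>\<^bsub>N\<^esub>) \<and>
    (\<forall>b\<in>carrier (res_module R F (Suc j)). g (?D (case_sum (\<lambda>_. \<zero>\<^bsub>R\<^esub>) b)) = \<zero>\<^bsub>N\<^esub>)" (is "?L \<longleftrightarrow> ?R1 \<and> ?R2")
  proof
    assume ?L
    thus "?R1 \<and> ?R2" using lin_closed[OF lin_in1[OF R]] lin_closed[OF lin_in2[OF R]] by blast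
  next
    assume A: "?R1 \<and> ?R2"
    show ?L
    proof
      fix z assume z: "z \<in> carrier (cone_module R F (Suc (Suc j)))"
      hence "z \<circ> Inl \<in> carrier (res_module R F (Suc (Suc j)))" "z \<circ> Inr \<in> carrier (res_module R F (Suc j))"
        unfolding cone_carrier_Suc by auto
      thus "g (?D z) = \<zero>\<^bsub>N\<^esub>"
        using cone_split[OF N lin_comp[OF cone_diff_lin[OF R F s] True] z] A by simp
    qed
  qed
  thus ?thesis using True s cl unfolding cocyc_def res_module_cone
    by (simp add: res_cone_diff D1 D2 minus_eq_zero_iff[OF N])
qed (simp add: cocyc_def)

text \<open>A cochain (\<gamma>, -\<epsilon>) of the cone, one degree lower, has coboundary
  (\<gamma> d, s \<gamma> + \<epsilon> d). So (\<alpha>, \<beta>) is a coboundary exactly if some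
  \<gamma> satisfies \<alpha> = \<gamma> d and makes \<beta> - s \<gamma> a coboundary of
  \<open>F\<close>; for \<open>j = 0\<close> the summand \<epsilon> is absent and \<beta> = s
  \<gamma>.\<close>

lemma cone_cobd_iff:
  assumes M: "module R M" and N: "module R N" and F: "is_free_res R M F" and s: "s \<in> carrier R"
    and g: "lin R (cone_module R F (Suc j)) N g"
  shows "cobd R (cone_res R M s F) N (Suc j) g \<longleftrightarrow> (\<exists>\<gamma>. lin R (res_module R F j) N \<gamma> \<and>
    (\<forall>a\<in>carrier (res_module R F (Suc j)). g (case_sum a (\<lambda>_. \<zero>\<^bsub>R\<^esub>)) = \<gamma> (res_diff F j a)) \<and>
    cobd R F N j (\<lambda>b. g (case_sum (\<lambda>_. \<zero>\<^bsub>R\<^esub>) b) \<ominus>\<^bsub>N\<^esub> s \<odot>\<^bsub>N\<^esub> \<gamma> b))"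
proof -
  note R = module_cring[OF M]
  interpret R: cring R by (rule R)
  interpret N: module R N by (rule N)
  note Fm = res_module_module[OF R, of F]
  note C = free_module_module[OF R]
  note dl = res_diff_lin[OF F] note dc = lin_closed[OF dl]
  note i1 = lin_in1[OF R, of F] and i2 = lin_in2[OF R, of F]
  note Dl = cone_diff_lin[OF R F s]
  let ?D = "cone_diff R s F j"
  let ?o = "\<lambda>_. \<zero>\<^bsub>R\<^esub>"
  have z0: "\<zero>\<^bsub>res_module R F k\<^esub> \<in> carrier (res_module R F k)" for k
    using submodule_zero[OF submodule_carrier[OF Fm]] .
  have down0: "cone_down R F k ?o = ?o" for k
  proof (cases k)
    case 0 thus ?thesis by (simp add: cone_down_def)
  next
    case (Suc l) thus ?thesis using lin_zero[OF Fm Fm lin_cone_down[OF R F], of l] by simp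
  qed
  have D1: "?D (case_sum a ?o) = case_sum (res_diff F j a) ?o"
    if a: "a \<in> carrier (res_module R F (Suc j))" for a
  proof -
    have "res_diff F j a \<oplus>\<^bsub>res_module R F j\<^esub> s \<odot>\<^bsub>res_module R F j\<^esub> ?o = res_diff F j a"
      using dc[OF a] s by (simp add: res_module_def free_carrier)
    thus ?thesis by (simp add: cone_diff_def down0 del: res_ops)
  qed
  have D2: "?D (case_sum ?o b) = case_sum (s \<odot>\<^bsub>res_module R F j\<^esub> b) (cone_down R F j b)"
    if b: "b \<in> carrier (res_module R F j)" for b
  proof -
    interpret F1: module R "res_module R F j" by (rule Fm)
    have "res_diff F j ?o = \<zero>\<^bsub>res_module R F j\<^esub>" using lin_zero[OF Fm Fm dl, of j] by simp
    hence "res_diff F j ?o \<oplus>\<^bsub>res_module R F j\<^esub> s \<odot>\<^bsub>res_module R F j\<^esub> b = s \<odot>\<^bsub>res_module R F j\<^esub> b"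
      using F1.smult_closed[OF s b] by (simp only: F1.l_zero)
    thus ?thesis unfolding cone_diff_def case_sum_comp by simp
  qed
  note g1 = lin_comp[OF i1 g] and g2 = lin_comp[OF i2 g]
  show ?thesis
  proof
    assume "cobd R (cone_res R M s F) N (Suc j) g"
    then obtain h where h: "lin R (cone_module R F j) N h"
      "\<And>z. z \<in> carrier (cone_module R F (Suc j)) \<Longrightarrow> g z = h (?D z)"
      by (auto simp: res_cone_diff)
    define \<gamma> where "\<gamma> a = h (case_sum a ?o)" for a
    have \<gamma>: "lin R (res_module R F j) N \<gamma>" unfolding \<gamma>_def by (rule lin_comp[OF i1 h(1)])
    have 1: "g (case_sum a ?o) = \<gamma> (res_diff F j a)" if "a \<in> carrier (res_module R F (Suc j))" for a
      using h(2)[OF lin_closed[OF i1 that]] D1[OF that] by (simp add: \<gamma>_def)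
    have 2: "g (case_sum ?o b) = h (case_sum (s \<odot>\<^bsub>res_module R F j\<^esub> b) (cone_down R F j b))"
      if "b \<in> carrier (res_module R F j)" for b
      using h(2)[OF lin_closed[OF i2 that]] D2[OF that] by simp
    have "cobd R F N j (\<lambda>b. g (case_sum ?o b) \<ominus>\<^bsub>N\<^esub> s \<odot>\<^bsub>N\<^esub> \<gamma> b)"
    proof (cases j)
      case 0
      have "g (case_sum ?o b) = s \<odot>\<^bsub>N\<^esub> \<gamma> b" if b: "b \<in> carrier (res_module R F 0)" for b
        using 2[of b] b 0 lin_smult[OF \<gamma> s, of b] by (simp add: cone_down_def \<gamma>_def)
      thus ?thesis using 0 lin_closed[OF \<gamma>] s by (auto simp: minus_eq_zero_iff[OF N])
    next
      case (Suc k)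
      \<comment> \<open>The negation undoes the sign of the cone differential in its second
        component.\<close>
      define \<epsilon> where "\<epsilon> w = h (case_sum ?o (\<ominus>\<^bsub>res_module R F k\<^esub> w))" for w
      have h': "lin R (cone_module R F (Suc k)) N h" using h(1) Suc by simp
      have \<epsilon>: "lin R (res_module R F k) N \<epsilon>"
        unfolding \<epsilon>_def by (intro lin_comp[OF _ h'] lin_comp[OF _ i2] lin_uminus lin_id Fm)
      have "g (case_sum ?o b) \<ominus>\<^bsub>N\<^esub> s \<odot>\<^bsub>N\<^esub> \<gamma> b = \<epsilon> (res_diff F k b)"
        if b: "b \<in> carrier (res_module R F (Suc k))" for b
      proof -
        interpret F1: module R "res_module R F j" by (rule Fm)
        have sb: "s \<odot>\<^bsub>res_module R F j\<^esub> b \<in> carrier (res_module R F j)" using F1.smult_closed[OF s] b Suc by simp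
        have c: "case_sum (s \<odot>\<^bsub>res_module R F j\<^esub> b) (cone_down R F j b) \<in> carrier (cone_module R F (Suc k))"
          using sb lin_closed[OF lin_cone_down[OF R F] b] Suc unfolding cone_carrier_Suc by simp
        have "g (case_sum ?o b) = s \<odot>\<^bsub>N\<^esub> \<gamma> b \<oplus>\<^bsub>N\<^esub> h (case_sum ?o (cone_down R F j b))"
          using 2[of b] b Suc cone_split[OF N h' c] lin_smult[OF \<gamma> s, of b] by (simp add: \<gamma>_def)
        moreover have "h (case_sum ?o (cone_down R F j b)) = \<epsilon> (res_diff F k b)"
          using Suc by (simp add: cone_down_def \<epsilon>_def)
        moreover have "(x \<oplus>\<^bsub>N\<^esub> y) \<ominus>\<^bsub>N\<^esub> x = y" if "x \<in> carrier N" "y \<in> carrier N" for x y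
          using that by (simp add: a_minus_def N.a_comm[of x] N.a_assoc N.r_neg)
        ultimately show ?thesis
          using lin_closed[OF \<epsilon> dc[OF b]] lin_closed[OF \<gamma>, of b] b Suc s by simp
      qed
      thus ?thesis using Suc \<epsilon> by auto
    qed
    thus "\<exists>\<gamma>. lin R (res_module R F j) N \<gamma> \<and>
      (\<forall>a\<in>carrier (res_module R F (Suc j)). g (case_sum a ?o) = \<gamma> (res_diff F j a)) \<and>
      cobd R F N j (\<lambda>b. g (case_sum ?o b) \<ominus>\<^bsub>N\<^esub> s \<odot>\<^bsub>N\<^esub> \<gamma> b)" using \<gamma> 1 by blast
  next
    assume "\<exists>\<gamma>. lin R (res_module R F j) N \<gamma> \<and>
      (\<forall>a\<in>carrier (res_module R F (Suc j)). g (case_sum a ?o) = \<gamma> (res_diff F j a)) \<and>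
      cobd R F N j (\<lambda>b. g (case_sum ?o b) \<ominus>\<^bsub>N\<^esub> s \<odot>\<^bsub>N\<^esub> \<gamma> b)"
    then obtain \<gamma> where \<gamma>: "lin R (res_module R F j) N \<gamma>"
      and 1: "\<And>a. a \<in> carrier (res_module R F (Suc j)) \<Longrightarrow> g (case_sum a ?o) = \<gamma> (res_diff F j a)"
      and 2: "cobd R F N j (\<lambda>b. g (case_sum ?o b) \<ominus>\<^bsub>N\<^esub> s \<odot>\<^bsub>N\<^esub> \<gamma> b)" by blast
    define e where "e b = g (case_sum ?o b) \<ominus>\<^bsub>N\<^esub> s \<odot>\<^bsub>N\<^esub> \<gamma> b" for b
    have gz: "g z = \<gamma> (?D z \<circ> Inl) \<oplus>\<^bsub>N\<^esub> e (z \<circ> Inr)" if z: "z \<in> carrier (cone_module R F (Suc j))" for z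
    proof -
      interpret F0: module R "res_module R F j" by (rule Fm)
      have zc: "z \<circ> Inl \<in> carrier (res_module R F (Suc j))" "z \<circ> Inr \<in> carrier (res_module R F j)"
        using z unfolding cone_carrier_Suc by auto
      have "\<gamma> (?D z \<circ> Inl) = \<gamma> (res_diff F j (z \<circ> Inl)) \<oplus>\<^bsub>N\<^esub> s \<odot>\<^bsub>N\<^esub> \<gamma> (z \<circ> Inr)"
        unfolding cone_diff_def case_sum_comp
        using lin_add[OF \<gamma> dc[OF zc(1)] F0.smult_closed[OF s zc(2)]] lin_smult[OF \<gamma> s zc(2)] by simp
      moreover have "(x \<oplus>\<^bsub>N\<^esub> y) \<oplus>\<^bsub>N\<^esub> (w \<ominus>\<^bsub>N\<^esub> y) = x \<oplus>\<^bsub>N\<^esub> w"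
        if "x \<in> carrier N" "y \<in> carrier N" "w \<in> carrier N" for x y w
        using that by (simp add: a_minus_def N.a_comm[of w] N.a_assoc N.r_neg2)
      ultimately show ?thesis
        using cone_split[OF N g z] 1[OF zc(1)] lin_closed[OF \<gamma> dc[OF zc(1)]] lin_closed[OF \<gamma> zc(2)]
          lin_closed[OF g2 zc(2)] s
        by (simp add: e_def)
    qed
    show "cobd R (cone_res R M s F) N (Suc j) g"
    proof (cases j)
      case 0
      have "g z = \<gamma> (?D z \<circ> Inl)" if z: "z \<in> carrier (cone_module R F (Suc j))" for z
      proof -
        have "z \<circ> Inr \<in> carrier (res_module R F 0)" using z 0 unfolding cone_carrier_Suc by simp
        hence "e (z \<circ> Inr) = \<zero>\<^bsub>N\<^esub>" using 2 0 by (simp add: e_def)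
        thus ?thesis using gz[OF z] lin_closed[OF \<gamma> lin_closed[OF lin_Inl[OF R] lin_closed[OF Dl z]]] by simp
      qed
      thus ?thesis using lin_comp[OF lin_Inl[OF R] \<gamma>]
        by (auto simp: res_cone_diff)
    next
      case (Suc k)
      then obtain \<epsilon> where \<epsilon>: "lin R (res_module R F k) N \<epsilon>"
        "\<And>b. b \<in> carrier (res_module R F (Suc k)) \<Longrightarrow> e b = \<epsilon> (res_diff F k b)"
        using 2 by (auto simp: e_def)
      let ?h = "\<lambda>z. \<gamma> (z \<circ> Inl) \<ominus>\<^bsub>N\<^esub> \<epsilon> (z \<circ> Inr)"
      have "lin R (cone_module R F (Suc k)) N ?h"
        using \<gamma> Suc by (intro lin_diff C N lin_comp[OF lin_Inl[OF R]] lin_comp[OF lin_Inr[OF R] \<epsilon>(1)]) simp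
      hence h: "lin R (cone_module R F j) N ?h" using Suc by simp
      have "g z = ?h (?D z)" if z: "z \<in> carrier (cone_module R F (Suc j))" for z
      proof -
        have zc: "z \<circ> Inr \<in> carrier (res_module R F (Suc k))" using z Suc unfolding cone_carrier_Suc by simp
        have "\<epsilon> (?D z \<circ> Inr) = \<ominus>\<^bsub>N\<^esub> \<epsilon> (res_diff F k (z \<circ> Inr))"
          unfolding cone_diff_def case_sum_comp
          using Suc lin_neg[OF Fm N \<epsilon>(1) dc[OF zc]] by (simp add: cone_down_def)
        thus ?thesis using gz[OF z] \<epsilon>(2)[OF zc] lin_closed[OF \<epsilon>(1) dc[OF zc]] by (simp add: a_minus_def)
      qed
      thus ?thesis using h by (auto simp: res_cone_diff)
    qed
  qed
qed


section \<open>Fiber-fullness and regularity on cohomology\<close>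

text \<open>Multiplication by \<open>t\<close> is injective on the cohomology of Hom(F, N) in degree
  \<open>j\<close>.\<close>

definition cobd_regular ::
  "('a, 'x) ring_scheme \<Rightarrow> ('a, 'b, 'm) free_res \<Rightarrow> ('a, 'n) module \<Rightarrow> nat \<Rightarrow> 'a \<Rightarrow> bool"
  where "cobd_regular R F N j t \<longleftrightarrow>
    (\<forall>g. cocyc R F N j g \<longrightarrow> cobd R F N j (\<lambda>z. t \<odot>\<^bsub>N\<^esub> g z) \<longrightarrow> cobd R F N j g)"

lemma cocyc_scale:
  assumes N: "module R N" and g: "cocyc R F N j g" and a: "a \<in> carrier R"
  shows "cocyc R F N j (\<lambda>z. a \<odot>\<^bsub>N\<^esub> g z)"
proof -
  interpret N: module R N by fact
  show ?thesis using g a lin_scale[OF res_module_module[OF N.R.is_cring] N cocyc_lin[OF g] a]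
    by (simp add: cocyc_def)
qed

lemma cobd_regular_mult:
  assumes N: "module R N" and "cobd_regular R F N j s" and "cobd_regular R F N j t"
    and s: "s \<in> carrier R" and t: "t \<in> carrier R"
  shows "cobd_regular R F N j (s \<otimes>\<^bsub>R\<^esub> t)"
  unfolding cobd_regular_def
proof (intro allI impI)
  interpret N: module R N by (rule N)
  fix g assume g: "cocyc R F N j g" and b: "cobd R F N j (\<lambda>z. s \<otimes>\<^bsub>R\<^esub> t \<odot>\<^bsub>N\<^esub> g z)"
  have "cobd R F N j (\<lambda>z. s \<odot>\<^bsub>N\<^esub> (t \<odot>\<^bsub>N\<^esub> g z))"
    using b by (rule cobd_cong) (use s t lin_closed[OF cocyc_lin[OF g]] in \<open>simp add: N.smult_assoc1\<close>)
  hence "cobd R F N j (\<lambda>z. t \<odot>\<^bsub>N\<^esub> g z)" using assms(2) cocyc_scale[OF N g t] by (simp add: cobd_regular_def)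
  thus "cobd R F N j g" using assms(3) g by (simp add: cobd_regular_def)
qed

lemma cobd_regular_unit:
  assumes N: "module R N" and "s \<otimes>\<^bsub>R\<^esub> t = \<one>\<^bsub>R\<^esub>" and s: "s \<in> carrier R" and t: "t \<in> carrier R"
  shows "cobd_regular R F N j t"
  unfolding cobd_regular_def
proof (intro allI impI)
  interpret N: module R N by (rule N)
  fix g assume g: "cocyc R F N j g" and b: "cobd R F N j (\<lambda>z. t \<odot>\<^bsub>N\<^esub> g z)"
  show "cobd R F N j g"
    by (rule cobd_cong[OF cobd_scale[OF N b s]])
      (use s t assms(2) lin_closed[OF cocyc_lin[OF g]] in \<open>simp add: N.smult_assoc1[symmetric]\<close>)
qed

lemma cobd_regular_pow:
  assumes N: "module R N" and r: "cobd_regular R F N j t" and t: "t \<in> carrier R"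
  shows "cobd_regular R F N j (t [^]\<^bsub>R\<^esub> (k::nat))"
proof (induct k)
  interpret N: module R N by (rule N)
  case 0
  show ?case using cobd_regular_unit[OF N, of "\<one>\<^bsub>R\<^esub>" "\<one>\<^bsub>R\<^esub>"] by simp
next
  interpret N: module R N by (rule N)
  case (Suc k)
  show ?case using cobd_regular_mult[OF N Suc r N.R.nat_pow_closed[OF t] t] by simp
qed

lemma cone_map_in1:
  assumes R: "cring R" and u: "u \<in> carrier R"
  shows "cone_map R u (Suc j) (case_sum a (\<lambda>_. \<zero>\<^bsub>R\<^esub>)) = case_sum a (\<lambda>_. \<zero>\<^bsub>R\<^esub>)"
proof -
  interpret R: cring R by fact
  show ?thesis using u by (simp add: cone_map_def)
qed

lemma cone_map_in2:
  "cone_map R u (Suc j) (case_sum (\<lambda>_. \<zero>\<^bsub>R\<^esub>) b) = case_sum (\<lambda>_. \<zero>\<^bsub>R\<^esub>) (u \<odot>\<^bsub>res_module R F j\<^esub> b)"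
  by (simp add: cone_map_def)

text \<open>Let (\<alpha>, \<beta>) be a cocycle of the cone of \<open>t\<close> whose pullback
  (\<alpha>, u \<beta>) is a coboundary, with \<alpha> = \<gamma> d. Then e = \<beta> - t \<gamma>
  is a cocycle, because \<beta> d = t \<alpha> = t \<gamma> d, and u e is a coboundary. Regularity
  of the power \<open>u\<close> of \<open>t\<close> makes e a coboundary, so (\<alpha>, \<beta>) is
  one with the same \<gamma>.\<close>

lemma regular_imp_pullback_inj:
  assumes M: "module R M" and N: "module R N" and F: "is_free_res R M F" and t: "t \<in> carrier R"
    and reg: "cobd_regular R F N j t" and u: "u = t [^]\<^bsub>R\<^esub> (k::nat)"
  shows "pullback_inj R (cone_res R M (u \<otimes>\<^bsub>R\<^esub> t) F) (cone_res R M t F) N (Suc j) (cone_map R u (Suc j))"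
  unfolding pullback_inj_def
proof (intro allI impI)
  interpret N: module R N by (rule N)
  note R = N.R.is_cring
  note Fm = res_module_module[OF R, of F]
  let ?o = "\<lambda>_. \<zero>\<^bsub>R\<^esub>"
  have uc: "u \<in> carrier R" using t u by simp
  fix g assume g: "cocyc R (cone_res R M t F) N (Suc j) g"
    and b: "cobd R (cone_res R M (u \<otimes>\<^bsub>R\<^esub> t) F) N (Suc j) (\<lambda>z. g (cone_map R u (Suc j) z))"
  have gl: "lin R (cone_module R F (Suc j)) N g" using cocyc_lin[OF g] by simp
  have g2: "\<And>b. b \<in> carrier (res_module R F (Suc j)) \<Longrightarrow>
      t \<odot>\<^bsub>N\<^esub> g (case_sum b ?o) = g (case_sum ?o (res_diff F j b))"
    using g unfolding cone_cocyc_iff[OF M N F t] by blast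
  note \<beta> = lin_comp[OF lin_in2[OF R, of F j] gl]
  have ut: "u \<otimes>\<^bsub>R\<^esub> t \<in> carrier R" using uc t by simp
  obtain \<gamma> where \<gamma>: "lin R (res_module R F j) N \<gamma>"
    and 1: "\<And>a. a \<in> carrier (res_module R F (Suc j)) \<Longrightarrow> g (case_sum a ?o) = \<gamma> (res_diff F j a)"
    and 2: "cobd R F N j (\<lambda>b. g (case_sum ?o (u \<odot>\<^bsub>res_module R F j\<^esub> b)) \<ominus>\<^bsub>N\<^esub> (u \<otimes>\<^bsub>R\<^esub> t) \<odot>\<^bsub>N\<^esub> \<gamma> b)"
    using b unfolding cone_cobd_iff[OF M N F ut lin_comp[OF cone_map_lin[OF R uc] gl]]
      cone_map_in1[OF R uc] cone_map_in2[where F = F] by blast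
  define e where "e b = g (case_sum ?o b) \<ominus>\<^bsub>N\<^esub> t \<odot>\<^bsub>N\<^esub> \<gamma> b" for b
  have el: "lin R (res_module R F j) N e"
    unfolding e_def by (intro lin_diff Fm N \<beta> lin_scale \<gamma> t)
  note dc = lin_closed[OF res_diff_lin[OF F]]
  have ec: "cocyc R F N j e" unfolding cocyc_def
  proof (intro conjI el ballI)
    fix a assume a: "a \<in> carrier (res_module R F (Suc j))"
    show "e (res_diff F j a) = \<zero>\<^bsub>N\<^esub>"
      using g2[OF a, symmetric] 1[OF a] lin_closed[OF \<gamma> dc[OF a]] t by (simp add: e_def minus_eq_zero_iff[OF N])
  qed
  have "cobd R F N j (\<lambda>b. u \<odot>\<^bsub>N\<^esub> e b)"
  proof (rule cobd_cong[OF 2])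
    fix b assume b: "b \<in> carrier (res_module R F j)"
    have "u \<odot>\<^bsub>N\<^esub> e b = u \<odot>\<^bsub>N\<^esub> g (case_sum ?o b) \<ominus>\<^bsub>N\<^esub> u \<odot>\<^bsub>N\<^esub> (t \<odot>\<^bsub>N\<^esub> \<gamma> b)"
      using lin_closed[OF \<beta> b] lin_closed[OF \<gamma> b] uc t
      by (simp add: e_def a_minus_def N.smult_r_distr N.smult_r_minus)
    thus "u \<odot>\<^bsub>N\<^esub> e b = g (case_sum ?o (u \<odot>\<^bsub>res_module R F j\<^esub> b)) \<ominus>\<^bsub>N\<^esub> (u \<otimes>\<^bsub>R\<^esub> t) \<odot>\<^bsub>N\<^esub> \<gamma> b"
      using lin_smult[OF \<beta> uc b] lin_closed[OF \<gamma> b] uc t by (simp add: N.smult_assoc1)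
  qed
  hence "cobd R F N j e"
    using cobd_regular_pow[OF N reg t, of k] ec u by (simp add: cobd_regular_def)
  thus "cobd R (cone_res R M t F) N (Suc j) g"
    unfolding cone_cobd_iff[OF M N F t gl] e_def using \<gamma> 1 by blast
qed

text \<open>Injectivity for every \<open>k\<close> makes each class of t-power torsion divisible by
  \<open>t\<close> within the torsion. A uniform bound on the exponents, supplied by Noetherianity,
  is then lowered to 0.\<close>

lemma pullback_inj_imp_regular:
  assumes M: "module R M" and N: "module R N" and F: "is_free_res R M F" and t: "t \<in> carrier R"
    and noeth: "noeth_module R (hom_module R (res_module R F j) N)"
    and inj: "\<And>k::nat. pullback_inj R (cone_res R M (t [^]\<^bsub>R\<^esub> k \<otimes>\<^bsub>R\<^esub> t) F) (cone_res R M t F) N (Suc j)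
      (cone_map R (t [^]\<^bsub>R\<^esub> k) (Suc j))"
  shows "cobd_regular R F N j t"
proof -
  interpret N: module R N by (rule N)
  note R = N.R.is_cring
  note Fm = res_module_module[OF R, of F]
  let ?o = "\<lambda>_. \<zero>\<^bsub>R\<^esub>"
  let ?Hom = "hom_module R (res_module R F j) N"
  have tk: "t [^]\<^bsub>R\<^esub> (k::nat) \<in> carrier R" for k using t by simp
  \<comment> \<open>\<open>S k g\<close>: the class of the cocycle \<open>g\<close> is annihilated
    by the \<open>k\<close>-th power of \<open>t\<close>. The sets \<open>H k\<close> of extensional
    representatives form an ascending chain in the Noetherian Hom module, hence a common exponent
    \<open>n\<close>.\<close>
  define S where "S k g \<longleftrightarrow> cocyc R F N j g \<and> cobd R F N j (\<lambda>z. t [^]\<^bsub>R\<^esub> (k::nat) \<odot>\<^bsub>N\<^esub> g z)" for k g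
  define H where "H k = {g \<in> mod_hom R (res_module R F j) N. S k g}" for k
  have Hom: "module R ?Hom" by (rule hom_module_module[OF Fm N])
  interpret Hom: module R ?Hom by (rule Hom)
  have Scong: "S k g'" if "S k g" "lin R (res_module R F j) N g'"
    "\<And>z. z \<in> carrier (res_module R F j) \<Longrightarrow> g' z = g z" for k g g'
    using that cobd_cong[of R F N j "\<lambda>z. t [^]\<^bsub>R\<^esub> k \<odot>\<^bsub>N\<^esub> g z" "\<lambda>z. t [^]\<^bsub>R\<^esub> k \<odot>\<^bsub>N\<^esub> g' z"]
      lin_closed[OF res_diff_lin[OF F]] by (auto simp: S_def cocyc_def)
  have Hr: "restrict g (carrier (res_module R F j)) \<in> H k" if "S k g" for k g
  proof -
    have "restrict g (carrier (res_module R F j)) \<in> mod_hom R (res_module R F j) N"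
      using that by (intro restrict_mod_hom[OF cocyc_lin Fm]) (simp add: S_def)
    moreover from Scong[OF that mod_hom_lin[OF this]] have "S k (restrict g (carrier (res_module R F j)))" by simp
    ultimately show ?thesis by (simp add: H_def)
  qed
  have Sadd: "S k (\<lambda>z. g z \<oplus>\<^bsub>N\<^esub> g' z)" if "S k g" "S k g'" for k g g'
  proof -
    have g: "cocyc R F N j g" "cocyc R F N j g'" using that by (auto simp: S_def)
    note l = cocyc_lin[OF g(1)] cocyc_lin[OF g(2)]
    have "cocyc R F N j (\<lambda>z. g z \<oplus>\<^bsub>N\<^esub> g' z)"
      using g lin_plus[OF Fm N l] by (simp add: cocyc_def)
    moreover have "cobd R F N j (\<lambda>z. t [^]\<^bsub>R\<^esub> k \<odot>\<^bsub>N\<^esub> (g z \<oplus>\<^bsub>N\<^esub> g' z))"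
      by (rule cobd_cong[OF cobd_plus[OF N, of F j "\<lambda>z. t [^]\<^bsub>R\<^esub> k \<odot>\<^bsub>N\<^esub> g z" "\<lambda>z. t [^]\<^bsub>R\<^esub> k \<odot>\<^bsub>N\<^esub> g' z"]])
        (use that lin_closed[OF l(1)] lin_closed[OF l(2)] tk in \<open>auto simp: S_def N.smult_r_distr\<close>)
    ultimately show ?thesis by (simp add: S_def)
  qed
  have Ssm: "S k (\<lambda>z. a \<odot>\<^bsub>N\<^esub> g z)" if "S k g" and a: "a \<in> carrier R" for k g a
  proof -
    have g: "cocyc R F N j g" using that by (auto simp: S_def)
    have "cobd R F N j (\<lambda>z. t [^]\<^bsub>R\<^esub> k \<odot>\<^bsub>N\<^esub> (a \<odot>\<^bsub>N\<^esub> g z))"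
      by (rule cobd_cong[OF cobd_scale[OF N, of F j "\<lambda>z. t [^]\<^bsub>R\<^esub> k \<odot>\<^bsub>N\<^esub> g z" a]])
        (use that lin_closed[OF cocyc_lin[OF g]] tk in
          \<open>auto simp: S_def N.smult_assoc1[symmetric] N.R.m_comm\<close>)
    thus ?thesis using cocyc_scale[OF N g a] by (simp add: S_def)
  qed
  have S0: "S k (\<lambda>z. \<zero>\<^bsub>N\<^esub>)" for k
    using lin_zero_map[OF Fm N] cobd_zero[OF N, of F j] tk by (simp add: S_def cocyc_def)
  have SSuc: "S (Suc k) g" if "S k g" for k g
    using Ssm[OF that t] that lin_closed[OF cocyc_lin, of R F N j g]
      cobd_cong[of R F N j "\<lambda>z. t [^]\<^bsub>R\<^esub> k \<odot>\<^bsub>N\<^esub> (t \<odot>\<^bsub>N\<^esub> g z)" "\<lambda>z. t [^]\<^bsub>R\<^esub> Suc k \<odot>\<^bsub>N\<^esub> g z"]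
    by (auto simp: S_def N.smult_assoc1 t tk)
  have Hsub: "submodule (H k) R ?Hom" for k
  proof (rule Hom.submoduleI)
    show "H k \<subseteq> carrier ?Hom" by (auto simp: H_def hom_carrier)
    have hz: "\<zero>\<^bsub>?Hom\<^esub> \<in> mod_hom R (res_module R F j) N" using Hom.zero_closed by (simp add: hom_carrier)
    show "\<zero>\<^bsub>?Hom\<^esub> \<in> H k" using hz Scong[OF S0 mod_hom_lin[OF hz]] by (simp add: H_def hom_zero)
    show add: "g \<oplus>\<^bsub>?Hom\<^esub> g' \<in> H k" if "g \<in> H k" "g' \<in> H k" for g g'
    proof -
      have "g \<oplus>\<^bsub>?Hom\<^esub> g' \<in> mod_hom R (res_module R F j) N"
        using Hom.a_closed[of g g'] that by (simp add: H_def hom_carrier)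
      thus ?thesis using Scong[OF Sadd[of k g g'] mod_hom_lin] that by (simp add: H_def hom_add)
    qed
    show sm: "a \<odot>\<^bsub>?Hom\<^esub> g \<in> H k" if "a \<in> carrier R" "g \<in> H k" for a g
    proof -
      have "a \<odot>\<^bsub>?Hom\<^esub> g \<in> mod_hom R (res_module R F j) N"
        using Hom.smult_closed[of a g] that by (simp add: H_def hom_carrier)
      thus ?thesis using Scong[OF Ssm[of k g a] mod_hom_lin] that by (simp add: H_def hom_smult)
    qed
    show "\<ominus>\<^bsub>?Hom\<^esub> g \<in> H k" if "g \<in> H k" for g
      using sm[of "\<ominus>\<^bsub>R\<^esub> \<one>\<^bsub>R\<^esub>" g] that Hom.smult_l_minus[of "\<one>\<^bsub>R\<^esub>" g] Hom.smult_one[of g]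
      by (simp add: H_def hom_carrier)
  qed
  have Hmono: "H n \<subseteq> H (Suc n)" for n by (auto simp: H_def SSuc)
  obtain n where n: "\<And>m. H m \<subseteq> H n" 
    using noeth_chain_stable[where H = H, OF noeth Hsub Hmono] by blast
  have Sn: "S n g" if "S m g" for m g
  proof -
    have "S n (restrict g (carrier (res_module R F j)))" using Hr[OF that] n[of m] by (auto simp: H_def)
    thus ?thesis by (rule Scong) (use that in \<open>auto simp: S_def intro: cocyc_lin\<close>)
  qed
  \<comment> \<open>The injectivity is applied to the pair (0, f). The resulting coboundary
    condition says that \<gamma> is a cocycle and that f and t \<gamma> are cohomologous; the
    annihilating exponent rises by one in passing from f to \<gamma>.\<close>
  have divide: "\<exists>\<gamma>. S (Suc k) \<gamma> \<and> cobd R F N j (\<lambda>z. f z \<ominus>\<^bsub>N\<^esub> t \<odot>\<^bsub>N\<^esub> \<gamma> z)" if f: "S k f" for k f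
  proof -
    have fc: "cocyc R F N j f" and fb: "cobd R F N j (\<lambda>z. t [^]\<^bsub>R\<^esub> k \<odot>\<^bsub>N\<^esub> f z)" using f by (auto simp: S_def)
    note fl = cocyc_lin[OF fc]
    have f0: "f ?o = \<zero>\<^bsub>N\<^esub>" using lin_zero[OF Fm N fl] by simp
    let ?g = "\<lambda>z. f (z \<circ> Inr)"
    have gl: "lin R (cone_module R F (Suc j)) N ?g" by (rule lin_comp[OF lin_Inr[OF R] fl])
    have g: "cocyc R (cone_res R M t F) N (Suc j) ?g"
      unfolding cone_cocyc_iff[OF M N F t] using gl f0 fc t by (simp add: cocyc_def)
    have ut: "t [^]\<^bsub>R\<^esub> k \<otimes>\<^bsub>R\<^esub> t \<in> carrier R" using t by simp
    \<comment> \<open>The pullback is (0, t^k f), a coboundary with \<gamma> = 0 because t^k f is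
      one on \<open>F\<close>.\<close>
    have "cobd R (cone_res R M (t [^]\<^bsub>R\<^esub> k \<otimes>\<^bsub>R\<^esub> t) F) N (Suc j) (\<lambda>z. ?g (cone_map R (t [^]\<^bsub>R\<^esub> k) (Suc j) z))"
      unfolding cone_cobd_iff[OF M N F ut lin_comp[OF cone_map_lin[OF R tk] gl]]
        cone_map_in1[OF R tk] cone_map_in2[where F = F] case_sum_comp
    proof (intro exI[of _ "\<lambda>z. \<zero>\<^bsub>N\<^esub>"] conjI ballI)
      show "cobd R F N j (\<lambda>b. f (t [^]\<^bsub>R\<^esub> k \<odot>\<^bsub>res_module R F j\<^esub> b) \<ominus>\<^bsub>N\<^esub> (t [^]\<^bsub>R\<^esub> k \<otimes>\<^bsub>R\<^esub> t) \<odot>\<^bsub>N\<^esub> \<zero>\<^bsub>N\<^esub>)"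
        by (rule cobd_cong[OF fb])
          (use ut tk lin_smult[OF fl tk] lin_closed[OF fl] N.minus_equality[of "\<zero>\<^bsub>N\<^esub>" "\<zero>\<^bsub>N\<^esub>"] in
            \<open>simp add: a_minus_def del: res_ops\<close>)
    qed (use f0 lin_zero_map[OF Fm N] in auto)
    hence "cobd R (cone_res R M t F) N (Suc j) ?g" using inj[of k] g by (simp add: pullback_inj_def)
    then obtain \<gamma> where \<gamma>: "lin R (res_module R F j) N \<gamma>"
      and 1: "\<And>a. a \<in> carrier (res_module R F (Suc j)) \<Longrightarrow> \<zero>\<^bsub>N\<^esub> = \<gamma> (res_diff F j a)"
      and 2: "cobd R F N j (\<lambda>b. f b \<ominus>\<^bsub>N\<^esub> t \<odot>\<^bsub>N\<^esub> \<gamma> b)"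
      unfolding cone_cobd_iff[OF M N F t gl] case_sum_comp f0 by blast
    have \<gamma>c: "cocyc R F N j \<gamma>" using \<gamma> 1 by (simp add: cocyc_def)
    have "cobd R F N j (\<lambda>z. t [^]\<^bsub>R\<^esub> k \<odot>\<^bsub>N\<^esub> f z \<ominus>\<^bsub>N\<^esub> t [^]\<^bsub>R\<^esub> k \<odot>\<^bsub>N\<^esub> (f z \<ominus>\<^bsub>N\<^esub> t \<odot>\<^bsub>N\<^esub> \<gamma> z))"
      by (rule cobd_minus[OF N fb cobd_scale[OF N 2 tk]])
        (use lin_closed[OF fl] lin_closed[OF \<gamma>] t tk in auto)
    hence "cobd R F N j (\<lambda>z. t [^]\<^bsub>R\<^esub> Suc k \<odot>\<^bsub>N\<^esub> \<gamma> z)"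
    proof (rule cobd_cong)
      fix z assume z: "z \<in> carrier (res_module R F j)"
      have "x \<ominus>\<^bsub>N\<^esub> (x \<ominus>\<^bsub>N\<^esub> y) = y" if "x \<in> carrier N" "y \<in> carrier N" for x y
        using that by (simp add: a_minus_def N.minus_add N.r_neg2)
      moreover have "t [^]\<^bsub>R\<^esub> k \<odot>\<^bsub>N\<^esub> (f z \<ominus>\<^bsub>N\<^esub> t \<odot>\<^bsub>N\<^esub> \<gamma> z) =
          t [^]\<^bsub>R\<^esub> k \<odot>\<^bsub>N\<^esub> f z \<ominus>\<^bsub>N\<^esub> t [^]\<^bsub>R\<^esub> Suc k \<odot>\<^bsub>N\<^esub> \<gamma> z"
        using lin_closed[OF fl z] lin_closed[OF \<gamma> z] t tk
        by (simp add: a_minus_def N.smult_r_distr N.smult_r_minus N.smult_assoc1)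
      ultimately show "t [^]\<^bsub>R\<^esub> Suc k \<odot>\<^bsub>N\<^esub> \<gamma> z =
          t [^]\<^bsub>R\<^esub> k \<odot>\<^bsub>N\<^esub> f z \<ominus>\<^bsub>N\<^esub> t [^]\<^bsub>R\<^esub> k \<odot>\<^bsub>N\<^esub> (f z \<ominus>\<^bsub>N\<^esub> t \<odot>\<^bsub>N\<^esub> \<gamma> z)"
        using lin_closed[OF fl z] lin_closed[OF \<gamma> z] t tk by simp
    qed
    thus ?thesis using \<gamma>c 2 by (auto simp: S_def)
  qed
  \<comment> \<open>Suppose t^(k+1) annihilates all torsion classes. Then it annihilates the class
    of the \<gamma> obtained from f, and t^k f, cohomologous to t^(k+1) \<gamma>, is already a
    coboundary: the bound drops to k.\<close>
  have "\<forall>m g. S m g \<longrightarrow> S 0 g" if "\<forall>m g. S m g \<longrightarrow> S n g" for n using that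
  proof (induction n)
    case (Suc k)
    have "S k f" if Sf: "S m f" for m f
    proof -
      have f: "S (Suc k) f" using Suc.prems Sf by blast
      obtain \<gamma> where \<gamma>: "S (Suc (Suc k)) \<gamma>" "cobd R F N j (\<lambda>z. f z \<ominus>\<^bsub>N\<^esub> t \<odot>\<^bsub>N\<^esub> \<gamma> z)"
        using divide[OF f] by blast
      have "S (Suc k) \<gamma>" using Suc.prems \<gamma>(1) by blast
      hence gb: "cobd R F N j (\<lambda>z. t [^]\<^bsub>R\<^esub> Suc k \<odot>\<^bsub>N\<^esub> \<gamma> z)" and gc: "cocyc R F N j \<gamma>"
        by (auto simp: S_def)
      have fc: "cocyc R F N j f" using f by (simp add: S_def)
      have "cobd R F N j (\<lambda>z. t [^]\<^bsub>R\<^esub> k \<odot>\<^bsub>N\<^esub> f z)"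
      proof (rule cobd_cong[OF cobd_plus[OF N cobd_scale[OF N \<gamma>(2) tk, of k] gb]])
        fix z assume z: "z \<in> carrier (res_module R F j)"
        note c = lin_closed[OF cocyc_lin[OF fc] z] lin_closed[OF cocyc_lin[OF gc] z]
        show "t [^]\<^bsub>R\<^esub> k \<odot>\<^bsub>N\<^esub> f z =
            t [^]\<^bsub>R\<^esub> k \<odot>\<^bsub>N\<^esub> (f z \<ominus>\<^bsub>N\<^esub> t \<odot>\<^bsub>N\<^esub> \<gamma> z) \<oplus>\<^bsub>N\<^esub> t [^]\<^bsub>R\<^esub> Suc k \<odot>\<^bsub>N\<^esub> \<gamma> z"
          using c t tk
          by (simp add: a_minus_def N.smult_r_distr N.smult_r_minus N.smult_assoc1 N.a_assoc N.l_neg)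
      qed
      thus ?thesis using fc by (simp add: S_def)
    qed
    thus ?case using Suc.IH by blast
  qed blast
  hence all: "\<And>m g. S m g \<Longrightarrow> S 0 g" using Sn by blast
  show ?thesis unfolding cobd_regular_def
  proof (intro allI impI)
    fix g assume g: "cocyc R F N j g" and b: "cobd R F N j (\<lambda>z. t \<odot>\<^bsub>N\<^esub> g z)"
    have "S 1 g" using g b t by (simp add: S_def)
    from all[OF this] have "cobd R F N j (\<lambda>z. t [^]\<^bsub>R\<^esub> (0::nat) \<odot>\<^bsub>N\<^esub> g z)" unfolding S_def by blast
    thus "cobd R F N j g" by (rule cobd_cong) (use lin_closed[OF cocyc_lin[OF g]] in simp)
  qed
qed


section \<open>Leading coefficients on graded cohomology\<close>

text \<open>The component of \<open>f\<close> that raises degrees by \<open>d\<close>. It is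
  prescribed on the basis: the image of \<open>b\<close>, which has degree \<open>dg b\<close>, is
  cut down to degree \<open>d + dg b\<close>.\<close>

definition hom_proj ::
  "('a, 'x) ring_scheme \<Rightarrow> ('a, 'n) module \<Rightarrow> (int \<Rightarrow> 'n \<Rightarrow> 'n) \<Rightarrow> ('b \<Rightarrow> int) \<Rightarrow> int
    \<Rightarrow> (('b \<Rightarrow> 'a) \<Rightarrow> 'n) \<Rightarrow> ('b \<Rightarrow> 'a) \<Rightarrow> 'n"
  where "hom_proj R N q dg d f = lin_ext R N (\<lambda>b. q (d + dg b) (f (basis_vec R b)))"

lemma hom_proj_lin:
  assumes N: "graded_mod R N r q" and f: "lin R (free_module R B) N f"
  shows "lin R (free_module R B) N (hom_proj R N q dg d f)"
proof -
  interpret N: graded_mod R N r q by fact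
  show ?thesis unfolding hom_proj_def
    by (intro lin_ext_lin[OF N.module_axioms] N.p_closed lin_closed[OF f] basis_vec_closed N.R.is_cring)
qed

lemma hom_proj_basis:
  assumes N: "graded_mod R N r q" and f: "lin R (free_module R B) N f" and b: "b \<in> B"
  shows "hom_proj R N q dg d f (basis_vec R b) = q (d + dg b) (f (basis_vec R b))"
proof -
  interpret N: graded_mod R N r q by fact
  show ?thesis unfolding hom_proj_def
    by (rule lin_ext_basis[OF N.module_axioms _ b])
      (intro N.p_closed lin_closed[OF f] basis_vec_closed N.R.is_cring)
qed

lemma hom_proj_cong:
  assumes N: "graded_mod R N r q" and f: "lin R (free_module R B) N f"
    and fg: "\<And>z. z \<in> carrier (free_module R B) \<Longrightarrow> g z = f z" and z: "z \<in> carrier (free_module R B)"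
  shows "hom_proj R N q dg d g z = hom_proj R N q dg d f z"
proof -
  interpret N: graded_mod R N r q by fact
  note Rc = N.R.is_cring
  have g: "lin R (free_module R B) N g" by (rule lin_cong[OF f free_module_module[OF Rc] fg])
  show ?thesis
    by (rule lin_free_eqI[OF Rc N.module_axioms hom_proj_lin[OF N g] hom_proj_lin[OF N f] _ z])
      (simp add: hom_proj_basis[OF N g] hom_proj_basis[OF N f] fg basis_vec_closed[OF Rc])
qed

text \<open>A description on all homogeneous elements rather than on basis vectors. It applies to
  the images of basis vectors under a differential, which are homogeneous but in general not basis
  vectors.\<close>

lemma hom_proj_homogeneous:
  assumes R: "graded_mod R (regular_module R) r r" and N: "graded_mod R N r q" and B: "finite B"
    and f: "lin R (free_module R B) N f" and y: "y \<in> carrier (free_module R B)"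
  shows "hom_proj R N q dg d f (free_proj R r dg e y) = q (d + e) (f (free_proj R r dg e y))"
proof -
  interpret R: graded_mod R "regular_module R" r r by fact
  interpret N: graded_mod R N r q by fact
  note Rc = R.R.is_cring
  let ?F = "free_module R B"
  interpret F: graded_mod R ?F r "free_proj R r dg" by (rule free_graded[OF R B])
  note h = hom_proj_lin[OF N f, of dg d]
  have r0: "r d \<zero>\<^bsub>R\<^esub> = \<zero>\<^bsub>R\<^esub>" for d using R.p_zero by simp
  have rc: "a \<in> carrier R \<Longrightarrow> r d a \<in> carrier R" for a d using R.p_closed by simp
  from Rc y show ?thesis
  proof (induction rule: free_induct)
    case zero
    have "free_proj R r dg e \<zero>\<^bsub>?F\<^esub> = \<zero>\<^bsub>?F\<^esub>" by (rule F.p_zero)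
    thus ?case using lin_zero[OF F.module_axioms N.module_axioms f]
      lin_zero[OF F.module_axioms N.module_axioms h] N.p_zero by simp
  next
    case (add a b w)
    note c = basis_vec_closed[OF Rc add.hyps(2)]
    note ac = F.smult_closed[OF add.hyps(1) c]
    let ?a = "r (e - dg b) a"
    have a: "?a \<in> carrier R" "r (e - dg b) ?a = ?a" using R.p_p add.hyps(1) rc by auto
    have pe: "free_proj R r dg e (a \<odot>\<^bsub>?F\<^esub> basis_vec R b) = ?a \<odot>\<^bsub>?F\<^esub> basis_vec R b"
      using add.hyps(1) rc by (auto simp: free_proj_def basis_vec_def fun_eq_iff r0)
    have "q (d + e) (?a \<odot>\<^bsub>N\<^esub> f (basis_vec R b)) = ?a \<odot>\<^bsub>N\<^esub> q (d + dg b) (f (basis_vec R b))"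
      using N.p_smult_hom[OF a lin_closed[OF f c], of "d + dg b"] by (simp add: algebra_simps)
    hence "hom_proj R N q dg d f (free_proj R r dg e (a \<odot>\<^bsub>?F\<^esub> basis_vec R b)) =
        q (d + e) (f (free_proj R r dg e (a \<odot>\<^bsub>?F\<^esub> basis_vec R b)))"
      unfolding pe using a(1) c
      by (simp add: lin_smult[OF f] lin_smult[OF h] hom_proj_basis[OF N f add.hyps(2)] del: free_ops)
    thus ?case
      using add.hyps(3) add.IH ac F.p_closed lin_closed[OF f]
      by (simp add: F.p_add lin_add[OF f] lin_add[OF h] N.p_add del: free_ops)
  qed
qed

text \<open>The differentials preserve degrees, so taking components commutes with composing with
  them. Hence components of cocycles are cocycles and components of coboundaries are
  coboundaries.\<close>

lemma hom_proj_diff: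
  assumes R: "graded_mod R (regular_module R) r r" and N: "graded_mod R N r q"
    and F: "is_free_res R M F" and fin: "\<And>i. finite (res_basis F i)"
    and hom: "\<And>i b. b \<in> res_basis F (Suc i) \<Longrightarrow>
      free_proj R r (dg i) (dg (Suc i) b) (res_diff F i (basis_vec R b)) = res_diff F i (basis_vec R b)"
    and g: "lin R (res_module R F i) N g" and z: "z \<in> carrier (res_module R F (Suc i))"
  shows "hom_proj R N q (dg (Suc i)) d (\<lambda>z. g (res_diff F i z)) z =
    hom_proj R N q (dg i) d g (res_diff F i z)"
proof -
  interpret N: graded_mod R N r q by fact
  note Rc = N.R.is_cring
  note d = res_diff_lin[OF F, of i, unfolded res_module_def]
  note g' = g[unfolded res_module_def] and z' = z[unfolded res_module_def]
  note gd = lin_comp[OF d g']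
  show ?thesis
  proof (rule lin_free_eqI[OF Rc N.module_axioms hom_proj_lin[OF N gd]
        lin_comp[OF d hom_proj_lin[OF N g']] _ z'])
    fix b assume b: "b \<in> res_basis F (Suc i)"
    note e = lin_closed[OF d basis_vec_closed[OF Rc b]]
    show "hom_proj R N q (dg (Suc i)) d (\<lambda>z. g (res_diff F i z)) (basis_vec R b) =
        hom_proj R N q (dg i) d g (res_diff F i (basis_vec R b))"
      using hom_proj_homogeneous[OF R N fin g' e, of "dg i" d "dg (Suc i) b"] hom[OF b]
      by (simp add: hom_proj_basis[OF N gd b])
  qed
qed

lemma hom_proj_cocyc:
  assumes R: "graded_mod R (regular_module R) r r" and N: "graded_mod R N r q"
    and F: "is_free_res R M F" and fin: "\<And>i. finite (res_basis F i)"
    and hom: "\<And>i b. b \<in> res_basis F (Suc i) \<Longrightarrow>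
      free_proj R r (dg i) (dg (Suc i) b) (res_diff F i (basis_vec R b)) = res_diff F i (basis_vec R b)"
    and g: "cocyc R F N i g"
  shows "cocyc R F N i (hom_proj R N q (dg i) d g)"
  unfolding cocyc_def
proof (intro conjI ballI)
  interpret N: graded_mod R N r q by fact
  note Nm = N.module_axioms
  note Rc = N.R.is_cring
  note gl = cocyc_lin[OF g]
  have z: "lin R (res_module R F (Suc i)) N (\<lambda>z. \<zero>\<^bsub>N\<^esub>)"
    by (rule lin_zero_map[OF res_module_module[OF Rc] Nm])
  show "lin R (res_module R F i) N (hom_proj R N q (dg i) d g)"
    using hom_proj_lin[OF N] gl by (simp add: res_module_def)
  fix w assume w: "w \<in> carrier (res_module R F (Suc i))"
  have "hom_proj R N q (dg i) d g (res_diff F i w) = hom_proj R N q (dg (Suc i)) d (\<lambda>z. g (res_diff F i z)) w"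
    by (rule hom_proj_diff[OF R N F fin hom gl w, symmetric])
  also have "\<dots> = hom_proj R N q (dg (Suc i)) d (\<lambda>z. \<zero>\<^bsub>N\<^esub>) w"
    by (rule hom_proj_cong[OF N z[unfolded res_module_def]]) (use g w in \<open>auto simp: cocyc_def res_module_def\<close>)
  also have "\<dots> = \<zero>\<^bsub>N\<^esub>"
    by (rule lin_free_eqI[OF Rc Nm hom_proj_lin[OF N z[unfolded res_module_def]] z[unfolded res_module_def]])
      (use w in \<open>auto simp: hom_proj_basis[OF N z[unfolded res_module_def]] N.p_zero res_module_def\<close>)
  finally show "hom_proj R N q (dg i) d g (res_diff F i w) = \<zero>\<^bsub>N\<^esub>" .
qed

lemma hom_proj_cobd:
  assumes R: "graded_mod R (regular_module R) r r" and N: "graded_mod R N r q"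
    and F: "is_free_res R M F" and fin: "\<And>i. finite (res_basis F i)"
    and hom: "\<And>i b. b \<in> res_basis F (Suc i) \<Longrightarrow>
      free_proj R r (dg i) (dg (Suc i) b) (res_diff F i (basis_vec R b)) = res_diff F i (basis_vec R b)"
    and g: "cobd R F N i g"
  shows "cobd R F N i (hom_proj R N q (dg i) d g)"
proof -
  interpret N: graded_mod R N r q by fact
  note Nm = N.module_axioms
  note Rc = N.R.is_cring
  show ?thesis
  proof (cases i)
    case 0
    have z: "lin R (free_module R (res_basis F 0)) N (\<lambda>z. \<zero>\<^bsub>N\<^esub>)"
      by (rule lin_zero_map[OF free_module_module[OF Rc] Nm])
    have "hom_proj R N q (dg 0) d g w = \<zero>\<^bsub>N\<^esub>" if w: "w \<in> carrier (free_module R (res_basis F 0))" for w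
    proof -
      have "hom_proj R N q (dg 0) d g w = hom_proj R N q (dg 0) d (\<lambda>z. \<zero>\<^bsub>N\<^esub>) w"
        by (rule hom_proj_cong[OF N z]) (use g w 0 in \<open>auto simp: res_module_def\<close>)
      also have "\<dots> = \<zero>\<^bsub>N\<^esub>"
        by (rule lin_free_eqI[OF Rc Nm hom_proj_lin[OF N z] z]) (use w in \<open>auto simp: hom_proj_basis[OF N z] N.p_zero\<close>)
      finally show ?thesis .
    qed
    thus ?thesis using 0 by (simp add: res_module_def)
  next
    case (Suc j)
    have "cobd R F N (Suc j) g" using g unfolding Suc .
    then obtain h where h: "lin R (res_module R F j) N h"
      "\<And>z. z \<in> carrier (res_module R F (Suc j)) \<Longrightarrow> g z = h (res_diff F j z)"
      unfolding cobd.simps by blast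
    have "hom_proj R N q (dg (Suc j)) d g z = hom_proj R N q (dg j) d h (res_diff F j z)"
      if z: "z \<in> carrier (res_module R F (Suc j))" for z
    proof -
      have "hom_proj R N q (dg (Suc j)) d g z = hom_proj R N q (dg (Suc j)) d (\<lambda>z. h (res_diff F j z)) z"
      proof (rule hom_proj_cong[OF N])
        show "lin R (free_module R (res_basis F (Suc j))) N (\<lambda>z. h (res_diff F j z))"
          using lin_comp[OF res_diff_lin[OF F] h(1)] by (simp only: res_module_def[of R F "Suc j"])
        show "w \<in> carrier (free_module R (res_basis F (Suc j))) \<Longrightarrow> g w = h (res_diff F j w)" for w
          using h(2) by (simp only: res_module_def[of R F "Suc j"])
        show "z \<in> carrier (free_module R (res_basis F (Suc j)))" using z by (simp only: res_module_def)
      qed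
      also have "\<dots> = hom_proj R N q (dg j) d h (res_diff F j z)"
        by (rule hom_proj_diff[OF R N F fin hom h(1) z])
      finally show ?thesis .
    qed
    moreover have "lin R (res_module R F j) N (hom_proj R N q (dg j) d h)"
      using hom_proj_lin[OF N] h(1) by (simp add: res_module_def)
    ultimately show ?thesis using Suc by auto
  qed
qed

section \<open>Regularity of a sum of homogeneous scalars from its leading term\<close>

lemma cobd_finsum:
  assumes N: "module R N" and "finite I"
    and "\<And>d. d \<in> I \<Longrightarrow> cobd R F N i (f d)" and "\<And>d. d \<in> I \<Longrightarrow> lin R (res_module R F i) N (f d)"
  shows "cobd R F N i (\<lambda>z. \<Oplus>\<^bsub>N\<^esub>d\<in>I. f d z)"
  using assms(2-4)
proof (induct I)
  case empty
  interpret N: module R N by fact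
  show ?case using cobd_zero[OF N] by simp
next
  case (insert d I)
  interpret N: module R N by fact
  show ?case
    by (rule cobd_cong[OF cobd_plus[OF N insert.prems(1)[of d] insert.hyps(3)]])
      (use insert lin_closed[OF insert.prems(2)] in auto)
qed

text \<open>The component of highest degree which is not a coboundary would survive multiplication by the
  leading term.\<close>

lemma leading_term_regular:
  fixes a :: "nat \<Rightarrow> 'a"
  assumes R: "graded_mod R (regular_module R) r r" and N: "graded_mod R N r q"
    and F: "is_free_res R M F" and fin: "\<And>i. finite (res_basis F i)"
    and hom: "\<And>i b. b \<in> res_basis F (Suc i) \<Longrightarrow>
      free_proj R r (dg i) (dg (Suc i) b) (res_diff F i (basis_vec R b)) = res_diff F i (basis_vec R b)"
    and a: "\<And>k. a k \<in> carrier R"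
    and ah: "\<And>k d x. x \<in> carrier N \<Longrightarrow> q (int k + d) (a k \<odot>\<^bsub>N\<^esub> x) = a k \<odot>\<^bsub>N\<^esub> q d x"
    and reg: "cobd_regular R F N i (a n)"
  shows "cobd_regular R F N i (\<Oplus>\<^bsub>R\<^esub>k\<in>{..n}. a k)"
  unfolding cobd_regular_def
proof (intro allI impI)
  interpret R: graded_mod R "regular_module R" r r by fact
  interpret N: graded_mod R N r q by fact
  note Nm = N.module_axioms
  note Rc = R.R.is_cring
  note Fm = res_module_module[OF Rc, of F]
  let ?P = "\<lambda>d. hom_proj R N q (dg i) d"
  let ?s = "\<Oplus>\<^bsub>R\<^esub>k\<in>{..n}. a k"
  fix f assume f: "cocyc R F N i f" and fb: "cobd R F N i (\<lambda>z. ?s \<odot>\<^bsub>N\<^esub> f z)"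
  note fl = cocyc_lin[OF f]
  note fl' = fl[unfolded res_module_def]
  have sc: "?s \<in> carrier R" using a by (intro R.R.finsum_closed) auto
  have Pl: "lin R (res_module R F i) N (?P d f)" for d
    using hom_proj_lin[OF N fl'] by (simp add: res_module_def)
  note Pc = lin_closed[OF Pl]
  have bc: "f (basis_vec R b) \<in> carrier N" if "b \<in> res_basis F i" for b
    by (rule lin_closed[OF fl' basis_vec_closed[OF Rc that]])
  \<comment> \<open>The finitely many degrees in which \<open>f\<close> can have a nonzero
    component: a component of degree e in the image of \<open>b\<close> contributes to degree
    \<open>e - dg i b\<close>.\<close>
  define D where "D = (\<Union>b\<in>res_basis F i. (\<lambda>d. d - dg i b) ` {d. q d (f (basis_vec R b)) \<noteq> \<zero>\<^bsub>N\<^esub>})"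
  have D: "finite D" unfolding D_def using fin bc N.p_finite by auto
  have Dz: "?P d f z = \<zero>\<^bsub>N\<^esub>" if d: "d \<notin> D" and z: "z \<in> carrier (res_module R F i)" for d z
  proof (rule lin_free_eqI[OF Rc Nm hom_proj_lin[OF N fl'] lin_zero_map[OF free_module_module[OF Rc] Nm]])
    show "z \<in> carrier (free_module R (res_basis F i))" using z by (simp add: res_module_def)
    fix b assume b: "b \<in> res_basis F i"
    have "q (d + dg i b) (f (basis_vec R b)) = \<zero>\<^bsub>N\<^esub>"
    proof (rule ccontr)
      assume "q (d + dg i b) (f (basis_vec R b)) \<noteq> \<zero>\<^bsub>N\<^esub>"
      moreover have "d = (d + dg i b) - dg i b" by simp
      ultimately have "d \<in> D" using b unfolding D_def by blast
      thus False using d by simp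
    qed
    thus "?P d f (basis_vec R b) = \<zero>\<^bsub>N\<^esub>" by (simp add: hom_proj_basis[OF N fl' b])
  qed
  have Dsum: "(\<Oplus>\<^bsub>N\<^esub>d\<in>D. ?P d f z) = f z" if z: "z \<in> carrier (res_module R F i)" for z
  proof -
    have sl: "lin R (free_module R (res_basis F i)) N (\<lambda>z. \<Oplus>\<^bsub>N\<^esub>d\<in>D. ?P d f z)"
      using D
    proof (induct D)
      case empty
      show ?case using lin_zero_map[OF free_module_module[OF Rc] Nm] by simp
    next
      case (insert d D)
      note l = lin_plus[OF free_module_module[OF Rc] Nm hom_proj_lin[OF N fl', of "dg i" d] insert.hyps(3)]
      show ?case
        by (rule lin_cong[OF l free_module_module[OF Rc]])
          (use insert.hyps Pc in \<open>simp add: res_module_def\<close>)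
    qed
    show ?thesis
    proof (rule lin_free_eqI[OF Rc Nm sl fl'])
      show "z \<in> carrier (free_module R (res_basis F i))" using z by (simp add: res_module_def)
      fix b assume b: "b \<in> res_basis F i"
      have "(\<Oplus>\<^bsub>N\<^esub>d\<in>D. ?P d f (basis_vec R b)) = (\<Oplus>\<^bsub>N\<^esub>d\<in>D. q (d + dg i b) (f (basis_vec R b)))"
        by (simp add: hom_proj_basis[OF N fl' b])
      also have "\<dots> = (\<Oplus>\<^bsub>N\<^esub>d\<in>(\<lambda>d. d + dg i b) ` D. q d (f (basis_vec R b)))"
        by (intro N.M.finsum_reindex[symmetric]) (auto simp: inj_on_def N.p_closed bc[OF b])
      also have "\<dots> = f (basis_vec R b)"
      proof (rule N.p_sum_superset[OF bc[OF b]])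
        show "{d. q d (f (basis_vec R b)) \<noteq> \<zero>\<^bsub>N\<^esub>} \<subseteq> (\<lambda>d. d + dg i b) ` D"
        proof
          fix d assume "d \<in> {d. q d (f (basis_vec R b)) \<noteq> \<zero>\<^bsub>N\<^esub>}"
          hence "d - dg i b \<in> D" using b unfolding D_def by blast
          thus "d \<in> (\<lambda>d. d + dg i b) ` D" by (rule rev_image_eqI) simp
        qed
      qed (use D in simp)
      finally show "(\<Oplus>\<^bsub>N\<^esub>d\<in>D. ?P d f (basis_vec R b)) = f (basis_vec R b)" .
    qed
  qed
  \<comment> \<open>The scalar \<open>a k\<close> raises degrees by \<open>k\<close>, so the degree
    \<open>d\<close> component of the product is a convolution sum.\<close>
  have Ps: "?P d (\<lambda>z. ?s \<odot>\<^bsub>N\<^esub> f z) z = (\<Oplus>\<^bsub>N\<^esub>k\<in>{..n}. a k \<odot>\<^bsub>N\<^esub> ?P (d - int k) f z)"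
    if z: "z \<in> carrier (res_module R F i)" for d z
  proof -
    note sf = lin_scale[OF free_module_module[OF Rc] Nm fl' sc]
    have sl: "lin R (free_module R (res_basis F i)) N (\<lambda>z. \<Oplus>\<^bsub>N\<^esub>k\<in>I. a k \<odot>\<^bsub>N\<^esub> ?P (d - int k) f z)"
      if "finite I" for I using that
    proof (induct I)
      case empty
      show ?case using lin_zero_map[OF free_module_module[OF Rc] Nm] by simp
    next
      case (insert k I)
      note l = lin_plus[OF free_module_module[OF Rc] Nm lin_scale[OF free_module_module[OF Rc] Nm
            hom_proj_lin[OF N fl', of "dg i" "d - int k"] a] insert.hyps(3)]
      show ?case
        by (rule lin_cong[OF l free_module_module[OF Rc]])
          (use insert.hyps Pc a in \<open>simp add: res_module_def\<close>)
    qed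
    have sdist: "?s \<odot>\<^bsub>N\<^esub> x = (\<Oplus>\<^bsub>N\<^esub>k\<in>{..n}. a k \<odot>\<^bsub>N\<^esub> x)" if x: "x \<in> carrier N" for x
    proof -
      have "lin R (regular_module R) N (\<lambda>a. a \<odot>\<^bsub>N\<^esub> x)"
        using x by (auto intro!: linI simp: N.smult_l_distr N.smult_assoc1)
      moreover have "?s = (\<Oplus>\<^bsub>regular_module R\<^esub>k\<in>{..n}. a k)" by (simp add: finsum_def finprod_def)
      ultimately show ?thesis using lin_finsum[OF R.module_axioms Nm, of "\<lambda>a. a \<odot>\<^bsub>N\<^esub> x" "{..n}" a] a by auto
    qed
    have qsum: "q e (\<Oplus>\<^bsub>N\<^esub>k\<in>I. g k) = (\<Oplus>\<^bsub>N\<^esub>k\<in>I. q e (g k))" if "finite I" "g \<in> I \<rightarrow> carrier N" for e g and I :: "nat set"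
      using that by (induct I) (auto simp: N.p_zero N.p_add N.p_closed Pi_def)
    show ?thesis
    proof (rule lin_free_eqI[OF Rc Nm hom_proj_lin[OF N sf] sl])
      show "z \<in> carrier (free_module R (res_basis F i))" using z by (simp add: res_module_def)
      fix b assume b: "b \<in> res_basis F i"
      have "q (d + dg i b) (a k \<odot>\<^bsub>N\<^esub> f (basis_vec R b)) = a k \<odot>\<^bsub>N\<^esub> q (d - int k + dg i b) (f (basis_vec R b))" for k
        using ah[OF bc[OF b], of k "d - int k + dg i b"] by (simp add: algebra_simps)
      thus "?P d (\<lambda>z. ?s \<odot>\<^bsub>N\<^esub> f z) (basis_vec R b) =
          (\<Oplus>\<^bsub>N\<^esub>k\<in>{..n}. a k \<odot>\<^bsub>N\<^esub> ?P (d - int k) f (basis_vec R b))"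
        using bc[OF b] a
        by (simp add: hom_proj_basis[OF N sf b] hom_proj_basis[OF N fl' b] sdist qsum)
    qed simp
  qed
  have "cobd R F N i (?P d f)" for d
  proof (rule ccontr)
    assume nc: "\<not> cobd R F N i (?P d f)"
    define E where "E = {d \<in> D. \<not> cobd R F N i (?P d f)}"
    have out: "cobd R F N i (?P e f)" if "e \<notin> E" for e
    proof (cases "e \<in> D")
      case True
      thus ?thesis using that by (simp add: E_def)
    next
      case False
      show ?thesis by (rule cobd_cong[OF cobd_zero[OF Nm]]) (rule Dz[OF False])
    qed
    have "finite E" using D by (simp add: E_def)
    moreover have "E \<noteq> {}" using nc out by blast
    ultimately have E: "finite E" "E \<noteq> {}" by blast+
    let ?m = "Max E"
    have "?m \<in> E" using E by simp
    \<comment> \<open>In the component of degree \<open>?m + n\<close> of the product, the terms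
      with \<open>k < n\<close> involve components of \<open>f\<close> of degree above the maximum
      \<open>?m\<close>, hence coboundaries. Only the leading term times the component of degree
      \<open>?m\<close> remains, and regularity of \<open>a n\<close> contradicts the choice of
      \<open>?m\<close>.\<close>
    have low: "cobd R F N i (?P (?m + int n - int k) f)" if "k < n" for k
    proof (rule out)
      show "?m + int n - int k \<notin> E" using Max_ge[OF E(1), of "?m + int n - int k"] that by auto
    qed
    have "cobd R F N i (?P (?m + int n) (\<lambda>z. ?s \<odot>\<^bsub>N\<^esub> f z))"
      by (rule hom_proj_cobd[OF R N F fin hom fb])
    hence 1: "cobd R F N i (\<lambda>z. \<Oplus>\<^bsub>N\<^esub>k\<in>{..n}. a k \<odot>\<^bsub>N\<^esub> ?P (?m + int n - int k) f z)"
      by (rule cobd_cong) (simp add: Ps)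
    have 2: "cobd R F N i (\<lambda>z. \<Oplus>\<^bsub>N\<^esub>k\<in>{..<n}. a k \<odot>\<^bsub>N\<^esub> ?P (?m + int n - int k) f z)"
      by (rule cobd_finsum[OF Nm]) (auto intro!: cobd_scale Nm low a lin_scale Fm Pl)
    have tc: "a k \<odot>\<^bsub>N\<^esub> ?P e f z \<in> carrier N" if "z \<in> carrier (res_module R F i)" for k e z
      using a Pc[OF that] by simp
    have "cobd R F N i (\<lambda>z. a n \<odot>\<^bsub>N\<^esub> ?P ?m f z)"
    proof (rule cobd_cong[OF cobd_minus[OF Nm 1 2]])
      fix z assume z: "z \<in> carrier (res_module R F i)"
      show c: "(\<Oplus>\<^bsub>N\<^esub>k\<in>{..<n}. a k \<odot>\<^bsub>N\<^esub> ?P (?m + int n - int k) f z) \<in> carrier N"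
        using tc[OF z] by (intro N.M.finsum_closed) auto
      have "(\<Oplus>\<^bsub>N\<^esub>k\<in>{..n}. a k \<odot>\<^bsub>N\<^esub> ?P (?m + int n - int k) f z) =
          a n \<odot>\<^bsub>N\<^esub> ?P ?m f z \<oplus>\<^bsub>N\<^esub> (\<Oplus>\<^bsub>N\<^esub>k\<in>{..<n}. a k \<odot>\<^bsub>N\<^esub> ?P (?m + int n - int k) f z)"
        using tc[OF z] by (simp add: lessThan_Suc_atMost[symmetric] lessThan_Suc)
      thus "a n \<odot>\<^bsub>N\<^esub> ?P ?m f z = (\<Oplus>\<^bsub>N\<^esub>k\<in>{..n}. a k \<odot>\<^bsub>N\<^esub> ?P (?m + int n - int k) f z) \<ominus>\<^bsub>N\<^esub>
          (\<Oplus>\<^bsub>N\<^esub>k\<in>{..<n}. a k \<odot>\<^bsub>N\<^esub> ?P (?m + int n - int k) f z)"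
        using c tc[OF z] by (simp add: a_minus_def N.a_assoc N.r_neg)
    qed
    hence "cobd R F N i (?P ?m f)"
      using reg hom_proj_cocyc[OF R N F fin hom f] by (simp add: cobd_regular_def)
    thus False using \<open>?m \<in> E\<close> by (simp add: E_def)
  qed
  hence "cobd R F N i (\<lambda>z. \<Oplus>\<^bsub>N\<^esub>d\<in>D. ?P d f z)" by (intro cobd_finsum[OF Nm D] Pl)
  thus "cobd R F N i f" by (rule cobd_cong) (simp add: Dsum)
qed


section \<open>Tensor products\<close>

text \<open>The universal property of the quotient, with the induced map defined through chosen
  representatives.\<close>

lemma quot_lift:
  assumes M: "module R M" and W: "module R W" and H: "submodule H R M" and e: "lin R M W e"
    and ker: "\<And>h. h \<in> H \<Longrightarrow> e h = \<zero>\<^bsub>W\<^esub>"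
  shows "\<exists>g\<in>mod_hom R (quot_module M H) W. \<forall>z\<in>carrier M. g (H +>\<^bsub>M\<^esub> z) = e z"
proof -
  interpret W: module R W by (rule W)
  let ?Q = "quot_module M H"
  note Q = quot_module_module[OF M H]
  have "\<forall>C\<in>carrier ?Q. \<exists>x. x \<in> carrier M \<and> C = H +>\<^bsub>M\<^esub> x" by (auto simp: quot_carrier)
  then obtain s where s: "\<And>C. C \<in> carrier ?Q \<Longrightarrow> s C \<in> carrier M \<and> C = H +>\<^bsub>M\<^esub> s C" by metis
  have es: "e (s (H +>\<^bsub>M\<^esub> z)) = e z" if z: "z \<in> carrier M" for z
  proof -
    have c: "s (H +>\<^bsub>M\<^esub> z) \<in> carrier M" "H +>\<^bsub>M\<^esub> z = H +>\<^bsub>M\<^esub> s (H +>\<^bsub>M\<^esub> z)" using s[OF quot_carrierI[OF z]] by auto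
    hence "s (H +>\<^bsub>M\<^esub> z) \<ominus>\<^bsub>M\<^esub> z \<in> H" using coset_eq_iff[OF M H c(1) z] by simp
    from ker[OF this] show ?thesis
      using lin_minus[OF M W e c(1) z] lin_closed[OF e c(1)] lin_closed[OF e z] by (simp add: minus_eq_zero_iff[OF W])
  qed
  have "lin R ?Q W (\<lambda>C. e (s C))"
  proof (rule linI)
    interpret M: module R M by (rule M)
    fix C assume "C \<in> carrier ?Q"
    then obtain x where x: "x \<in> carrier M" "C = H +>\<^bsub>M\<^esub> x" by (auto simp: quot_carrier)
    show "e (s C) \<in> carrier W" using x by (simp add: es lin_closed[OF e])
    show "e (s (a \<odot>\<^bsub>?Q\<^esub> C)) = a \<odot>\<^bsub>W\<^esub> e (s C)" if "a \<in> carrier R" for a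
      using x that by (simp add: quot_smult[OF M H] es lin_smult[OF e])
    fix D assume "D \<in> carrier ?Q"
    then obtain y where y: "y \<in> carrier M" "D = H +>\<^bsub>M\<^esub> y" by (auto simp: quot_carrier)
    show "e (s (C \<oplus>\<^bsub>?Q\<^esub> D)) = e (s C) \<oplus>\<^bsub>W\<^esub> e (s D)"
      using x y by (simp add: quot_add[OF M H] es lin_add[OF e])
  qed
  note g = restrict_mod_hom[OF this Q]
  show ?thesis by (rule bexI[OF _ g]) (simp add: es quot_carrierI)
qed

lemma tensor_relations_sub:
  assumes M: "module R M" and U: "module R U"
  shows "tensor_relations R M U \<subseteq> carrier (free_module R (carrier M \<times> carrier U))"
proof -
  interpret M: module R M by (rule M)
  interpret U: module R U by (rule U)
  note Rc = M.R.is_cring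
  interpret F: module R "free_module R (carrier M \<times> carrier U)" by (rule free_module_module[OF Rc])
  note c = basis_vec_closed[OF Rc, of _ "carrier M \<times> carrier U"]
  show ?thesis unfolding tensor_relations_def Let_def
    by (intro Un_least subsetI; elim CollectE exE conjE; hypsubst;
        intro F.minus_closed F.a_closed F.smult_closed c) auto
qed

lemma tensor_kernel_submodule:
  assumes "module R M" and "module R U"
  shows "submodule (tensor_kernel R M U) R (free_module R (carrier M \<times> carrier U))"
  unfolding tensor_kernel_def
  by (rule submod_span_submodule[OF free_module_module[OF module_cring[OF assms(1)]] tensor_relations_sub[OF assms]])

lemma tensor_product_module:
  assumes "module R M" and "module R U"
  shows "module R (tensor_product R M U)"
  unfolding tensor_product_def
  by (rule quot_module_module[OF free_module_module[OF module_cring[OF assms(1)]] tensor_kernel_submodule[OF assms]])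

text \<open>The tensor product receives bilinear maps: if the values on pairs are bilinear, every
  defining relation is annihilated, and so is the submodule they span.\<close>

lemma tensor_kernel_subI:
  assumes M: "module R M" and U: "module R U" and W: "module R W" and e: "lin R (free_module R (carrier M \<times> carrier U)) W e"
    and 1: "\<And>x x' y. \<lbrakk>x \<in> carrier M; x' \<in> carrier M; y \<in> carrier U\<rbrakk> \<Longrightarrow>
      e (basis_vec R (x \<oplus>\<^bsub>M\<^esub> x', y)) = e (basis_vec R (x, y)) \<oplus>\<^bsub>W\<^esub> e (basis_vec R (x', y))"
    and 2: "\<And>x y y'. \<lbrakk>x \<in> carrier M; y \<in> carrier U; y' \<in> carrier U\<rbrakk> \<Longrightarrow>
      e (basis_vec R (x, y \<oplus>\<^bsub>U\<^esub> y')) = e (basis_vec R (x, y)) \<oplus>\<^bsub>W\<^esub> e (basis_vec R (x, y'))"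
    and 3: "\<And>a x y. \<lbrakk>a \<in> carrier R; x \<in> carrier M; y \<in> carrier U\<rbrakk> \<Longrightarrow>
      e (basis_vec R (a \<odot>\<^bsub>M\<^esub> x, y)) = a \<odot>\<^bsub>W\<^esub> e (basis_vec R (x, y))"
    and 4: "\<And>a x y. \<lbrakk>a \<in> carrier R; x \<in> carrier M; y \<in> carrier U\<rbrakk> \<Longrightarrow>
      e (basis_vec R (x, a \<odot>\<^bsub>U\<^esub> y)) = a \<odot>\<^bsub>W\<^esub> e (basis_vec R (x, y))"
    and z: "z \<in> tensor_kernel R M U"
  shows "e z = \<zero>\<^bsub>W\<^esub>"
proof -
  let ?F = "free_module R (carrier M \<times> carrier U)"
  interpret M: module R M by (rule M)
  interpret U: module R U by (rule U)
  note Rc = M.R.is_cring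
  note F = free_module_module[OF Rc, of "carrier M \<times> carrier U"]
  interpret F: module R ?F by (rule F)
  interpret W: module R W by (rule W)
  have c: "basis_vec R (x, y) \<in> carrier ?F" if "x \<in> carrier M" "y \<in> carrier U" for x y
    using that by (intro basis_vec_closed Rc) auto
  note ec = lin_closed[OF e c]
  have m: "e (v \<ominus>\<^bsub>?F\<^esub> w) = \<zero>\<^bsub>W\<^esub>" if "v \<in> carrier ?F" "w \<in> carrier ?F" "e v = e w" for v w
    using that lin_minus[OF F W e] lin_closed[OF e] by (simp add: minus_eq_zero_iff[OF W])
  have "tensor_relations R M U \<subseteq> {z \<in> carrier ?F. e z = \<zero>\<^bsub>W\<^esub>}"
  proof
    fix z assume zr: "z \<in> tensor_relations R M U"
    hence "z \<in> carrier ?F" using tensor_relations_sub[OF M U] by blast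
    moreover have "e z = \<zero>\<^bsub>W\<^esub>" using zr unfolding tensor_relations_def Let_def
      by (elim UnE CollectE exE conjE; hypsubst;
          intro m F.a_closed F.smult_closed c)
        (simp_all add: c lin_add[OF e] lin_smult[OF e] 1 2 3 4 del: free_ops)
    ultimately show "z \<in> {z \<in> carrier ?F. e z = \<zero>\<^bsub>W\<^esub>}" by simp
  qed
  hence "tensor_kernel R M U \<subseteq> {z \<in> carrier ?F. e z = \<zero>\<^bsub>W\<^esub>}"
    unfolding tensor_kernel_def by (rule submod_span_least[OF submodule_ker[OF F W e]])
  thus ?thesis using z by blast
qed

lemma tensor_carrier:
  "C \<in> carrier (tensor_product R M U) \<longleftrightarrow>
    (\<exists>z\<in>carrier (free_module R (carrier M \<times> carrier U)).
      C = tensor_kernel R M U +>\<^bsub>free_module R (carrier M \<times> carrier U)\<^esub> z)"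
  by (simp add: tensor_product_def quot_carrier)

section \<open>Rules of computation for pure tensors\<close>

context
  fixes R :: "('a, 'x) ring_scheme" and M :: "('a, 'm) module" and U :: "('a, 'n) module"
  assumes M: "module R M" and U: "module R U"
begin

interpretation M: module R M by (rule M)
interpretation U: module R U by (rule U)
interpretation F: module R "free_module R (carrier M \<times> carrier U)"
  by (rule free_module_module[OF M.R.is_cring])
interpretation T: module R "tensor_product R M U" by (rule tensor_product_module[OF M U])

lemma tensor_proj_lin: "lin R (free_module R (carrier M \<times> carrier U)) (tensor_product R M U) (\<lambda>z. tensor_kernel R M U +>\<^bsub>free_module R (carrier M \<times> carrier U)\<^esub> z)"
  unfolding tensor_product_def by (rule quot_proj_lin[OF F.module_axioms tensor_kernel_submodule[OF M U]])

lemma tensor_proj_eq_zero: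
  "z \<in> carrier (free_module R (carrier M \<times> carrier U)) \<Longrightarrow> tensor_kernel R M U +>\<^bsub>free_module R (carrier M \<times> carrier U)\<^esub> z = \<zero>\<^bsub>tensor_product R M U\<^esub> \<longleftrightarrow> z \<in> tensor_kernel R M U"
  unfolding tensor_product_def quot_zero
  by (rule coset_eq_zero_iff[OF F.module_axioms tensor_kernel_submodule[OF M U]])

lemma pair_basis_closed: "x \<in> carrier M \<Longrightarrow> y \<in> carrier U \<Longrightarrow> basis_vec R (x, y) \<in> carrier (free_module R (carrier M \<times> carrier U))"
  by (intro basis_vec_closed M.R.is_cring) auto

lemma pure_tensor_closed: "x \<in> carrier M \<Longrightarrow> y \<in> carrier U \<Longrightarrow> pure_tensor R M U x y \<in> carrier (tensor_product R M U)"
  unfolding pure_tensor_def by (rule lin_closed[OF tensor_proj_lin pair_basis_closed])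

lemma tensor_relation_coset:
  assumes v: "v \<in> carrier (free_module R (carrier M \<times> carrier U))" and w: "w \<in> carrier (free_module R (carrier M \<times> carrier U))" and r: "v \<ominus>\<^bsub>free_module R (carrier M \<times> carrier U)\<^esub> w \<in> tensor_relations R M U"
  shows "tensor_kernel R M U +>\<^bsub>free_module R (carrier M \<times> carrier U)\<^esub> v = tensor_kernel R M U +>\<^bsub>free_module R (carrier M \<times> carrier U)\<^esub> w"
proof -
  have "v \<ominus>\<^bsub>free_module R (carrier M \<times> carrier U)\<^esub> w \<in> tensor_kernel R M U" unfolding tensor_kernel_def by (rule subsetD[OF submod_span_incl r])
  thus ?thesis using coset_eq_iff[OF F.module_axioms tensor_kernel_submodule[OF M U] v w] by simp
qed

lemma pure_tensor_add_left:
  assumes "x \<in> carrier M" and "x' \<in> carrier M" and "y \<in> carrier U"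
  shows "pure_tensor R M U (x \<oplus>\<^bsub>M\<^esub> x') y = pure_tensor R M U x y \<oplus>\<^bsub>tensor_product R M U\<^esub> pure_tensor R M U x' y"
proof -
  have "basis_vec R (x \<oplus>\<^bsub>M\<^esub> x', y) \<ominus>\<^bsub>free_module R (carrier M \<times> carrier U)\<^esub> (basis_vec R (x, y) \<oplus>\<^bsub>free_module R (carrier M \<times> carrier U)\<^esub> basis_vec R (x', y)) \<in> tensor_relations R M U"
    unfolding tensor_relations_def Let_def using assms by blast
  from tensor_relation_coset[OF _ _ this] show ?thesis
    unfolding pure_tensor_def using assms
    by (subst lin_add[OF tensor_proj_lin, symmetric]) (auto intro: pair_basis_closed simp del: free_ops)
qed

lemma pure_tensor_add_right:
  assumes "x \<in> carrier M" and "y \<in> carrier U" and "y' \<in> carrier U"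
  shows "pure_tensor R M U x (y \<oplus>\<^bsub>U\<^esub> y') = pure_tensor R M U x y \<oplus>\<^bsub>tensor_product R M U\<^esub> pure_tensor R M U x y'"
proof -
  have "basis_vec R (x, y \<oplus>\<^bsub>U\<^esub> y') \<ominus>\<^bsub>free_module R (carrier M \<times> carrier U)\<^esub> (basis_vec R (x, y) \<oplus>\<^bsub>free_module R (carrier M \<times> carrier U)\<^esub> basis_vec R (x, y')) \<in> tensor_relations R M U"
    unfolding tensor_relations_def Let_def using assms by blast
  from tensor_relation_coset[OF _ _ this] show ?thesis
    unfolding pure_tensor_def using assms
    by (subst lin_add[OF tensor_proj_lin, symmetric]) (auto intro: pair_basis_closed simp del: free_ops)
qed

lemma pure_tensor_smult_left:
  assumes "a \<in> carrier R" and "x \<in> carrier M" and "y \<in> carrier U"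
  shows "pure_tensor R M U (a \<odot>\<^bsub>M\<^esub> x) y = a \<odot>\<^bsub>tensor_product R M U\<^esub> pure_tensor R M U x y"
proof -
  have "basis_vec R (a \<odot>\<^bsub>M\<^esub> x, y) \<ominus>\<^bsub>free_module R (carrier M \<times> carrier U)\<^esub> (a \<odot>\<^bsub>free_module R (carrier M \<times> carrier U)\<^esub> basis_vec R (x, y)) \<in> tensor_relations R M U"
    unfolding tensor_relations_def Let_def using assms by blast
  from tensor_relation_coset[OF _ _ this] show ?thesis
    unfolding pure_tensor_def using assms
    by (subst lin_smult[OF tensor_proj_lin, symmetric]) (auto intro: pair_basis_closed simp del: free_ops)
qed

lemma pure_tensor_smult_right:
  assumes "a \<in> carrier R" and "x \<in> carrier M" and "y \<in> carrier U"
  shows "pure_tensor R M U x (a \<odot>\<^bsub>U\<^esub> y) = a \<odot>\<^bsub>tensor_product R M U\<^esub> pure_tensor R M U x y"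
proof -
  have "basis_vec R (x, a \<odot>\<^bsub>U\<^esub> y) \<ominus>\<^bsub>free_module R (carrier M \<times> carrier U)\<^esub> (a \<odot>\<^bsub>free_module R (carrier M \<times> carrier U)\<^esub> basis_vec R (x, y)) \<in> tensor_relations R M U"
    unfolding tensor_relations_def Let_def using assms by blast
  from tensor_relation_coset[OF _ _ this] show ?thesis
    unfolding pure_tensor_def using assms
    by (subst lin_smult[OF tensor_proj_lin, symmetric]) (auto intro: pair_basis_closed simp del: free_ops)
qed

end

text \<open>The definite description in \<open>tensor_map\<close> denotes a map: replacing each pair
  (x, u) by (x, f u) respects the relations, and a homomorphism is determined by its values on pure
  tensors. The second claim gives this map on arbitrary representatives.\<close>

lemma tensor_map_spec:
  assumes M: "module R M" and U: "module R U" and V: "module R V" and f: "f \<in> mod_hom R U V"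
  shows "tensor_map R M U V f \<in> mod_hom R (tensor_product R M U) (tensor_product R M V)"
    and "z \<in> carrier (free_module R (carrier M \<times> carrier U)) \<Longrightarrow>
      tensor_map R M U V f (tensor_kernel R M U +>\<^bsub>free_module R (carrier M \<times> carrier U)\<^esub> z) =
      tensor_kernel R M V +>\<^bsub>free_module R (carrier M \<times> carrier V)\<^esub>
        lin_ext R (free_module R (carrier M \<times> carrier V)) (\<lambda>(x, u). basis_vec R (x, f u)) z"
proof -
  let ?F = "free_module R (carrier M \<times> carrier U)" and ?G = "free_module R (carrier M \<times> carrier V)"
  let ?TU = "tensor_product R M U" and ?TV = "tensor_product R M V"
  interpret M: module R M by (rule M)
  interpret U: module R U by (rule U)
  interpret V: module R V by (rule V)
  note Rc = M.R.is_cring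
  note F = free_module_module[OF Rc, of "carrier M \<times> carrier U"]
  note G = free_module_module[OF Rc, of "carrier M \<times> carrier V"]
  note TU = tensor_product_module[OF M U] and TV = tensor_product_module[OF M V]
  note fl = mod_hom_lin[OF f]
  note fc = lin_closed[OF fl]
  let ?v = "\<lambda>(x, u). basis_vec R (x, f u)"
  have v: "b \<in> carrier M \<times> carrier U \<Longrightarrow> ?v b \<in> carrier ?G" for b
    using fc by (auto intro!: pair_basis_closed[OF M V])
  let ?f = "lin_ext R ?G ?v"
  have fs: "lin R ?F ?G ?f" using v by (rule lin_ext_lin[OF G])
  have fb: "?f (basis_vec R (x, u)) = basis_vec R (x, f u)" if "x \<in> carrier M" "u \<in> carrier U" for x u
    using lin_ext_basis[OF G, of "carrier M \<times> carrier U" ?v "(x, u)"] v that by simp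
  let ?e = "\<lambda>z. tensor_kernel R M V +>\<^bsub>?G\<^esub> ?f z"
  have e: "lin R ?F ?TV ?e" by (rule lin_comp[OF fs tensor_proj_lin[OF M V]])
  have eb: "?e (basis_vec R (x, u)) = pure_tensor R M V x (f u)" if "x \<in> carrier M" "u \<in> carrier U" for x u
    using fb[OF that] by (simp add: pure_tensor_def)
  have ker: "?e h = \<zero>\<^bsub>?TV\<^esub>" if "h \<in> tensor_kernel R M U" for h
    by (rule tensor_kernel_subI[OF M U TV e _ _ _ _ that])
      (simp_all add: eb fc lin_add[OF fl] lin_smult[OF fl] pure_tensor_add_left[OF M V]
        pure_tensor_add_right[OF M V] pure_tensor_smult_left[OF M V] pure_tensor_smult_right[OF M V])
  obtain g where g: "g \<in> mod_hom R ?TU ?TV"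
    "\<And>z. z \<in> carrier ?F \<Longrightarrow> g (tensor_kernel R M U +>\<^bsub>?F\<^esub> z) = ?e z"
    using quot_lift[OF F TV tensor_kernel_submodule[OF M U] e ker] unfolding tensor_product_def by blast
  have "tensor_map R M U V f = g" unfolding tensor_map_def
  proof (rule the_equality)
    show "g \<in> mod_hom R ?TU ?TV \<and>
      (\<forall>x\<in>carrier M. \<forall>y\<in>carrier U. g (pure_tensor R M U x y) = pure_tensor R M V x (f y))"
      using g eb pair_basis_closed[OF M U] by (simp add: pure_tensor_def)
  next
    fix g' assume g': "g' \<in> mod_hom R ?TU ?TV \<and>
      (\<forall>x\<in>carrier M. \<forall>y\<in>carrier U. g' (pure_tensor R M U x y) = pure_tensor R M V x (f y))"
    show "g' = g"
    proof (rule mod_hom_eqI)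
      fix C assume "C \<in> carrier ?TU"
      then obtain z where z: "z \<in> carrier ?F" "C = tensor_kernel R M U +>\<^bsub>?F\<^esub> z" by (auto simp: tensor_carrier)
      have "g' (tensor_kernel R M U +>\<^bsub>?F\<^esub> z) = ?e z"
      proof (rule lin_free_eqI[OF Rc TV _ e _ z(1)])
        show "lin R ?F ?TV (\<lambda>z. g' (tensor_kernel R M U +>\<^bsub>?F\<^esub> z))"
          using g' by (intro lin_comp[OF tensor_proj_lin[OF M U]] mod_hom_lin) blast
        show "g' (tensor_kernel R M U +>\<^bsub>?F\<^esub> basis_vec R b) = ?e (basis_vec R b)"
          if "b \<in> carrier M \<times> carrier U" for b
          using that g' eb by (cases b) (auto simp: pure_tensor_def)
      qed
      thus "g' C = g C" using g(2) z by simp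
    qed (use g g' in auto)
  qed
  thus "tensor_map R M U V f \<in> mod_hom R ?TU ?TV"
    and "z \<in> carrier ?F \<Longrightarrow> tensor_map R M U V f (tensor_kernel R M U +>\<^bsub>?F\<^esub> z) = ?e z"
    using g by auto
qed


section \<open>Flatness over Euclidean domains\<close>

definition torsion_free :: "('a, 'x) ring_scheme \<Rightarrow> ('a, 'm) module \<Rightarrow> bool"
  where "torsion_free R M \<longleftrightarrow>
    (\<forall>p\<in>carrier R. \<forall>x\<in>carrier M. p \<odot>\<^bsub>M\<^esub> x = \<zero>\<^bsub>M\<^esub> \<longrightarrow> p = \<zero>\<^bsub>R\<^esub> \<or> x = \<zero>\<^bsub>M\<^esub>)"

text \<open>Tensor the injection given by multiplication with \<open>p\<close> on the ring. It sends
  x tensor 1 to x tensor p, which equals p x tensor 1 and so vanishes; flatness gives x tensor 1 =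
  0.\<close>

lemma flat_imp_torsion_free:
  fixes M :: "('a, 'm) module"
  assumes R: "domain R" and fl: "flat_module R M"
  shows "torsion_free R M"
  unfolding torsion_free_def
proof (intro ballI impI)
  have "x = \<zero>\<^bsub>M\<^esub>" if p: "p \<in> carrier R" "p \<noteq> \<zero>\<^bsub>R\<^esub>" and x: "x \<in> carrier M" and px: "p \<odot>\<^bsub>M\<^esub> x = \<zero>\<^bsub>M\<^esub>" for p x
  proof -
    interpret R: domain R by (rule R)
    have M: "module R M" using fl by (simp add: flat_module_def)
    interpret M: module R M by (rule M)
    let ?U = "regular_module R"
    note U = regular_module_module[OF R.is_cring]
    interpret T: module R "tensor_product R M ?U" by (rule tensor_product_module[OF M U])
    let ?f = "restrict (\<lambda>u. p \<otimes>\<^bsub>R\<^esub> u) (carrier ?U)"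
    have f: "?f \<in> mod_hom R ?U ?U" using restrict_mod_hom[OF lin_mult[OF U p(1)] U] by simp
    have "inj_on ?f (carrier ?U)" using p R.m_lcancel by (auto simp: inj_on_def)
    hence inj: "inj_on (tensor_map R M ?U ?U ?f) (carrier (tensor_product R M ?U))"
      using fl U f by (auto simp: flat_module_def)
    note ts = tensor_map_spec[OF M U U f]
    note F = free_module_module[OF R.is_cring, of "carrier M \<times> carrier ?U"]
    have one: "\<one>\<^bsub>R\<^esub> \<in> carrier ?U" by simp
    note b = pair_basis_closed[OF M U x one]
    have v: "c \<in> carrier M \<times> carrier ?U \<Longrightarrow>
        (\<lambda>(x, u). basis_vec R (x, ?f u)) c \<in> carrier (free_module R (carrier M \<times> carrier ?U))" for c
      using p by (auto intro!: pair_basis_closed[OF M U, simplified])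
    have "tensor_map R M ?U ?U ?f (pure_tensor R M ?U x \<one>\<^bsub>R\<^esub>) = pure_tensor R M ?U x p"
      unfolding pure_tensor_def
      by (subst ts(2)[OF b], subst lin_ext_basis[OF F, of "carrier M \<times> carrier ?U"]) (use v x p in auto)
    also have "\<dots> = p \<odot>\<^bsub>tensor_product R M ?U\<^esub> pure_tensor R M ?U x \<one>\<^bsub>R\<^esub>"
      using pure_tensor_smult_right[OF M U p(1) x one] p by simp
    also have "\<dots> = pure_tensor R M ?U (\<zero>\<^bsub>R\<^esub> \<odot>\<^bsub>M\<^esub> \<zero>\<^bsub>M\<^esub>) \<one>\<^bsub>R\<^esub>"
      using pure_tensor_smult_left[OF M U p(1) x one] px by simp
    also have "\<dots> = \<zero>\<^bsub>tensor_product R M ?U\<^esub>"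
      using pure_tensor_smult_left[OF M U R.zero_closed M.zero_closed one]
        pure_tensor_closed[OF M U M.zero_closed one] by simp
    also have "\<dots> = tensor_map R M ?U ?U ?f \<zero>\<^bsub>tensor_product R M ?U\<^esub>"
      using lin_zero[OF T.module_axioms T.module_axioms mod_hom_lin[OF ts(1)]] by simp
    finally have "pure_tensor R M ?U x \<one>\<^bsub>R\<^esub> = \<zero>\<^bsub>tensor_product R M ?U\<^esub>"
      using inj pure_tensor_closed[OF M U x one] by (auto dest: inj_onD)
    hence k: "basis_vec R (x, \<one>\<^bsub>R\<^esub>) \<in> tensor_kernel R M ?U"
      unfolding pure_tensor_def using tensor_proj_eq_zero[OF M U b] by simp
    \<comment> \<open>The bilinear action map sends x tensor 1 to \<open>x\<close>, so
      \<open>x\<close> vanishes with it.\<close>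
    let ?w = "\<lambda>(x, u). u \<odot>\<^bsub>M\<^esub> x"
    have w: "c \<in> carrier M \<times> carrier ?U \<Longrightarrow> ?w c \<in> carrier M" for c by auto
    have e: "lin R (free_module R (carrier M \<times> carrier ?U)) M (lin_ext R M ?w)" using w by (rule lin_ext_lin[OF M])
    have eb: "lin_ext R M ?w (basis_vec R (x, u)) = u \<odot>\<^bsub>M\<^esub> x" if "x \<in> carrier M" "u \<in> carrier R" for x u
      using lin_ext_basis[OF M, of "carrier M \<times> carrier ?U" ?w "(x, u)"] w that by simp
    have "lin_ext R M ?w (basis_vec R (x, \<one>\<^bsub>R\<^esub>)) = \<zero>\<^bsub>M\<^esub>"
      by (rule tensor_kernel_subI[OF M U M e _ _ _ _ k])
        (simp_all add: eb M.smult_l_distr M.smult_r_distr M.smult_assoc1[symmetric] R.m_comm)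
    thus ?thesis using eb[OF x] x by simp
  qed
  thus "p = \<zero>\<^bsub>R\<^esub> \<or> x = \<zero>\<^bsub>M\<^esub>" if "p \<in> carrier R" "x \<in> carrier M" "p \<odot>\<^bsub>M\<^esub> x = \<zero>\<^bsub>M\<^esub>" for p x
    using that by blast
qed

text \<open>Precomposing a generating map with this automorphism changes the generating family
  without changing its span. A relation \<open>w\<close> becomes its preimage, with \<open>q\<close>
  times the entry at \<open>i\<close> subtracted from the entry at \<open>k\<close>.\<close>

lemma free_elementary:
  assumes R: "cring R" and i: "i \<in> B" and k: "k \<in> B" and ik: "i \<noteq> k" and q: "q \<in> carrier R"
  defines "E \<equiv> \<lambda>w. w(k := w k \<oplus>\<^bsub>R\<^esub> q \<otimes>\<^bsub>R\<^esub> w i)"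
  shows "lin R (free_module R B) (free_module R B) E" and "w \<in> carrier (free_module R B) \<Longrightarrow>
    w(k := w k \<ominus>\<^bsub>R\<^esub> q \<otimes>\<^bsub>R\<^esub> w i) \<in> carrier (free_module R B) \<and> E (w(k := w k \<ominus>\<^bsub>R\<^esub> q \<otimes>\<^bsub>R\<^esub> w i)) = w"
proof -
  interpret R: cring R by fact
  have fin: "finite {b. (w(k := c)) b \<noteq> \<zero>\<^bsub>R\<^esub>}" if "finite {b. w b \<noteq> \<zero>\<^bsub>R\<^esub>}" for w :: "'c \<Rightarrow> 'a" and c
  proof (rule finite_subset)
    show "{b. (w(k := c)) b \<noteq> \<zero>\<^bsub>R\<^esub>} \<subseteq> insert k {b. w b \<noteq> \<zero>\<^bsub>R\<^esub>}" by auto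
  qed (use that in simp)
  have c: "w(k := c) \<in> carrier (free_module R B)" if "w \<in> carrier (free_module R B)" "c \<in> carrier R" for w c
    using that fin k by (auto simp: free_carrier)
  show "lin R (free_module R B) (free_module R B) E"
  proof (rule linI)
    show "E w \<in> carrier (free_module R B)" if "w \<in> carrier (free_module R B)" for w
      unfolding E_def by (rule c[OF that]) (use that q in \<open>auto simp: free_carrier\<close>)
  qed (use q ik in \<open>auto simp: E_def fun_eq_iff free_carrier R.r_distr R.a_ac R.m_ac\<close>)
  assume w: "w \<in> carrier (free_module R B)"
  show "w(k := w k \<ominus>\<^bsub>R\<^esub> q \<otimes>\<^bsub>R\<^esub> w i) \<in> carrier (free_module R B) \<and> E (w(k := w k \<ominus>\<^bsub>R\<^esub> q \<otimes>\<^bsub>R\<^esub> w i)) = w"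
  proof
    show "w(k := w k \<ominus>\<^bsub>R\<^esub> q \<otimes>\<^bsub>R\<^esub> w i) \<in> carrier (free_module R B)"
      by (rule c[OF w]) (use w q in \<open>auto simp: free_carrier\<close>)
    show "E (w(k := w k \<ominus>\<^bsub>R\<^esub> q \<otimes>\<^bsub>R\<^esub> w i)) = w"
      using w q ik by (auto simp: E_def fun_eq_iff free_carrier a_minus_def R.a_assoc R.l_neg)
  qed
qed

text \<open>Among all nonzero relations between a generating family of minimal size pick one with an entry of
  minimal Euclidean size. Elementary transformations show that this entry divides all others, so
  torsion-freeness makes one generator redundant.\<close>

lemma euclidean_torsion_free_basis:
  fixes B :: "'b set"
  assumes R: "euclidean_domain R \<delta>" and M: "module R M" and B: "finite B"
    and f: "lin R (free_module R B) M f"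
    and tf: "torsion_free R M"
  shows "\<exists>(C :: 'b set) g. finite C \<and> lin R (free_module R C) M g \<and> inj_on g (carrier (free_module R C)) \<and>
    g ` carrier (free_module R C) = f ` carrier (free_module R B)"
proof -
  interpret R: euclidean_domain R \<delta> by (rule R)
  interpret M: module R M by (rule M)
  note Rc = R.is_cring
  note Fm = free_module_module[OF Rc]
  let ?I = "f ` carrier (free_module R B)"
  define G where "G C g \<longleftrightarrow> finite C \<and> lin R (free_module R C) M g \<and> g ` carrier (free_module R C) = ?I"
    for C :: "'b set" and g
  define n where "n = (LEAST n. \<exists>C g. G C g \<and> card C = n)"
  have "G B f" using B f by (simp add: G_def)
  hence ex: "\<exists>n C g. G C g \<and> card C = n" by blast
  obtain C g where Cg: "G C g" "card C = n" using LeastI_ex[OF ex] unfolding n_def by blast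
  have min: "n \<le> card C'" if "G C' g'" for C' g' unfolding n_def by (rule Least_le) (use that in blast)
  have C: "finite C" using Cg by (simp add: G_def)
  have Gl: "lin R (free_module R C) M g" if "G C g" for g using that by (simp add: G_def)
  \<comment> \<open>A relation with an entry equal to 1 expresses that generator through the others,
    against minimality of the number of generators.\<close>
  have red: False if g: "G C g" and q: "q \<in> carrier (free_module R C)" and i: "i \<in> C" "q i = \<one>\<^bsub>R\<^esub>"
    and gq: "g q = \<zero>\<^bsub>M\<^esub>" for g q i
  proof -
    note gl = Gl[OF g]
    have inc: "lin R (free_module R (C - {i})) (free_module R C) (\<lambda>z. z)"
      by (rule linI) (auto intro: free_mono[of "C - {i}"])
    note gi = lin_comp[OF inc gl]
    have "g z \<in> g ` carrier (free_module R (C - {i}))" if z: "z \<in> carrier (free_module R C)" for z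
    proof -
      interpret F: module R "free_module R C" by (rule Fm)
      have zi: "z i \<in> carrier R" using z by (simp add: free_carrier)
      have zq: "z i \<odot>\<^bsub>free_module R C\<^esub> q \<in> carrier (free_module R C)" using zi q by (rule F.smult_closed)
      let ?w = "z \<ominus>\<^bsub>free_module R C\<^esub> z i \<odot>\<^bsub>free_module R C\<^esub> q"
      have w: "?w \<in> carrier (free_module R C)" using z zq by (rule F.minus_closed)
      have "?w i = z i \<ominus>\<^bsub>R\<^esub> (z i \<odot>\<^bsub>free_module R C\<^esub> q) i" by (rule free_minus[OF Rc z zq])
      also have "\<dots> = \<zero>\<^bsub>R\<^esub>" using i zi by (simp add: a_minus_def R.r_neg)
      finally have "?w i = \<zero>\<^bsub>R\<^esub>" .
      hence w': "?w \<in> carrier (free_module R (C - {i}))" using w by (auto simp: free_carrier)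
      have "g ?w = g z \<ominus>\<^bsub>M\<^esub> z i \<odot>\<^bsub>M\<^esub> g q"
        using lin_minus[OF Fm M gl z zq] lin_smult[OF gl zi q] by simp
      also have "\<dots> = g z" using gq zi lin_closed[OF gl z] M.minus_equality[of "\<zero>\<^bsub>M\<^esub>" "\<zero>\<^bsub>M\<^esub>"] by (simp add: a_minus_def)
      finally show ?thesis using w' by (metis imageI)
    qed
    hence "g ` carrier (free_module R (C - {i})) = g ` carrier (free_module R C)"
      using free_mono[of "C - {i}" C] by blast
    hence "G (C - {i}) g" using g gi C by (simp add: G_def)
    from min[OF this] show False using Cg(2) C i(1) by (metis card_Diff1_less linorder_not_less)
  qed
  have "inj_on g (carrier (free_module R C))"
  proof (rule ccontr)
    assume "\<not> inj_on g (carrier (free_module R C))"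
    then obtain z w where zw: "z \<in> carrier (free_module R C)" "w \<in> carrier (free_module R C)" "g z = g w" "z \<noteq> w"
      by (auto simp: inj_on_def)
    interpret F: module R "free_module R C" by (rule Fm)
    \<comment> \<open>The minimum is taken over all generating maps on \<open>C\<close> as well as
      all relations, because an elementary transformation changes the map.\<close>
    define K where "K m \<longleftrightarrow> (\<exists>g z i. G C g \<and> z \<in> carrier (free_module R C) \<and> i \<in> C \<and> z i \<noteq> \<zero>\<^bsub>R\<^esub> \<and>
      g z = \<zero>\<^bsub>M\<^esub> \<and> \<delta> (z i) = m)" for m
    have "g (z \<ominus>\<^bsub>free_module R C\<^esub> w) = \<zero>\<^bsub>M\<^esub>"
      using lin_minus[OF Fm M Gl[OF Cg(1)] zw(1,2)] zw(3) lin_closed[OF Gl[OF Cg(1)] zw(2)]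
      by (simp add: minus_eq_zero_iff[OF M])
    moreover have d: "z \<ominus>\<^bsub>free_module R C\<^esub> w \<in> carrier (free_module R C)" using zw by (intro F.minus_closed)
    moreover have "z \<ominus>\<^bsub>free_module R C\<^esub> w \<noteq> \<zero>\<^bsub>free_module R C\<^esub>"
      using minus_eq_zero_iff[OF Fm zw(1,2)] zw(4) by blast
    then obtain i where "(z \<ominus>\<^bsub>free_module R C\<^esub> w) i \<noteq> \<zero>\<^bsub>R\<^esub>" by (auto simp: fun_eq_iff)
    moreover from this d have "i \<in> C" by (auto simp: free_carrier)
    ultimately have "K (\<delta> ((z \<ominus>\<^bsub>free_module R C\<^esub> w) i))" using Cg(1) unfolding K_def by blast
    hence K: "K (LEAST m. K m)" by (rule LeastI)
    then obtain g z i where g: "G C g" and z: "z \<in> carrier (free_module R C)" and i: "i \<in> C" "z i \<noteq> \<zero>\<^bsub>R\<^esub>"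
      and gz: "g z = \<zero>\<^bsub>M\<^esub>" and d: "\<delta> (z i) = (LEAST m. K m)" unfolding K_def[of "LEAST m. K m"] by blast
    note gl = Gl[OF g]
    have zc: "z b \<in> carrier R" for b using z by (simp add: free_carrier)
    have "\<exists>q\<in>carrier R. z k = z i \<otimes>\<^bsub>R\<^esub> q" for k
    proof (cases "z k = \<zero>\<^bsub>R\<^esub> \<or> k = i")
      case True
      thus ?thesis using zc[of i] R.zero_closed R.one_closed R.r_null R.r_one by metis
    next
      case False
      hence k: "z k \<noteq> \<zero>\<^bsub>R\<^esub>" "i \<noteq> k" "k \<in> C" using z by (auto simp: free_carrier)
      obtain q r where qr: "q \<in> carrier R" "r \<in> carrier R" "z k = z i \<otimes>\<^bsub>R\<^esub> q \<oplus>\<^bsub>R\<^esub> r" "r = \<zero>\<^bsub>R\<^esub> \<or> \<delta> r < \<delta> (z i)"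
        using R.euclidean_function[of "z k" "z i"] zc k i(2) by blast
      have "r = \<zero>\<^bsub>R\<^esub>"
      proof (rule ccontr)
        assume r: "r \<noteq> \<zero>\<^bsub>R\<^esub>"
        \<comment> \<open>Dividing the entry at \<open>k\<close> by the entry at \<open>i\<close>
          leaves \<open>r\<close>. The transformation produces a relation with entry
          \<open>r\<close> at \<open>k\<close>, of smaller size unless \<open>r\<close> is
          zero.\<close>
        let ?E = "\<lambda>w. w(k := w k \<oplus>\<^bsub>R\<^esub> q \<otimes>\<^bsub>R\<^esub> w i)"
        note E = free_elementary[OF Rc i(1) k(3,2) qr(1)]
        let ?z = "z(k := z k \<ominus>\<^bsub>R\<^esub> q \<otimes>\<^bsub>R\<^esub> z i)"
        have zk: "?z k = r" using qr zc[of i]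
          by (simp add: a_minus_def R.m_comm[of q] R.a_comm[of _ r] R.a_assoc R.r_neg)
        have "?E ` carrier (free_module R C) = carrier (free_module R C)"
        proof
          show "?E ` carrier (free_module R C) \<subseteq> carrier (free_module R C)"
            by (rule image_subsetI) (rule lin_closed[OF E(1)])
          show "carrier (free_module R C) \<subseteq> ?E ` carrier (free_module R C)"
          proof
            fix w assume "w \<in> carrier (free_module R C)"
            from E(2)[OF this] show "w \<in> ?E ` carrier (free_module R C)"
              by (intro image_eqI[of _ ?E "w(k := w k \<ominus>\<^bsub>R\<^esub> q \<otimes>\<^bsub>R\<^esub> w i)"]) simp_all
          qed
        qed
        hence "(\<lambda>w. g (?E w)) ` carrier (free_module R C) = g ` carrier (free_module R C)"
          using image_image[of g ?E "carrier (free_module R C)"] by simp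
        hence "G C (\<lambda>w. g (?E w))" using g lin_comp[OF E(1) gl] by (simp add: G_def)
        moreover have "?z \<in> carrier (free_module R C)" "g (?E ?z) = \<zero>\<^bsub>M\<^esub>" using E(2)[OF z] gz by auto
        moreover have "?z k \<noteq> \<zero>\<^bsub>R\<^esub>" using zk r by simp
        ultimately have "K (\<delta> (?z k))" using k(3) unfolding K_def by blast
        hence "(LEAST m. K m) \<le> \<delta> r" using zk by (auto intro: Least_le)
        thus False using qr(4) r d by simp
      qed
      thus ?thesis using qr zc[of i] by auto
    qed
    \<comment> \<open>The relation is \<open>z i\<close> times the vector \<open>q\<close> with
      \<open>q i = 1\<close>. Torsion-freeness cancels the factor \<open>z i\<close>, so
      \<open>q\<close> is itself a relation.\<close>
    then obtain q where q: "\<And>k. q k \<in> carrier R" "\<And>k. z k = z i \<otimes>\<^bsub>R\<^esub> q k" by metis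
    have q0: "q k = \<zero>\<^bsub>R\<^esub>" if "z k = \<zero>\<^bsub>R\<^esub>" for k
      using R.integral[of "z i" "q k"] q that i(2) zc[of i] by metis
    have "{k. q k \<noteq> \<zero>\<^bsub>R\<^esub>} \<subseteq> {k. z k \<noteq> \<zero>\<^bsub>R\<^esub>}" using q0 by blast
    hence "finite {k. q k \<noteq> \<zero>\<^bsub>R\<^esub>}" by (rule finite_subset) (use z in \<open>simp add: free_carrier\<close>)
    hence qc: "q \<in> carrier (free_module R C)" using q(1) q0 z by (auto simp: free_carrier)
    have "z i \<otimes>\<^bsub>R\<^esub> q i = z i \<otimes>\<^bsub>R\<^esub> \<one>\<^bsub>R\<^esub>" using q(2)[of i] zc[of i] by simp
    hence qi: "q i = \<one>\<^bsub>R\<^esub>" using R.m_lcancel[OF i(2) zc q(1) R.one_closed] by blast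
    have "z = z i \<odot>\<^bsub>free_module R C\<^esub> q" unfolding free_ops by (rule ext) (rule q(2))
    hence "z i \<odot>\<^bsub>M\<^esub> g q = \<zero>\<^bsub>M\<^esub>" using lin_smult[OF gl zc qc, of i] gz by simp
    hence "g q = \<zero>\<^bsub>M\<^esub>" using tf zc[of i] i(2) lin_closed[OF gl qc] by (auto simp: torsion_free_def)
    thus False using red[OF g qc i(1) qi] by simp
  qed
  thus ?thesis using Cg(1) unfolding G_def by blast
qed

text \<open>The finitely generated span is free, and the functionals \<open>l c\<close> are its
  coordinates. They are linear on the span only, which is why their domain is the module with
  restricted carrier.\<close>

lemma torsion_free_dual_basis:
  fixes M :: "('a, 'm) module"
  assumes R: "euclidean_domain R \<delta>" and M: "module R M" and S: "finite S" "S \<subseteq> carrier M"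
    and tf: "torsion_free R M"
  shows "\<exists>(C :: 'm set) v l. finite C \<and> (\<forall>c\<in>C. v c \<in> carrier M) \<and>
    (\<forall>c\<in>C. lin R (M\<lparr>carrier := submod_span R M S\<rparr>) (regular_module R) (l c)) \<and>
    (\<forall>x\<in>submod_span R M S. x = (\<Oplus>\<^bsub>M\<^esub>c\<in>C. l c x \<odot>\<^bsub>M\<^esub> v c))"
proof -
  interpret R: euclidean_domain R \<delta> by (rule R)
  interpret M: module R M by (rule M)
  note Rc = R.is_cring
  note Fm = free_module_module[OF Rc]
  let ?H = "submod_span R M S"
  have idS: "b \<in> S \<Longrightarrow> b \<in> carrier M" for b using S by blast
  have fl: "lin R (free_module R S) M (lin_ext R M (\<lambda>b. b))" using idS by (rule lin_ext_lin[OF M])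
  have "(\<lambda>b. lin_ext R M (\<lambda>b. b) (basis_vec R b)) ` S = S"
    using lin_ext_basis[where v = "\<lambda>b. b", OF M idS] by force
  hence im: "lin_ext R M (\<lambda>b. b) ` carrier (free_module R S) = ?H"
    by (simp only: free_image_span[OF M fl])
  obtain C :: "'m set" and g where C: "finite C" and gl: "lin R (free_module R C) M g"
    and inj: "inj_on g (carrier (free_module R C))" and gH: "g ` carrier (free_module R C) = ?H"
    using euclidean_torsion_free_basis[OF R M S(1) fl tf] im by metis
  define l where "l c x = inv_into (carrier (free_module R C)) g x c" for c x
  have lg: "l c (g z) = z c" if "z \<in> carrier (free_module R C)" for c z
    using inv_into_f_f[OF inj that] by (simp add: l_def)
  have lin: "lin R (M\<lparr>carrier := ?H\<rparr>) (regular_module R) (l c)" for c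
  proof (rule linI)
    interpret F: module R "free_module R C" by (rule Fm)
    fix x assume "x \<in> carrier (M\<lparr>carrier := ?H\<rparr>)"
    then obtain z where z: "z \<in> carrier (free_module R C)" "x = g z" using gH by auto
    show "l c x \<in> carrier (regular_module R)" using z lg by (auto simp: free_carrier)
    show "l c (a \<odot>\<^bsub>M\<lparr>carrier := ?H\<rparr>\<^esub> x) = a \<odot>\<^bsub>regular_module R\<^esub> l c x" if "a \<in> carrier R" for a
      using z that lg lg[OF F.smult_closed[OF that z(1)]] lin_smult[OF gl that z(1)] by simp
    fix y assume "y \<in> carrier (M\<lparr>carrier := ?H\<rparr>)"
    then obtain w where w: "w \<in> carrier (free_module R C)" "y = g w" using gH by auto
    show "l c (x \<oplus>\<^bsub>M\<lparr>carrier := ?H\<rparr>\<^esub> y) = l c x \<oplus>\<^bsub>regular_module R\<^esub> l c y"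
      using z w lg lg[OF F.a_closed[OF z(1) w(1)]] lin_add[OF gl z(1) w(1)] by simp
  qed
  let ?v = "\<lambda>c. g (basis_vec R c)"
  have vc: "c \<in> C \<Longrightarrow> ?v c \<in> carrier M" for c by (rule lin_closed[OF gl basis_vec_closed[OF Rc]])
  have "x = (\<Oplus>\<^bsub>M\<^esub>c\<in>C. l c x \<odot>\<^bsub>M\<^esub> ?v c)" if "x \<in> ?H" for x
  proof -
    obtain z where z: "z \<in> carrier (free_module R C)" "x = g z" using gH \<open>x \<in> ?H\<close> by auto
    have "g z = lin_ext R M ?v z" by (rule lin_free_eq_lin_ext[OF M gl z(1)])
    also have "\<dots> = (\<Oplus>\<^bsub>M\<^esub>c\<in>C. z c \<odot>\<^bsub>M\<^esub> ?v c)"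
      by (rule lin_ext_eq[where B = C, OF M vc z(1) C]) (use z(1) in \<open>auto simp: free_carrier\<close>)
    also have "\<dots> = (\<Oplus>\<^bsub>M\<^esub>c\<in>C. l c (g z) \<odot>\<^bsub>M\<^esub> ?v c)" by (simp only: lg[OF z(1)])
    finally show ?thesis unfolding z(2) .
  qed
  thus ?thesis using C vc lin by (intro exI[of _ C] exI[of _ ?v] exI[of _ l]) blast
qed

text \<open>Let a tensor die after applying \<open>f\<close>. The relations responsible involve
  finitely many elements of \<open>M\<close>, so coordinate functionals of a finitely generated span
  annihilate the image. They commute with \<open>f\<close>, and injectivity of \<open>f\<close>
  shows that the coordinates of the original tensor vanish; the dual basis reassembles it as
  zero.\<close>

lemma torsion_free_imp_flat:
  fixes M :: "('a, 'm) module"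
  assumes R: "euclidean_domain R \<delta>" and M: "module R M"
    and tf: "torsion_free R M"
  shows "flat_module R M"
  unfolding flat_module_def
proof (intro conjI M allI impI)
  fix U V :: "('a, 'a) module" and f
  assume "module R U \<and> module R V \<and> f \<in> mod_hom R U V \<and> inj_on f (carrier U)"
  hence U: "module R U" and V: "module R V" and f: "f \<in> mod_hom R U V" and inj: "inj_on f (carrier U)" by auto
  interpret R: euclidean_domain R \<delta> by (rule R)
  interpret M: module R M by (rule M)
  interpret U: module R U by (rule U)
  interpret V: module R V by (rule V)
  note Rc = R.is_cring
  note Fm = free_module_module[OF Rc]
  note fl = mod_hom_lin[OF f]
  note fc = lin_closed[OF fl]
  let ?FU = "free_module R (carrier M \<times> carrier U)" and ?FV = "free_module R (carrier M \<times> carrier V)"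
  interpret FU: module R ?FU by (rule Fm)
  interpret TU: module R "tensor_product R M U" by (rule tensor_product_module[OF M U])
  \<comment> \<open>Contraction with \<open>l\<close> has to be given on all pairs, so
    \<open>l\<close> is extended by zero off \<open>H\<close>. It respects relations only among
    elements of \<open>H\<close>.\<close>
  let ?w = "\<lambda>H l W (x, v). (if x \<in> H then l x else \<zero>\<^bsub>R\<^esub>) \<odot>\<^bsub>W\<^esub> v"
  define ev where "ev H l W = lin_ext R W (?w H l W)" for H :: "'m set" and l :: "'m \<Rightarrow> 'a" and W :: "('a, 'a) module"
  have evw: "?w H l W b \<in> carrier W"
    if "module R W" "lin R (M\<lparr>carrier := H\<rparr>) (regular_module R) l" "b \<in> carrier M \<times> carrier W" for H l W b
    using that(3) module.smult_closed[OF that(1)] lin_closed[OF that(2)] by auto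
  have evl: "lin R (free_module R (carrier M \<times> carrier W)) W (ev H l W)"
    if "module R W" "lin R (M\<lparr>carrier := H\<rparr>) (regular_module R) l" for H l W
    unfolding ev_def using evw[OF that] by (rule lin_ext_lin[OF that(1)])
  have evb: "ev H l W (basis_vec R (x, v)) = (if x \<in> H then l x else \<zero>\<^bsub>R\<^esub>) \<odot>\<^bsub>W\<^esub> v"
    if "module R W" "lin R (M\<lparr>carrier := H\<rparr>) (regular_module R) l" "x \<in> carrier M" "v \<in> carrier W" for H l W x v
  proof -
    have "ev H l W (basis_vec R (x, v)) = ?w H l W (x, v)" unfolding ev_def
      using evw[OF that(1,2)] that(3,4) by (intro lin_ext_basis[OF that(1), where B = "carrier M \<times> carrier W"]) auto
    thus ?thesis by simp
  qed
  \<comment> \<open>The quantification over all larger finite sets makes the property closed under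
    sums: two exceptional sets are merged into their union.\<close>
  define Z where "Z S w \<longleftrightarrow> (\<forall>S' l. finite S' \<longrightarrow> S \<subseteq> S' \<longrightarrow> S' \<subseteq> carrier M \<longrightarrow>
    lin R (M\<lparr>carrier := submod_span R M S'\<rparr>) (regular_module R) l \<longrightarrow> ev (submod_span R M S') l V w = \<zero>\<^bsub>V\<^esub>)" for S w
  let ?K = "{w \<in> carrier ?FV. \<exists>S. finite S \<and> S \<subseteq> carrier M \<and> Z S w}"
  have K: "submodule ?K R ?FV"
  proof -
    interpret FV: module R ?FV by (rule Fm)
    show ?thesis
    proof (rule FV.submoduleI)
      have "Z {} \<zero>\<^bsub>?FV\<^esub>" unfolding Z_def using lin_zero[OF Fm V evl[OF V]] by blast
      thus "\<zero>\<^bsub>?FV\<^esub> \<in> ?K" using FV.zero_closed by blast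
      show add: "v \<oplus>\<^bsub>?FV\<^esub> w \<in> ?K" if "v \<in> ?K" "w \<in> ?K" for v w
      proof -
        from that obtain S T where S: "finite S" "S \<subseteq> carrier M" "Z S v" and T: "finite T" "T \<subseteq> carrier M" "Z T w"
          and vw: "v \<in> carrier ?FV" "w \<in> carrier ?FV" by blast
        have "Z (S \<union> T) (v \<oplus>\<^bsub>?FV\<^esub> w)" unfolding Z_def
        proof (intro allI impI)
          fix S' l assume a: "finite S'" "S \<union> T \<subseteq> S'" "S' \<subseteq> carrier M"
            "lin R (M\<lparr>carrier := submod_span R M S'\<rparr>) (regular_module R) l"
          have "ev (submod_span R M S') l V v = \<zero>\<^bsub>V\<^esub>" "ev (submod_span R M S') l V w = \<zero>\<^bsub>V\<^esub>"
            using S(3) T(3) a unfolding Z_def by auto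
          thus "ev (submod_span R M S') l V (v \<oplus>\<^bsub>?FV\<^esub> w) = \<zero>\<^bsub>V\<^esub>"
            using lin_add[OF evl[OF V a(4)] vw] by simp
        qed
        thus ?thesis using S T FV.a_closed[OF vw] by (intro CollectI conjI exI[of _ "S \<union> T"]) auto
      qed
      show sm: "a \<odot>\<^bsub>?FV\<^esub> v \<in> ?K" if a: "a \<in> carrier R" and "v \<in> ?K" for a v
      proof -
        from that obtain S where S: "finite S" "S \<subseteq> carrier M" "Z S v" and v: "v \<in> carrier ?FV" by blast
        have "Z S (a \<odot>\<^bsub>?FV\<^esub> v)" unfolding Z_def
        proof (intro allI impI)
          fix S' l assume a': "finite S'" "S \<subseteq> S'" "S' \<subseteq> carrier M"
            "lin R (M\<lparr>carrier := submod_span R M S'\<rparr>) (regular_module R) l"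
          have "ev (submod_span R M S') l V v = \<zero>\<^bsub>V\<^esub>" using S(3) a' unfolding Z_def by auto
          thus "ev (submod_span R M S') l V (a \<odot>\<^bsub>?FV\<^esub> v) = \<zero>\<^bsub>V\<^esub>"
            using lin_smult[OF evl[OF V a'(4)] a v] a by simp
        qed
        thus ?thesis using S FV.smult_closed[OF a v] by blast
      qed
      show "\<ominus>\<^bsub>?FV\<^esub> v \<in> ?K" if "v \<in> ?K" for v
        using sm[of "\<ominus>\<^bsub>R\<^esub> \<one>\<^bsub>R\<^esub>" v] that FV.smult_l_minus[of "\<one>\<^bsub>R\<^esub>" v] FV.smult_one[of v] by simp
    qed auto
  qed
  have in_span: "x \<in> submod_span R M S'" if "x \<in> S" "S \<subseteq> S'" for x S S'
    using that submod_span_incl[of S' R M] by blast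
  have rel: "v \<ominus>\<^bsub>?FV\<^esub> w \<in> ?K"
    if vw: "v \<in> carrier ?FV" "w \<in> carrier ?FV" and S: "finite S" "S \<subseteq> carrier M"
      and eq: "\<And>S' l. S \<subseteq> S' \<Longrightarrow> submodule (submod_span R M S') R M \<Longrightarrow>
        lin R (M\<lparr>carrier := submod_span R M S'\<rparr>) (regular_module R) l \<Longrightarrow>
        ev (submod_span R M S') l V v = ev (submod_span R M S') l V w" for v w S
  proof -
    interpret FV: module R ?FV by (rule Fm)
    have "Z S (v \<ominus>\<^bsub>?FV\<^esub> w)" unfolding Z_def
    proof (intro allI impI)
      fix S' l assume a: "finite S'" "S \<subseteq> S'" "S' \<subseteq> carrier M"
        "lin R (M\<lparr>carrier := submod_span R M S'\<rparr>) (regular_module R) l"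
      show "ev (submod_span R M S') l V (v \<ominus>\<^bsub>?FV\<^esub> w) = \<zero>\<^bsub>V\<^esub>"
        using eq[OF a(2) submod_span_submodule[OF M a(3)] a(4)] lin_minus[OF Fm V evl[OF V a(4)] vw]
          lin_closed[OF evl[OF V a(4)]] vw by (simp add: minus_eq_zero_iff[OF V])
    qed
    thus ?thesis using S FV.minus_closed[OF vw] by blast
  qed
  note pb = pair_basis_closed[OF M V]
  have "tensor_relations R M V \<subseteq> ?K"
  proof -
    interpret FV: module R ?FV by (rule Fm)
    have r1: "basis_vec R (x \<oplus>\<^bsub>M\<^esub> x', y) \<ominus>\<^bsub>?FV\<^esub> (basis_vec R (x, y) \<oplus>\<^bsub>?FV\<^esub> basis_vec R (x', y)) \<in> ?K"
      if c: "x \<in> carrier M" "x' \<in> carrier M" "y \<in> carrier V" for x x' y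
    proof (rule rel[of _ _ "{x, x'}"])
      fix S' l assume a: "{x, x'} \<subseteq> S'" "submodule (submod_span R M S') R M"
        "lin R (M\<lparr>carrier := submod_span R M S'\<rparr>) (regular_module R) l"
      have s: "x \<in> submod_span R M S'" "x' \<in> submod_span R M S'" using in_span a(1) by auto
      show "ev (submod_span R M S') l V (basis_vec R (x \<oplus>\<^bsub>M\<^esub> x', y)) =
          ev (submod_span R M S') l V (basis_vec R (x, y) \<oplus>\<^bsub>?FV\<^esub> basis_vec R (x', y))"
        using c s submodule_add[OF a(2) s] lin_add[OF a(3), of x x'] lin_closed[OF a(3)] pb
        by (simp add: lin_add[OF evl[OF V a(3)]] evb[OF V a(3)] V.smult_l_distr del: free_ops)
    qed (use c pb in \<open>auto simp del: free_ops\<close>)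
    have r2: "basis_vec R (x, y \<oplus>\<^bsub>V\<^esub> y') \<ominus>\<^bsub>?FV\<^esub> (basis_vec R (x, y) \<oplus>\<^bsub>?FV\<^esub> basis_vec R (x, y')) \<in> ?K"
      if c: "x \<in> carrier M" "y \<in> carrier V" "y' \<in> carrier V" for x y y'
    proof (rule rel[of _ _ "{x}"])
      fix S' l assume a: "{x} \<subseteq> S'" "submodule (submod_span R M S') R M"
        "lin R (M\<lparr>carrier := submod_span R M S'\<rparr>) (regular_module R) l"
      have s: "x \<in> submod_span R M S'" using in_span a(1) by auto
      show "ev (submod_span R M S') l V (basis_vec R (x, y \<oplus>\<^bsub>V\<^esub> y')) =
          ev (submod_span R M S') l V (basis_vec R (x, y) \<oplus>\<^bsub>?FV\<^esub> basis_vec R (x, y'))"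
        using c s lin_closed[OF a(3), of x] pb
        by (simp add: lin_add[OF evl[OF V a(3)]] evb[OF V a(3)] V.smult_r_distr del: free_ops)
    qed (use c pb in \<open>auto simp del: free_ops\<close>)
    have r3: "basis_vec R (a \<odot>\<^bsub>M\<^esub> x, y) \<ominus>\<^bsub>?FV\<^esub> (a \<odot>\<^bsub>?FV\<^esub> basis_vec R (x, y)) \<in> ?K"
      if c: "a \<in> carrier R" "x \<in> carrier M" "y \<in> carrier V" for a x y
    proof (rule rel[of _ _ "{x}"])
      fix S' l assume a: "{x} \<subseteq> S'" "submodule (submod_span R M S') R M"
        "lin R (M\<lparr>carrier := submod_span R M S'\<rparr>) (regular_module R) l"
      have s: "x \<in> submod_span R M S'" using in_span a(1) by auto
      show "ev (submod_span R M S') l V (basis_vec R (a \<odot>\<^bsub>M\<^esub> x, y)) =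
          ev (submod_span R M S') l V (a \<odot>\<^bsub>?FV\<^esub> basis_vec R (x, y))"
        using c s submodule_smult[OF a(2) c(1) s] lin_smult[OF a(3) c(1), of x] lin_closed[OF a(3), of x] pb
        by (simp add: lin_smult[OF evl[OF V a(3)]] evb[OF V a(3)] V.smult_assoc1 del: free_ops)
    qed (use c pb in \<open>auto simp del: free_ops\<close>)
    have r4: "basis_vec R (x, a \<odot>\<^bsub>V\<^esub> y) \<ominus>\<^bsub>?FV\<^esub> (a \<odot>\<^bsub>?FV\<^esub> basis_vec R (x, y)) \<in> ?K"
      if c: "a \<in> carrier R" "x \<in> carrier M" "y \<in> carrier V" for a x y
    proof (rule rel[of _ _ "{x}"])
      fix S' l assume a: "{x} \<subseteq> S'" "submodule (submod_span R M S') R M"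
        "lin R (M\<lparr>carrier := submod_span R M S'\<rparr>) (regular_module R) l"
      have s: "x \<in> submod_span R M S'" using in_span a(1) by auto
      show "ev (submod_span R M S') l V (basis_vec R (x, a \<odot>\<^bsub>V\<^esub> y)) =
          ev (submod_span R M S') l V (a \<odot>\<^bsub>?FV\<^esub> basis_vec R (x, y))"
        using c s lin_closed[OF a(3), of x] pb
        by (simp add: lin_smult[OF evl[OF V a(3)]] evb[OF V a(3)] V.smult_assoc1[symmetric] R.m_comm del: free_ops)
    qed (use c pb in \<open>auto simp del: free_ops\<close>)
    show ?thesis unfolding tensor_relations_def Let_def
      by (intro Un_least subsetI; elim CollectE exE conjE; hypsubst) (fact r1 r2 r3 r4)+
  qed
  hence TK: "tensor_kernel R M V \<subseteq> ?K" unfolding tensor_kernel_def by (rule submod_span_least[OF K])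
  let ?v = "\<lambda>(x, u). basis_vec R (x, f u)"
  let ?f = "lin_ext R ?FV ?v"
  have v: "b \<in> carrier M \<times> carrier U \<Longrightarrow> ?v b \<in> carrier ?FV" for b
    using fc by (auto intro!: pb)
  have fs: "lin R ?FU ?FV ?f" using v by (rule lin_ext_lin[OF Fm])
  have fb: "?f (basis_vec R (x, u)) = basis_vec R (x, f u)" if "x \<in> carrier M" "u \<in> carrier U" for x u
    using lin_ext_basis[OF Fm, of "carrier M \<times> carrier U" ?v "carrier M \<times> carrier V" "(x, u)"] v that by simp
  have main: "z \<in> tensor_kernel R M U" if z: "z \<in> carrier ?FU" and fz: "?f z \<in> tensor_kernel R M V" for z
  proof -
    from fz TK obtain S where S: "finite S" "S \<subseteq> carrier M" "Z S (?f z)" by blast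
    \<comment> \<open>Besides the elements used by the relations, the span must contain the first
      entries of the support of \<open>z\<close>, so that \<open>z\<close> itself is expanded in the
      dual basis.\<close>
    let ?S = "S \<union> fst ` {b. z b \<noteq> \<zero>\<^bsub>R\<^esub>}"
    let ?H = "submod_span R M ?S"
    have "{b. z b \<noteq> \<zero>\<^bsub>R\<^esub>} \<subseteq> carrier M \<times> carrier U" using z unfolding free_carrier by blast
    hence "fst ` {b. z b \<noteq> \<zero>\<^bsub>R\<^esub>} \<subseteq> carrier M" by auto
    hence S': "finite ?S" "?S \<subseteq> carrier M" using S z by (auto simp: free_carrier)
    obtain C :: "'m set" and e l where C: "finite C" and e: "\<And>c. c \<in> C \<Longrightarrow> e c \<in> carrier M"
      and l: "\<And>c. c \<in> C \<Longrightarrow> lin R (M\<lparr>carrier := ?H\<rparr>) (regular_module R) (l c)"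
      and xe: "\<And>x. x \<in> ?H \<Longrightarrow> x = (\<Oplus>\<^bsub>M\<^esub>c\<in>C. l c x \<odot>\<^bsub>M\<^esub> e c)"
      using torsion_free_dual_basis[OF R M S' tf] by blast
    have Hc: "x \<in> ?H \<Longrightarrow> x \<in> carrier M" for x using submodule_sub[OF submod_span_submodule[OF M S'(2)]] .
    have ev0: "ev ?H (l c) U z = \<zero>\<^bsub>U\<^esub>" if c: "c \<in> C" for c
    proof -
      have "ev ?H (l c) V (?f z) = f (ev ?H (l c) U z)"
      proof (rule lin_free_eqI[OF Rc V lin_comp[OF fs evl[OF V l[OF c]]] lin_comp[OF evl[OF U l[OF c]] fl] _ z])
        fix b assume "b \<in> carrier M \<times> carrier U"
        then obtain x u where b: "b = (x, u)" "x \<in> carrier M" "u \<in> carrier U" by auto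
        have "(if x \<in> ?H then l c x else \<zero>\<^bsub>R\<^esub>) \<in> carrier R" using lin_closed[OF l[OF c], of x] by auto
        thus "ev ?H (l c) V (?f (basis_vec R b)) = f (ev ?H (l c) U (basis_vec R b))"
          using b fc by (simp only: fb evb[OF V l[OF c]] evb[OF U l[OF c]] lin_smult[OF fl])
      qed
      moreover have "ev ?H (l c) V (?f z) = \<zero>\<^bsub>V\<^esub>"
        using S(3) S' l[OF c] unfolding Z_def by blast
      ultimately have "f (ev ?H (l c) U z) = f \<zero>\<^bsub>U\<^esub>" using lin_zero[OF U V fl] by simp
      thus ?thesis using inj lin_closed[OF evl[OF U l[OF c]] z] by (auto dest: inj_onD)
    qed
    let ?p = "\<lambda>z. tensor_kernel R M U +>\<^bsub>?FU\<^esub> z"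
    let ?G = "free_module R (?H \<times> carrier U)"
    have inc: "lin R ?G ?FU (\<lambda>z. z)" by (rule linI) (use Hc in \<open>auto intro: free_mono[of "?H \<times> carrier U"]\<close>)
    have pl: "lin R U (tensor_product R M U) (pure_tensor R M U x)" if "x \<in> carrier M" for x
      using that by (intro linI pure_tensor_closed[OF M U] pure_tensor_add_right[OF M U] pure_tensor_smult_right[OF M U])
    have suml: "lin R ?FU (tensor_product R M U) (\<lambda>z. \<Oplus>\<^bsub>tensor_product R M U\<^esub>c\<in>I. pure_tensor R M U (e c) (ev ?H (l c) U z))"
      if "finite I" "I \<subseteq> C" for I using that
    proof (induct I)
      case empty
      show ?case using lin_zero_map[OF Fm TU.module_axioms] by simp
    next
      case (insert c I)
      have c: "lin R ?FU (tensor_product R M U) (\<lambda>z. pure_tensor R M U (e c) (ev ?H (l c) U z))" if "c \<in> C" for c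
        by (intro lin_comp[OF evl[OF U l[OF that]] pl] e that)
      have i: "c \<in> C" "I \<subseteq> C" using insert.prems by auto
      note lp = lin_plus[OF Fm TU.module_axioms c[OF i(1)] insert.hyps(3)[OF i(2)]]
      show ?case
      proof (rule lin_cong[OF lp Fm])
        fix w assume w: "w \<in> carrier ?FU"
        have "pure_tensor R M U (e d) (ev ?H (l d) U w) \<in> carrier (tensor_product R M U)" if "d \<in> C" for d
          by (rule lin_closed[OF c[OF that] w])
        thus "(\<Oplus>\<^bsub>tensor_product R M U\<^esub>c\<in>insert c I. pure_tensor R M U (e c) (ev ?H (l c) U w)) =
            pure_tensor R M U (e c) (ev ?H (l c) U w) \<oplus>\<^bsub>tensor_product R M U\<^esub>
            (\<Oplus>\<^bsub>tensor_product R M U\<^esub>c\<in>I. pure_tensor R M U (e c) (ev ?H (l c) U w))"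
          using insert.hyps i by (intro TU.finsum_insert) auto
      qed
    qed
    have zG: "z \<in> carrier ?G"
    proof -
      have "b \<in> ?H \<times> carrier U" if "z b \<noteq> \<zero>\<^bsub>R\<^esub>" for b
      proof -
        have "b \<in> carrier M \<times> carrier U" using that z unfolding free_carrier by blast
        moreover have "fst b \<in> ?H" by (rule in_span[of _ ?S]) (use that in auto)
        ultimately show ?thesis by (cases b) auto
      qed
      thus ?thesis using z unfolding free_carrier by blast
    qed
    \<comment> \<open>On a pair (x, u) this is x tensor u = sum of e_c tensor l_c(x) u, obtained by
      expanding x and moving the coefficients across.\<close>
    have "?p z = (\<Oplus>\<^bsub>tensor_product R M U\<^esub>c\<in>C. pure_tensor R M U (e c) (ev ?H (l c) U z))"
    proof (rule lin_free_eqI[OF Rc TU.module_axioms lin_comp[OF inc tensor_proj_lin[OF M U]]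
          lin_comp[OF inc suml[OF C order_refl]] _ zG])
      fix b assume "b \<in> ?H \<times> carrier U"
      then obtain x u where b: "b = (x, u)" "x \<in> ?H" "u \<in> carrier U" by auto
      note xc = Hc[OF b(2)]
      have lc: "c \<in> C \<Longrightarrow> l c x \<in> carrier R" for c using lin_closed[OF l, of c x] b(2) by simp
      have pu: "lin R M (tensor_product R M U) (\<lambda>x. pure_tensor R M U x u)"
        using b(3) by (intro linI pure_tensor_closed[OF M U] pure_tensor_add_left[OF M U] pure_tensor_smult_left[OF M U])
      have "?p (basis_vec R b) = pure_tensor R M U (\<Oplus>\<^bsub>M\<^esub>c\<in>C. l c x \<odot>\<^bsub>M\<^esub> e c) u"
        unfolding xe[OF b(2), symmetric] b(1) pure_tensor_def ..
      also have "\<dots> = (\<Oplus>\<^bsub>tensor_product R M U\<^esub>c\<in>C. pure_tensor R M U (l c x \<odot>\<^bsub>M\<^esub> e c) u)"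
        by (rule lin_finsum[OF M TU.module_axioms pu C]) (use lc e in auto)
      also have "\<dots> = (\<Oplus>\<^bsub>tensor_product R M U\<^esub>c\<in>C. pure_tensor R M U (e c) (ev ?H (l c) U (basis_vec R b)))"
      proof (rule TU.finsum_cong')
        show "(\<lambda>c. pure_tensor R M U (e c) (ev ?H (l c) U (basis_vec R b))) \<in> C \<rightarrow> carrier (tensor_product R M U)"
          using b xc lin_closed[OF evl[OF U l]] pair_basis_closed[OF M U] e
          by (auto intro!: pure_tensor_closed[OF M U])
        fix c assume c: "c \<in> C"
        show "pure_tensor R M U (l c x \<odot>\<^bsub>M\<^esub> e c) u = pure_tensor R M U (e c) (ev ?H (l c) U (basis_vec R b))"
          using b xc c by (simp add: evb[OF U l[OF c]] lc e pure_tensor_smult_left[OF M U] pure_tensor_smult_right[OF M U])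
      qed simp
      finally show "?p (basis_vec R b) = \<dots>" .
    qed
    also have "\<dots> = (\<Oplus>\<^bsub>tensor_product R M U\<^esub>c\<in>C. \<zero>\<^bsub>tensor_product R M U\<^esub>)"
      using lin_zero[OF U TU.module_axioms pl[OF e]] by (intro TU.finsum_cong') (auto simp: ev0)
    also have "\<dots> = \<zero>\<^bsub>tensor_product R M U\<^esub>" by simp
    finally show ?thesis using tensor_proj_eq_zero[OF M U z] by simp
  qed
  note ts = tensor_map_spec[OF M U V f]
  show "inj_on (tensor_map R M U V f) (carrier (tensor_product R M U))"
  proof (rule inj_onI)
    fix C D assume "C \<in> carrier (tensor_product R M U)" "D \<in> carrier (tensor_product R M U)"
      and eq: "tensor_map R M U V f C = tensor_map R M U V f D"
    then obtain z w where z: "z \<in> carrier ?FU" "C = tensor_kernel R M U +>\<^bsub>?FU\<^esub> z"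
      and w: "w \<in> carrier ?FU" "D = tensor_kernel R M U +>\<^bsub>?FU\<^esub> w" by (auto simp: tensor_carrier)
    have "?f z \<ominus>\<^bsub>?FV\<^esub> ?f w \<in> tensor_kernel R M V"
      using eq z w ts(2)[OF z(1)] ts(2)[OF w(1)]
        coset_eq_iff[OF Fm tensor_kernel_submodule[OF M V] lin_closed[OF fs z(1)] lin_closed[OF fs w(1)]] by simp
    hence "?f (z \<ominus>\<^bsub>?FU\<^esub> w) \<in> tensor_kernel R M V" using lin_minus[OF Fm Fm fs z(1) w(1)] by simp
    hence "z \<ominus>\<^bsub>?FU\<^esub> w \<in> tensor_kernel R M U" by (intro main FU.minus_closed z w)
    thus "C = D" using z w coset_eq_iff[OF Fm tensor_kernel_submodule[OF M U] z(1) w(1)] by simp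
  qed
qed


section \<open>Homogeneous components\<close>

definition grade_comp :: "('m, 'x) ring_scheme \<Rightarrow> (int \<Rightarrow> 'm set) \<Rightarrow> int \<Rightarrow> 'm \<Rightarrow> 'm"
  where "grade_comp M \<M> d x = (THE c. (\<forall>d. c d \<in> \<M> d) \<and> finite {d. c d \<noteq> \<zero>\<^bsub>M\<^esub>} \<and>
      x = (\<Oplus>\<^bsub>M\<^esub>d\<in>{d. c d \<noteq> \<zero>\<^bsub>M\<^esub>}. c d)) d"

lemma grading_sub: "is_grading M \<M> \<Longrightarrow> x \<in> \<M> d \<Longrightarrow> x \<in> carrier M"
  using additive_subgroup.a_subset by (fastforce simp: is_grading_def)

lemma grading_zero: "is_grading M \<M> \<Longrightarrow> \<zero>\<^bsub>M\<^esub> \<in> \<M> d"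
  using additive_subgroup.zero_closed by (fastforce simp: is_grading_def)

lemma grading_add: "is_grading M \<M> \<Longrightarrow> x \<in> \<M> d \<Longrightarrow> y \<in> \<M> d \<Longrightarrow> x \<oplus>\<^bsub>M\<^esub> y \<in> \<M> d"
  using additive_subgroup.a_closed by (fastforce simp: is_grading_def)

lemma grade_comp_eqI:
  assumes M: "abelian_group M" and gr: "is_grading M \<M>" and c: "\<And>d. c d \<in> \<M> d"
    and T: "finite T" "\<And>d. d \<notin> T \<Longrightarrow> c d = \<zero>\<^bsub>M\<^esub>" and x: "x = (\<Oplus>\<^bsub>M\<^esub>d\<in>T. c d)"
  shows "grade_comp M \<M> d x = c d"
proof -
  interpret M: abelian_group M by (rule M)
  have cc: "c d \<in> carrier M" for d using grading_sub[OF gr c] .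
  have sub: "{d. c d \<noteq> \<zero>\<^bsub>M\<^esub>} \<subseteq> T" using T(2) by blast
  have "(\<Oplus>\<^bsub>M\<^esub>d\<in>{d. c d \<noteq> \<zero>\<^bsub>M\<^esub>}. c d) = (\<Oplus>\<^bsub>M\<^esub>d\<in>T. c d)"
    by (rule M.add.finprod_mono_neutral_cong_left) (use T(1) sub cc in auto)
  hence 1: "(\<forall>d. c d \<in> \<M> d) \<and> finite {d. c d \<noteq> \<zero>\<^bsub>M\<^esub>} \<and> x = (\<Oplus>\<^bsub>M\<^esub>d\<in>{d. c d \<noteq> \<zero>\<^bsub>M\<^esub>}. c d)"
    using c finite_subset[OF sub T(1)] x by simp
  have "x \<in> carrier M" unfolding x using cc by (intro M.finsum_closed) auto
  hence ex: "\<exists>!c. (\<forall>d. c d \<in> \<M> d) \<and> finite {d. c d \<noteq> \<zero>\<^bsub>M\<^esub>} \<and> x = (\<Oplus>\<^bsub>M\<^esub>d\<in>{d. c d \<noteq> \<zero>\<^bsub>M\<^esub>}. c d)"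
    using gr by (simp add: is_grading_def)
  have "(THE c. (\<forall>d. c d \<in> \<M> d) \<and> finite {d. c d \<noteq> \<zero>\<^bsub>M\<^esub>} \<and>
      x = (\<Oplus>\<^bsub>M\<^esub>d\<in>{d. c d \<noteq> \<zero>\<^bsub>M\<^esub>}. c d)) = c"
    by (rule the1_equality[OF ex]) (rule 1)
  thus ?thesis by (simp add: grade_comp_def)
qed

lemma
  assumes gr: "is_grading M \<M>" and x: "x \<in> carrier M"
  shows grade_comp_mem: "grade_comp M \<M> d x \<in> \<M> d"
    and grade_comp_finite: "finite {d. grade_comp M \<M> d x \<noteq> \<zero>\<^bsub>M\<^esub>}"
    and grade_comp_sum: "(\<Oplus>\<^bsub>M\<^esub>d\<in>{d. grade_comp M \<M> d x \<noteq> \<zero>\<^bsub>M\<^esub>}. grade_comp M \<M> d x) = x"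
proof -
  let ?P = "\<lambda>c. (\<forall>d. c d \<in> \<M> d) \<and> finite {d. c d \<noteq> \<zero>\<^bsub>M\<^esub>} \<and> x = (\<Oplus>\<^bsub>M\<^esub>d\<in>{d. c d \<noteq> \<zero>\<^bsub>M\<^esub>}. c d)"
  have "\<exists>!c. ?P c" using gr x by (simp add: is_grading_def)
  from theI'[OF this] have "?P (\<lambda>d. grade_comp M \<M> d x)" unfolding grade_comp_def .
  thus "grade_comp M \<M> d x \<in> \<M> d" "finite {d. grade_comp M \<M> d x \<noteq> \<zero>\<^bsub>M\<^esub>}"
    "(\<Oplus>\<^bsub>M\<^esub>d\<in>{d. grade_comp M \<M> d x \<noteq> \<zero>\<^bsub>M\<^esub>}. grade_comp M \<M> d x) = x" by auto
qed

lemma grade_comp_homogeneous: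
  assumes M: "abelian_group M" and gr: "is_grading M \<M>" and x: "x \<in> \<M> e"
  shows "grade_comp M \<M> d x = (if d = e then x else \<zero>\<^bsub>M\<^esub>)"
proof (rule grade_comp_eqI[OF M gr, of _ "{e}"])
  interpret M: abelian_group M by (rule M)
  show "x = (\<Oplus>\<^bsub>M\<^esub>d\<in>{e}. if d = e then x else \<zero>\<^bsub>M\<^esub>)" using grading_sub[OF gr x] by simp
qed (use x grading_zero[OF gr] in auto)

lemma grade_comp_add:
  assumes M: "abelian_group M" and gr: "is_grading M \<M>" and x: "x \<in> carrier M" and y: "y \<in> carrier M"
  shows "grade_comp M \<M> d (x \<oplus>\<^bsub>M\<^esub> y) = grade_comp M \<M> d x \<oplus>\<^bsub>M\<^esub> grade_comp M \<M> d y"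
proof -
  interpret M: abelian_group M by (rule M)
  let ?S = "\<lambda>x. {d. grade_comp M \<M> d x \<noteq> \<zero>\<^bsub>M\<^esub>}"
  note fin = grade_comp_finite[OF gr x] grade_comp_finite[OF gr y]
  have cx: "grade_comp M \<M> d x \<in> carrier M" and cy: "grade_comp M \<M> d y \<in> carrier M" for d
    using grading_sub[OF gr grade_comp_mem[OF gr]] x y by auto
  have "(\<Oplus>\<^bsub>M\<^esub>d\<in>?S x. grade_comp M \<M> d x) = (\<Oplus>\<^bsub>M\<^esub>d\<in>?S x \<union> ?S y. grade_comp M \<M> d x)"
    by (rule M.add.finprod_mono_neutral_cong_left) (use fin cx in auto)
  moreover have "(\<Oplus>\<^bsub>M\<^esub>d\<in>?S y. grade_comp M \<M> d y) = (\<Oplus>\<^bsub>M\<^esub>d\<in>?S x \<union> ?S y. grade_comp M \<M> d y)"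
    by (rule M.add.finprod_mono_neutral_cong_left) (use fin cy in auto)
  ultimately have "x \<oplus>\<^bsub>M\<^esub> y = (\<Oplus>\<^bsub>M\<^esub>d\<in>?S x \<union> ?S y. grade_comp M \<M> d x \<oplus>\<^bsub>M\<^esub> grade_comp M \<M> d y)"
    using cx cy grade_comp_sum[OF gr x] grade_comp_sum[OF gr y] by (subst M.finsum_addf) auto
  thus ?thesis
    by (intro grade_comp_eqI[OF M gr, of _ "?S x \<union> ?S y"])
      (use fin grade_comp_mem[OF gr x] grade_comp_mem[OF gr y] grading_add[OF gr] in auto)
qed

text \<open>An additive map raising degrees by \<open>e\<close> commutes with taking components. It
  serves for multiplication by a homogeneous scalar, for the map from a ring element to its multiple
  of a homogeneous vector, and for monomials acting on \<open>N\<close>.\<close>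

lemma grade_comp_shift:
  assumes G: "abelian_group G" and M: "abelian_group M" and grG: "is_grading G \<G>" and gr: "is_grading M \<M>"
    and sc: "\<And>x. x \<in> carrier G \<Longrightarrow> s x \<in> carrier M"
    and sa: "\<And>x y. x \<in> carrier G \<Longrightarrow> y \<in> carrier G \<Longrightarrow> s (x \<oplus>\<^bsub>G\<^esub> y) = s x \<oplus>\<^bsub>M\<^esub> s y"
    and sg: "\<And>j x. x \<in> \<G> j \<Longrightarrow> s x \<in> \<M> (e + j)" and x: "x \<in> carrier G"
  shows "grade_comp M \<M> (e + d) (s x) = s (grade_comp G \<G> d x)"
proof -
  interpret G: abelian_group G by (rule G)
  interpret M: abelian_group M by (rule M)
  have "s \<zero>\<^bsub>G\<^esub> = s \<zero>\<^bsub>G\<^esub> \<oplus>\<^bsub>M\<^esub> s \<zero>\<^bsub>G\<^esub>" using sa[of "\<zero>\<^bsub>G\<^esub>" "\<zero>\<^bsub>G\<^esub>"] by simp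
  hence s0: "s \<zero>\<^bsub>G\<^esub> = \<zero>\<^bsub>M\<^esub>" using sc[of "\<zero>\<^bsub>G\<^esub>"] by (metis M.add.r_cancel_one' G.zero_closed)
  have ssum: "s (\<Oplus>\<^bsub>G\<^esub>i\<in>I. g i) = (\<Oplus>\<^bsub>M\<^esub>i\<in>I. s (g i))" if "finite I" "\<And>i. g i \<in> carrier G" for I and g :: "int \<Rightarrow> _"
    using that(1)
  proof (induct I)
    case (insert i I)
    have "(\<Oplus>\<^bsub>G\<^esub>i\<in>I. g i) \<in> carrier G" using that(2) by (intro G.finsum_closed) auto
    thus ?case using insert that(2) sc by (simp add: sa Pi_def)
  qed (simp add: s0)
  let ?S = "{d. grade_comp G \<G> d x \<noteq> \<zero>\<^bsub>G\<^esub>}"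
  let ?c = "\<lambda>d. s (grade_comp G \<G> (d - e) x)"
  note mem = grade_comp_mem[OF grG x]
  note cc = grading_sub[OF grG mem]
  have "grade_comp M \<M> (e + d) (s x) = ?c (e + d)"
  proof (rule grade_comp_eqI[OF M gr, of _ "(\<lambda>d. e + d) ` ?S"])
    show "?c d \<in> \<M> d" for d using sg[OF mem, of "d - e"] by simp
    show "finite ((\<lambda>d. e + d) ` ?S)" using grade_comp_finite[OF grG x] by simp
    show "?c d = \<zero>\<^bsub>M\<^esub>" if "d \<notin> (\<lambda>d. e + d) ` ?S" for d
    proof -
      have "d - e \<notin> ?S"
      proof
        assume "d - e \<in> ?S"
        hence "d \<in> (\<lambda>d. e + d) ` ?S" by (intro image_eqI[of _ _ "d - e"]) auto
        thus False using that by simp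
      qed
      thus ?thesis using s0 by simp
    qed
    have "s x = (\<Oplus>\<^bsub>M\<^esub>d\<in>?S. s (grade_comp G \<G> d x))"
      using ssum[OF grade_comp_finite[OF grG x], of "\<lambda>d. grade_comp G \<G> d x"] cc grade_comp_sum[OF grG x] by simp
    also have "\<dots> = (\<Oplus>\<^bsub>M\<^esub>d\<in>(\<lambda>d. e + d) ` ?S. ?c d)"
      using cc sc by (subst M.finsum_reindex) auto
    finally show "s x = (\<Oplus>\<^bsub>M\<^esub>d\<in>(\<lambda>d. e + d) ` ?S. ?c d)" .
  qed
  thus ?thesis by simp
qed

lemma graded_module_graded_mod:
  assumes R: "graded_ring R \<R>" and M: "graded_module R \<R> M \<M>"
  shows "graded_mod R M (grade_comp R \<R>) (grade_comp M \<M>)"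
proof -
  have Mm: "module R M" and gr: "is_grading M \<M>"
    and sm: "\<And>i j a x. a \<in> \<R> i \<Longrightarrow> x \<in> \<M> j \<Longrightarrow> a \<odot>\<^bsub>M\<^esub> x \<in> \<M> (i + j)"
    using M by (auto simp: graded_module_def)
  have grR: "is_grading R \<R>" using R by (simp add: graded_ring_def)
  interpret M: module R M by (rule Mm)
  note ag = M.abelian_group_axioms and agR = M.R.abelian_group_axioms
  show ?thesis
  proof unfold_locales
    fix x y d assume x: "x \<in> carrier M"
    show "grade_comp M \<M> d x \<in> carrier M" by (rule grading_sub[OF gr grade_comp_mem[OF gr x]])
    show "finite {d. grade_comp M \<M> d x \<noteq> \<zero>\<^bsub>M\<^esub>}" by (rule grade_comp_finite[OF gr x])
    show "(\<Oplus>\<^bsub>M\<^esub>d\<in>{d. grade_comp M \<M> d x \<noteq> \<zero>\<^bsub>M\<^esub>}. grade_comp M \<M> d x) = x" by (rule grade_comp_sum[OF gr x])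
    show "grade_comp M \<M> d (grade_comp M \<M> e x) = (if d = e then grade_comp M \<M> e x else \<zero>\<^bsub>M\<^esub>)" for e
      by (rule grade_comp_homogeneous[OF ag gr grade_comp_mem[OF gr x]])
    show "y \<in> carrier M \<Longrightarrow> grade_comp M \<M> d (x \<oplus>\<^bsub>M\<^esub> y) = grade_comp M \<M> d x \<oplus>\<^bsub>M\<^esub> grade_comp M \<M> d y"
      by (rule grade_comp_add[OF ag gr x])
  next
    fix a e x d assume a: "a \<in> carrier R" "grade_comp R \<R> e a = a" and x: "x \<in> carrier M"
    have "a \<in> \<R> e" using grade_comp_mem[OF grR a(1), of e] a(2) by simp
    thus "grade_comp M \<M> (e + d) (a \<odot>\<^bsub>M\<^esub> x) = a \<odot>\<^bsub>M\<^esub> grade_comp M \<M> d x"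
      using a(1) x by (intro grade_comp_shift[OF ag ag gr gr]) (auto simp: M.smult_r_distr sm)
  next
    fix a x e d assume a: "a \<in> carrier R" and x: "x \<in> carrier M" "grade_comp M \<M> e x = x"
    have "x \<in> \<M> e" using grade_comp_mem[OF gr x(1), of e] x(2) by simp
    hence "b \<odot>\<^bsub>M\<^esub> x \<in> \<M> (e + j)" if "b \<in> \<R> j" for b j using sm[OF that, of x e] by (simp add: add.commute)
    hence "grade_comp M \<M> (e + (d - e)) (a \<odot>\<^bsub>M\<^esub> x) = grade_comp R \<R> (d - e) a \<odot>\<^bsub>M\<^esub> x"
      using a x(1) by (intro grade_comp_shift[OF agR ag grR gr, where s = "\<lambda>a. a \<odot>\<^bsub>M\<^esub> x"]) (auto simp: M.smult_l_distr)
    thus "grade_comp M \<M> d (a \<odot>\<^bsub>M\<^esub> x) = grade_comp R \<R> (d - e) a \<odot>\<^bsub>M\<^esub> x" by simp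
  qed
qed

text \<open>A ring and its regular module have the same addition but different record types, so
  finite sums and components have to be identified by unfolding.\<close>

lemma graded_ring_graded_mod:
  assumes "cring R" and R: "graded_ring R \<R>"
  shows "graded_mod R (regular_module R) (grade_comp R \<R>) (grade_comp R \<R>)"
proof -
  have "finsum (regular_module R) f I = finsum R f I" for f :: "int \<Rightarrow> _" and I
    by (simp add: finsum_def finprod_def)
  hence c: "grade_comp (regular_module R) \<R> = grade_comp R \<R>"
    and "is_grading (regular_module R) \<R> = is_grading R \<R>"
    by (simp_all add: fun_eq_iff grade_comp_def is_grading_def additive_subgroup_def subgroup_def m_inv_def)
  hence "graded_module R \<R> (regular_module R) \<R>"
    using R regular_module_module[OF assms(1)] by (simp add: graded_module_def graded_ring_def)
  from graded_module_graded_mod[OF R this] show ?thesis by (simp only: c)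
qed


section \<open>Fiber-fullness and flatness of Ext\<close>

lemma UP_euclidean_domain:
  assumes "field K"
  shows "euclidean_domain (UP K) (deg K)"
proof -
  interpret K: field K by fact
  interpret P: UP_domain K "UP K" by unfold_locales simp
  show ?thesis
  proof unfold_locales
    fix f g assume "f \<in> carrier (UP K) - {\<zero>\<^bsub>UP K\<^esub>}" "g \<in> carrier (UP K) - {\<zero>\<^bsub>UP K\<^esub>}"
    hence f: "f \<in> carrier (UP K)" and g: "g \<in> carrier (UP K)" "g \<noteq> \<zero>\<^bsub>UP K\<^esub>" by auto
    let ?l = "coeff (UP K) g (deg K g)"
    \<comment> \<open>Long division divides \<open>f\<close> only after multiplication by a power of
      the leading coefficient of \<open>g\<close>; over a field this power is a unit and is divided
      out again.\<close>
    obtain q r k where qr: "q \<in> carrier (UP K)" "r \<in> carrier (UP K)"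
      "?l [^]\<^bsub>K\<^esub> (k::nat) \<odot>\<^bsub>UP K\<^esub> f = g \<otimes>\<^bsub>UP K\<^esub> q \<oplus>\<^bsub>UP K\<^esub> r" "r = \<zero>\<^bsub>UP K\<^esub> \<or> deg K r < deg K g"
      using P.long_div_theorem[OF g(1) f g(2)] by blast
    have l: "?l \<in> carrier K" "?l \<noteq> \<zero>\<^bsub>K\<^esub>" using g P.lcoeff_nonzero by auto
    have lk: "?l [^]\<^bsub>K\<^esub> k \<in> Units K" using l K.field_Units by (intro K.Units_pow_closed) auto
    define u where "u = inv\<^bsub>K\<^esub> (?l [^]\<^bsub>K\<^esub> k)"
    have u: "u \<in> carrier K" "u \<otimes>\<^bsub>K\<^esub> ?l [^]\<^bsub>K\<^esub> k = \<one>\<^bsub>K\<^esub>" using lk by (auto simp: u_def)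
    have "f = u \<odot>\<^bsub>UP K\<^esub> (?l [^]\<^bsub>K\<^esub> k \<odot>\<^bsub>UP K\<^esub> f)"
      using u f l by (simp add: P.smult_assoc1[symmetric])
    also have "\<dots> = g \<otimes>\<^bsub>UP K\<^esub> (u \<odot>\<^bsub>UP K\<^esub> q) \<oplus>\<^bsub>UP K\<^esub> u \<odot>\<^bsub>UP K\<^esub> r"
    proof -
      have "u \<odot>\<^bsub>UP K\<^esub> (g \<otimes>\<^bsub>UP K\<^esub> q) = g \<otimes>\<^bsub>UP K\<^esub> (u \<odot>\<^bsub>UP K\<^esub> q)"
        using u g qr P.UP_smult_assoc2[of u q g] by (simp add: P.P.m_comm[of g])
      thus ?thesis using u g qr by (simp add: P.smult_r_distr)
    qed
    finally have "f = g \<otimes>\<^bsub>UP K\<^esub> (u \<odot>\<^bsub>UP K\<^esub> q) \<oplus>\<^bsub>UP K\<^esub> u \<odot>\<^bsub>UP K\<^esub> r" .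
    moreover have "u \<odot>\<^bsub>UP K\<^esub> r = \<zero>\<^bsub>UP K\<^esub> \<or> deg K (u \<odot>\<^bsub>UP K\<^esub> r) < deg K g"
      using qr u P.deg_smult_ring[of u r] by (auto split: if_splits)
    ultimately show "\<exists>q r. q \<in> carrier (UP K) \<and> r \<in> carrier (UP K) \<and> f = g \<otimes>\<^bsub>UP K\<^esub> q \<oplus>\<^bsub>UP K\<^esub> r \<and>
        (r = \<zero>\<^bsub>UP K\<^esub> \<or> deg K r < deg K g)"
      using u qr by (intro exI[of _ "u \<odot>\<^bsub>UP K\<^esub> q"] exI[of _ "u \<odot>\<^bsub>UP K\<^esub> r"]) auto
  qed
qed

text \<open>Multiplication by \<open>a\<close> on a resolution lifts multiplication by
  \<open>a\<close> on the module. Regularity thus inherits independence of the resolution from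
  \<open>pullback_inj_indep\<close>.\<close>

lemma cobd_regular_iff_pullback_inj:
  assumes N: "module R N" and a: "a \<in> carrier R"
  shows "cobd_regular R F N j a \<longleftrightarrow> pullback_inj R F F N j (\<lambda>z. a \<odot>\<^bsub>res_module R F j\<^esub> z)"
proof -
  have "cobd R F N j (\<lambda>z. g (a \<odot>\<^bsub>res_module R F j\<^esub> z)) \<longleftrightarrow> cobd R F N j (\<lambda>z. a \<odot>\<^bsub>N\<^esub> g z)"
    if "cocyc R F N j g" for g
    by (intro iffI; erule cobd_cong) (simp_all add: lin_smult[OF cocyc_lin[OF that] a] del: res_ops)
  thus ?thesis unfolding cobd_regular_def pullback_inj_def by blast
qed

lemma cobd_regular_indep:
  assumes M: "module R M" and N: "module R N" and F: "is_free_res R M F" and G: "is_free_res R M G"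
    and a: "a \<in> carrier R" and reg: "cobd_regular R F N j a"
  shows "cobd_regular R G N j a"
proof -
  note Fm = res_module_module[OF module_cring[OF N]]
  have lift: "lin_lift R P P (\<lambda>x. a \<odot>\<^bsub>M\<^esub> x) (\<lambda>i z. a \<odot>\<^bsub>res_module R P i\<^esub> z)" if "is_free_res R M P" for P
    unfolding lin_lift_def using lin_mult[OF Fm[of P] a] lin_smult[OF res_aug_lin[OF that] a]
      lin_smult[OF res_diff_lin[OF that] a] by (simp del: res_ops)
  show ?thesis
    using pullback_inj_indep[OF M M N lin_mult[OF M a] G G F F lift[OF G] lift[OF F], of j] reg
    unfolding cobd_regular_iff_pullback_inj[OF N a] by blast
qed

section \<open>Quotients by powers of the variable, and polynomial scalars\<close>

lemma pow_mult_image_eq: "pow_mult_image A t m M = smult_image (t [^]\<^bsub>A\<^esub> m) M"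
  by (simp add: pow_mult_image_def smult_image_def)

lemma pow_proj_coset:
  assumes M: "module A M" and t: "t \<in> carrier A" and m: "m \<ge> 1" and x: "x \<in> carrier M"
  shows "pow_proj A t m M (pow_mult_image A t m M +>\<^bsub>M\<^esub> x) = pow_mult_image A t 1 M +>\<^bsub>M\<^esub> x"
proof -
  interpret M: module A M by (rule M)
  let ?H = "\<lambda>m. pow_mult_image A t m M"
  have H: "submodule (?H k) A M" for k
    unfolding pow_mult_image_eq by (rule smult_image_submodule[OF M]) (simp add: t)
  have sub: "?H m \<subseteq> ?H 1"
  proof
    fix h assume "h \<in> ?H m"
    then obtain y where y: "y \<in> carrier M" "h = t [^]\<^bsub>A\<^esub> m \<odot>\<^bsub>M\<^esub> y" by (auto simp: pow_mult_image_def)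
    obtain k where k: "m = Suc k" using m by (cases m) auto
    have "h = t [^]\<^bsub>A\<^esub> (1::nat) \<odot>\<^bsub>M\<^esub> (t [^]\<^bsub>A\<^esub> k \<odot>\<^bsub>M\<^esub> y)"
      using y t k by (simp add: M.smult_assoc1[symmetric] M.R.m_comm)
    thus "h \<in> ?H 1" using y t by (auto simp: pow_mult_image_def)
  qed
  have "(\<Union>y\<in>?H m +>\<^bsub>M\<^esub> x. ?H 1 +>\<^bsub>M\<^esub> y) = ?H 1 +>\<^bsub>M\<^esub> x"
  proof (rule coset_UN[OF M H x])
    fix h assume h: "h \<in> ?H m"
    have hc: "h \<in> carrier M" by (rule submodule_sub[OF H h])
    have "h \<oplus>\<^bsub>M\<^esub> x \<ominus>\<^bsub>M\<^esub> x = h" using hc x by (simp add: a_minus_def M.a_assoc M.r_neg)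
    thus "?H 1 +>\<^bsub>M\<^esub> (h \<oplus>\<^bsub>M\<^esub> x) = ?H 1 +>\<^bsub>M\<^esub> x"
      using coset_eq_iff[OF M H, of "h \<oplus>\<^bsub>M\<^esub> x" x 1] hc x h sub by auto
  qed
  thus ?thesis using x by (simp add: pow_proj_def pow_quot_def quot_carrierI)
qed

lemma pow_proj_lin:
  assumes M: "module A M" and t: "t \<in> carrier A" and m: "m \<ge> 1"
  shows "lin A (pow_quot A t m M) (pow_quot A t 1 M) (pow_proj A t m M)"
proof -
  interpret M: module A M by (rule M)
  have H: "submodule (pow_mult_image A t k M) A M" for k
    unfolding pow_mult_image_eq by (rule smult_image_submodule[OF M]) (simp add: t)
  note pc = pow_proj_coset[OF M t m]
  show ?thesis unfolding pow_quot_def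
    by (rule linI) (auto simp: quot_carrier quot_add[OF M H] quot_smult[OF M H] pc)
qed

lemma restrict_scalars_torsion_free:
  "torsion_free P (restrict_scalars A M) \<longleftrightarrow>
    (\<forall>p\<in>carrier P. p \<noteq> \<zero>\<^bsub>P\<^esub> \<longrightarrow> (\<forall>x\<in>carrier M. (p \<odot>\<^bsub>A\<^esub> \<one>\<^bsub>A\<^esub>) \<odot>\<^bsub>M\<^esub> x = \<zero>\<^bsub>M\<^esub> \<longrightarrow> x = \<zero>\<^bsub>M\<^esub>))"
  by (auto simp: torsion_free_def)

text \<open>A polynomial is a sum of monomials, each homogeneous on \<open>N\<close>; its leading
  monomial is a unit of \<open>K\<close> times a power of \<open>t\<close>, hence regular.
  \<open>leading_term_regular\<close> passes to the whole polynomial.\<close>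

lemma polynomial_regular:
  fixes A :: "(nat \<Rightarrow> 'k, 'a) module"
  assumes K: "field K" and A: "algebra (UP K) A"
    and R: "graded_mod A (regular_module A) r r" and N: "graded_mod A N r (grade_comp N \<N>)"
    and F: "is_free_res A M F" and fin: "\<And>i. finite (res_basis F i)"
    and hom: "\<And>i b. b \<in> res_basis F (Suc i) \<Longrightarrow>
      free_proj A r (dg i) (dg (Suc i) b) (res_diff F i (basis_vec A b)) = res_diff F i (basis_vec A b)"
    and gr: "is_grading N \<N>"
    and grN: "graded_module (UP K) (poly_grading K) (restrict_scalars A N) \<N>"
    and reg: "cobd_regular A F N j (alg_var K A)"
    and p: "p \<in> carrier (UP K)" "p \<noteq> \<zero>\<^bsub>UP K\<^esub>"
  shows "cobd_regular A F N j (p \<odot>\<^bsub>A\<^esub> \<one>\<^bsub>A\<^esub>)"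
proof -
  interpret K: field K by fact
  interpret P: UP_domain K "UP K" by unfold_locales simp
  interpret A: algebra "UP K" A by (rule A)
  interpret N: graded_mod A N r "grade_comp N \<N>" by (rule N)
  note Nm = N.module_axioms
  define \<iota> where "\<iota> p = p \<odot>\<^bsub>A\<^esub> \<one>\<^bsub>A\<^esub>" for p
  have \<iota>c: "\<iota> p \<in> carrier A" if "p \<in> carrier (UP K)" for p using that by (simp add: \<iota>_def)
  have \<iota>m: "\<iota> (p \<otimes>\<^bsub>UP K\<^esub> q) = \<iota> p \<otimes>\<^bsub>A\<^esub> \<iota> q" if "p \<in> carrier (UP K)" "q \<in> carrier (UP K)" for p q
    using that by (simp add: \<iota>_def A.smult_assoc1 A.smult_assoc2)
  have \<iota>1: "\<iota> \<one>\<^bsub>UP K\<^esub> = \<one>\<^bsub>A\<^esub>" by (simp add: \<iota>_def)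
  have \<iota>t: "\<iota> (monom (UP K) \<one>\<^bsub>K\<^esub> n) = alg_var K A [^]\<^bsub>A\<^esub> n" for n
  proof (induct n)
    case 0
    show ?case using \<iota>1 by simp
  next
    case (Suc n)
    show ?case unfolding P.monom_one_Suc using Suc by (simp add: \<iota>m) (simp add: alg_var_def \<iota>_def)
  qed
  define a where "a k = \<iota> (monom (UP K) (coeff (UP K) p k) k)" for k
  have ac: "a k \<in> carrier A" for k using p by (simp add: a_def \<iota>c)
  have ah: "grade_comp N \<N> (int k + d) (a k \<odot>\<^bsub>N\<^esub> x) = a k \<odot>\<^bsub>N\<^esub> grade_comp N \<N> d x" if x: "x \<in> carrier N" for k d x
  proof (rule grade_comp_shift[OF N.abelian_group_axioms N.abelian_group_axioms gr gr _ _ _ x])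
    fix i y assume y: "y \<in> \<N> i"
    \<comment> \<open>The degree of the action of \<open>a k\<close> on \<open>N\<close> is read off
      from the grading of \<open>N\<close> over \<open>UP K\<close>.\<close>
    have "monom (UP K) (coeff (UP K) p k) k \<in> poly_grading K (int k)" using p by (auto simp: poly_grading_def)
    thus "a k \<odot>\<^bsub>N\<^esub> y \<in> \<N> (int k + i)" using grN y unfolding graded_module_def a_def \<iota>_def by force
  qed (use ac in \<open>auto simp: N.smult_r_distr\<close>)
  let ?n = "deg K p"
  let ?c = "coeff (UP K) p ?n"
  have c: "?c \<in> carrier K" "?c \<noteq> \<zero>\<^bsub>K\<^esub>" using p P.lcoeff_nonzero by auto
  hence cu: "?c \<in> Units K" using K.field_Units by simp
  have "a ?n = \<iota> (monom (UP K) ?c 0) \<otimes>\<^bsub>A\<^esub> alg_var K A [^]\<^bsub>A\<^esub> ?n"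
    using P.monom_mult[OF c(1) K.one_closed, of 0 ?n] c(1) by (simp add: a_def \<iota>m \<iota>t[symmetric])
  moreover have "cobd_regular A F N j (\<iota> (monom (UP K) ?c 0))"
  proof (rule cobd_regular_unit[OF Nm])
    have "\<iota> (monom (UP K) (inv\<^bsub>K\<^esub> ?c) 0) \<otimes>\<^bsub>A\<^esub> \<iota> (monom (UP K) ?c 0) = \<iota> (monom (UP K) (inv\<^bsub>K\<^esub> ?c \<otimes>\<^bsub>K\<^esub> ?c) 0)"
      using cu c(1) P.monom_mult[of "inv\<^bsub>K\<^esub> ?c" ?c 0 0] by (simp add: \<iota>m)
    thus "\<iota> (monom (UP K) (inv\<^bsub>K\<^esub> ?c) 0) \<otimes>\<^bsub>A\<^esub> \<iota> (monom (UP K) ?c 0) = \<one>\<^bsub>A\<^esub>" using cu \<iota>1 by simp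
  qed (use cu c(1) in \<open>auto intro: \<iota>c\<close>)
  moreover have tc: "alg_var K A \<in> carrier A" by (simp add: alg_var_def)
  ultimately have lead: "cobd_regular A F N j (a ?n)"
    using cobd_regular_mult[OF Nm _ cobd_regular_pow[OF Nm reg tc, of ?n], of "\<iota> (monom (UP K) ?c 0)"]
      c(1) by (simp add: \<iota>c)
  have "cobd_regular A F N j (\<Oplus>\<^bsub>A\<^esub>k\<in>{..?n}. a k)"
    by (rule leading_term_regular[OF R N F fin hom ac ah lead])
  moreover have "(\<Oplus>\<^bsub>A\<^esub>k\<in>{..?n}. a k) = \<iota> p"
  proof -
    have "lin (UP K) (regular_module (UP K)) A \<iota>"
      by (rule linI) (auto simp: \<iota>_def A.smult_l_distr A.smult_assoc1)
    hence "\<iota> (\<Oplus>\<^bsub>regular_module (UP K)\<^esub>k\<in>{..?n}. monom (UP K) (coeff (UP K) p k) k) = (\<Oplus>\<^bsub>A\<^esub>k\<in>{..?n}. a k)"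
      unfolding a_def using p by (intro lin_finsum[OF regular_module_module A.module_axioms]) (auto intro: P.UP_cring)
    moreover have "finsum (regular_module (UP K)) f I = finsum (UP K) f I" for f :: "nat \<Rightarrow> _" and I
      by (simp add: finsum_def finprod_def)
    ultimately show ?thesis using P.up_repr[OF p(1)] by simp
  qed
  ultimately show ?thesis by (simp add: \<iota>_def)
qed

text \<open>The projection from the quotient by t^(k+1) to the quotient by t is lifted by the cone
  map with u = t^k. Its injectivity in degree \<open>Suc j\<close> for all \<open>k\<close> is
  regularity of \<open>t\<close> in degree \<open>j\<close>.\<close>

lemma fiber_full_iff_regular:
  fixes A :: "(nat \<Rightarrow> 'k, 'a) module" and N :: "('a, 'n) module" and M :: "('a, 'm) module"
  assumes A: "cring A" "noetherian_ring A" and M: "fin_gen_module A M" and N: "fin_gen_module A N"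
    and t: "alg_var K A \<in> carrier A"
    and nzd: "\<And>x. x \<in> carrier M \<Longrightarrow> alg_var K A \<odot>\<^bsub>M\<^esub> x = \<zero>\<^bsub>M\<^esub> \<Longrightarrow> x = \<zero>\<^bsub>M\<^esub>"
    and F: "is_free_res A M F" and fin: "\<And>i. finite (res_basis F i)"
  shows "fiber_full_up_to K A N h M \<longleftrightarrow> (\<forall>j. int j \<le> h - 1 \<longrightarrow> cobd_regular A F N j (alg_var K A))"
proof -
  have Mm: "module A M" and Nm: "module A N" using M N by (auto simp: fin_gen_module_def)
  interpret M: module A M by (rule Mm)
  let ?t = "alg_var K A"
  have tk: "?t [^]\<^bsub>A\<^esub> (k::nat) \<in> carrier A" for k using t by simp
  let ?Q = "\<lambda>m. pow_quot A ?t m M"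
  let ?C = "\<lambda>k. cone_res A M (?t [^]\<^bsub>A\<^esub> (k::nat) \<otimes>\<^bsub>A\<^esub> ?t) F"
  have H: "submodule (pow_mult_image A ?t m M) A M" for m
    unfolding pow_mult_image_eq by (rule smult_image_submodule[OF Mm tk])
  have Qm: "module A (?Q m)" for m unfolding pow_quot_def by (rule quot_module_module[OF Mm H])
  have Qfg: "fin_gen_module A (?Q m)" for m
    by (rule fin_gen_image[OF M Qm[unfolded pow_quot_def] quot_proj_lin[OF Mm H], folded pow_quot_def])
      (auto simp: pow_quot_def quot_carrier)
  note Qres = chosen_res_free_res[OF A Qfg]
  have nzd_pow: "x = \<zero>\<^bsub>M\<^esub>" if "x \<in> carrier M" "?t [^]\<^bsub>A\<^esub> (m::nat) \<odot>\<^bsub>M\<^esub> x = \<zero>\<^bsub>M\<^esub>" for m x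
    using that
  proof (induct m arbitrary: x)
    case (Suc m)
    have e: "?t [^]\<^bsub>A\<^esub> m \<odot>\<^bsub>M\<^esub> (?t \<odot>\<^bsub>M\<^esub> x) = \<zero>\<^bsub>M\<^esub>" using Suc.prems t tk by (simp add: M.smult_assoc1)
    have c: "?t \<odot>\<^bsub>M\<^esub> x \<in> carrier M" using t Suc.prems(1) by simp
    show ?case by (rule nzd[OF Suc.prems(1) Suc.hyps[OF c e]])
  qed simp
  have Cres: "is_free_res A (?Q (Suc k)) (?C k)" for k
    using cone_is_free_res[OF Mm F tk[of "Suc k"]] nzd_pow[of _ "Suc k"]
    by (simp add: pow_quot_def pow_mult_image_eq)
  have C0: "?C 0 = cone_res A M ?t F" using t by simp
  have Ct: "is_free_res A (?Q 1) (cone_res A M ?t F)" using Cres[of 0] unfolding C0 by simp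
  have lift: "lin_lift A (?C k) (cone_res A M ?t F) (pow_proj A ?t (Suc k) M) (cone_map A (?t [^]\<^bsub>A\<^esub> k))" for k
  proof (rule cone_map_lift[OF Mm F t tk])
    fix x assume x: "x \<in> carrier M"
    show "pow_proj A ?t (Suc k) M (smult_image (?t [^]\<^bsub>A\<^esub> k \<otimes>\<^bsub>A\<^esub> ?t) M +>\<^bsub>M\<^esub> x) = smult_image ?t M +>\<^bsub>M\<^esub> x"
      using pow_proj_coset[OF Mm t, of "Suc k" x] x t by (simp add: pow_mult_image_eq)
  qed
  have inj: "inj_on (Ext_map A i (?Q (Suc k)) (?Q 1) N (pow_proj A ?t (Suc k) M)) (carrier (Ext A i (?Q 1) N)) \<longleftrightarrow>
      pullback_inj A (?C k) (cone_res A M ?t F) N i (cone_map A (?t [^]\<^bsub>A\<^esub> k) i)" for i k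
  proof -
    have f: "lin A (?Q (Suc k)) (?Q 1) (pow_proj A ?t (Suc k) M)" by (rule pow_proj_lin[OF Mm t]) simp
    note E = Ext_map_inj_iff[OF Qm Qm Nm f Qres Qres refl]
    show ?thesis unfolding E(2)
      using pullback_inj_indep[OF Qm Qm Nm f Qres Qres Cres Ct E(1) lift, of i]
        pullback_inj_indep[OF Qm Qm Nm f Cres Ct Qres Qres lift E(1), of i] by blast
  qed
  have noeth: "noeth_module A (hom_module A (res_module A F j) N)" for j
    unfolding res_module_def by (rule fin_gen_noeth[OF A fin_gen_hom_free[OF A(1) N fin]])
  \<comment> \<open>In degree 0 the cone map is the identity, so fiber-fullness imposes no condition
    there.\<close>
  have zero: "pullback_inj A (?C k) (cone_res A M ?t F) N 0 (cone_map A (?t [^]\<^bsub>A\<^esub> k) 0)" for k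
    by (simp add: pullback_inj_def cone_map_def)
  have reg_iff: "(\<forall>k. pullback_inj A (?C k) (cone_res A M ?t F) N (Suc j) (cone_map A (?t [^]\<^bsub>A\<^esub> k) (Suc j))) \<longleftrightarrow>
      cobd_regular A F N j ?t" for j
    using pullback_inj_imp_regular[OF Mm Nm F t noeth] regular_imp_pullback_inj[OF Mm Nm F t _ refl] by blast
  have ge1: "(\<forall>m\<ge>1. Z m) \<longleftrightarrow> (\<forall>k. Z (Suc k))" for Z :: "nat \<Rightarrow> bool"
  proof
    assume Z: "\<forall>k. Z (Suc k)"
    show "\<forall>m\<ge>1. Z m"
    proof (intro allI impI)
      fix m :: nat assume "m \<ge> 1"
      then obtain k where "m = Suc k" by (cases m) auto
      thus "Z m" using Z by simp
    qed
  qed simp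
  have "fiber_full_up_to K A N h M \<longleftrightarrow> (\<forall>k i. int i \<le> h \<longrightarrow>
      pullback_inj A (?C k) (cone_res A M ?t F) N i (cone_map A (?t [^]\<^bsub>A\<^esub> k) i))"
    unfolding fiber_full_up_to_def Let_def ge1 inj ..
  also have "\<dots> \<longleftrightarrow> (\<forall>j. int (Suc j) \<le> h \<longrightarrow> cobd_regular A F N j ?t)"
  proof (intro iffI allI impI)
    fix j assume L: "\<forall>k i. int i \<le> h \<longrightarrow> pullback_inj A (?C k) (cone_res A M ?t F) N i (cone_map A (?t [^]\<^bsub>A\<^esub> k) i)"
      and j: "int (Suc j) \<le> h"
    show "cobd_regular A F N j ?t" unfolding reg_iff[symmetric] using L j by blast
  next
    fix k i assume R: "\<forall>j. int (Suc j) \<le> h \<longrightarrow> cobd_regular A F N j ?t" and i: "int i \<le> h"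
    show "pullback_inj A (?C k) (cone_res A M ?t F) N i (cone_map A (?t [^]\<^bsub>A\<^esub> k) i)"
    proof (cases i)
      case 0
      thus ?thesis using zero by simp
    next
      case (Suc j)
      hence "cobd_regular A F N j ?t" using R i by blast
      thus ?thesis using reg_iff Suc by blast
    qed
  qed
  also have "\<dots> \<longleftrightarrow> (\<forall>j. int j \<le> h - 1 \<longrightarrow> cobd_regular A F N j ?t)"
  proof -
    have "int (Suc j) \<le> h \<longleftrightarrow> int j \<le> h - 1" for j by auto
    thus ?thesis by simp
  qed
  finally show ?thesis .
qed

theorem mainTheorem1:
  fixes K :: "('k, 'x) ring_scheme"
    and A :: "(nat \<Rightarrow> 'k, 'a) module"
    and M :: "('a, 'm) module"
    and N :: "('a, 'n) module"
    and \<A> :: "int \<Rightarrow> 'a set" and \<M> :: "int \<Rightarrow> 'm set" and \<N> :: "int \<Rightarrow> 'n set"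
    and h :: int
  assumes "field K"
    and "algebra (UP K) A" and "noetherian_ring A" and "flat_module (UP K) A"
    and "fin_gen_module A M" and "flat_module (UP K) (restrict_scalars A M)"
    and "fin_gen_module A N" and "flat_module (UP K) (restrict_scalars A N)"
    and "graded_module (UP K) (poly_grading K) A \<A>"
    and "graded_module (UP K) (poly_grading K) (restrict_scalars A M) \<M>"
    and "graded_module (UP K) (poly_grading K) (restrict_scalars A N) \<N>"
    and "graded_ring A \<A>" and "graded_module A \<A> M \<M>" and "graded_module A \<A> N \<N>"
  shows "fiber_full_up_to K A N h M \<longleftrightarrow>
    (\<forall>i. int i \<le> h - 1 \<longrightarrow> flat_module (UP K) (restrict_scalars A (Ext A i M N)))"
proof -
  interpret K: field K by fact
  interpret P: UP_domain K "UP K" by unfold_locales simp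
  interpret A: algebra "UP K" A by fact
  note Ac = A.M_cring
  have Mm: "module A M" and Nm: "module A N" using assms(5,7) by (auto simp: fin_gen_module_def)
  let ?t = "alg_var K A"
  let ?m = "monom (UP K) \<one>\<^bsub>K\<^esub> 1"
  have mc: "?m \<in> carrier (UP K)" by simp
  have "coeff (UP K) ?m 1 \<noteq> \<zero>\<^bsub>K\<^esub>" by simp
  hence m0: "?m \<noteq> \<zero>\<^bsub>UP K\<^esub>" by (metis P.coeff_zero)
  have t: "?t \<in> carrier A" by (simp add: alg_var_def)
  have nzd: "x = \<zero>\<^bsub>M\<^esub>" if "x \<in> carrier M" "?t \<odot>\<^bsub>M\<^esub> x = \<zero>\<^bsub>M\<^esub>" for x
    using flat_imp_torsion_free[OF P.UP_domain assms(6)] that mc m0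
    unfolding restrict_scalars_torsion_free alg_var_def by blast
  note gA = graded_ring_graded_mod[OF Ac assms(12)]
  note gM = graded_module_graded_mod[OF assms(12,13)] and gN = graded_module_graded_mod[OF assms(12,14)]
  \<comment> \<open>For finite bases the natural numbers suffice as basis elements.
    \<open>chosen_res\<close> carries no grading, so the graded argument runs on \<open>F\<close>,
    and regularity is transported by \<open>cobd_regular_indep\<close>.\<close>
  obtain F :: "('a, nat, 'm) free_res" and dg where F: "is_free_res A M F"
    and fin: "\<And>i. finite (res_basis F i)"
    and hom: "\<And>i b. b \<in> res_basis F (Suc i) \<Longrightarrow>
      free_proj A (grade_comp A \<A>) (dg i) (dg (Suc i) b) (res_diff F i (basis_vec A b)) = res_diff F i (basis_vec A b)"
    using graded_free_res_exists[OF Ac assms(3) gA gM assms(5) infinite_UNIV_nat] by blast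
  have gr: "is_grading N \<N>" using assms(14) by (simp add: graded_module_def)
  note E = chosen_res_free_res[OF Ac assms(3,5)]
  have "flat_module (UP K) (restrict_scalars A (Ext A i M N)) \<longleftrightarrow> cobd_regular A F N i ?t" for i
  proof -
    let ?E = "restrict_scalars A (Ext A i M N)"
    have Em: "module (UP K) ?E" by (rule restrict_scalars_module[OF assms(2) Ext_module[OF Nm E]])
    have "flat_module (UP K) ?E \<longleftrightarrow> torsion_free (UP K) ?E"
      using flat_imp_torsion_free[OF P.UP_domain] torsion_free_imp_flat[OF UP_euclidean_domain[OF assms(1)] Em] by blast
    also have "\<dots> \<longleftrightarrow> (\<forall>p\<in>carrier (UP K). p \<noteq> \<zero>\<^bsub>UP K\<^esub> \<longrightarrow> cobd_regular A (chosen_res A M) N i (p \<odot>\<^bsub>A\<^esub> \<one>\<^bsub>A\<^esub>))"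
      unfolding restrict_scalars_torsion_free using Ext_smult_zero_iff[OF Nm E, of _ i]
      by (simp add: cobd_regular_def)
    also have "\<dots> \<longleftrightarrow> (\<forall>p\<in>carrier (UP K). p \<noteq> \<zero>\<^bsub>UP K\<^esub> \<longrightarrow> cobd_regular A F N i (p \<odot>\<^bsub>A\<^esub> \<one>\<^bsub>A\<^esub>))"
    proof -
      have "cobd_regular A (chosen_res A M) N i a \<longleftrightarrow> cobd_regular A F N i a" if "a \<in> carrier A" for a
        using cobd_regular_indep[OF Mm Nm E F that] cobd_regular_indep[OF Mm Nm F E that] by blast
      thus ?thesis by simp
    qed
    \<comment> \<open>One direction takes the variable itself as the polynomial; the converse is
      where the gradings enter.\<close>
    also have "\<dots> \<longleftrightarrow> cobd_regular A F N i ?t"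
    proof
      assume "\<forall>p\<in>carrier (UP K). p \<noteq> \<zero>\<^bsub>UP K\<^esub> \<longrightarrow> cobd_regular A F N i (p \<odot>\<^bsub>A\<^esub> \<one>\<^bsub>A\<^esub>)"
      thus "cobd_regular A F N i ?t" using mc m0 unfolding alg_var_def by blast
    next
      assume r: "cobd_regular A F N i ?t"
      show "\<forall>p\<in>carrier (UP K). p \<noteq> \<zero>\<^bsub>UP K\<^esub> \<longrightarrow> cobd_regular A F N i (p \<odot>\<^bsub>A\<^esub> \<one>\<^bsub>A\<^esub>)"
        using polynomial_regular[OF assms(1,2) gA gN F fin hom gr assms(11) r] by blast
    qed
    finally show ?thesis .
  qed
  thus ?thesis using fiber_full_iff_regular[OF Ac assms(3,5,7) t nzd F fin, of h] by simp
qed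

end
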